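(* Let $\Sigma$ be a manifold with log corners and let $\mathcal{C}^{\infty,\log}_\Sigma$ be its sheaf of logarithmic functions. Let $U\subset\Sigma$ be an open set with basic coordinates $r_1,\dots,r_n$ and phantom coordinates $t_1,\dots,t_k$, and let $j:U^\circ\hookrightarrow U$ be the inclusion of the interior. Then $\mathcal{C}^{\infty,\log}_\Sigma|_U$ is identified with the algebra of functions admitting finite expansions $$f=\sum_{I,J}f_{I,J}(r)\,\log^I(r)\,\log^J(t),$$ where $I\in\mathbb{N}^n$, $J\in\mathbb{N}^k$ are multi-indices and the $f_{I,J}$ are smooth functions. Precisely: there is an isomorphism of sheaves of $\mathcal{C}^\infty_U$-algebras from $\mathcal{C}^{\infty,\log}_\Sigma|_U$ onto the sheaf of those sections of the polynomial algebra $(j_*\mathcal{C}^\infty_{U^\circ})[T_1,\dots,T_k]$ which are locally finite sums $\sum_{I,J}f_{I,J}(r)\,(\log r_1)^{I_1}\cdots(\log r_n)^{I_n}\,T_1^{J_1}\cdots T_k^{J_k}$ with $f_{I,J}\in\mathcal{C}^\infty_U$. It sends the symbol $\log(r_i)$ to the function $\log r_i$ on the interior and the symbol $\log(t_l)$ to the variable $T_l$.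
   Context: Monoids are commutative and $\mathbb{N}=\{0,1,2,\dots\}$. A map between subsets of Euclidean spaces is smooth if it extends to a smooth map on an open neighbourhood. A manifold with corners is a second countable Hausdorff space with a maximal atlas of charts onto open subsets of orthants $[0,\infty)^n$ with diffeomorphic transition maps; its interior is the open set of points at which all coordinates of a chart are positive. $\mathcal{C}^{\infty}\supset\mathcal{C}^{\infty,\ge 0}\supset\mathcal{C}^{\infty,>0}$ denote the sheaves of smooth functions with real, non-negative, positive values. A positive log structure on a manifold with corners $\underline\Sigma$ is a sheaf of monoids $\mathcal{M}_\Sigma$ with a morphism $\alpha:\mathcal{M}_\Sigma\to\mathcal{C}^{\infty,\ge0}_\Sigma$ (multiplicative monoid) such that $\alpha^{-1}(\mathcal{C}^{\infty,>0}_\Sigma)\to\mathcal{C}^{\infty,>0}_\Sigma$ is an isomorphism; one thereby views $\mathcal{C}^{\infty,>0}_\Sigma\subset\mathcal{M}_\Sigma$. The standard log corner $[0,\infty)^n\times[0)^k$ is $[0,\infty)^n$ with coordinates $r_1,\dots,r_n$ and $\mathcal{M}=\mathcal{C}^{\infty,>0}r_1^{\mathbb N}\cdots r_n^{\mathbb N}\cdot t_1^{\mathbb N}\cdots t_k^{\mathbb N}$ (positive smooth functions times monomials in the $r_i$, times monomials in free formal variables $t_l$), with $\alpha$ the identity on functions of $r$ and $\alpha(t_l)=0$. A manifold with log corners is a manifold with corners with positive log structure that is locally isomorphic to open subsets of standard log corners; the corresponding $r_i$ and $t_l$ are called basic and phantom coordinates. A germ $f\in\mathcal{M}_\Sigma$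 is basic if $\alpha(f)\ne0$ as a germ; basic germs form the subsheaf $\mathcal{M}^{\mathrm{bas}}_\Sigma$. $\mathcal{M}^{\mathrm{gp}}$ is the group completion. The sheaf of logarithmic functions $\mathcal{C}^{\infty,\log}_\Sigma$ is the sheaf of commutative $\mathcal{C}^\infty_\Sigma$-algebras generated by formal symbols $\log(f)$, $f\in\mathcal{M}^{\mathrm{gp}}_\Sigma$, subject to: (1) $\log(f_1f_2)=\log(f_1)+\log(f_2)$; (2) if $f\in\mathcal{M}^{\mathrm{bas}}_\Sigma$ and $g\in\mathcal{C}^\infty_\Sigma$ are such that the function $g\log(\alpha(f))$ (smooth on the interior, with the real-valued logarithm) extends to a smooth function on $\Sigma$, then $g\cdot\log(f)$ equals this smooth function. *)

theory Defs
  imports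
    "HOL-Analysis.Analysis"
    "HOL-Algebra.QuotRing"
    "HOL-Algebra.Indexed_Polynomials"
begin

section \<open>Smooth maps between subsets of Euclidean spaces\<close>

text \<open>
  Dimensions vary (and may be \<open>0\<close>), so points of \<open>n\<close>-space are the sequences
  \<open>x :: nat \<Rightarrow> real\<close> in \<^const>\<open>Euclidean_space\<close>~\<open>n\<close>, i.e. with \<open>x i = 0\<close> for \<open>i \<ge> n\<close>.
  \<open>Ck k n W f\<close>, for \<open>W\<close> open, says that all iterated partial derivatives of \<open>f\<close> of order at
  most \<open>k\<close> exist and are continuous on \<open>W\<close>.
\<close>

primrec Ck :: "nat \<Rightarrow> nat \<Rightarrow> (nat \<Rightarrow> real) set \<Rightarrow> ((nat \<Rightarrow> real) \<Rightarrow> real) \<Rightarrow> bool" where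
  "Ck 0 n W f \<longleftrightarrow> continuous_map (subtopology (Euclidean_space n) W) euclideanreal f"
| "Ck (Suc k) n W f \<longleftrightarrow> continuous_map (subtopology (Euclidean_space n) W) euclideanreal f \<and>
     (\<forall>i<n. \<exists>f'. (\<forall>x\<in>W. ((\<lambda>u. f (x(i := u))) has_real_derivative f' x) (at (x i))) \<and> Ck k n W f')"

definition smooth_on :: "nat \<Rightarrow> (nat \<Rightarrow> real) set \<Rightarrow> ((nat \<Rightarrow> real) \<Rightarrow> real) \<Rightarrow> bool" where
  "smooth_on n A f \<longleftrightarrow>
     (\<exists>W F. openin (Euclidean_space n) W \<and> A \<subseteq> W \<and> (\<forall>k. Ck k n W F) \<and> (\<forall>x\<in>A. F x = f x))"

definition smooth_map_on ::
    "nat \<Rightarrow> nat \<Rightarrow> (nat \<Rightarrow> real) set \<Rightarrow> ((nat \<Rightarrow> real) \<Rightarrow> (nat \<Rightarrow> real)) \<Rightarrow> bool" where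
  "smooth_map_on n m A g \<longleftrightarrow> (\<forall>j<m. smooth_on n A (\<lambda>x. g x j))"


section \<open>Manifolds with corners\<close>

definition orthant :: "nat \<Rightarrow> (nat \<Rightarrow> real) topology" where
  "orthant n = subtopology (Euclidean_space n) {x. \<forall>i<n. 0 \<le> x i}"

text \<open>
  A chart is a triple of a dimension \<open>n\<close>, a domain \<open>U\<close> and a map \<open>\<phi>\<close>, of which only the
  restriction to \<open>U\<close> is relevant.
\<close>

type_synonym 'p chart = "nat \<times> 'p set \<times> ('p \<Rightarrow> nat \<Rightarrow> real)"

definition is_chart :: "'p topology \<Rightarrow> 'p chart \<Rightarrow> bool" where
  "is_chart \<T> = (\<lambda>(n, U, \<phi>). openin \<T> U \<and> openin (orthant n) (\<phi> ` U) \<and>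
     homeomorphic_map (subtopology \<T> U) (subtopology (orthant n) (\<phi> ` U)) \<phi>)"

definition chart_compatible :: "'p chart \<Rightarrow> 'p chart \<Rightarrow> bool" where
  "chart_compatible = (\<lambda>(n, U, \<phi>) (m, V, \<psi>).
     smooth_map_on n m (\<phi> ` (U \<inter> V)) (\<psi> \<circ> inv_into U \<phi>) \<and>
     smooth_map_on m n (\<psi> ` (U \<inter> V)) (\<phi> \<circ> inv_into V \<psi>))"

definition manifold_with_corners :: "'p topology \<Rightarrow> 'p chart set \<Rightarrow> bool" where
  "manifold_with_corners \<T> \<A> \<longleftrightarrow>
     Hausdorff_space \<T> \<and> second_countable \<T> \<and>
     (\<forall>c\<in>\<A>. is_chart \<T> c) \<and>
     (\<forall>p\<in>topspace \<T>. \<exists>(n, U, \<phi>)\<in>\<A>. p \<in> U) \<and>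
     (\<forall>c\<in>\<A>. \<forall>d\<in>\<A>. chart_compatible c d) \<and>
     (\<forall>c. is_chart \<T> c \<and> (\<forall>d\<in>\<A>. chart_compatible c d) \<longrightarrow> c \<in> \<A>)"

definition mfd_interior :: "'p chart set \<Rightarrow> 'p set" where
  "mfd_interior \<A> = {p. \<exists>(n, U, \<phi>)\<in>\<A>. p \<in> U \<and> (\<forall>i<n. 0 < \<phi> p i)}"

definition smooth_fun :: "'p chart set \<Rightarrow> 'p set \<Rightarrow> ('p \<Rightarrow> real) \<Rightarrow> bool" where
  "smooth_fun \<A> V f \<longleftrightarrow>
     (\<forall>p\<in>V. \<exists>(n, U, \<phi>)\<in>\<A>. p \<in> U \<and> U \<subseteq> V \<and> smooth_on n (\<phi> ` U) (f \<circ> inv_into U \<phi>))"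

text \<open>Functions on \<open>V\<close> are taken to be \<^const>\<open>extensional\<close>, and are restricted by \<^const>\<open>restrict\<close>.\<close>

definition smooth_ring :: "'p chart set \<Rightarrow> 'p set \<Rightarrow> ('p \<Rightarrow> real) ring" where
  "smooth_ring \<A> V =
     \<lparr>carrier = {f \<in> extensional V. smooth_fun \<A> V f},
      mult = (\<lambda>f g. \<lambda>p\<in>V. f p * g p), one = (\<lambda>p\<in>V. 1),
      zero = (\<lambda>p\<in>V. 0), add = (\<lambda>f g. \<lambda>p\<in>V. f p + g p)\<rparr>"


section \<open>Sheaves and sheafification\<close>

definition sheaf_of_monoids ::
    "'p topology \<Rightarrow> ('p set \<Rightarrow> 's monoid) \<Rightarrow> ('p set \<Rightarrow> 'p set \<Rightarrow> 's \<Rightarrow> 's) \<Rightarrow> bool" where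
  "sheaf_of_monoids \<T> F \<rho> \<longleftrightarrow>
     (\<forall>V. openin \<T> V \<longrightarrow> comm_monoid (F V)) \<and>
     (\<forall>V W. openin \<T> V \<and> openin \<T> W \<and> W \<subseteq> V \<longrightarrow>
        \<rho> V W \<in> hom (F V) (F W) \<and> \<rho> V W \<one>\<^bsub>F V\<^esub> = \<one>\<^bsub>F W\<^esub>) \<and>
     (\<forall>V. openin \<T> V \<longrightarrow> (\<forall>s\<in>carrier (F V). \<rho> V V s = s)) \<and>
     (\<forall>V W N. openin \<T> V \<and> openin \<T> W \<and> openin \<T> N \<and> N \<subseteq> W \<and> W \<subseteq> V \<longrightarrow>
        (\<forall>s\<in>carrier (F V). \<rho> W N (\<rho> V W s) = \<rho> V N s)) \<and>
     (\<forall>\<U>. (\<forall>W\<in>\<U>. openin \<T> W) \<longrightarrow>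
        (\<forall>s. (\<forall>W\<in>\<U>. s W \<in> carrier (F W)) \<and>
             (\<forall>W\<in>\<U>. \<forall>W'\<in>\<U>. \<rho> W (W \<inter> W') (s W) = \<rho> W' (W \<inter> W') (s W')) \<longrightarrow>
             (\<exists>!t. t \<in> carrier (F (\<Union>\<U>)) \<and> (\<forall>W\<in>\<U>. \<rho> (\<Union>\<U>) W t = s W))))"

text \<open>
  A germ at \<open>p\<close> of a presheaf of sets \<open>F\<close> with restriction maps \<open>\<rho>\<close> is the class of all pairs
  \<open>(W, t)\<close>, \<open>t \<in> F W\<close>, which agree with \<open>(V, s)\<close> near \<open>p\<close>. A section of the associated sheaf over
  \<open>V\<close> is a function assigning to each \<open>p \<in> V\<close> a germ at \<open>p\<close>, locally given by sections of \<open>F\<close>; such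
  functions are again restricted by \<^const>\<open>restrict\<close>.
\<close>

definition germ ::
    "'p topology \<Rightarrow> ('p set \<Rightarrow> 's set) \<Rightarrow> ('p set \<Rightarrow> 'p set \<Rightarrow> 's \<Rightarrow> 's) \<Rightarrow>
     'p set \<Rightarrow> 's \<Rightarrow> 'p \<Rightarrow> ('p set \<times> 's) set" where
  "germ \<T> F \<rho> V s p =
     {(W, t). openin \<T> W \<and> p \<in> W \<and> t \<in> F W \<and>
        (\<exists>N. openin \<T> N \<and> p \<in> N \<and> N \<subseteq> V \<inter> W \<and> \<rho> V N s = \<rho> W N t)}"

definition sheafify_sections ::
    "'p topology \<Rightarrow> ('p set \<Rightarrow> 's set) \<Rightarrow> ('p set \<Rightarrow> 'p set \<Rightarrow> 's \<Rightarrow> 's) \<Rightarrow>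
     'p set \<Rightarrow> ('p \<Rightarrow> ('p set \<times> 's) set) set" where
  "sheafify_sections \<T> F \<rho> V =
     {\<sigma> \<in> extensional V. \<forall>p\<in>V. \<exists>W s. openin \<T> W \<and> p \<in> W \<and> W \<subseteq> V \<and> s \<in> F W \<and>
        (\<forall>q\<in>W. \<sigma> q = germ \<T> F \<rho> W s q)}"

definition to_sheafify ::
    "'p topology \<Rightarrow> ('p set \<Rightarrow> 's set) \<Rightarrow> ('p set \<Rightarrow> 'p set \<Rightarrow> 's \<Rightarrow> 's) \<Rightarrow>
     'p set \<Rightarrow> 's \<Rightarrow> 'p \<Rightarrow> ('p set \<times> 's) set" where
  "to_sheafify \<T> F \<rho> V s = restrict (germ \<T> F \<rho> V s) V"

text \<open>
  A family of binary operations on the \<open>F V\<close>, compatible with restriction, acts on germs through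
  representatives with a common domain; the sets in the union below all coincide.
\<close>

definition sheafify_op ::
    "'p topology \<Rightarrow> ('p set \<Rightarrow> 's set) \<Rightarrow> ('p set \<Rightarrow> 'p set \<Rightarrow> 's \<Rightarrow> 's) \<Rightarrow>
     ('p set \<Rightarrow> 's \<Rightarrow> 's \<Rightarrow> 's) \<Rightarrow> 'p set \<Rightarrow>
     ('p \<Rightarrow> ('p set \<times> 's) set) \<Rightarrow> ('p \<Rightarrow> ('p set \<times> 's) set) \<Rightarrow> 'p \<Rightarrow> ('p set \<times> 's) set" where
  "sheafify_op \<T> F \<rho> opr V \<sigma> \<tau> =
     (\<lambda>p\<in>V. \<Union>{germ \<T> F \<rho> W (opr W s t) p | W s t. (W, s) \<in> \<sigma> p \<and> (W, t) \<in> \<tau> p})"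

definition sheafify_monoid ::
    "'p topology \<Rightarrow> ('p set \<Rightarrow> 's monoid) \<Rightarrow> ('p set \<Rightarrow> 'p set \<Rightarrow> 's \<Rightarrow> 's) \<Rightarrow>
     'p set \<Rightarrow> ('p \<Rightarrow> ('p set \<times> 's) set) monoid" where
  "sheafify_monoid \<T> F \<rho> V =
     \<lparr>carrier = sheafify_sections \<T> (\<lambda>W. carrier (F W)) \<rho> V,
      mult = sheafify_op \<T> (\<lambda>W. carrier (F W)) \<rho> (\<lambda>W. mult (F W)) V,
      one = to_sheafify \<T> (\<lambda>W. carrier (F W)) \<rho> V \<one>\<^bsub>F V\<^esub>\<rparr>"

definition sheafify_ring ::
    "'p topology \<Rightarrow> ('p set \<Rightarrow> 's ring) \<Rightarrow> ('p set \<Rightarrow> 'p set \<Rightarrow> 's \<Rightarrow> 's) \<Rightarrow>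
     'p set \<Rightarrow> ('p \<Rightarrow> ('p set \<times> 's) set) ring" where
  "sheafify_ring \<T> F \<rho> V =
     \<lparr>carrier = sheafify_sections \<T> (\<lambda>W. carrier (F W)) \<rho> V,
      mult = sheafify_op \<T> (\<lambda>W. carrier (F W)) \<rho> (\<lambda>W. mult (F W)) V,
      one = to_sheafify \<T> (\<lambda>W. carrier (F W)) \<rho> V \<one>\<^bsub>F V\<^esub>,
      zero = to_sheafify \<T> (\<lambda>W. carrier (F W)) \<rho> V \<zero>\<^bsub>F V\<^esub>,
      add = sheafify_op \<T> (\<lambda>W. carrier (F W)) \<rho> (\<lambda>W. add (F W)) V\<rparr>"


section \<open>Positive log structures and manifolds with log corners\<close>

text \<open>The sections of the monoid sheaf over all open sets are encoded in one type \<open>'m\<close>.\<close>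

record ('p, 'm) log_space =
  space_of :: "'p topology"
  atlas :: "'p chart set"
  log_secs :: "'p set \<Rightarrow> 'm monoid"
  log_restr :: "'p set \<Rightarrow> 'p set \<Rightarrow> 'm \<Rightarrow> 'm"
  log_alpha :: "'p set \<Rightarrow> 'm \<Rightarrow> 'p \<Rightarrow> real"

definition positive_log_structure :: "('p, 'm) log_space \<Rightarrow> bool" where
  "positive_log_structure S \<longleftrightarrow>
     sheaf_of_monoids (space_of S) (log_secs S) (log_restr S) \<and>
     (\<forall>V. openin (space_of S) V \<longrightarrow>
        (\<forall>s\<in>carrier (log_secs S V).
           log_alpha S V s \<in> carrier (smooth_ring (atlas S) V) \<and> (\<forall>p\<in>V. 0 \<le> log_alpha S V s p)) \<and>
        log_alpha S V \<in> hom (log_secs S V) (smooth_ring (atlas S) V) \<and>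
        log_alpha S V \<one>\<^bsub>log_secs S V\<^esub> = \<one>\<^bsub>smooth_ring (atlas S) V\<^esub> \<and>
        bij_betw (log_alpha S V)
          {s \<in> carrier (log_secs S V). \<forall>p\<in>V. 0 < log_alpha S V s p}
          {f \<in> carrier (smooth_ring (atlas S) V). \<forall>p\<in>V. 0 < f p}) \<and>
     (\<forall>V W. openin (space_of S) V \<and> openin (space_of S) W \<and> W \<subseteq> V \<longrightarrow>
        (\<forall>s\<in>carrier (log_secs S V).
           log_alpha S W (log_restr S V W s) = restrict (log_alpha S V s) W))"

text \<open>
  The monoid sheaf of the standard log corner \<open>[0,\<infinity>)\<^sup>n \<times> [0)\<^sup>k\<close>. The phantom coordinates are free, so
  monomials in them are multisets \<open>c\<close> of indices below \<open>k\<close>, whereas the basic coordinates are actual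
  functions. Hence a section is a function \<open>y \<mapsto> (h y \<cdot> y\<^sup>a, c)\<close> where locally \<open>h\<close> is positive and
  smooth, and \<open>a\<close> and \<open>c\<close> are constant.
\<close>

type_synonym std_section = "(nat \<Rightarrow> real) \<Rightarrow> real \<times> nat multiset"

definition std_log_secs :: "nat \<Rightarrow> nat \<Rightarrow> (nat \<Rightarrow> real) set \<Rightarrow> std_section monoid" where
  "std_log_secs n k W =
     \<lparr>carrier = {s \<in> extensional W. \<forall>x\<in>W. \<exists>N h a c.
        openin (orthant n) N \<and> x \<in> N \<and> N \<subseteq> W \<and> smooth_on n N h \<and> (\<forall>y\<in>N. 0 < h y) \<and>
        set_mset c \<subseteq> {..<k} \<and> (\<forall>y\<in>N. s y = (h y * (\<Prod>i<n. y i ^ a i), c))},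
      mult = (\<lambda>s t. \<lambda>x\<in>W. (fst (s x) * fst (t x), snd (s x) + snd (t x))),
      one = (\<lambda>x\<in>W. (1, {#}))\<rparr>"

definition std_alpha :: "std_section \<Rightarrow> (nat \<Rightarrow> real) \<Rightarrow> real" where
  "std_alpha s x = (if snd (s x) = {#} then fst (s x) else 0)"

definition std_basic :: "(nat \<Rightarrow> real) set \<Rightarrow> nat \<Rightarrow> std_section" where
  "std_basic W i = (\<lambda>x\<in>W. (x i, {#}))"

definition std_phantom :: "(nat \<Rightarrow> real) set \<Rightarrow> nat \<Rightarrow> std_section" where
  "std_phantom W l = (\<lambda>x\<in>W. (1, {#l#}))"

text \<open>
  \<open>log_chart S n k U \<phi> \<Phi>\<close>: an isomorphism of the open set \<open>U\<close> with an open subset of the standard log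
  corner. The underlying diffeomorphism is a chart of the (maximal) atlas, and \<open>\<Phi>\<close> is an isomorphism
  of sheaves of monoids from the standard one on \<open>\<phi> ` U\<close> to the given one on \<open>U\<close>, over \<open>\<alpha>\<close>.
\<close>

definition log_chart ::
    "('p, 'm) log_space \<Rightarrow> nat \<Rightarrow> nat \<Rightarrow> 'p set \<Rightarrow> ('p \<Rightarrow> nat \<Rightarrow> real) \<Rightarrow>
     ((nat \<Rightarrow> real) set \<Rightarrow> std_section \<Rightarrow> 'm) \<Rightarrow> bool" where
  "log_chart S n k U \<phi> \<Phi> \<longleftrightarrow>
     (n, U, \<phi>) \<in> atlas S \<and>
     (\<forall>W. openin (orthant n) W \<and> W \<subseteq> \<phi> ` U \<longrightarrow>
        \<Phi> W \<in> iso (std_log_secs n k W) (log_secs S (U \<inter> \<phi> -` W)) \<and>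
        (\<forall>s\<in>carrier (std_log_secs n k W). \<forall>p\<in>U \<inter> \<phi> -` W.
           log_alpha S (U \<inter> \<phi> -` W) (\<Phi> W s) p = std_alpha s (\<phi> p))) \<and>
     (\<forall>W N. openin (orthant n) W \<and> openin (orthant n) N \<and> N \<subseteq> W \<and> W \<subseteq> \<phi> ` U \<longrightarrow>
        (\<forall>s\<in>carrier (std_log_secs n k W).
           log_restr S (U \<inter> \<phi> -` W) (U \<inter> \<phi> -` N) (\<Phi> W s) = \<Phi> N (restrict s N)))"

definition manifold_with_log_corners :: "('p, 'm) log_space \<Rightarrow> bool" where
  "manifold_with_log_corners S \<longleftrightarrow>
     manifold_with_corners (space_of S) (atlas S) \<and> positive_log_structure S \<and>
     (\<forall>p\<in>topspace (space_of S). \<exists>n k U \<phi> \<Phi>. p \<in> U \<and> log_chart S n k U \<phi> \<Phi>)"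

definition log_coordinates ::
    "('p, 'm) log_space \<Rightarrow> 'p set \<Rightarrow> nat \<Rightarrow> nat \<Rightarrow> (nat \<Rightarrow> 'm) \<Rightarrow> (nat \<Rightarrow> 'm) \<Rightarrow> bool" where
  "log_coordinates S U n k r t \<longleftrightarrow>
     (\<exists>\<phi> \<Phi>. log_chart S n k U \<phi> \<Phi> \<and>
        (\<forall>i<n. r i = \<Phi> (\<phi> ` U) (std_basic (\<phi> ` U) i)) \<and>
        (\<forall>l<k. t l = \<Phi> (\<phi> ` U) (std_phantom (\<phi> ` U) l)))"

definition basic_secs :: "('p, 'm) log_space \<Rightarrow> 'p set \<Rightarrow> 'm set" where
  "basic_secs S V = {f \<in> carrier (log_secs S V).
     \<forall>p\<in>V. \<forall>N. openin (space_of S) N \<and> p \<in> N \<and> N \<subseteq> V \<longrightarrow> (\<exists>q\<in>N. log_alpha S V f q \<noteq> 0)}"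


section \<open>Group completion\<close>

definition gp_rel :: "'m monoid \<Rightarrow> (('m \<times> 'm) \<times> ('m \<times> 'm)) set" where
  "gp_rel G = {((a, b), (c, d)). {a, b, c, d} \<subseteq> carrier G \<and>
     (\<exists>e\<in>carrier G. e \<otimes>\<^bsub>G\<^esub> (a \<otimes>\<^bsub>G\<^esub> d) = e \<otimes>\<^bsub>G\<^esub> (c \<otimes>\<^bsub>G\<^esub> b))}"

text \<open>The class of \<open>(a, b)\<close> stands for the quotient \<open>a / b\<close>.\<close>

definition gp_class :: "'m monoid \<Rightarrow> 'm \<Rightarrow> 'm \<Rightarrow> ('m \<times> 'm) set" where
  "gp_class G a b = gp_rel G `` {(a, b)}"

definition gp_completion :: "'m monoid \<Rightarrow> ('m \<times> 'm) set monoid" where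
  "gp_completion G =
     \<lparr>carrier = (carrier G \<times> carrier G) // gp_rel G,
      mult = (\<lambda>A B. \<Union>(a, b)\<in>A. \<Union>(c, d)\<in>B. gp_class G (a \<otimes>\<^bsub>G\<^esub> c) (b \<otimes>\<^bsub>G\<^esub> d)),
      one = gp_class G \<one>\<^bsub>G\<^esub> \<one>\<^bsub>G\<^esub>\<rparr>"

definition gp_presheaf :: "('p, 'm) log_space \<Rightarrow> 'p set \<Rightarrow> ('m \<times> 'm) set monoid" where
  "gp_presheaf S V = gp_completion (log_secs S V)"

definition gp_presheaf_restr ::
    "('p, 'm) log_space \<Rightarrow> 'p set \<Rightarrow> 'p set \<Rightarrow> ('m \<times> 'm) set \<Rightarrow> ('m \<times> 'm) set" where
  "gp_presheaf_restr S V W A =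
     (\<Union>(a, b)\<in>A. gp_class (log_secs S W) (log_restr S V W a) (log_restr S V W b))"

type_synonym ('p, 'm) gp_section = "'p \<Rightarrow> ('p set \<times> ('m \<times> 'm) set) set"

definition gp_secs :: "('p, 'm) log_space \<Rightarrow> 'p set \<Rightarrow> ('p, 'm) gp_section monoid" where
  "gp_secs S = sheafify_monoid (space_of S) (gp_presheaf S) (gp_presheaf_restr S)"

definition to_gp :: "('p, 'm) log_space \<Rightarrow> 'p set \<Rightarrow> 'm \<Rightarrow> ('p, 'm) gp_section" where
  "to_gp S V f =
     to_sheafify (space_of S) (\<lambda>W. carrier (gp_presheaf S W)) (gp_presheaf_restr S) V
       (gp_class (log_secs S V) f \<one>\<^bsub>log_secs S V\<^esub>)"


section \<open>Polynomial algebras\<close>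

text \<open>
  Polynomials over \<open>R\<close> in the variables \<open>I\<close>, as in \<^theory>\<open>HOL-Algebra.Indexed_Polynomials\<close>: functions
  from monomials (multisets of variables) to coefficients. That theory only provides multiplication
  by a variable.
\<close>

definition mpoly_ring :: "'a ring \<Rightarrow> 'c set \<Rightarrow> ('c multiset \<Rightarrow> 'a) ring" where
  "mpoly_ring R I =
     \<lparr>carrier = ring.indexed_pset R I (carrier R),
      mult = (\<lambda>P Q m. \<Oplus>\<^bsub>R\<^esub>a\<in>{a. a \<subseteq># m}. P a \<otimes>\<^bsub>R\<^esub> Q (m - a)),
      one = ring.indexed_const R \<one>\<^bsub>R\<^esub>,
      zero = ring.indexed_const R \<zero>\<^bsub>R\<^esub>,
      add = ring.indexed_padd R\<rparr>"

text \<open>The map of polynomial algebras induced by \<open>h\<close> on coefficients and \<open>g\<close> on variables.\<close>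

definition mpoly_map ::
    "'a ring \<Rightarrow> 'b ring \<Rightarrow> ('a \<Rightarrow> 'b) \<Rightarrow> ('c \<Rightarrow> 'd) \<Rightarrow> ('c multiset \<Rightarrow> 'a) \<Rightarrow> 'd multiset \<Rightarrow> 'b" where
  "mpoly_map R R' h g P m =
     (\<Oplus>\<^bsub>R'\<^esub>a\<in>{a. P a \<noteq> \<zero>\<^bsub>R\<^esub> \<and> image_mset g a = m}. h (P a))"


section \<open>The sheaf of logarithmic functions\<close>

text \<open>
  The sheaf is associated to the presheaf which maps \<open>V\<close> to the polynomial algebra over the smooth
  functions on \<open>V\<close> with one variable \<open>log f\<close> for each section \<open>f\<close> of the group completion over \<open>V\<close>,
  modulo the ideal generated by the two kinds of relations.
\<close>

type_synonym ('p, 'm) free_log = "('p, 'm) gp_section multiset \<Rightarrow> 'p \<Rightarrow> real"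
type_synonym ('p, 'm) log_section = "'p \<Rightarrow> ('p set \<times> ('p, 'm) free_log set) set"

definition free_log_ring :: "('p, 'm) log_space \<Rightarrow> 'p set \<Rightarrow> ('p, 'm) free_log ring" where
  "free_log_ring S V = mpoly_ring (smooth_ring (atlas S) V) (carrier (gp_secs S V))"

abbreviation free_log_var ::
    "('p, 'm) log_space \<Rightarrow> 'p set \<Rightarrow> ('p, 'm) gp_section \<Rightarrow> ('p, 'm) free_log" where
  "free_log_var S V \<equiv> ring.indexed_var (smooth_ring (atlas S) V)"

abbreviation free_log_const ::
    "('p, 'm) log_space \<Rightarrow> 'p set \<Rightarrow> ('p \<Rightarrow> real) \<Rightarrow> ('p, 'm) free_log" where
  "free_log_const S V \<equiv> ring.indexed_const (smooth_ring (atlas S) V)"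

definition log_relations :: "('p, 'm) log_space \<Rightarrow> 'p set \<Rightarrow> ('p, 'm) free_log set" where
  "log_relations S V =
     {free_log_var S V (f\<^sub>1 \<otimes>\<^bsub>gp_secs S V\<^esub> f\<^sub>2) \<ominus>\<^bsub>free_log_ring S V\<^esub>
        (free_log_var S V f\<^sub>1 \<oplus>\<^bsub>free_log_ring S V\<^esub> free_log_var S V f\<^sub>2)
      | f\<^sub>1 f\<^sub>2. f\<^sub>1 \<in> carrier (gp_secs S V) \<and> f\<^sub>2 \<in> carrier (gp_secs S V)} \<union>
     {(free_log_const S V g \<otimes>\<^bsub>free_log_ring S V\<^esub> free_log_var S V (to_gp S V f))
        \<ominus>\<^bsub>free_log_ring S V\<^esub> free_log_const S V G
      | f g G. f \<in> basic_secs S V \<and>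
          g \<in> carrier (smooth_ring (atlas S) V) \<and> G \<in> carrier (smooth_ring (atlas S) V) \<and>
          (\<forall>p\<in>V \<inter> mfd_interior (atlas S). G p = g p * ln (log_alpha S V f p))}"

definition log_ideal :: "('p, 'm) log_space \<Rightarrow> 'p set \<Rightarrow> ('p, 'm) free_log set" where
  "log_ideal S V = genideal (free_log_ring S V) (log_relations S V)"

definition log_presheaf :: "('p, 'm) log_space \<Rightarrow> 'p set \<Rightarrow> ('p, 'm) free_log set ring" where
  "log_presheaf S V = free_log_ring S V Quot log_ideal S V"

definition log_class ::
    "('p, 'm) log_space \<Rightarrow> 'p set \<Rightarrow> ('p, 'm) free_log \<Rightarrow> ('p, 'm) free_log set" where
  "log_class S V P = log_ideal S V +>\<^bsub>free_log_ring S V\<^esub> P"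

definition log_presheaf_restr ::
    "('p, 'm) log_space \<Rightarrow> 'p set \<Rightarrow> 'p set \<Rightarrow> ('p, 'm) free_log set \<Rightarrow> ('p, 'm) free_log set" where
  "log_presheaf_restr S V W A =
     (\<Union>P\<in>A. log_class S W
        (mpoly_map (smooth_ring (atlas S) V) (smooth_ring (atlas S) W)
           (\<lambda>f. restrict f W) (\<lambda>\<sigma>. restrict \<sigma> W) P))"

definition log_sheaf :: "('p, 'm) log_space \<Rightarrow> 'p set \<Rightarrow> ('p, 'm) log_section ring" where
  "log_sheaf S = sheafify_ring (space_of S) (log_presheaf S) (log_presheaf_restr S)"

definition log_sheaf_class ::
    "('p, 'm) log_space \<Rightarrow> 'p set \<Rightarrow> ('p, 'm) free_log \<Rightarrow> ('p, 'm) log_section" where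
  "log_sheaf_class S V P =
     to_sheafify (space_of S) (\<lambda>W. carrier (log_presheaf S W)) (log_presheaf_restr S) V
       (log_class S V P)"

definition log_symbol ::
    "('p, 'm) log_space \<Rightarrow> 'p set \<Rightarrow> ('p, 'm) gp_section \<Rightarrow> ('p, 'm) log_section" where
  "log_symbol S V f = log_sheaf_class S V (free_log_var S V f)"

definition log_scalar ::
    "('p, 'm) log_space \<Rightarrow> 'p set \<Rightarrow> ('p \<Rightarrow> real) \<Rightarrow> ('p, 'm) log_section" where
  "log_scalar S V g = log_sheaf_class S V (free_log_const S V g)"


section \<open>Polynomials in the logarithms\<close>

abbreviation interior_ring :: "('p, 'm) log_space \<Rightarrow> 'p set \<Rightarrow> ('p \<Rightarrow> real) ring" where
  "interior_ring S V \<equiv> smooth_ring (atlas S) (V \<inter> mfd_interior (atlas S))"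

text \<open>
  Sections over \<open>V\<close> of the sheaf of algebras \<open>(j\<^sub>* C\<^sup>\<infinity>)[T\<^sub>0, \<dots>, T\<^sub>k\<^sub>-\<^sub>1]\<close>, where \<open>j\<close> is the inclusion of the
  interior: families of smooth functions on the interior of \<open>V\<close>, indexed by the monomials in the
  \<open>T\<^sub>l\<close>, which near each point of \<open>V\<close> are polynomials. The product of two such families is a finite sum
  in each monomial, given by the same formula as for polynomials.
\<close>

definition poly_sheaf ::
    "('p, 'm) log_space \<Rightarrow> nat \<Rightarrow> 'p set \<Rightarrow> (nat multiset \<Rightarrow> 'p \<Rightarrow> real) ring" where
  "poly_sheaf S k V = (mpoly_ring (interior_ring S V) {..<k})
     \<lparr>carrier := {F. (\<forall>J. F J \<in> carrier (interior_ring S V)) \<and>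
        (\<forall>p\<in>V. \<exists>W. openin (space_of S) W \<and> p \<in> W \<and> W \<subseteq> V \<and>
           (\<lambda>J. restrict (F J) (W \<inter> mfd_interior (atlas S)))
             \<in> carrier (mpoly_ring (interior_ring S W) {..<k}))}\<rparr>"

text \<open>
  The sections over \<open>V \<subseteq> U\<close> which are locally finite sums of terms
  \<open>f\<^sub>I\<^sub>,\<^sub>J (log r)\<^sup>I T\<^sup>J\<close> with \<open>f\<^sub>I\<^sub>,\<^sub>J\<close> smooth up to the boundary, compared coefficientwise.
\<close>

definition log_poly_sheaf ::
    "('p, 'm) log_space \<Rightarrow> 'p set \<Rightarrow> nat \<Rightarrow> nat \<Rightarrow> (nat \<Rightarrow> 'm) \<Rightarrow> 'p set \<Rightarrow>
     (nat multiset \<Rightarrow> 'p \<Rightarrow> real) ring" where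
  "log_poly_sheaf S U n k r V = (poly_sheaf S k V)
     \<lparr>carrier := {F \<in> carrier (poly_sheaf S k V).
        \<forall>p\<in>V. \<exists>W A c. openin (space_of S) W \<and> p \<in> W \<and> W \<subseteq> V \<and> finite A \<and>
          (\<forall>(I, J)\<in>A. set_mset I \<subseteq> {..<n} \<and> set_mset J \<subseteq> {..<k} \<and>
             c I J \<in> carrier (smooth_ring (atlas S) W)) \<and>
          (\<forall>J. \<forall>q\<in>W \<inter> mfd_interior (atlas S).
             F J q = (\<Sum>I | (I, J) \<in> A. c I J q * (\<Prod>i<n. ln (log_alpha S U (r i) q) ^ count I i)))}\<rparr>"

definition poly_scalar ::
    "('p, 'm) log_space \<Rightarrow> 'p set \<Rightarrow> ('p \<Rightarrow> real) \<Rightarrow> nat multiset \<Rightarrow> 'p \<Rightarrow> real" where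
  "poly_scalar S V g =
     ring.indexed_const (interior_ring S V) (restrict g (V \<inter> mfd_interior (atlas S)))"

definition poly_sheaf_restr ::
    "('p, 'm) log_space \<Rightarrow> 'p set \<Rightarrow> (nat multiset \<Rightarrow> 'p \<Rightarrow> real) \<Rightarrow> nat multiset \<Rightarrow> 'p \<Rightarrow> real" where
  "poly_sheaf_restr S W F = (\<lambda>J. restrict (F J) (W \<inter> mfd_interior (atlas S)))"

end

theory Submission
  imports Defs "HOL-Real_Asymp.Real_Asymp" "HOL-Library.Poly_Mapping"
begin

text \<open>
  At an interior point \<open>q\<close> a germ of the monoid sheaf is a positive number \<open>v\<close> times a phantom monomial
  \<open>t\<^sup>c\<close>; sending \<open>log f\<close> to \<open>ln v + (\<Sum>l\<in>c. T\<^sub>l)\<close> respects both kinds of relations and defines the map to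
  polynomials. Since a germ is a unit times a monomial in the coordinates, and the logarithm of a
  unit is a smooth function, every germ of a logarithmic function is a polynomial in the symbols
  \<open>log r\<^sub>i\<close> and \<open>log t\<^sub>l\<close>; this gives the image.

  Injectivity comes down to smooth relations \<open>\<Sum>\<^sub>I f\<^sub>I (log r)\<^sup>I = 0\<close> near a corner. Comparing growth rates
  along rays, the coefficients vanish to infinite order on the stratum where all coordinates involved
  vanish. A partition of unity by functions of degree \<open>0\<close> writes such a coefficient as a sum of
  functions \<open>g\<close> vanishing to infinite order along one hyperplane \<open>r\<^sub>i = 0\<close>, for which \<open>g log r\<^sub>i\<close> is smooth,
  so that a relation \<open>g log r\<^sub>i = h\<close> of the second kind removes \<open>log r\<^sub>i\<close>. Induction on the number of
  coordinates shows that the relation follows from those of the second kind.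
\<close>

section \<open>Smoothness up to the boundary\<close>

text \<open>Infinite order vanishing is available only on the deepest stratum, and this shapes the
  elimination. If g1 is flat along r_1 = 0 and g2 along r_2 = 0, then (g1 + g2) log r_1 log r_2 -
  (g1 log r_1) log r_2 - (g2 log r_2) log r_1 = 0 has smooth coefficients, but the leading one is in
  general flat along neither hyperplane. So no logarithm can be removed before this coefficient is
  split. The splitting functions have degree 0 and are singular at the corner; flatness of the
  coefficient there repairs this. Two notions of smoothness are kept apart. Charts ask for a smooth
  extension to an open set, whereas products such as g log r_i are controlled only through one-sided
  derivatives on the orthant. Reflection across the boundary hyperplanes identifies the two locally.
  Values are taken at interior points only, where all basic coordinates are positive. The phantom
  logarithms are independent variables, so a relation splits into one relation between basic
  logarithms for every phantom monomial.\<close>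

type_synonym rfun = "(nat \<Rightarrow> real) \<Rightarrow> real"

definition espace :: "nat \<Rightarrow> (nat \<Rightarrow> real) set" where
 "espace n = {x. \<forall>i\<ge>n. x i = 0}"

lemma Euclidean_space_top_of_set: "Euclidean_space n = top_of_set (espace n)"
 by (simp add: Euclidean_space_def espace_def euclidean_product_topology)

lemma espace_upd [simp]: "x \<in> espace n ==> i < n ==> x(i := u) \<in> espace n" by (auto simp: espace_def)

text \<open>The parameter \<open>u\<close> ranges over the slice of \<open>D\<close> through
  \<open>x\<close>, so the derivative is one-sided at a boundary point of an orthant and two-sided
  where the slice contains a neighbourhood.\<close>

definition has_partial :: "nat \<Rightarrow> (nat \<Rightarrow> real) set \<Rightarrow> rfun \<Rightarrow> rfun \<Rightarrow> bool" where
 "has_partial i D f f' \<longleftrightarrow>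
  (\<forall>x\<in>D. ((\<lambda>u. f (x(i := u))) has_real_derivative f' x) (at (x i) within {u. x(i := u) \<in> D}))"

text \<open>The condition \<open>P\<close> is imposed on every iterated partial. It is a parameter
  so that one calculus serves continuous, bounded, flat and polynomially growing functions.\<close>

primrec partials :: "(rfun \<Rightarrow> bool) \<Rightarrow> nat \<Rightarrow> (nat \<Rightarrow> real) set \<Rightarrow> nat \<Rightarrow> rfun \<Rightarrow> bool" where
 "partials P n D 0 f \<longleftrightarrow> P f"
| "partials P n D (Suc k) f \<longleftrightarrow> P f \<and> (\<forall>i<n. \<exists>f'. has_partial i D f f' \<and> partials P n D k f')"

definition smooth_with :: "(rfun \<Rightarrow> bool) \<Rightarrow> nat \<Rightarrow> (nat \<Rightarrow> real) set \<Rightarrow> rfun \<Rightarrow> bool" where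
 "smooth_with P n D f \<longleftrightarrow> (\<forall>k. partials P n D k f)"

abbreviation smooth :: "nat \<Rightarrow> (nat \<Rightarrow> real) set \<Rightarrow> rfun \<Rightarrow> bool" where
 "smooth n D \<equiv> smooth_with (continuous_on D) n D"

text \<open>Every slice accumulates at the point in question, which makes one-sided partials
  unique.\<close>

definition slices_fat :: "nat \<Rightarrow> (nat \<Rightarrow> real) set \<Rightarrow> bool" where
 "slices_fat n D \<longleftrightarrow> (\<forall>x\<in>D. \<forall>i<n. at (x i) within {u. x(i := u) \<in> D} \<noteq> bot)"

definition respects_on :: "(nat \<Rightarrow> real) set \<Rightarrow> (rfun \<Rightarrow> bool) \<Rightarrow> bool" where
 "respects_on D P \<longleftrightarrow> (\<forall>f g. (\<forall>x\<in>D. f x = g x) \<longrightarrow> P f \<longrightarrow> P g)"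

definition closed_add :: "(rfun \<Rightarrow> bool) \<Rightarrow> bool" where
 "closed_add P \<longleftrightarrow> (\<forall>f g. P f \<longrightarrow> P g \<longrightarrow> P (\<lambda>x. f x + g x))"

definition closed_mult :: "(rfun \<Rightarrow> bool) \<Rightarrow> (rfun \<Rightarrow> bool) \<Rightarrow>
  (rfun \<Rightarrow> bool) \<Rightarrow> bool" where
 "closed_mult P Q R \<longleftrightarrow> (\<forall>f g. P f \<longrightarrow> Q g \<longrightarrow> R (\<lambda>x. f x * g x))"

lemma has_partial_cong:
 assumes "has_partial i D f f'" "\<And>x. x \<in> D ==> f x = g x" "\<And>x. x \<in> D ==> f' x = g' x"
 shows "has_partial i D g g'" unfolding has_partial_def
proof
 fix x assume x: "x \<in> D"
 have "((\<lambda>u. f (x(i := u))) has_real_derivative f' x) (at (x i) within {u. x(i := u) \<in> D})" using assms(1) x by (auto simp: has_partial_def)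
 then have "((\<lambda>u. g (x(i := u))) has_real_derivative f' x) (at (x i) within {u. x(i := u) \<in> D})" unfolding has_field_derivative_def
  by (rule has_derivative_transform[rotated 2]) (use assms(2) x in auto)
 then show "((\<lambda>u. g (x(i := u))) has_real_derivative g' x) (at (x i) within {u. x(i := u) \<in> D})" using assms(3)[OF x] by simp
qed

lemma has_partial_subset: "has_partial i D f f' ==> D' \<subseteq> D ==> has_partial i D' f f'" unfolding has_partial_def by (blast intro: DERIV_subset)

lemma has_partial_unique:
 assumes "slices_fat n D" "i < n" "has_partial i D f f'" "has_partial i D f g'" "x \<in> D"
 shows "f' x = g' x"
proof -
 have "((\<lambda>u. f (x(i := u))) has_real_derivative f' x) (at (x i) within {u. x(i := u) \<in> D})"
   "((\<lambda>u. f (x(i := u))) has_real_derivative g' x) (at (x i) within {u. x(i := u) \<in> D})"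
   "at (x i) within {u. x(i := u) \<in> D} \<noteq> bot" using assms by (auto simp: has_partial_def slices_fat_def)
 then show ?thesis unfolding has_field_derivative_iff using tendsto_unique by fast
qed

lemma has_partial_add:
 "has_partial i D f f' ==> has_partial i D g g' ==> has_partial i D (\<lambda>x. f x + g x) (\<lambda>x. f' x + g' x)"
 unfolding has_partial_def by (auto intro!: DERIV_add)

lemma has_partial_mult:
 "has_partial i D f f' ==> has_partial i D g g' ==> has_partial i D (\<lambda>x. f x * g x) (\<lambda>x. f x * g' x + f' x * g x)"
 unfolding has_partial_def by (auto intro!: derivative_eq_intros)

text \<open>The derivative is expressed through \<open>1 / f\<close> again, so that an induction
  over the order only has to form products.\<close>

lemma has_partial_inverse:
 assumes "has_partial i D f f'" "\<And>x. x \<in> D ==> f x \<noteq> 0"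
 shows "has_partial i D (\<lambda>x. 1 / f x) (\<lambda>x. (- f' x) * ((1 / f x) * (1 / f x)))"
 using assms unfolding has_partial_def by (auto intro!: derivative_eq_intros simp: field_simps)

lemma has_partial_const: "has_partial i D (\<lambda>x. c) (\<lambda>x. 0)" unfolding has_partial_def by auto

lemma has_partial_coord: "has_partial i D (\<lambda>x. x j) (\<lambda>x. if i = j then 1 else 0)"
 unfolding has_partial_def by (auto intro!: derivative_eq_intros)

lemma continuous_on_upd: "continuous_on S (\<lambda>u. (x :: nat \<Rightarrow> real)(i := u))"
proof (rule continuous_on_coordinatewise_then_product)
 fix j show "continuous_on S (\<lambda>u. (x(i := u)) j)" by (cases "j = i") (auto intro: continuous_on_id)
qed

lemma continuous_on_upd_const: "continuous_on S (\<lambda>x. (x :: nat \<Rightarrow> real)(i := c))"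
proof (rule continuous_on_coordinatewise_then_product)
 fix j show "continuous_on S (\<lambda>x. (x(i := c)) j)" by (cases "j = i") (auto intro: continuous_on_product_coordinates continuous_on_subset)
qed

lemma at_slice_open:
 assumes "open O'" "(x :: nat \<Rightarrow> real) \<in> O'"
 shows "at (x i) within {u. x(i := u) \<in> D \<inter> O'} = at (x i) within {u. x(i := u) \<in> D}"
proof (rule at_within_nhd)
 have "open ((\<lambda>u. x(i := u)) -` O')" using continuous_on_upd[of UNIV x i] assms(1) by (simp add: continuous_on_open_vimage)
 then show "open {u. x(i := u) \<in> O'}" by (simp add: vimage_def)
 show "x i \<in> {u. x(i := u) \<in> O'}" using assms(2) by simp
qed auto

lemma slices_fat_Int_open: "slices_fat n D ==> open O' ==> slices_fat n (D \<inter> O')" unfolding slices_fat_def using at_slice_open by fastforce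

lemma partials_SucE:
 assumes "partials P n D (Suc k) f" "i < n"
 obtains f' where "has_partial i D f f'" "partials P n D k f'" using assms by auto

lemma partials_SucI:
 assumes "P f" "\<And>i. i < n ==> \<exists>f'. has_partial i D f f' \<and> partials P n D k f'"
 shows "partials P n D (Suc k) f" using assms by simp

lemma partials_imp: "partials P n D k f ==> P f" by (cases k) auto

lemma partials_SucD: "partials P n D (Suc k) f ==> partials P n D k f"
proof (induction k arbitrary: f)
 case (Suc k)
 show ?case
 proof (rule partials_SucI)
  show "P f" using Suc.prems by (rule partials_imp)
  show "\<exists>f'. has_partial i D f f' \<and> partials P n D k f'" if "i < n" for i using partials_SucE[OF Suc.prems that] Suc.IH by metis
 qed
qed auto

lemma partials_mono:
 assumes "partials P n D k f" "\<And>f. P f ==> Q f"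
 shows "partials Q n D k f" using assms(1)
proof (induction k arbitrary: f)
 case (Suc k)
 show ?case
 proof (rule partials_SucI)
  show "Q f" using assms(2) partials_imp[OF Suc.prems] .
  show "\<exists>f'. has_partial i D f f' \<and> partials Q n D k f'" if "i < n" for i using partials_SucE[OF Suc.prems that] Suc.IH by metis
 qed
qed (use assms(2) in auto)

lemma partials_cong:
 assumes "partials P n D k f" "\<And>x. x \<in> D ==> f x = g x"
  and "respects_on D P"
 shows "partials P n D k g"
proof (cases k)
 case 0 then show ?thesis using assms(2,3) partials_imp[OF assms(1)] by (auto simp: respects_on_def)
next
 case (Suc l)
 have "has_partial i D g f'" if "has_partial i D f f'" for i f' by (rule has_partial_cong[OF that assms(2)]) simp_all
 moreover have "P g" using assms(2,3) partials_imp[OF assms(1)] unfolding respects_on_def by blast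
 ultimately show ?thesis using assms(1) unfolding Suc partials.simps by blast
qed

lemma partials_subset:
 assumes "partials P n D k f" "D' \<subseteq> D" "\<And>f. P f ==> Q f"
 shows "partials Q n D' k f" using assms(1)
proof (induction k arbitrary: f)
 case (Suc k)
 show ?case
 proof (rule partials_SucI)
  show "Q f" using assms(3) partials_imp[OF Suc.prems] .
  show "\<exists>f'. has_partial i D' f f' \<and> partials Q n D' k f'" if "i < n" for i
   using partials_SucE[OF Suc.prems that] has_partial_subset[OF _ assms(2)] Suc.IH by metis
 qed
qed (use assms(3) in auto)

lemma partials_add:
 assumes add: "closed_add P"
 shows "partials P n D k f ==> partials P n D k g ==> partials P n D k (\<lambda>x. f x + g x)"
proof (induction k arbitrary: f g)
 case (Suc k)
 have "\<exists>h. has_partial i D (\<lambda>x. f x + g x) h \<and> partials P n D k h" if i: "i < n" for i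
 proof -
  obtain f' where f': "has_partial i D f f'" "partials P n D k f'" by (rule partials_SucE[OF Suc.prems(1) i])
  obtain g' where g': "has_partial i D g g'" "partials P n D k g'" by (rule partials_SucE[OF Suc.prems(2) i])
  show ?thesis using Suc.IH[OF f'(2) g'(2)] has_partial_add[OF f'(1) g'(1)] by blast
 qed
 then show ?case using Suc.prems add by (simp add: closed_add_def)
qed (use add in \<open>auto simp: closed_add_def\<close>)

lemma partials_mult:
 assumes mult: "closed_mult P Q R" and add: "closed_add R"
 shows "partials P n D k f ==> partials Q n D k g ==> partials R n D k (\<lambda>x. f x * g x)"
proof (induction k arbitrary: f g)
 case (Suc k)
 have "\<exists>h. has_partial i D (\<lambda>x. f x * g x) h \<and> partials R n D k h" if i: "i < n" for i
 proof -
  obtain f' where f': "has_partial i D f f'" "partials P n D k f'" by (rule partials_SucE[OF Suc.prems(1) i])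
  obtain g' where g': "has_partial i D g g'" "partials Q n D k g'" by (rule partials_SucE[OF Suc.prems(2) i])
  have "partials R n D k (\<lambda>x. f x * g' x + f' x * g x)" by (intro partials_add[OF add] Suc.IH f'(2) g'(2) partials_SucD[OF Suc.prems(1)]
     partials_SucD[OF Suc.prems(2)])
  then show ?thesis using has_partial_mult[OF f'(1) g'(1)] by blast
 qed
 then show ?case using Suc.prems mult by (simp add: closed_mult_def)
qed (use mult in \<open>auto simp: closed_mult_def\<close>)

lemma partials_const:
 "P (\<lambda>x. c) ==> P (\<lambda>x. 0) ==> partials P n D k (\<lambda>x. c)" by (induction k arbitrary: c) (auto intro: has_partial_const)

lemma partials_coord:
 "P (\<lambda>x. x j) ==> (\<And>c. P (\<lambda>x. c)) ==> partials P n D k (\<lambda>x. x j)"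
proof (cases k)
 case (Suc l)
 assume P: "P (\<lambda>x. x j)" "\<And>c. P (\<lambda>x. c)"
 have "\<exists>h. has_partial i D (\<lambda>x. x j) h \<and> partials P n D l h" for i
 proof (intro exI conjI)
  show "has_partial i D (\<lambda>x. x j) (\<lambda>x. if i = j then 1 else 0)" by (rule has_partial_coord)
  show "partials P n D l (\<lambda>x. if i = j then 1 else 0)" by (rule partials_const; rule P(2))
 qed
 then show ?thesis using P(1) unfolding Suc by (intro partials_SucI)
qed simp

lemma partials_inverse:
 assumes mult: "closed_mult P P P" and add: "closed_add P"
  and const: "\<And>c. P (\<lambda>x. c)" and inv: "P (\<lambda>x. 1 / f x)" and nz: "\<And>x. x \<in> D ==> f x \<noteq> 0"
 shows "partials P n D k f ==> partials P n D k (\<lambda>x. 1 / f x)"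
proof (induction k)
 case (Suc k)
 note pmult = partials_mult[OF mult add]
 have "\<exists>h. has_partial i D (\<lambda>x. 1 / f x) h \<and> partials P n D k h" if i: "i < n" for i
 proof -
  obtain f' where f': "has_partial i D f f'" "partials P n D k f'" using Suc.prems i by auto
  have c: "partials P n D k (\<lambda>x. - 1)" by (rule partials_const) (use const in auto)
  have "partials P n D k (\<lambda>x. (- 1) * f' x)" by (rule pmult[OF c f'(2)])
  moreover have "partials P n D k (\<lambda>x. 1 / f x)" by (rule Suc.IH[OF partials_SucD[OF Suc.prems]])
  ultimately have "partials P n D k (\<lambda>x. ((- 1) * f' x) * ((1 / f x) * (1 / f x)))" using pmult by blast
  then have "partials P n D k (\<lambda>x. (- f' x) * ((1 / f x) * (1 / f x)))" by (simp only: mult_minus1)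
  then show ?thesis using has_partial_inverse[OF f'(1) nz] by blast
 qed
 then show ?case using inv by simp
qed (use inv in auto)

lemma smooth_with_imp: "smooth_with P n D f ==> P f" by (auto simp: smooth_with_def dest: partials_imp)

text \<open>\<open>partials\<close> may choose another derivative for each order \<open>k\<close>.
  On a domain with fat slices all choices agree, so a single \<open>f'\<close> serves every
  order.\<close>

lemma smooth_with_partial:
 assumes fat: "slices_fat n D" and f: "smooth_with P n D f" and i: "i < n"
  and cong: "respects_on D P"
 obtains f' where "has_partial i D f f'" "smooth_with P n D f'"
proof -
 obtain f' where f': "has_partial i D f f'" using f i by (metis partials_SucE smooth_with_def)
 have "partials P n D k f'" for k
 proof -
  obtain g where g: "has_partial i D f g" "partials P n D k g" using f i by (metis partials_SucE smooth_with_def)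
  have eq: "g x = f' x" if "x \<in> D" for x by (rule has_partial_unique[OF fat i g(1) f' that])
  show ?thesis by (rule partials_cong[OF g(2) _ cong]) (rule eq)
 qed
 then show ?thesis using that f' by (auto simp: smooth_with_def)
qed

lemma smooth_withI:
 assumes "P f" "\<And>i. i < n ==> \<exists>f'. has_partial i D f f' \<and> smooth_with P n D f'"
 shows "smooth_with P n D f" unfolding smooth_with_def
proof
 fix k show "partials P n D k f"
 proof (cases k)
  case (Suc l)
  have "\<exists>f'. has_partial i D f f' \<and> partials P n D l f'" if "i < n" for i using assms(2)[OF that] unfolding smooth_with_def by blast
  then show ?thesis using assms(1) Suc by simp
 qed (use assms(1) in simp)
qed

lemma continuous_on_respects: "respects_on D (continuous_on D)" unfolding respects_on_def by (simp cong: continuous_on_cong)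

lemma continuous_on_closed_add: "closed_add (continuous_on D)" by (simp add: closed_add_def continuous_on_add)

lemma continuous_on_closed_mult: "closed_mult (continuous_on D) (continuous_on D) (continuous_on D)"
 by (simp add: closed_mult_def continuous_on_mult)

lemma smooth_partial:
 assumes "slices_fat n D" "smooth n D f" "i < n"
 obtains f' where "has_partial i D f f'" "smooth n D f'" by (rule smooth_with_partial[OF assms continuous_on_respects]) (rule that)

lemma smooth_cong: "smooth n D f ==> (\<And>x. x \<in> D ==> f x = g x) ==> smooth n D g"
 unfolding smooth_with_def using partials_cong[OF _ _ continuous_on_respects] by blast

lemma smooth_subset: "smooth n D f ==> D' \<subseteq> D ==> smooth n D' f" unfolding smooth_with_def
proof
 fix k assume *: "\<forall>k. partials (continuous_on D) n D k f" "D' \<subseteq> D"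
 have "continuous_on D g ==> continuous_on D' g" for g :: rfun using *(2) continuous_on_subset by metis
 from partials_subset[OF *(1)[rule_format] *(2) this]
 show "partials (continuous_on D') n D' k f" .
qed

lemma smooth_continuous: "smooth n D f ==> continuous_on D f" by (rule smooth_with_imp[where P = "continuous_on D"])

lemma continuous_on_coord: "continuous_on D (\<lambda>x :: nat \<Rightarrow> real. x j)"
 by (rule continuous_on_subset[OF continuous_on_product_coordinates subset_UNIV])

lemma smooth_const : "smooth n D (\<lambda>x. c)" unfolding smooth_with_def
 using partials_const[where P = "continuous_on D", OF continuous_on_const continuous_on_const] by simp

lemma smooth_coord : "smooth n D (\<lambda>x. x j)" unfolding smooth_with_def
 using partials_coord[where P = "continuous_on D", OF continuous_on_coord continuous_on_const] by simp

lemma smooth_add : "smooth n D f ==> smooth n D g ==> smooth n D (\<lambda>x. f x + g x)" unfolding smooth_with_def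
 using partials_add[OF continuous_on_closed_add] by simp

lemma smooth_mult : "smooth n D f ==> smooth n D g ==> smooth n D (\<lambda>x. f x * g x)" unfolding smooth_with_def
 using partials_mult[OF continuous_on_closed_mult continuous_on_closed_add] by simp

lemma smooth_minus : "smooth n D f ==> smooth n D (\<lambda>x. - f x)" using smooth_mult[OF smooth_const[where c = "-1"]] by simp

lemma smooth_sum : "(\<And>a. a \<in> A ==> smooth n D (f a)) ==> smooth n D (\<lambda>x. \<Sum>a\<in>A. f a x)"
 by (induction A rule: infinite_finite_induct) (simp_all add: smooth_const smooth_add)

lemma smooth_prod : "(\<And>a. a \<in> A ==> smooth n D (f a)) ==> smooth n D (\<lambda>x. \<Prod>a\<in>A. f a x)"
 by (induction A rule: infinite_finite_induct) (simp_all add: smooth_const smooth_mult)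

lemma smooth_divide :
 assumes "smooth n D f" "smooth n D g" "\<And>x. x \<in> D ==> g x \<noteq> 0"
 shows "smooth n D (\<lambda>x. f x / g x)"
proof -
 have "smooth n D (\<lambda>x. 1 / g x)" unfolding smooth_with_def
 proof
  fix k show "partials (continuous_on D) n D k (\<lambda>x. 1 / g x)"
  proof (rule partials_inverse[where P = "continuous_on D", OF continuous_on_closed_mult continuous_on_closed_add continuous_on_const])
   show "continuous_on D (\<lambda>x. 1 / g x)" using smooth_continuous[OF assms(2)] assms(3) by (simp add: continuous_on_divide)
  qed (use assms in \<open>simp_all add: smooth_with_def\<close>)
 qed
 from smooth_mult[OF assms(1) this] show ?thesis by simp
qed

lemma smooth_ln:
 assumes "smooth n D f" "\<And>x. x \<in> D ==> 0 < f x"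
 shows "smooth n D (\<lambda>x. ln (f x))" unfolding smooth_with_def
proof
 fix k
 have c: "continuous_on D (\<lambda>x. ln (f x))"
  using assms(2) by (intro continuous_on_ln smooth_continuous[OF assms(1)]) (simp add: less_imp_neq[symmetric])
 show "partials (continuous_on D) n D k (\<lambda>x. ln (f x))"
 proof (cases k)
  case (Suc l)
  have "\<exists>h. has_partial i D (\<lambda>x. ln (f x)) h \<and> partials (continuous_on D) n D l h" if "i < n" for i
  proof -
   obtain f' where f': "has_partial i D f f'" "partials (continuous_on D) n D l f'"
    by (rule partials_SucE[OF assms(1)[unfolded smooth_with_def, rule_format, of "Suc l"] \<open>i < n\<close>])
   have "smooth n D (\<lambda>x. 1 / f x)" by (rule smooth_divide[OF smooth_const assms(1)]) (use assms(2) in \<open>simp add: less_imp_neq[symmetric]\<close>)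
   then have "partials (continuous_on D) n D l (\<lambda>x. f' x * (1 / f x))" unfolding smooth_with_def
    by (intro partials_mult[OF continuous_on_closed_mult continuous_on_closed_add f'(2)]) simp
   moreover have "has_partial i D (\<lambda>x. ln (f x)) (\<lambda>x. f' x * (1 / f x))"
    using f'(1) assms(2) unfolding has_partial_def by (auto intro!: derivative_eq_intros simp: field_simps)
   ultimately show ?thesis by blast
  qed
  with c Suc show ?thesis by simp
 qed (use c in simp)
qed

text \<open>Local partials glue because fat slices make them unique and because an open set does not
  change the filter along a slice.\<close>

lemma smooth_local:
 assumes fat: "slices_fat n D"
  and loc: "\<And>x. x \<in> D ==> \<exists>O'. open O' \<and> x \<in> O' \<and> smooth n (D \<inter> O') f"
 shows "smooth n D f"
proof -
 have "partials (continuous_on D) n D k f"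
  if "\<And>x. x \<in> D ==> \<exists>O'. open O' \<and> x \<in> O' \<and> partials (continuous_on (D \<inter> O')) n (D \<inter> O') k f" for k f using that
 proof (induction k arbitrary: f)
  case cont: 0
  show ?case
  proof (simp add: continuous_on_eq_continuous_within, intro ballI)
   fix x assume x: "x \<in> D"
   then obtain O' where O': "open O'" "x \<in> O'" "continuous_on (D \<inter> O') f" using cont by auto
   then show "continuous (at x within D) f" using x at_within_nhd[of x O' D "D \<inter> O'"] by (auto simp: continuous_on_eq_continuous_within)
  qed
 next
  case (Suc k)
  have "continuous_on D f"
  proof (rule partials_imp[where P = "continuous_on D", OF Suc.IH])
   fix x assume "x \<in> D"
   from Suc.prems[OF this]
   show "\<exists>O'. open O' \<and> x \<in> O' \<and> partials (continuous_on (D \<inter> O')) n (D \<inter> O') k f"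
    using partials_SucD[where P = "continuous_on (D \<inter> O')" for O'] by meson
  qed
  moreover have "\<exists>f'. has_partial i D f f' \<and> partials (continuous_on D) n D k f'" if i: "i < n" for i
  proof -
   \<comment> \<open>By uniqueness the chosen value is the derivative given by any local
     representation near \<open>x\<close>.\<close>
   define f' where "f' x = (SOME d. ((\<lambda>u. f (x(i := u))) has_real_derivative d) (at (x i) within {u. x(i := u) \<in> D}))" for x
   have key: "\<exists>O'. open O' \<and> x \<in> O' \<and> has_partial i (D \<inter> O') f f' \<and> partials (continuous_on (D \<inter> O')) n (D \<inter> O') k f'"
    if x: "x \<in> D" for x
   proof -
    obtain O' where O': "open O'" "x \<in> O'" "partials (continuous_on (D \<inter> O')) n (D \<inter> O') (Suc k) f" using Suc.prems x by blast
    then obtain g where g: "has_partial i (D \<inter> O') f g" "partials (continuous_on (D \<inter> O')) n (D \<inter> O') k g" using i by auto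
    have eq: "g y = f' y" if y: "y \<in> D \<inter> O'" for y
    proof -
     have d: "((\<lambda>u. f (y(i := u))) has_real_derivative g y) (at (y i) within {u. y(i := u) \<in> D})"
      using g(1)[unfolded has_partial_def, rule_format, OF y] at_slice_open[OF O'(1), of y i D] y by simp
     then have "((\<lambda>u. f (y(i := u))) has_real_derivative f' y) (at (y i) within {u. y(i := u) \<in> D})" unfolding f'_def by (rule someI)
     moreover have "at (y i) within {u. y(i := u) \<in> D} \<noteq> bot" using fat y i by (auto simp: slices_fat_def)
     ultimately show ?thesis using d tendsto_unique[OF \<open>_ \<noteq> bot\<close>] unfolding has_field_derivative_iff by blast
    qed
    have "has_partial i (D \<inter> O') f f'" using has_partial_cong[OF g(1) refl eq] .
    moreover have "partials (continuous_on (D \<inter> O')) n (D \<inter> O') k f'" by (rule partials_cong[OF g(2) eq continuous_on_respects])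
    ultimately show ?thesis using O' by blast
   qed
   have "has_partial i D f f'" unfolding has_partial_def
   proof
    fix x assume x: "x \<in> D"
    from key[OF x] obtain O' where O': "open O'" "x \<in> O'" "has_partial i (D \<inter> O') f f'" by blast
    show "((\<lambda>u. f (x(i := u))) has_real_derivative f' x) (at (x i) within {u. x(i := u) \<in> D})"
     using O'(3)[unfolded has_partial_def, rule_format, of x] at_slice_open[OF O'(1,2), of i D] O'(2) x by simp
   qed
   moreover have "partials (continuous_on D) n D k f'" using Suc.IH[of f'] key by blast
   ultimately show ?thesis by blast
  qed
  ultimately show ?case by simp
 qed
 note local = this
 show ?thesis unfolding smooth_with_def
 proof
  fix k show "partials (continuous_on D) n D k f" by (rule local) (use loc[unfolded smooth_with_def] in blast)
 qed
qed

section \<open>Comparison with ordinary partial derivatives on relatively open sets\<close>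

lemma partials_Ck:
 assumes "W \<subseteq> espace n"
 shows "Ck k n W f ==> partials (continuous_on W) n W k f"
proof (induction k arbitrary: f)
 case 0
 then show ?case using assms by (simp add: Euclidean_space_top_of_set subtopology_subtopology Int_absorb1)
next
 case (Suc k)
 have "\<exists>f'. has_partial i W f f' \<and> partials (continuous_on W) n W k f'" if "i < n" for i
 proof -
  obtain f' where f': "\<forall>x\<in>W. ((\<lambda>u. f (x(i := u))) has_real_derivative f' x) (at (x i))" "Ck k n W f'" using Suc.prems \<open>i < n\<close> by auto
  have "has_partial i W f f'" unfolding has_partial_def using f'(1) by (auto intro: has_field_derivative_at_within)
  with Suc.IH[OF f'(2)] show ?thesis by blast
 qed
 then show ?case using Suc.prems assms by (simp add: Euclidean_space_top_of_set subtopology_subtopology Int_absorb1)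
qed

lemma open_relE:
 assumes "openin (Euclidean_space n) W"
 obtains O' where "open O'" "W = espace n \<inter> O'" using assms unfolding Euclidean_space_top_of_set openin_open by blast

text \<open>Within \<open>espace n\<close> no coordinate below \<open>n\<close> is constrained, so a
  slice of a relatively open set contains a neighbourhood and one-sided partials are ordinary
  ones.\<close>

lemma slice_at_open:
 assumes "openin (Euclidean_space n) W" "x \<in> W" "i < n"
 shows "at (x i) within {u. x(i := u) \<in> W} = at (x i)"
proof -
 obtain O' where O': "open O'" "W = espace n \<inter> O'" using open_relE[OF assms(1)] .
 have "{u. x(i := u) \<in> espace n} = UNIV" using assms O' by auto
 then show ?thesis using at_slice_open[OF O'(1), of x i "espace n"] O' assms by simp
qed

lemma Ck_partials:
 assumes "openin (Euclidean_space n) W"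
 shows "partials (continuous_on W) n W k f ==> Ck k n W f"
proof (induction k arbitrary: f)
 case 0
 have "W \<subseteq> espace n" using assms openin_subset by (fastforce simp: topspace_Euclidean_space espace_def)
 with 0 show ?case by (simp add: Euclidean_space_top_of_set subtopology_subtopology Int_absorb1)
next
 case (Suc k)
 have W: "W \<subseteq> espace n" using assms openin_subset by (fastforce simp: topspace_Euclidean_space espace_def)
 have "\<exists>f'. (\<forall>x\<in>W. ((\<lambda>u. f (x(i := u))) has_real_derivative f' x) (at (x i))) \<and> Ck k n W f'" if "i < n" for i
 proof -
  obtain f' where f': "has_partial i W f f'" "partials (continuous_on W) n W k f'" using Suc.prems \<open>i < n\<close> by auto
  have "\<forall>x\<in>W. ((\<lambda>u. f (x(i := u))) has_real_derivative f' x) (at (x i))"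
   using f'(1) slice_at_open[OF assms _ \<open>i < n\<close>] unfolding has_partial_def by simp
  with Suc.IH[OF f'(2)] show ?thesis by blast
 qed
 then show ?case using Suc.prems W by (simp add: Euclidean_space_top_of_set subtopology_subtopology Int_absorb1)
qed

lemma smooth_on_imp_smooth:
 assumes "smooth_on n A f" shows "smooth n A f"
proof -
 obtain W F where W: "openin (Euclidean_space n) W" "A \<subseteq> W" "\<forall>k. Ck k n W F" "\<forall>x\<in>A. F x = f x" using assms unfolding smooth_on_def by blast
 have "W \<subseteq> espace n" using W openin_subset by (fastforce simp: topspace_Euclidean_space espace_def)
 then have "smooth n W F" using W(3) partials_Ck unfolding smooth_with_def by simp
 then have "smooth n A F" using W(2) by (rule smooth_subset)
 then show ?thesis by (rule smooth_cong) (use W in auto)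
qed

lemma smooth_imp_smooth_on:
 assumes "openin (Euclidean_space n) W" "smooth n W F" "A \<subseteq> W" "\<And>x. x \<in> A ==> F x = f x"
 shows "smooth_on n A f" unfolding smooth_on_def
proof (intro exI conjI)
 show "\<forall>k. Ck k n W F" using Ck_partials[OF assms(1)] assms(2) unfolding smooth_with_def by simp
qed (use assms in auto)

lemma slices_fat_openin:
 assumes "openin (Euclidean_space n) W" shows "slices_fat n W" unfolding slices_fat_def using slice_at_open[OF assms] by simp

text \<open>Only finitely many coordinates are constrained, which makes the box open in the product
  topology; inside \<open>espace n\<close> the others are 0.\<close>

definition ebox :: "nat \<Rightarrow> (nat \<Rightarrow> real) \<Rightarrow> real \<Rightarrow> (nat \<Rightarrow> real) set" where
 "ebox n p d = {x. \<forall>i<n. \<bar>x i - p i\<bar> < d}"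

lemma open_ebox: "open (ebox n p d)"
proof -
 have "open (\<Inter>i\<in>{..<n}. {x. \<bar>x i - p i\<bar> < d})"
  by (intro open_INT finite_lessThan ballI open_Collect_less continuous_intros continuous_on_coord)
 moreover have "(\<Inter>i\<in>{..<n}. {x. \<bar>x i - p i\<bar> < d}) = ebox n p d" by (auto simp: ebox_def)
 ultimately show ?thesis by simp
qed

lemma ebox_subset_open:
 assumes "open O'" "p \<in> O'" "p \<in> espace n"
 obtains d where "d > 0" "espace n \<inter> ebox n p d \<subseteq> O'"
proof -
 obtain Y where Y: "p \<in> PiE UNIV Y" "\<And>i. open (Y i)" "finite {i. Y i \<noteq> UNIV}" "PiE UNIV Y \<subseteq> O'"
  using product_topology_open_contains_basis[of "\<lambda>i::nat. euclideanreal" UNIV O' p] assms(1,2) by (auto simp: open_fun_def)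
 have "\<exists>e>0. \<forall>y. \<bar>y - p i\<bar> < e \<longrightarrow> y \<in> Y i" for i using Y(1) Y(2)[of i] by (auto simp: open_dist dist_real_def PiE_iff)
 then obtain e where e: "\<And>i. e i > 0" "\<And>i y. \<bar>y - p i\<bar> < e i ==> y \<in> Y i" by metis
 define d where "d = Min (insert 1 (e ` {..<n}))"
 have d: "d > 0" "\<And>i. i < n ==> d \<le> e i" using e(1) by (auto simp: d_def)
 have "x \<in> PiE UNIV Y" if x: "x \<in> espace n" "x \<in> ebox n p d" for x
 proof -
  have "x i \<in> Y i" for i
  proof (cases "i < n")
   case True then show ?thesis using x d(2)[of i] e(2)[of "x i" i] by (force simp: ebox_def)
  next
   case False then show ?thesis using x assms(3) e(2)[of "x i" i] e(1)[of i] by (auto simp: espace_def)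
  qed
  then show ?thesis by auto
 qed
 then show ?thesis using Y(4) by (intro that[OF d(1)]) blast
qed

text \<open>Telescoping over the coordinates and the mean value theorem: continuous partials give a
 total derivative.\<close>

lemma total_increment:
 fixes f :: rfun
 assumes part: "\<And>j. j < n ==> has_partial j B f (g j)"
  and B: "\<And>w y z. y \<in> B ==> z \<in> B ==> (\<And>j. w j = y j \<or> w j = z j \<or> y j \<le> w j \<and> w j \<le> z j \<or> z j \<le> w j \<and> w j \<le> y j) ==> w \<in> B"
  and small: "\<And>j x. j < n ==> x \<in> B ==> \<bar>g j x - c j\<bar> \<le> e"
  and yp: "y \<in> B" "p \<in> B" "y \<in> espace n" "p \<in> espace n"
 shows "\<bar>f y - f p - (\<Sum>j<n. c j * (y j - p j))\<bar> \<le> e * (\<Sum>j<n. \<bar>y j - p j\<bar>)"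
proof -
 define w where "w m = (\<lambda>i. if i < m then y i else p i)" for m
 have step: "\<bar>f (w (Suc m)) - f (w m) - c m * (y m - p m)\<bar> \<le> e * \<bar>y m - p m\<bar>" if m: "m < n" for m
 proof -
  have wS: "w (Suc m) = (w m)(m := y m)" "(w m)(m := p m) = w m" by (auto simp: w_def)
  define h where "h u = f ((w m)(m := u))" for u
  define S where "S = closed_segment (p m) (y m)"
  have inB: "(w m)(m := u) \<in> B" if "u \<in> S" for u
  proof (rule B[OF yp(1,2)])
   fix j show "((w m)(m := u)) j = y j \<or> ((w m)(m := u)) j = p j \<or> y j \<le> ((w m)(m := u)) j \<and> ((w m)(m := u)) j \<le> p j \<or> p j \<le> ((w m)(m := u)) j \<and> ((w m)(m := u)) j \<le> y j"
    using that by (auto simp: w_def S_def closed_segment_eq_real_ivl split: if_splits)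
  qed
  have der: "(h has_real_derivative g m ((w m)(m := u))) (at u within S)" if "u \<in> S" for u
  proof -
   have "((\<lambda>v. f (((w m)(m := u))(m := v))) has_real_derivative g m ((w m)(m := u)))
    (at (((w m)(m := u)) m) within {v. ((w m)(m := u))(m := v) \<in> B})" using part[OF m] inB[OF that] unfolding has_partial_def by blast
   then have "(h has_real_derivative g m ((w m)(m := u))) (at u within {v. (w m)(m := v) \<in> B})" by (simp add: h_def[abs_def])
   then show ?thesis by (rule DERIV_subset) (use inB in auto)
  qed
  have "((\<lambda>u. h u - c m * u) has_real_derivative (g m ((w m)(m := u)) - c m)) (at u within S)" if "u \<in> S" for u
   using der[OF that] by (auto intro!: derivative_eq_intros)
  moreover have "\<bar>g m ((w m)(m := u)) - c m\<bar> \<le> e" if "u \<in> S" for u using small[OF m inB[OF that]] .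
  ultimately have "norm ((h (y m) - c m * y m) - (h (p m) - c m * p m)) \<le> e * norm (y m - p m)"
   by (intro field_differentiable_bound[of S _ "\<lambda>u. g m ((w m)(m := u)) - c m"]) (auto simp: S_def)
  then show ?thesis unfolding h_def using wS by (simp add: algebra_simps)
 qed
 have tele: "f (w m) - f (w 0) = (\<Sum>j<m. f (w (Suc j)) - f (w j))" for m by (induction m) auto
 have "w n = y" "w 0 = p" using yp by (auto simp: w_def espace_def fun_eq_iff)
 then have "f y - f p - (\<Sum>j<n. c j * (y j - p j)) = (\<Sum>j<n. f (w (Suc j)) - f (w j) - c j * (y j - p j))"
  using tele[of n] by (simp add: sum_subtractf)
 also have "\<bar>\<dots>\<bar> \<le> (\<Sum>j<n. \<bar>f (w (Suc j)) - f (w j) - c j * (y j - p j)\<bar>)" by (rule sum_abs)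
 also have "\<dots> \<le> (\<Sum>j<n. e * \<bar>y j - p j\<bar>)" by (rule sum_mono) (use step in auto)
 finally show ?thesis by (simp add: sum_distrib_left)
qed

text \<open>The parameter set \<open>T\<close> is arbitrary, since the curves of interest run along
  slices of an orthant and may start at the boundary. On a small box the partials of
  \<open>f\<close> differ from their values at the base point by at most \<open>e\<close>, so the
  increment of \<open>f\<close> is linear up to \<open>e\<close> times the summed increments of the
  coordinates.\<close>

lemma chain_curve:
 fixes f :: rfun and \<gamma> :: "real \<Rightarrow> nat \<Rightarrow> real"
 assumes W: "openin (Euclidean_space n) W"
  and part: "\<And>j. j < n ==> has_partial j W f (g j)" "\<And>j. j < n ==> continuous_on W (g j)"
  and \<gamma>: "\<And>t. t \<in> T ==> \<gamma> t \<in> W" "t0 \<in> T"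
  and der: "\<And>j. j < n ==> ((\<lambda>t. \<gamma> t j) has_real_derivative d j) (at t0 within T)"
 shows "((\<lambda>t. f (\<gamma> t)) has_real_derivative (\<Sum>j<n. g j (\<gamma> t0) * d j)) (at t0 within T)"
proof -
 define p where "p = \<gamma> t0"
 have Wsub: "W \<subseteq> espace n" using W openin_subset by (fastforce simp: topspace_Euclidean_space espace_def)
 obtain O' where O': "open O'" "W = espace n \<inter> O'" using open_relE[OF W] .
 have pW: "p \<in> W" "p \<in> espace n" using \<gamma> Wsub by (auto simp: p_def)
 define q where "q t = (\<lambda>j. (\<gamma> t j - \<gamma> t0 j) / (t - t0))" for t
 have qlim: "((\<lambda>t. q t j) \<longlongrightarrow> d j) (at t0 within T)" if "j < n" for j using der[OF that] unfolding has_field_derivative_iff q_def by simp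
 \<comment> \<open>\<open>M\<close> exceeds the limit of the summed absolute difference quotients;
   the summand 1 makes the bound strict and \<open>M\<close> positive.\<close>
 define M where "M = (\<Sum>j<n. \<bar>d j\<bar>) + 1"
 have Mpos: "M > 0" unfolding M_def by (simp add: sum_nonneg add_nonneg_pos)
 have lim: "((\<lambda>t. \<Sum>j<n. g j p * q t j) \<longlongrightarrow> (\<Sum>j<n. g j p * d j)) (at t0 within T)" by (intro tendsto_intros) (use qlim in auto)
 have bnd: "\<forall>\<^sub>F t in at t0 within T. (\<Sum>j<n. \<bar>q t j\<bar>) < M"
 proof (rule order_tendstoD)
  show "((\<lambda>t. \<Sum>j<n. \<bar>q t j\<bar>) \<longlongrightarrow> (\<Sum>j<n. \<bar>d j\<bar>)) (at t0 within T)" by (intro tendsto_intros) (use qlim in auto)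
 qed (simp add: M_def)
 have "((\<lambda>t. (f (\<gamma> t) - f p) / (t - t0) - (\<Sum>j<n. g j p * q t j)) \<longlongrightarrow> 0) (at t0 within T)"
 proof (rule tendstoI)
  fix \<epsilon> :: real assume "\<epsilon> > 0"
  define e where "e = \<epsilon> / (2 * M)"
  have e: "e > 0" "e * M < \<epsilon>" using \<open>\<epsilon> > 0\<close> Mpos by (simp_all add: e_def)
  have "\<exists>O1. open O1 \<and> p \<in> O1 \<and> (\<forall>x\<in>W \<inter> O1. \<bar>g j x - g j p\<bar> < e)" if j: "j < n" for j
  proof -
   have "\<exists>A. open A \<and> A \<inter> W = g j -` {g j p - e <..< g j p + e} \<inter> W"
    using part(2)[OF j, unfolded continuous_on_open_invariant, rule_format, of "{g j p - e <..< g j p + e}"] by simp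
   then obtain A where A: "open A" "A \<inter> W = g j -` {g j p - e <..< g j p + e} \<inter> W" by blast
   have "p \<in> A" using A pW e by auto
   moreover have "\<bar>g j x - g j p\<bar> < e" if "x \<in> W \<inter> A" for x
   proof -
    have "x \<in> g j -` {g j p - e <..< g j p + e} \<inter> W" using A(2) that by blast
    then show ?thesis by (auto simp: abs_less_iff)
   qed
   ultimately show ?thesis using A(1) by blast
  qed
  then obtain O1 where O1: "\<And>j. j < n ==> open (O1 j)" "\<And>j. j < n ==> p \<in> O1 j"
   "\<And>j x. j < n ==> x \<in> W \<inter> O1 j ==> \<bar>g j x - g j p\<bar> < e" by metis
  have "open (O' \<inter> (\<Inter>j\<in>{..<n}. O1 j))" using O1(1) O'(1) by auto
  moreover have "p \<in> O' \<inter> (\<Inter>j\<in>{..<n}. O1 j)" using O1(2) O'(2) pW by auto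
  ultimately obtain r where r: "r > 0" "espace n \<inter> ebox n p r \<subseteq> O' \<inter> (\<Inter>j\<in>{..<n}. O1 j)" using ebox_subset_open[OF _ _ pW(2)] by metis
  define B where "B = espace n \<inter> ebox n p r"
  have BW: "B \<subseteq> W" using r O' by (auto simp: B_def)
  have inc: "\<bar>f y - f p - (\<Sum>j<n. g j p * (y j - p j))\<bar> \<le> e * (\<Sum>j<n. \<bar>y j - p j\<bar>)" if y: "y \<in> B" for y
  proof (rule total_increment[where B = B and g = g])
   show "has_partial j B f (g j)" if "j < n" for j using part(1)[OF that] BW has_partial_subset by blast
   show "w \<in> B" if "y \<in> B" "z \<in> B" "\<And>j. w j = y j \<or> w j = z j \<or> y j \<le> w j \<and> w j \<le> z j \<or> z j \<le> w j \<and> w j \<le> y j" for w y z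
   proof -
    have "w j = 0" if "j \<ge> n" for j using that \<open>y \<in> B\<close> \<open>z \<in> B\<close> \<open>\<And>j. _ j \<or> _ j\<close>[of j] by (auto simp: B_def espace_def)
    moreover have "\<bar>w j - p j\<bar> < r" if "j < n" for j
    proof -
     have "\<bar>y j - p j\<bar> < r" "\<bar>z j - p j\<bar> < r" using \<open>y \<in> B\<close> \<open>z \<in> B\<close> that by (auto simp: B_def ebox_def)
     then show ?thesis using \<open>\<And>j. _ j \<or> _ j\<close>[of j] by linarith
    qed
    ultimately show ?thesis by (auto simp: B_def espace_def ebox_def)
   qed
   show "\<bar>g j x - g j p\<bar> \<le> e" if "j < n" "x \<in> B" for j x using O1(3)[OF that(1), of x] that r BW by (force simp: B_def)
   show "p \<in> B" using pW r by (auto simp: B_def ebox_def)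
   show "y \<in> espace n" using y by (simp add: B_def)
  qed (use y pW in auto)
  have "\<forall>\<^sub>F t in at t0 within T. \<bar>\<gamma> t j - p j\<bar> < r" if "j < n" for j
  proof -
   have "((\<lambda>t. \<gamma> t j) \<longlongrightarrow> p j) (at t0 within T)" using DERIV_continuous[OF der[OF that]] unfolding continuous_within p_def by simp
   then show ?thesis using r(1) by (auto dest!: tendstoD simp: dist_real_def)
  qed
  then have "\<forall>\<^sub>F t in at t0 within T. \<forall>j\<in>{..<n}. \<bar>\<gamma> t j - p j\<bar> < r" by (intro eventually_ball_finite) auto
  with bnd have "\<forall>\<^sub>F t in at t0 within T. t \<in> T \<and> t \<noteq> t0 \<and> (\<Sum>j<n. \<bar>q t j\<bar>) < M \<and> (\<forall>j\<in>{..<n}. \<bar>\<gamma> t j - p j\<bar> < r)"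
   by (auto simp: eventually_conj_iff eventually_at_filter)
  then show "\<forall>\<^sub>F t in at t0 within T. dist ((f (\<gamma> t) - f p) / (t - t0) - (\<Sum>j<n. g j p * q t j)) 0 < \<epsilon>"
  proof (rule eventually_mono)
   fix t assume t: "t \<in> T \<and> t \<noteq> t0 \<and> (\<Sum>j<n. \<bar>q t j\<bar>) < M \<and> (\<forall>j\<in>{..<n}. \<bar>\<gamma> t j - p j\<bar> < r)"
   have "\<gamma> t \<in> B" using t \<gamma>(1) Wsub by (auto simp: B_def ebox_def)
   from inc[OF this] have le: "\<bar>f (\<gamma> t) - f p - (\<Sum>j<n. g j p * (\<gamma> t j - p j))\<bar> / \<bar>t - t0\<bar> \<le> e * (\<Sum>j<n. \<bar>\<gamma> t j - p j\<bar>) / \<bar>t - t0\<bar>"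
    using t by (intro divide_right_mono) auto
   have "e * (\<Sum>j<n. \<bar>\<gamma> t j - p j\<bar>) / \<bar>t - t0\<bar> = e * (\<Sum>j<n. \<bar>q t j\<bar>)" by (simp add: q_def p_def sum_divide_distrib[symmetric] abs_divide)
   also have "\<dots> \<le> e * M" using t e by (intro mult_left_mono) auto
   also have "\<dots> < \<epsilon>" using e by simp
   finally have "\<bar>f (\<gamma> t) - f p - (\<Sum>j<n. g j p * (\<gamma> t j - p j))\<bar> / \<bar>t - t0\<bar> < \<epsilon>" using le by linarith
   moreover have "(f (\<gamma> t) - f p) / (t - t0) - (\<Sum>j<n. g j p * q t j) = (f (\<gamma> t) - f p - (\<Sum>j<n. g j p * (\<gamma> t j - p j))) / (t - t0)"
   proof -
    have "(\<Sum>j<n. g j p * q t j) = (\<Sum>j<n. g j p * (\<gamma> t j - p j)) / (t - t0)" by (simp add: q_def p_def sum_divide_distrib)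
    then show ?thesis by (simp add: diff_divide_distrib)
   qed
   ultimately show "dist ((f (\<gamma> t) - f p) / (t - t0) - (\<Sum>j<n. g j p * q t j)) 0 < \<epsilon>" by (simp add: dist_real_def abs_divide)
  qed
 qed
 from tendsto_add[OF this lim] show ?thesis unfolding has_field_derivative_iff p_def by simp
qed

text \<open>Only the outer function lives on an open set; the inner map may have one-sided partials.
  The induction over the order treats all \<open>f\<close> at once, because the partials of the
  composite contain the partials of \<open>f\<close> composed with the same
  \<open>\<tau>\<close>.\<close>

lemma smooth_compose:
 assumes W: "openin (Euclidean_space n) W" and f: "smooth n W f"
  and \<tau>: "\<And>x. x \<in> D ==> \<tau> x \<in> W" "\<And>j. j < n ==> smooth m D (\<lambda>x. \<tau> x j)"
 shows "smooth m D (\<lambda>x. f (\<tau> x))"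
proof -
 have Wsub: "W \<subseteq> espace n" using W openin_subset by (fastforce simp: topspace_Euclidean_space espace_def)
 have conttau: "continuous_on D \<tau>"
 proof (rule continuous_on_coordinatewise_then_product)
  fix j show "continuous_on D (\<lambda>x. \<tau> x j)"
  proof (cases "j < n")
   case True then show ?thesis using smooth_continuous[OF \<tau>(2)] by blast
  next
   case False
   then have "\<tau> x j = 0" if "x \<in> D" for x using \<tau>(1)[OF that] Wsub by (auto simp: espace_def)
   then show ?thesis by (simp cong: continuous_on_cong)
  qed
 qed
 have cont: "continuous_on D (\<lambda>x. h (\<tau> x))" if "smooth n W h" for h
  using continuous_on_compose2[OF smooth_continuous[OF that] conttau] \<tau>(1) by blast
 have "partials (continuous_on D) m D k (\<lambda>x. f (\<tau> x))" if "smooth n W f" for k f using that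
 proof (induction k arbitrary: f)
  case (Suc k)
  show ?case
  proof (rule partials_SucI[where P = "continuous_on D"])
   show "continuous_on D (\<lambda>x. f (\<tau> x))" by (rule cont[OF Suc.prems])
   fix i assume i: "i < m"
   have "\<exists>g. has_partial j W f g \<and> smooth n W g" if "j < n" for j using smooth_partial[OF slices_fat_openin[OF W] Suc.prems that] by metis
   then obtain g where g: "\<And>j. j < n ==> has_partial j W f (g j)" "\<And>j. j < n ==> smooth n W (g j)" by metis
   have "\<exists>h. has_partial i D (\<lambda>x. \<tau> x j) h \<and> partials (continuous_on D) m D k h" if "j < n" for j
    using partials_SucE[OF \<tau>(2)[OF that, unfolded smooth_with_def, rule_format, of "Suc k"] i] by metis
   then obtain h where h: "\<And>j. j < n ==> has_partial i D (\<lambda>x. \<tau> x j) (h j)" "\<And>j. j < n ==> partials (continuous_on D) m D k (h j)" by metis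
   have "has_partial i D (\<lambda>x. f (\<tau> x)) (\<lambda>x. \<Sum>j<n. g j (\<tau> x) * h j x)" unfolding has_partial_def
   proof
    fix x assume x: "x \<in> D"
    have "((\<lambda>u. f (\<tau> (x(i := u)))) has_real_derivative (\<Sum>j<n. g j (\<tau> (x(i := x i))) * h j x)) (at (x i) within {u. x(i := u) \<in> D})"
    proof (rule chain_curve[OF W g(1)])
     show "continuous_on W (g j)" if "j < n" for j using smooth_continuous[OF g(2)[OF that]] .
     show "((\<lambda>u. \<tau> (x(i := u)) j) has_real_derivative h j x) (at (x i) within {u. x(i := u) \<in> D})" if "j < n" for j
      using h(1)[OF that] x by (auto simp: has_partial_def)
    qed (use x \<tau>(1) in auto)
    then show "((\<lambda>u. f (\<tau> (x(i := u)))) has_real_derivative (\<Sum>j<n. g j (\<tau> x) * h j x)) (at (x i) within {u. x(i := u) \<in> D})" by simp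
   qed
   moreover have "partials (continuous_on D) m D k (\<lambda>x. \<Sum>j\<in>A. g j (\<tau> x) * h j x)" if "A \<subseteq> {..<n}" for A
    using finite_subset[OF that finite_lessThan] that
   proof (induction A rule: finite_induct)
    case empty
    then show ?case using partials_const[where P = "continuous_on D", OF continuous_on_const continuous_on_const] by simp
   next
    case (insert a A)
    then show ?case
     using partials_add[OF continuous_on_closed_add] partials_mult[OF continuous_on_closed_mult continuous_on_closed_add Suc.IH[OF g(2)] h(2)]
     by simp
   qed
   ultimately show "\<exists>f'. has_partial i D (\<lambda>x. f (\<tau> x)) f' \<and> partials (continuous_on D) m D k f'" by blast
  qed
 qed (use cont in simp)
 then show ?thesis using f by (simp add: smooth_with_def)
qed

section \<open>Extension across the boundary of an orthant\<close>

text \<open>Taylor coefficients of the entire function given by the product of 1 - z / 2^m over all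
  m \<ge> 0.\<close>

primrec seeley_pre :: "nat \<Rightarrow> real" where
 "seeley_pre 0 = 1"
| "seeley_pre (Suc k) = - seeley_pre k * 2 / (2 ^ Suc k - 1)"

lemma two_power_gt: "(1::real) < 2 ^ Suc k" by (rule one_less_power) auto

lemma seeley_pre_summable: "summable (\<lambda>k. \<bar>seeley_pre k\<bar> * z ^ k)" if "z \<ge> 0"
proof -
 \<comment> \<open>From index \<open>N\<close> on, the ratio 2 z / (2^(k+1) - 1) of consecutive
   terms is at most 1/2.\<close>
 obtain N where N: "4 * z + 1 \<le> 2 ^ N" using real_arch_pow[of 2 "4 * z + 1"] by (auto intro: less_imp_le)
 show ?thesis
 proof (rule summable_ratio_test[where c = "1 / 2" and N = N])
  fix k assume "k \<ge> N"
  then have "(2::real) ^ N \<le> 2 ^ Suc k" by (intro power_increasing) auto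
  then have le: "4 * z \<le> 2 ^ Suc k - 1" using N by linarith
  have pos: "(2::real) ^ Suc k - 1 > 0" using two_power_gt[of k] by simp
  have "2 * z / (2 ^ Suc k - 1) \<le> 1 / 2" using le pos by (simp add: field_simps)
  then have "(\<bar>seeley_pre k\<bar> * z ^ k) * (2 * z / (2 ^ Suc k - 1)) \<le> (\<bar>seeley_pre k\<bar> * z ^ k) * (1 / 2)"
   using that by (intro mult_left_mono) auto
  moreover have "\<bar>seeley_pre (Suc k)\<bar> * z ^ Suc k = (\<bar>seeley_pre k\<bar> * z ^ k) * (2 * z / (2 ^ Suc k - 1))"
   using pos by (simp add: abs_mult abs_divide)
  moreover have nn: "norm (\<bar>seeley_pre l\<bar> * z ^ l) = \<bar>seeley_pre l\<bar> * z ^ l" for l using that by simp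
  ultimately show "norm (\<bar>seeley_pre (Suc k)\<bar> * z ^ Suc k) \<le> 1 / 2 * norm (\<bar>seeley_pre k\<bar> * z ^ k)" unfolding nn by linarith
 qed simp
qed

lemma seeley_pre_summable': "summable (\<lambda>k. seeley_pre k * z ^ k)" if "z \<ge> 0"
proof (rule summable_norm_cancel)
 show "summable (\<lambda>k. norm (seeley_pre k * z ^ k))" using seeley_pre_summable[OF that] that by (simp add: abs_mult)
qed

text \<open>The power series \<open>E\<close> with coefficients \<^const>\<open>seeley_pre\<close> satisfies \<open>E (2 z) = (1 - 2 z) E z\<close>
 and so vanishes at all powers of \<open>2\<close>.\<close>

lemma seeley_pre_functional:
 assumes "z \<ge> 0"
 shows "(suminf (\<lambda>k. seeley_pre k * (2 * z) ^ k)) = (1 - 2 * z) * (suminf (\<lambda>k. seeley_pre k * z ^ k))"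
proof -
 have rec: "seeley_pre (Suc k) * (2 * z) ^ Suc k = seeley_pre (Suc k) * z ^ Suc k - 2 * z * (seeley_pre k * z ^ k)" for k
 proof -
  have "seeley_pre (Suc k) * (2 ^ Suc k - 1) = - 2 * seeley_pre k" using two_power_gt[of k] by simp
  then have "seeley_pre (Suc k) * (2 ^ Suc k - 1) * z ^ Suc k = - 2 * seeley_pre k * z ^ Suc k" by simp
  moreover have "seeley_pre (Suc k) * (2 * z) ^ Suc k =
    seeley_pre (Suc k) * (2 ^ Suc k - 1) * z ^ Suc k + seeley_pre (Suc k) * z ^ Suc k"
   by (simp only: power_mult_distrib) (simp only: algebra_simps)
  ultimately show ?thesis by simp
 qed
 have s: "summable (\<lambda>k. seeley_pre k * z ^ k)" "summable (\<lambda>k. seeley_pre k * (2 * z) ^ k)"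
  by (rule seeley_pre_summable'; use assms in simp)+
 have s1: "summable (\<lambda>k. seeley_pre (Suc k) * z ^ Suc k)" using s(1) by (subst summable_Suc_iff)
 have "(suminf (\<lambda>k. seeley_pre k * (2 * z) ^ k)) = 1 + (suminf (\<lambda>k. seeley_pre (Suc k) * (2 * z) ^ Suc k))"
  using suminf_split_head[OF s(2)] by simp
 also have "\<dots> = 1 + (suminf (\<lambda>k. seeley_pre (Suc k) * z ^ Suc k - 2 * z * (seeley_pre k * z ^ k)))" by (simp only: rec)
 also have "\<dots> = 1 + ((suminf (\<lambda>k. seeley_pre (Suc k) * z ^ Suc k)) - 2 * z * (suminf (\<lambda>k. seeley_pre k * z ^ k)))"
  using s s1 by (subst suminf_diff[symmetric]) (auto simp: suminf_mult intro: summable_mult)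
 also have "\<dots> = (suminf (\<lambda>k. seeley_pre k * z ^ k)) - 2 * z * (suminf (\<lambda>k. seeley_pre k * z ^ k))" using suminf_split_head[OF s(1)] by simp
 finally show ?thesis by (simp add: algebra_simps)
qed

lemma seeley_pre_zero: "(suminf (\<lambda>k. seeley_pre k * (2 ^ m) ^ k)) = 0"
proof (induction m)
 case 0 show ?case using seeley_pre_functional[of "1 / 2"] by simp
next
 case (Suc m) then show ?case using seeley_pre_functional[of "2 ^ m"] by simp
qed

text \<open>Dividing the coefficient of z^k by 1 + 2^k gives a power series A with A(2 z) + A(z) =
  E(z). As E vanishes at the powers of 2, A changes sign from 2^m to 2^(m+1), so that A(2^m) =
  (-1)^m A(1). This is the moment condition up to the factor A(1), which is divided out.\<close>

lemma seeley_coefficients: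
 "\<exists>a :: nat \<Rightarrow> real. (\<forall>m. summable (\<lambda>k. \<bar>a k\<bar> * (2 ^ k) ^ m)) \<and> (\<forall>m. (\<lambda>k. a k * (- (2 ^ k)) ^ m) sums 1)"
proof -
 define c where "c k = seeley_pre k / (1 + 2 ^ k)" for k
 have pos: "(0::real) < 1 + 2 ^ k" for k :: nat by (rule add_pos_pos) simp_all
 have cle: "\<bar>c k\<bar> \<le> \<bar>seeley_pre k\<bar>" for k
 proof -
  have "\<bar>seeley_pre k\<bar> / (1 + 2 ^ k) \<le> \<bar>seeley_pre k\<bar> / 1" using pos[of k] by (intro divide_left_mono) auto
  then show ?thesis using pos[of k] by (simp add: c_def abs_divide)
 qed
 have sabs: "summable (\<lambda>k. \<bar>c k\<bar> * z ^ k)" if "z \<ge> 0" for z by (rule summable_comparison_test'[OF seeley_pre_summable[OF that], of 0])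
   (use that cle in \<open>auto simp: abs_mult intro!: mult_right_mono\<close>)
 have sc: "summable (\<lambda>k. c k * z ^ k)" if "z \<ge> 0" for z by (rule summable_norm_cancel) (use sabs[OF that] that in \<open>simp add: abs_mult\<close>)
 define A where "A z = (suminf (\<lambda>k. c k * z ^ k))" for z
 have A2: "A (2 * 2 ^ m) = - A (2 ^ m)" for m :: nat
 proof -
  have "A (2 * 2 ^ m) + A (2 ^ m) = (suminf (\<lambda>k. c k * (2 * 2 ^ m) ^ k + c k * (2 ^ m) ^ k))"
   unfolding A_def by (intro suminf_add sc) simp_all
  also have "\<dots> = (suminf (\<lambda>k. seeley_pre k * (2 ^ m) ^ k))"
  proof (rule suminf_cong)
   fix k
   have "c k * (2 * 2 ^ m) ^ k + c k * (2 ^ m) ^ k = (c k * (1 + 2 ^ k)) * (2 ^ m) ^ k" by (simp add: power_mult_distrib algebra_simps)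
   then show "c k * (2 * 2 ^ m) ^ k + c k * (2 ^ m) ^ k = seeley_pre k * (2 ^ m) ^ k" using pos[of k] by (simp add: c_def)
  qed
  finally show ?thesis using seeley_pre_zero[of m] by simp
 qed
 have Am: "A (2 ^ m) = (- 1) ^ m * A 1" for m by (induction m) (use A2 in auto)
 \<comment> \<open>The first four terms sum to at least 1/50. From index 4 on, where the coefficient
   of E is 16/315 and the divisor at least 16, the terms are bounded by (1/315) (1/2)^k, so the tail
   is at most 2/315.\<close>
 have "A 1 \<noteq> 0"
 proof -
  have bs: "\<bar>seeley_pre (k + 4)\<bar> \<le> 16 / 315 * (1 / 2) ^ k" for k
  proof (induction k)
   case 0 show ?case by (simp add: eval_nat_numeral)
  next
   case (Suc k)
   have "(2::real) ^ 3 \<le> 2 ^ Suc (k + 4)" by (intro power_increasing) auto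
   then have "(2::real) ^ Suc (k + 4) - 1 \<ge> 4" by simp
   then have "2 / ((2::real) ^ Suc (k + 4) - 1) \<le> 1 / 2" by (simp add: field_simps)
   then have "\<bar>seeley_pre (k + 4)\<bar> * (2 / (2 ^ Suc (k + 4) - 1)) \<le> (16 / 315 * (1 / 2) ^ k) * (1 / 2)"
    using Suc two_power_gt[of "k + 4"] by (intro mult_mono) auto
   moreover have "\<bar>seeley_pre (Suc (k + 4))\<bar> = \<bar>seeley_pre (k + 4)\<bar> * (2 / (2 ^ Suc (k + 4) - 1))"
    unfolding seeley_pre.simps using two_power_gt[of "k + 4"] by (simp del: power_Suc add: abs_mult abs_divide)
   ultimately show ?case by (simp only: add_Suc power_Suc2 mult.assoc)
  qed
  have cs: "\<bar>c (k + 4)\<bar> \<le> 1 / 315 * (1 / 2) ^ k" for k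
  proof -
   have "(2::real) ^ 4 \<le> 2 ^ (k + 4)" by (intro power_increasing) auto
   then have "\<bar>c (k + 4)\<bar> \<le> \<bar>seeley_pre (k + 4)\<bar> / 16" unfolding c_def abs_divide by (intro frac_le) auto
   then show ?thesis using bs[of k] by simp
  qed
  have c1: "summable c" using sc[of 1] by simp
  have tail: "\<bar>suminf (\<lambda>k. c (k + 4))\<bar> \<le> (suminf (\<lambda>k. 1 / 315 * (1 / 2) ^ k))"
  proof -
   have sg: "summable (\<lambda>k. 1 / 315 * (1 / 2 :: real) ^ k)" by (intro summable_mult summable_geometric) simp
   have "summable (\<lambda>k. \<bar>c (k + 4)\<bar>)" by (rule summable_comparison_test'[OF sg, of 0]) (use cs in auto)
   then show ?thesis using summable_rabs[of "\<lambda>k. c (k + 4)"] suminf_le[OF cs _ sg] by linarith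
  qed
  also have "\<dots> = 2 / 315" by (subst suminf_mult) (auto simp: suminf_geometric)
  finally have t: "\<bar>suminf (\<lambda>k. c (k + 4))\<bar> \<le> 2 / 315" .
  have "A 1 = (suminf (\<lambda>k. c (k + 4))) + (\<Sum>k<4. c k)" unfolding A_def using suminf_split_initial_segment[OF c1, of 4] by simp
  moreover have "(\<Sum>k<4. c k) \<ge> 1 / 50" by (simp add: c_def eval_nat_numeral field_simps)
  ultimately show ?thesis using t by (auto simp: field_simps)
 qed
 show ?thesis
 proof (intro exI[of _ "\<lambda>k. c k / A 1"] conjI allI)
  fix m :: nat
  have "(\<lambda>k. \<bar>c k / A 1\<bar> * (2 ^ k) ^ m) = (\<lambda>k. (1 / \<bar>A 1\<bar>) * (\<bar>c k\<bar> * (2 ^ m) ^ k))"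
   by (simp add: abs_divide power_mult[symmetric] mult.commute)
  then show "summable (\<lambda>k. \<bar>c k / A 1\<bar> * (2 ^ k) ^ m)" using summable_mult[OF sabs[of "2 ^ m"], of "1 / \<bar>A 1\<bar>"] by simp
 next
  fix m :: nat
  have "(\<lambda>k. c k * (2 ^ m) ^ k) sums A (2 ^ m)" unfolding A_def using sc[of "2 ^ m"] by (simp add: summable_sums)
  then have s1: "(\<lambda>k. ((- 1) ^ m / A 1) * (c k * (2 ^ m) ^ k)) sums (((- 1) ^ m / A 1) * A (2 ^ m))" by (rule sums_mult)
  have s2: "((- 1) ^ m / A 1) * A (2 ^ m) = 1" using \<open>A 1 \<noteq> 0\<close> by (simp add: Am flip: power_add mult_2)
  have s3: "(\<lambda>k. ((- 1) ^ m / A 1) * (c k * (2 ^ m) ^ k)) = (\<lambda>k. c k / A 1 * (- (2 ^ k)) ^ m)"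
  proof
   fix k :: nat
   have "(- ((2::real) ^ k)) ^ m = (- 1) ^ m * (2 ^ m) ^ k" by (simp add: power_minus[of "2 ^ k"] power_mult[symmetric] mult.commute)
   then show "((- 1) ^ m / A 1) * (c k * (2 ^ m) ^ k) = c k / A 1 * (- (2 ^ k)) ^ m" by simp
  qed
  show "(\<lambda>k. c k / A 1 * (- (2 ^ k)) ^ m) sums 1" using s1 unfolding s2 s3 .
 qed
qed

text \<open>The domain reached after the coordinates below \<open>j\<close> have been freed: the
  orthant for \<open>j = 0\<close>, the whole space for \<open>j = n\<close>.\<close>

definition half_orthant :: "nat \<Rightarrow> nat \<Rightarrow> (nat \<Rightarrow> real) set" where
 "half_orthant n j = {x \<in> espace n. \<forall>i. j \<le> i \<and> i < n \<longrightarrow> 0 \<le> x i}"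

text \<open>Boundedness supplies the uniform majorant under which the reflection series may be
  differentiated term by term.\<close>

definition bdd_cont :: "(nat \<Rightarrow> real) set \<Rightarrow> rfun \<Rightarrow> bool" where
 "bdd_cont D f \<longleftrightarrow> continuous_on D f \<and> (\<exists>B. \<forall>x\<in>D. \<bar>f x\<bar> \<le> B)"

text \<open>Seeley's reflection in the \<open>j\<close>-th coordinate; the parameter \<open>m\<close> counts the derivatives
 taken in that direction.\<close>

locale seeley =
 fixes a :: "nat \<Rightarrow> real" and n j :: nat
 assumes a_summable: "\<And>m. summable (\<lambda>k. \<bar>a k\<bar> * (2 ^ k) ^ m)"
  and a_sums: "\<And>m. (\<lambda>k. a k * (- (2 ^ k)) ^ m) sums 1"
  and j: "j < n"
begin

definition reflect :: "nat \<Rightarrow> (nat \<Rightarrow> real) \<Rightarrow> nat \<Rightarrow> real" where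
 "reflect k x = x(j := - (2 ^ k) * x j)"

definition series :: "nat \<Rightarrow> rfun \<Rightarrow> (nat \<Rightarrow> real) \<Rightarrow> real" where
 "series m f x = (suminf (\<lambda>k. a k * (- (2 ^ k)) ^ m * f (reflect k x)))"

definition ext :: "nat \<Rightarrow> rfun \<Rightarrow> (nat \<Rightarrow> real) \<Rightarrow> real" where
 "ext m f x = (if x j \<le> 0 then series m f x else f x)"

abbreviation "D \<equiv> half_orthant n j"
abbreviation "D' \<equiv> half_orthant n (Suc j)"

lemma reflect_D: "x \<in> D' ==> x j \<le> 0 ==> reflect k x \<in> D"
 using j by (auto simp: half_orthant_def espace_def reflect_def mult_nonneg_nonpos not_less_eq_eq le_less_Suc_eq)

lemma in_D: "x \<in> D' ==> 0 \<le> x j ==> x \<in> D" by (auto simp: half_orthant_def) (metis le_antisym not_less_eq_eq)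

lemma D_D': "x \<in> D ==> x \<in> D' \<and> 0 \<le> x j" using j by (auto simp: half_orthant_def)

text \<open>Every reflection fixes such a point, and the moments of \<open>a\<close> are all 1. This
  is what makes the reflected series and the function agree along the hyperplane, for every number
  \<open>m\<close> of derivatives.\<close>

lemma series_zero: "x j = 0 ==> series m f x = f x"
proof -
 assume "x j = 0"
 then have "reflect k x = x" for k by (auto simp: reflect_def)
 then show ?thesis using sums_mult2[OF a_sums[of m], of "f x"] by (simp add: series_def sums_iff)
qed

lemma ext_nonneg: "0 \<le> x j ==> ext m f x = f x" by (cases "x j = 0") (auto simp: ext_def series_zero)

lemma term_bound:
 assumes "\<And>x. x \<in> D ==> \<bar>f x\<bar> \<le> B" "x \<in> D'" "x j \<le> 0"
 shows "norm (a k * (- (2 ^ k)) ^ m * f (reflect k x)) \<le> B * (\<bar>a k\<bar> * (2 ^ k) ^ m)"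
proof -
 have "\<bar>f (reflect k x)\<bar> \<le> B" using assms reflect_D by blast
 then have "(\<bar>a k\<bar> * (2 ^ k) ^ m) * \<bar>f (reflect k x)\<bar> \<le> (\<bar>a k\<bar> * (2 ^ k) ^ m) * B" by (intro mult_left_mono) auto
 then show ?thesis by (simp add: abs_mult power_abs mult.commute)
qed

lemma series_uniform:
 assumes "\<And>x. x \<in> D ==> \<bar>f x\<bar> \<le> B"
 shows "uniform_limit {x \<in> D'. x j \<le> 0} (\<lambda>N x. \<Sum>k<N. a k * (- (2 ^ k)) ^ m * f (reflect k x)) (series m f) sequentially"
 unfolding series_def[abs_def] by (rule Weierstrass_m_test[OF _ summable_mult[OF a_summable]]) (use term_bound[OF assms] in auto)

lemma series_summable:
 assumes "\<And>x. x \<in> D ==> \<bar>f x\<bar> \<le> B" "x \<in> D'" "x j \<le> 0"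
 shows "summable (\<lambda>k. a k * (- (2 ^ k)) ^ m * f (reflect k x))"
 by (rule summable_comparison_test'[OF summable_mult[OF a_summable], of 0]) (use term_bound[OF assms] in auto)

lemma continuous_reflect: "continuous_on S (reflect k)" unfolding reflect_def
proof (rule continuous_on_coordinatewise_then_product)
 fix i show "continuous_on S (\<lambda>x. (x(j := - (2 ^ k) * x j)) i)" by (cases "i = j") (auto intro!: continuous_intros continuous_on_coord)
qed

lemma ext_bdd_cont:
 assumes "bdd_cont D f" shows "bdd_cont D' (ext m f)"
proof -
 obtain B where B: "\<And>x. x \<in> D ==> \<bar>f x\<bar> \<le> B" using assms by (auto simp: bdd_cont_def)
 have cf: "continuous_on D f" using assms by (simp add: bdd_cont_def)
 have c1: "continuous_on {x \<in> D'. x j \<le> 0} (series m f)"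
 proof (rule uniform_limit_theorem[OF _ series_uniform[OF B]])
  have "continuous_on {x \<in> D'. x j \<le> 0} (\<lambda>x. f (reflect k x))" for k
   by (rule continuous_on_compose2[OF cf continuous_reflect]) (use reflect_D in auto)
  then show "\<forall>\<^sub>F N in sequentially. continuous_on {x \<in> D'. x j \<le> 0} (\<lambda>x. \<Sum>k<N. a k * (- (2 ^ k)) ^ m * f (reflect k x))"
   by (intro always_eventually allI continuous_intros)
 qed simp_all
 have "continuous_on D' (ext m f)" unfolding ext_def
 proof (rule continuous_on_cases_le[OF c1])
  show "continuous_on {t \<in> D'. 0 \<le> t j} f" by (rule continuous_on_subset[OF cf]) (use in_D in auto)
 qed (auto simp: series_zero continuous_on_coord)
 moreover have "\<bar>ext m f x\<bar> \<le> max B (B * (suminf (\<lambda>k. \<bar>a k\<bar> * (2 ^ k) ^ m)))" if x: "x \<in> D'" for x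
 proof (cases "x j \<le> 0")
  case True
  have sm: "summable (\<lambda>k. B * (\<bar>a k\<bar> * (2 ^ k) ^ m))" by (rule summable_mult[OF a_summable])
  have "norm (series m f x) \<le> (suminf (\<lambda>k. B * (\<bar>a k\<bar> * (2 ^ k) ^ m)))"
   unfolding series_def by (rule norm_suminf_le[OF term_bound[OF B x True] sm])
  then show ?thesis using True by (simp add: ext_def suminf_mult[OF a_summable])
 next
  case False then show ?thesis using B[OF in_D[OF x]] by (auto simp: ext_def)
 qed
 ultimately show ?thesis unfolding bdd_cont_def by blast
qed

lemma convex_slice: "convex {u. x(i := u) \<in> half_orthant n l}"
proof -
 have "is_interval {u. x(i := u) \<in> half_orthant n l}"
  unfolding is_interval_1 half_orthant_def espace_def by (auto simp: fun_upd_def split: if_splits)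
 then show ?thesis by (simp add: is_interval_convex_1)
qed

text \<open>Reflection commutes with moving another coordinate, so the terms are differentiated with
  unchanged weights.\<close>

lemma series_partial_other:
 assumes f: "has_partial i D f f'" "bdd_cont D f" "bdd_cont D f'" and i: "i \<noteq> j" and x: "x \<in> D'" "x j \<le> 0"
 shows "((\<lambda>u. series m f (x(i := u))) has_real_derivative series m f' x) (at (x i) within {u. x(i := u) \<in> D'})"
proof -
 define S where "S = {u. x(i := u) \<in> D'}"
 obtain B where B: "\<And>x. x \<in> D ==> \<bar>f x\<bar> \<le> B" using f by (auto simp: bdd_cont_def)
 obtain B' where B': "\<And>x. x \<in> D ==> \<bar>f' x\<bar> \<le> B'" using f by (auto simp: bdd_cont_def)
 have xi: "x i \<in> S" using x by (simp add: S_def)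
 have neg: "(x(i := u)) j \<le> 0" for u using i x by simp
 have "\<exists>g. \<forall>u\<in>S. (\<lambda>k. a k * (- (2 ^ k)) ^ m * f (reflect k (x(i := u)))) sums g u \<and>
   (g has_field_derivative series m f' (x(i := u))) (at u within S)"
 proof (rule has_field_derivative_series[where f' = "\<lambda>k u. a k * (- (2 ^ k)) ^ m * f' (reflect k (x(i := u)))"])
  show "convex S" unfolding S_def by (rule convex_slice)
  show "((\<lambda>u. a k * (- (2 ^ k)) ^ m * f (reflect k (x(i := u)))) has_real_derivative
    a k * (- (2 ^ k)) ^ m * f' (reflect k (x(i := u)))) (at u within S)" if u: "u \<in> S" for k u
  proof -
   have R: "reflect k (x(i := v)) = (reflect k x)(i := v)" for v using i by (auto simp: reflect_def)
   have rD: "reflect k (x(i := v)) \<in> D" if "v \<in> S" for v using that neg by (intro reflect_D) (auto simp: S_def)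
   have "((\<lambda>v. f ((reflect k (x(i := u)))(i := v))) has_real_derivative f' (reflect k (x(i := u))))
    (at ((reflect k (x(i := u))) i) within {v. (reflect k (x(i := u)))(i := v) \<in> D})" using f(1) rD[OF u] unfolding has_partial_def by blast
   then have "((\<lambda>v. f (reflect k (x(i := v)))) has_real_derivative f' (reflect k (x(i := u))))
    (at u within {v. reflect k (x(i := v)) \<in> D})" by (simp add: R)
   then have "((\<lambda>v. f (reflect k (x(i := v)))) has_real_derivative f' (reflect k (x(i := u)))) (at u within S)"
    by (rule DERIV_subset) (use rD in auto)
   then show ?thesis by (rule DERIV_cmult)
  qed
  have "uniform_limit S (\<lambda>N u. \<Sum>k<N. a k * (- (2 ^ k)) ^ m * f' (reflect k (x(i := u)))) (\<lambda>u. series m f' (x(i := u))) sequentially"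
   by (rule uniform_limit_compose'[OF series_uniform[OF B']]) (auto simp: S_def Pi_iff simp del: fun_upd_apply intro: neg)
  then show "uniform_limit S (\<lambda>N u. \<Sum>k<N. a k * (- (2 ^ k)) ^ m * f' (reflect k (x(i := u)))) (\<lambda>u. series m f' (x(i := u))) sequentially" .
  show "x i \<in> S" by (rule xi)
  show "summable (\<lambda>k. a k * (- (2 ^ k)) ^ m * f (reflect k (x(i := x i))))" by (rule series_summable[OF B]) (use x in auto)
 qed
 then obtain g where g: "\<And>u. u \<in> S ==> (\<lambda>k. a k * (- (2 ^ k)) ^ m * f (reflect k (x(i := u)))) sums g u"
   "\<And>u. u \<in> S ==> (g has_field_derivative series m f' (x(i := u))) (at u within S)" by blast
 have "series m f (x(i := u)) = g u" if "u \<in> S" for u using g(1)[OF that] by (simp add: series_def sums_iff)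
 then show ?thesis using g(2)[OF xi] xi unfolding has_field_derivative_def S_def[symmetric]
  by (auto elim: has_derivative_transform[rotated 2])
qed

text \<open>The chain rule contributes a factor -(2^k) to the k-th term, which raises
  \<open>m\<close> by one; the new series still converges because all moments converge
  absolutely.\<close>

lemma series_partial_self:
 assumes f: "has_partial j D f f'" "bdd_cont D f" "bdd_cont D f'" and x: "x \<in> D'" "x j \<le> 0"
 shows "((\<lambda>u. series m f (x(j := u))) has_real_derivative series (Suc m) f' x) (at (x j) within {..0})"
proof -
 define S where "S = {..(0::real)}"
 obtain B where B: "\<And>x. x \<in> D ==> \<bar>f x\<bar> \<le> B" using f by (auto simp: bdd_cont_def)
 obtain B' where B': "\<And>x. x \<in> D ==> \<bar>f' x\<bar> \<le> B'" using f by (auto simp: bdd_cont_def)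
 have xi: "x j \<in> S" using x by (simp add: S_def)
 have xD: "x(j := u) \<in> D'" for u using x(1) j by (auto simp: half_orthant_def espace_def)
 have "\<exists>g. \<forall>u\<in>S. (\<lambda>k. a k * (- (2 ^ k)) ^ m * f (reflect k (x(j := u)))) sums g u \<and>
   (g has_field_derivative series (Suc m) f' (x(j := u))) (at u within S)"
 proof (rule has_field_derivative_series[where f' = "\<lambda>k u. a k * (- (2 ^ k)) ^ Suc m * f' (reflect k (x(j := u)))"])
  show "convex S" unfolding S_def by simp
  show "((\<lambda>u. a k * (- (2 ^ k)) ^ m * f (reflect k (x(j := u)))) has_real_derivative
    a k * (- (2 ^ k)) ^ Suc m * f' (reflect k (x(j := u)))) (at u within S)" if u: "u \<in> S" for k u
  proof -
   have R: "reflect k (x(j := v)) = x(j := - (2 ^ k) * v)" for v by (auto simp: reflect_def)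
   have rD: "x(j := - (2 ^ k) * v) \<in> D" if "v \<in> S" for v using reflect_D[OF xD[of v], of k] that by (simp add: S_def R)
   have "((\<lambda>v. f (x(j := v))) has_real_derivative f' (x(j := - (2 ^ k) * u)))
    (at (- (2 ^ k) * u) within {v. x(j := v) \<in> D})" using f(1) rD[OF u] unfolding has_partial_def by fastforce
   then have *: "((\<lambda>v. f (x(j := v))) has_real_derivative f' (x(j := - (2 ^ k) * u)))
    (at (- (2 ^ k) * u) within (\<lambda>v. - (2 ^ k) * v) ` S)" by (rule DERIV_subset) (use rD in auto)
   have "((\<lambda>v. - (2 ^ k) * v) has_real_derivative - (2 ^ k)) (at u within S)" by (auto intro!: derivative_eq_intros)
   from DERIV_image_chain[OF * this]
   have "((\<lambda>v. f (x(j := - (2 ^ k) * v))) has_real_derivative f' (x(j := - (2 ^ k) * u)) * (- (2 ^ k))) (at u within S)"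
    by (simp add: o_def)
   from DERIV_cmult[OF this, of "a k * (- (2 ^ k)) ^ m"] show ?thesis by (simp add: R mult_ac)
  qed
  show "uniform_limit S (\<lambda>N u. \<Sum>k<N. a k * (- (2 ^ k)) ^ Suc m * f' (reflect k (x(j := u)))) (\<lambda>u. series (Suc m) f' (x(j := u))) sequentially"
   by (rule uniform_limit_compose'[OF series_uniform[OF B']]) (auto simp: S_def Pi_iff fun_upd_same simp del: fun_upd_apply intro: xD)
  show "x j \<in> S" by (rule xi)
  show "summable (\<lambda>k. a k * (- (2 ^ k)) ^ m * f (reflect k (x(j := x j))))" by (rule series_summable[OF B]) (use x in auto)
 qed
 then obtain g where g: "\<And>u. u \<in> S ==> (\<lambda>k. a k * (- (2 ^ k)) ^ m * f (reflect k (x(j := u)))) sums g u"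
   "\<And>u. u \<in> S ==> (g has_field_derivative series (Suc m) f' (x(j := u))) (at u within S)" by blast
 have "series m f (x(j := u)) = g u" if "u \<in> S" for u using g(1)[OF that] by (simp add: series_def sums_iff)
 then show ?thesis using g(2)[OF xi] xi unfolding has_field_derivative_def S_def[symmetric]
  by (auto elim: has_derivative_transform[rotated 2])
qed

lemma ext_partial_other:
 assumes f: "has_partial i D f f'" "bdd_cont D f" "bdd_cont D f'" and i: "i \<noteq> j"
 shows "has_partial i D' (ext m f) (ext m f')" unfolding has_partial_def
proof
 fix x assume x: "x \<in> D'"
 show "((\<lambda>u. ext m f (x(i := u))) has_real_derivative ext m f' x) (at (x i) within {u. x(i := u) \<in> D'})"
 proof (cases "x j \<le> 0")
  case True then show ?thesis using series_partial_other[OF f i x True] i by (simp add: ext_def)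
 next
  case False
  have "((\<lambda>u. f (x(i := u))) has_real_derivative f' x) (at (x i) within {u. x(i := u) \<in> D})"
   using f(1) in_D[OF x] False unfolding has_partial_def by simp
  moreover have "{u. x(i := u) \<in> D} = {u. x(i := u) \<in> D'}" using D_D' in_D[of "x(i := u)" for u] i False by fastforce
  ultimately show ?thesis using i False by (simp add: ext_def)
 qed
qed

text \<open>The slice in direction \<open>j\<close> is the whole line. Where it meets the
  hyperplane, the series side and the original side have the same one-sided derivative, and the two
  one-sided limits combine.\<close>

lemma ext_partial_self:
 assumes f: "has_partial j D f f'" "bdd_cont D f" "bdd_cont D f'"
 shows "has_partial j D' (ext m f) (ext (Suc m) f')" unfolding has_partial_def
proof
 fix x assume x: "x \<in> D'"
 have xD: "x(j := u) \<in> D'" for u using x j by (auto simp: half_orthant_def espace_def)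
 have slice: "{u. x(j := u) \<in> D} = {0..}" using in_D[OF xD] D_D'[of "x(j := u)" for u] by fastforce
 have neg: "((\<lambda>u. ext m f (x(j := u))) has_real_derivative ext (Suc m) f' x) (at (x j) within {..0})" if "x j \<le> 0"
 proof -
  have "((\<lambda>u. series m f (x(j := u))) has_real_derivative ext (Suc m) f' x) (at (x j) within {..0})"
   using series_partial_self[OF f x that] that by (simp add: ext_def)
  then show ?thesis unfolding has_field_derivative_def by (rule has_derivative_transform[rotated 2]) (use that in \<open>auto simp: ext_def\<close>)
 qed
 have pos: "((\<lambda>u. ext m f (x(j := u))) has_real_derivative ext (Suc m) f' x) (at (x j) within {0..})" if "0 \<le> x j"
 proof -
  have "((\<lambda>u. f (x(j := u))) has_real_derivative ext (Suc m) f' x) (at (x j) within {0..})"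
   using f(1) in_D[OF x that] that unfolding has_partial_def slice[symmetric] by (simp add: ext_nonneg)
  then show ?thesis unfolding has_field_derivative_def by (rule has_derivative_transform[rotated 2]) (use that in \<open>auto simp: ext_nonneg\<close>)
 qed
 have "((\<lambda>u. ext m f (x(j := u))) has_real_derivative ext (Suc m) f' x) (at (x j))"
 proof (cases "x j" "0::real" rule: linorder_cases)
  case less
  then have "at (x j) within {..0} = at (x j)" by (intro at_within_interior) simp
  then show ?thesis using neg less by simp
 next
  case greater
  then have "at (x j) within {0..} = at (x j)" by (intro at_within_interior) simp
  then show ?thesis using pos greater by simp
 next
  case equal
  have U: "{..(0::real)} \<union> {0..} = UNIV" by auto
  have le: "x j \<le> 0" "0 \<le> x j" using equal by auto
  from Lim_Un[OF neg[OF le(1), unfolded has_field_derivative_iff] pos[OF le(2), unfolded has_field_derivative_iff]]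
  show ?thesis unfolding U has_field_derivative_iff .
 qed
 moreover have "{u. x(j := u) \<in> D'} = UNIV" using xD by auto
 ultimately show "((\<lambda>u. ext m f (x(j := u))) has_real_derivative ext (Suc m) f' x) (at (x j) within {u. x(j := u) \<in> D'})" by simp
qed

lemma ext_partials:
 "partials (bdd_cont D) n D k f ==> partials (bdd_cont D') n D' k (ext m f)"
proof (induction k arbitrary: m f)
 case 0 then show ?case by (simp add: ext_bdd_cont)
next
 case (Suc k)
 have bf: "bdd_cont D f" using Suc.prems by simp
 show ?case
 proof (rule partials_SucI[where P = "bdd_cont D'"])
  show "bdd_cont D' (ext m f)" by (rule ext_bdd_cont[OF bf])
  fix i assume "i < n"
  then obtain f' where f': "has_partial i D f f'" "partials (bdd_cont D) n D k f'" by (rule partials_SucE[OF Suc.prems])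
  have bf': "bdd_cont D f'" by (rule partials_imp[OF f'(2)])
  show "\<exists>g. has_partial i D' (ext m f) g \<and> partials (bdd_cont D') n D' k g"
  proof (cases "i = j")
   case True
   then have "has_partial i D' (ext m f) (ext (Suc m) f')" using ext_partial_self[OF _ bf bf'] f'(1) by blast
   then show ?thesis using Suc.IH[OF f'(2)] by blast
  next
   case False
   show ?thesis using ext_partial_other[OF f'(1) bf bf' False] Suc.IH[OF f'(2)] by blast
  qed
 qed
qed

end

text \<open>One coordinate is freed at a time. Boundedness of all partials is carried along, since
  the next reflection relies on it again.\<close>

lemma seeley_extension:
 assumes "smooth_with (bdd_cont (half_orthant n 0)) n (half_orthant n 0) f"
 obtains F where "smooth n (espace n) F" "\<And>x. x \<in> half_orthant n 0 ==> F x = f x"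
proof -
 obtain a :: "nat \<Rightarrow> real" where a: "\<And>m. summable (\<lambda>k. \<bar>a k\<bar> * (2 ^ k) ^ m)" "\<And>m. (\<lambda>k. a k * (- (2 ^ k)) ^ m) sums 1"
  using seeley_coefficients by blast
 have "\<exists>F. smooth_with (bdd_cont (half_orthant n j)) n (half_orthant n j) F \<and> (\<forall>x\<in>half_orthant n 0. F x = f x)" if "j \<le> n" for j using that
 proof (induction j)
  case (Suc j)
  then obtain F where F: "smooth_with (bdd_cont (half_orthant n j)) n (half_orthant n j) F" "\<forall>x\<in>half_orthant n 0. F x = f x" by auto
  interpret seeley a n j by unfold_locales (use a Suc.prems in auto)
  have "smooth_with (bdd_cont D') n D' (ext 0 F)" using ext_partials F(1) unfolding smooth_with_def by simp
  moreover have "\<forall>x\<in>half_orthant n 0. ext 0 F x = f x" using F(2) Suc.prems by (auto simp: half_orthant_def ext_nonneg)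
  ultimately show ?case by blast
 qed (use assms in auto)
 then obtain F where F: "smooth_with (bdd_cont (half_orthant n n)) n (half_orthant n n) F" "\<forall>x\<in>half_orthant n 0. F x = f x" by blast
 have "half_orthant n n = espace n" by (auto simp: half_orthant_def)
 then have "smooth_with (bdd_cont (espace n)) n (espace n) F" using F(1) by simp
 then have "smooth n (espace n) F"
  unfolding smooth_with_def using partials_mono[where P = "bdd_cont (espace n)" and Q = "continuous_on (espace n)"]
  by (simp add: bdd_cont_def)
 then show ?thesis using F(2) that by blast
qed

text \<open>The powers in the denominator make the family closed under differentiation, so that one
  induction over the order handles all members.\<close>

definition flat_exp :: "nat \<Rightarrow> real \<Rightarrow> real" where
 "flat_exp m x = (if x > 0 then exp (- 1 / x) / x ^ m else 0)"

lemma flat_exp_deriv: "(flat_exp m has_real_derivative (flat_exp (m + 2) x - m * flat_exp (m + 1) x)) (at x)"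
proof (cases x "0::real" rule: linorder_cases)
 case less
 have "((\<lambda>_. 0) has_real_derivative 0) (at x)" by simp
 then have "(flat_exp m has_real_derivative 0) (at x)"
  by (rule has_field_derivative_transform_within_open[where S = "{..<0}"]) (use less in \<open>auto simp: flat_exp_def\<close>)
 then show ?thesis using less by (simp add: flat_exp_def)
next
 case greater
 have "((\<lambda>x. exp (- 1 / x) / x ^ m) has_real_derivative (flat_exp (m + 2) x - m * flat_exp (m + 1) x)) (at x)"
 proof (cases m)
  case 0
  then show ?thesis using greater by (auto intro!: derivative_eq_intros simp: flat_exp_def power2_eq_square field_simps)
 next
  case (Suc k)
  have "((\<lambda>x. exp (- 1 / x) / x ^ m) has_real_derivative
    ((exp (- 1 / x) * (1 / x\<^sup>2)) * x ^ m - exp (- 1 / x) * (m * x ^ k)) / (x ^ m * x ^ m)) (at x)"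
  proof (rule DERIV_divide)
   show "((\<lambda>x. exp (- 1 / x)) has_real_derivative exp (- 1 / x) * (1 / x\<^sup>2)) (at x)"
    using greater by (auto intro!: derivative_eq_intros simp: power2_eq_square)
   show "((\<lambda>x. x ^ m) has_real_derivative m * x ^ k) (at x)" using DERIV_pow[of m x] Suc by simp
  qed (use greater in simp)
  moreover have "((exp (- 1 / x) * (1 / x\<^sup>2)) * x ^ m - exp (- 1 / x) * (m * x ^ k)) / (x ^ m * x ^ m) =
    flat_exp (m + 2) x - m * flat_exp (m + 1) x" using greater Suc by (simp add: flat_exp_def field_simps power2_eq_square)
  ultimately show ?thesis by simp
 qed
 then show ?thesis by (rule has_field_derivative_transform_within_open[where S = "{0<..}"]) (use greater in \<open>auto simp: flat_exp_def\<close>)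
next
 case equal
 have r: "((\<lambda>h. flat_exp m h / h) \<longlongrightarrow> 0) (at_right 0)"
 proof (rule Lim_transform_eventually)
  show "((\<lambda>h::real. exp (- 1 / h) / h ^ m / h) \<longlongrightarrow> 0) (at_right 0)" by real_asymp
  show "\<forall>\<^sub>F h in at_right 0. exp (- 1 / h) / h ^ m / h = flat_exp m h / h" by (auto simp: eventually_at_filter flat_exp_def)
 qed
 have l: "((\<lambda>h. flat_exp m h / h) \<longlongrightarrow> 0) (at_left 0)"
  by (rule Lim_transform_eventually[OF tendsto_const]) (auto simp: eventually_at_filter flat_exp_def)
 have "((\<lambda>h. flat_exp m h / h) \<longlongrightarrow> 0) (at 0)" using l r by (simp add: filterlim_split_at_real)
 then show ?thesis using equal by (simp add: has_field_derivative_iff flat_exp_def)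
qed

lemma flat_exp_pos: "0 < x ==> 0 < flat_exp m x" by (simp add: flat_exp_def)

lemma continuous_on_flat_exp: "continuous_on S (flat_exp m)" using flat_exp_deriv DERIV_isCont continuous_at_imp_continuous_on by blast

text \<open>Generic in \<open>P\<close>: continuity gives the bump functions, tameness the cutoffs
  of the partition of unity. The index \<open>m\<close> varies in the induction because
  differentiation raises it.\<close>

lemma partials_flat_exp:
 assumes mult: "closed_mult P P P" and add: "closed_add P" and const: "\<And>c. P (\<lambda>x. c)"
  and P: "\<And>m. P (\<lambda>x. flat_exp m (y x))"
 shows "partials P n D k y ==> partials P n D k (\<lambda>x. flat_exp m (y x))"
proof (induction k arbitrary: m)
 case (Suc k)
 show ?case
 proof (rule partials_SucI[where P = P])
  fix i assume "i < n"
  then obtain y' where y': "has_partial i D y y'" "partials P n D k y'" by (rule partials_SucE[OF Suc.prems])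
  define f' where "f' x = (flat_exp (m + 2) (y x) + (- real m) * flat_exp (m + 1) (y x)) * y' x" for x
  have "has_partial i D (\<lambda>x. flat_exp m (y x)) f'" unfolding has_partial_def
  proof
   fix x assume "x \<in> D"
   then have "((\<lambda>u. y (x(i := u))) has_real_derivative y' x) (at (x i) within {u. x(i := u) \<in> D})"
    using y'(1) by (auto simp: has_partial_def)
   from DERIV_chain2[OF flat_exp_deriv this]
   show "((\<lambda>u. flat_exp m (y (x(i := u)))) has_real_derivative f' x) (at (x i) within {u. x(i := u) \<in> D})" unfolding f'_def by simp
  qed
  moreover have "partials P n D k f'" unfolding f'_def by (intro partials_mult[OF mult add] partials_add[OF add] y'(2)
     Suc.IH[OF partials_SucD[OF Suc.prems]] partials_const[where P = P, OF const const])
  ultimately show "\<exists>f'. has_partial i D (\<lambda>x. flat_exp m (y x)) f' \<and> partials P n D k f'" by blast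
 qed (rule P)
qed (simp add: P)

lemma smooth_flat_exp: "smooth n D (\<lambda>x. flat_exp m (s * x i + c))"
proof -
 have "smooth n D (\<lambda>x. s * x i + c)" by (intro smooth_add smooth_mult smooth_const smooth_coord)
 moreover have "continuous_on D (\<lambda>x. flat_exp m (s * x i + c))" for m by (rule continuous_on_compose2[OF continuous_on_flat_exp[of UNIV]])
   (auto intro!: continuous_intros continuous_on_coord)
 ultimately show ?thesis using partials_flat_exp[where P = "continuous_on D" and y = "\<lambda>x. s * x i + c",
    OF continuous_on_closed_mult continuous_on_closed_add continuous_on_const] unfolding smooth_with_def by simp
qed

section \<open>From one-sided smoothness to local extendability\<close>

lemma compact_espace_box: "compact {x \<in> espace n. \<forall>i<n. lo i \<le> x i \<and> x i \<le> hi i}"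
proof -
 have "compactin (product_topology (\<lambda>i::nat. euclideanreal) UNIV) (PiE UNIV (\<lambda>i. if i < n then {lo i..hi i} else {0}))"
  by (subst compactin_PiE) auto
 moreover have "PiE UNIV (\<lambda>i. if i < n then {lo i..hi i} else {0}) = {x \<in> espace n. \<forall>i<n. lo i \<le> x i \<and> x i \<le> hi i}"
  by (auto simp: PiE_iff espace_def extensional_def split: if_splits)
 ultimately show ?thesis by (simp add: euclidean_product_topology)
qed

definition orth :: "nat \<Rightarrow> (nat \<Rightarrow> real) set" where
 "orth n = {x \<in> espace n. \<forall>i<n. 0 \<le> x i}"

lemma orthant_top_of_set: "orthant n = top_of_set (orth n)"
 by (simp add: orthant_def Euclidean_space_top_of_set subtopology_subtopology orth_def Int_def)

lemma slices_fat_box: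
 assumes "\<And>x i. x \<in> D ==> i < n ==> \<exists>a b. a < b \<and> a \<le> x i \<and> x i \<le> b \<and> (\<forall>u\<in>{a..b}. x(i := u) \<in> D)"
 shows "slices_fat n D" unfolding slices_fat_def
proof (intro ballI allI impI)
 fix x i assume "x \<in> D" "i < n"
 from assms[OF this] obtain a b where ab: "a < b" "a \<le> x i" "x i \<le> b" "\<And>u. u \<in> {a..b} ==> x(i := u) \<in> D" by blast
 have "x i islimpt {a..b}" using ab by (intro connected_imp_perfect) auto
 then have "x i islimpt {u. x(i := u) \<in> D}" by (rule islimpt_subset) (use ab(4) in auto)
 then show "at (x i) within {u. x(i := u) \<in> D} \<noteq> bot" by (simp add: trivial_limit_within)
qed

lemma slices_fat_orth: "slices_fat n (orth n)"
proof (rule slices_fat_box)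
 fix x i assume "x \<in> orth n" "i < n"
 then show "\<exists>a b. a < b \<and> a \<le> x i \<and> x i \<le> b \<and> (\<forall>u\<in>{a..b}. x(i := u) \<in> orth n)"
  by (intro exI[of _ "x i"] exI[of _ "x i + 1"]) (auto simp: orth_def espace_def)
qed

lemma slices_fat_openin_orthant:
 assumes "openin (orthant n) A" shows "slices_fat n A"
 using assms slices_fat_Int_open[OF slices_fat_orth] unfolding orthant_top_of_set openin_open by auto

text \<open>A function that is 0 on a relatively open set has partials that are 0 there. Applied to
  the exterior of a box, it confines all partials of a cut-off function to a compact set.\<close>

lemma partials_vanish:
 assumes fat: "slices_fat n D" and "open O2"
 shows "partials (continuous_on D) n D k g ==> (\<And>x. x \<in> D \<inter> O2 ==> g x = 0) ==>
  partials (\<lambda>f. continuous_on D f \<and> (\<forall>x\<in>D \<inter> O2. f x = 0)) n D k g"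
proof (induction k arbitrary: g)
 case (Suc k)
 show ?case
 proof (rule partials_SucI[where P = "\<lambda>f. continuous_on D f \<and> (\<forall>x\<in>D \<inter> O2. f x = 0)"])
  fix i assume i: "i < n"
  obtain g' where g': "has_partial i D g g'" "partials (continuous_on D) n D k g'" by (rule partials_SucE[OF Suc.prems(1) i])
  have "g' x = 0" if x: "x \<in> D \<inter> O2" for x
  proof (rule has_partial_unique[OF slices_fat_Int_open[OF fat assms(2)] i _ _ x])
   show "has_partial i (D \<inter> O2) g g'" by (rule has_partial_subset[OF g'(1)]) auto
   show "has_partial i (D \<inter> O2) g (\<lambda>x. 0)" by (rule has_partial_cong[OF has_partial_const[of i _ 0]]) (use Suc.prems(2) in auto)
  qed
  then show "\<exists>f'. has_partial i D g f' \<and> partials (\<lambda>f. continuous_on D f \<and> (\<forall>x\<in>D \<inter> O2. f x = 0)) n D k f'" using g' Suc.IH by blast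
 qed (use Suc.prems in auto)
qed auto

lemma half_orthant_0: "half_orthant n 0 = orth n" by (auto simp: half_orthant_def orth_def)

text \<open>Smoothness on an open subset of the orthant, with one-sided derivatives at the boundary,
 is smoothness in the sense of local extendability: multiply by a bump function, reflect, divide.\<close>

lemma smooth_imp_locally_smooth_on:
 assumes A: "openin (orthant n) A" and f: "smooth n A f" and p: "p \<in> A"
 obtains N where "openin (orthant n) N" "p \<in> N" "N \<subseteq> A" "smooth_on n N f"
proof -
 obtain O' where O': "open O'" "A = orth n \<inter> O'" using A unfolding orthant_top_of_set openin_open by blast
 have po: "p \<in> orth n" "p \<in> O'" "p \<in> espace n" using p O' by (auto simp: orth_def)
 obtain d where d: "d > 0" "espace n \<inter> ebox n p d \<subseteq> O'" using ebox_subset_open[OF O'(1) po(2,3)] .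
 \<comment> \<open>Half the radius leaves room: \<open>A\<close> and the set \<open>O2\<close> of
   points with some coordinate farther than \<open>e\<close> from that of \<open>p\<close> together
   cover the orthant.\<close>
 define e where "e = d / 2"
 have e: "e > 0" "e < d" using d by (auto simp: e_def)
 \<comment> \<open>The two factors for \<open>i\<close> are both positive exactly when x_i is within
   \<open>e\<close> of p_i, so \<open>b\<close> is positive exactly on the open box.\<close>
 define b where "b x = (\<Prod>i<n. flat_exp 0 (1 * x i + (e - p i)) * flat_exp 0 ((- 1) * x i + (p i + e)))" for x
 have b_smooth: "smooth n D b" for D unfolding b_def[abs_def] by (intro smooth_prod smooth_mult smooth_flat_exp)
 have b_pos: "0 < b x" if "x \<in> ebox n p e" for x unfolding b_def
 proof (rule prod_pos)
  fix i assume "i \<in> {..<n}"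
  then have "\<bar>x i - p i\<bar> < e" using that by (auto simp: ebox_def)
  then show "0 < flat_exp 0 (1 * x i + (e - p i)) * flat_exp 0 ((- 1) * x i + (p i + e))" by (intro mult_pos_pos flat_exp_pos) linarith+
 qed
 have b_zero: "b x = 0" if "x \<notin> ebox n p e" for x
 proof -
  obtain i where i: "i < n" "\<not> \<bar>x i - p i\<bar> < e" using \<open>x \<notin> ebox n p e\<close> by (auto simp: ebox_def)
  then have "flat_exp 0 (1 * x i + (e - p i)) * flat_exp 0 ((- 1) * x i + (p i + e)) = 0" by (auto simp: flat_exp_def)
  then show ?thesis unfolding b_def using i by (intro prod_zero) auto
 qed
 define O2 where "O2 = {x. \<exists>i<n. e < \<bar>x i - p i\<bar>}"
 have "open (\<Union>i\<in>{..<n}. {x. e < \<bar>x i - p i\<bar>})" by (intro open_UN ballI open_Collect_less continuous_intros continuous_on_coord)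
 moreover have "(\<Union>i\<in>{..<n}. {x. e < \<bar>x i - p i\<bar>}) = O2" by (auto simp: O2_def)
 ultimately have O2: "open O2" by simp
 have b_O2: "b x = 0" if "x \<in> O2" for x using that by (intro b_zero) (auto simp: O2_def ebox_def)
 define g where "g x = (if x \<in> A then f x * b x else 0)" for x
 have g_zero: "g x = 0" if "x \<in> O2" for x using b_O2[OF that] by (simp add: g_def)
 have "smooth n (orth n) g"
 proof (rule smooth_local[OF slices_fat_orth])
  fix x assume x: "x \<in> orth n"
  show "\<exists>O'. open O' \<and> x \<in> O' \<and> smooth n (orth n \<inter> O') g"
  proof (cases "x \<in> A")
   case True
   have "smooth n A g" by (rule smooth_cong[OF smooth_mult[OF f b_smooth]]) (simp add: g_def)
   then show ?thesis using O' True by blast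
  next
   case False
   then have "\<not> x \<in> ebox n p d" using x O' d by (auto simp: orth_def)
   then have "x \<in> O2" using e by (force simp: O2_def ebox_def)
   moreover have "smooth n (orth n \<inter> O2) g" by (rule smooth_cong[OF smooth_const[where c = 0]]) (use g_zero in auto)
   ultimately show ?thesis using O2 by blast
  qed
 qed
 \<comment> \<open>\<open>g\<close> and its partials vanish outside a compact box, so continuity
   already gives the boundedness on which the reflection relies.\<close>
 have "smooth_with (bdd_cont (orth n)) n (orth n) g" unfolding smooth_with_def
 proof
  fix k
  let ?P = "\<lambda>f. continuous_on (orth n) f \<and> (\<forall>x\<in>orth n \<inter> O2. f x = 0)"
  have it: "partials ?P n (orth n) k g"
   using partials_vanish[OF slices_fat_orth O2] \<open>smooth n (orth n) g\<close> g_zero unfolding smooth_with_def by simp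
  have bd: "bdd_cont (orth n) h" if h: "?P h" for h
  proof -
   define C where "C = {x \<in> espace n. \<forall>i<n. max 0 (p i - e) \<le> x i \<and> x i \<le> p i + e}"
   have "compact C" unfolding C_def by (rule compact_espace_box)
   moreover have CO: "C \<subseteq> orth n" by (auto simp: C_def orth_def)
   ultimately have "compact (h ` C)" using h by (meson compact_continuous_image continuous_on_subset)
   then have "bounded (h ` C)" by (rule compact_imp_bounded)
   then obtain B where B: "\<And>x. x \<in> C ==> \<bar>h x\<bar> \<le> B" unfolding bounded_iff by auto
   have "\<bar>h x\<bar> \<le> max B 0" if x: "x \<in> orth n" for x
   proof (cases "x \<in> O2")
    case False
    have "max 0 (p i - e) \<le> x i \<and> x i \<le> p i + e" if "i < n" for i
    proof -
     have "\<not> e < \<bar>x i - p i\<bar>" using False that unfolding O2_def by blast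
     moreover have "0 \<le> x i" using x that by (simp add: orth_def)
     ultimately show ?thesis by linarith
    qed
    then have "x \<in> C" using x unfolding C_def orth_def by simp
    then show ?thesis using B[of x] by simp
   qed (use h x in auto)
   then show ?thesis using h unfolding bdd_cont_def by blast
  qed
  show "partials (bdd_cont (orth n)) n (orth n) k g" by (rule partials_mono[OF it bd])
 qed
 then obtain F where F: "smooth n (espace n) F" "\<And>x. x \<in> orth n ==> F x = g x"
  using seeley_extension[of n g] unfolding half_orthant_0 by metis
 define W where "W = espace n \<inter> ebox n p e"
 have W: "openin (Euclidean_space n) W" unfolding W_def Euclidean_space_top_of_set by (simp add: openin_open_Int open_ebox)
 define N where "N = orth n \<inter> ebox n p e"
 have NA: "N \<subseteq> A" using d e O' unfolding N_def by (force simp: ebox_def orth_def)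
 have "smooth_on n N f"
 proof (rule smooth_imp_smooth_on[OF W])
  show "smooth n W (\<lambda>x. F x / b x)"
  proof (rule smooth_divide[OF smooth_subset[OF F(1)] b_smooth])
   show "b x \<noteq> 0" if "x \<in> W" for x using b_pos[of x] that by (auto simp: W_def)
  qed (auto simp: W_def)
  show "N \<subseteq> W" by (auto simp: N_def W_def orth_def)
  show "F x / b x = f x" if "x \<in> N" for x using F(2)[of x] b_pos[of x] NA that by (auto simp: N_def g_def)
 qed
 moreover have "openin (orthant n) N" unfolding N_def orthant_top_of_set by (simp add: openin_open_Int open_ebox)
 moreover have "p \<in> N" using po e by (auto simp: N_def ebox_def)
 ultimately show ?thesis using that NA by blast
qed

text \<open>Multiplication by the inverse of the top power of \<open>y\<close> isolates the top
  coefficient, as all inverse powers of \<open>y\<close> tend to 0. Induction removes the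
  coefficients from the top.\<close>

lemma lim_poly_zero:
 fixes c :: "nat \<Rightarrow> real"
 assumes "((\<lambda>t. \<Sum>d\<le>M. c d * y t ^ d) \<longlongrightarrow> 0) F" "filterlim y at_infinity F" "F \<noteq> bot" "d \<le> M"
 shows "c d = 0" using assms(1,4)
proof (induction M arbitrary: d)
 case 0 then show ?case using assms(3) by (auto simp: tendsto_const_iff)
next
 case (Suc M)
 have inv: "((\<lambda>t. inverse (y t) ^ Suc l) \<longlongrightarrow> 0) F" for l
  using tendsto_power[OF filterlim_compose[OF tendsto_inverse_0 assms(2)], of "Suc l"] by simp
 have ne: "\<forall>\<^sub>F t in F. y t \<noteq> 0" using filterlim_at_infinity_imp_eventually_ne[OF assms(2), of 0] by simp
 have "((\<lambda>t. (\<Sum>d\<le>Suc M. c d * y t ^ d) * inverse (y t) ^ Suc M) \<longlongrightarrow> 0 * 0) F" by (intro tendsto_mult Suc.prems inv)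
 moreover have "((\<lambda>t. (\<Sum>d\<le>Suc M. c d * y t ^ d) * inverse (y t) ^ Suc M) \<longlongrightarrow> (\<Sum>d\<le>M. c d * 0) + c (Suc M)) F"
 proof (rule Lim_transform_eventually)
  show "((\<lambda>t. (\<Sum>d\<le>M. c d * inverse (y t) ^ Suc (M - d)) + c (Suc M)) \<longlongrightarrow> (\<Sum>d\<le>M. c d * 0) + c (Suc M)) F" by (intro tendsto_intros inv)
  show "\<forall>\<^sub>F t in F. (\<Sum>d\<le>M. c d * inverse (y t) ^ Suc (M - d)) + c (Suc M) = (\<Sum>d\<le>Suc M. c d * y t ^ d) * inverse (y t) ^ Suc M"
  proof (rule eventually_mono[OF ne])
   fix t assume y: "y t \<noteq> 0"
   have "y t ^ d * inverse (y t) ^ Suc M = inverse (y t) ^ Suc (M - d)" if "d \<le> M" for d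
   proof -
    have "Suc M = d + Suc (M - d)" using that by simp
    then have "inverse (y t) ^ Suc M = inverse (y t) ^ d * inverse (y t) ^ Suc (M - d)" by (metis power_add)
    then show ?thesis using y by (simp add: power_inverse)
   qed
   then have "(\<Sum>d\<le>M. c d * inverse (y t) ^ Suc (M - d)) = (\<Sum>d\<le>M. c d * y t ^ d * inverse (y t) ^ Suc M)"
    by (intro sum.cong refl) (metis atMost_iff mult.assoc)
   moreover have "c (Suc M) * y t ^ Suc M * inverse (y t) ^ Suc M = c (Suc M)"
   proof -
    have "y t ^ Suc M * inverse (y t) ^ Suc M = 1" using y by (metis power_mult_distrib power_one right_inverse)
    then show ?thesis by (simp only: mult.assoc mult_1_right)
   qed
   ultimately show "(\<Sum>d\<le>M. c d * inverse (y t) ^ Suc (M - d)) + c (Suc M) = (\<Sum>d\<le>Suc M. c d * y t ^ d) * inverse (y t) ^ Suc M"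
    by (simp add: sum_distrib_right distrib_right)
  qed
 qed
 ultimately have "(\<Sum>d\<le>M. c d * 0) + c (Suc M) = 0" using tendsto_unique[OF assms(3)] by fastforce
 then have c: "c (Suc M) = 0" by simp
 then show ?case using Suc.IH[of d] Suc.prems by (cases "d = Suc M") auto
qed

text \<open>The remainder of \<open>g 0\<close> has as its derivative the remainder of
  \<open>g 1\<close>, one order lower; the mean value bound then gains one factor \<open>u\<close>.
  The sharper constant with a factorial is of no interest here.\<close>

lemma taylor_within:
 fixes g :: "nat \<Rightarrow> real \<Rightarrow> real"
 assumes "\<And>m u. u \<in> {0..b} ==> (g m has_real_derivative g (Suc m) u) (at u within {0..b})"
  and "\<And>u. u \<in> {0..b} ==> \<bar>g N u\<bar> \<le> B" "u \<in> {0..b}"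
 shows "\<bar>g 0 u - (\<Sum>m<N. u ^ m / fact m * g m 0)\<bar> \<le> B * u ^ N" using assms
proof (induction N arbitrary: g u)
 case 0 then show ?case by simp
next
 case (Suc N)
 define R where "R v = g 0 v - (\<Sum>m<Suc N. v ^ m / fact m * g m 0)" for v
 define R' where "R' v = g 1 v - (\<Sum>m<N. v ^ m / fact m * g (Suc m) 0)" for v
 have B: "B \<ge> 0" using Suc.prems(2)[of u] Suc.prems(3) by force
 have bound: "\<bar>R' v\<bar> \<le> B * v ^ N" if "v \<in> {0..b}" for v unfolding R'_def using Suc.IH[of "\<lambda>m. g (Suc m)" v] Suc.prems that by auto
 have der: "(R has_real_derivative R' v) (at v within {0..u})" if v: "v \<in> {0..u}" for v
 proof -
  have "(g 0 has_real_derivative g 1 v) (at v within {0..u})" using Suc.prems(1)[of v 0] Suc.prems(3) v by (auto intro: DERIV_subset)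
  moreover have "((\<lambda>v. \<Sum>m<Suc N. v ^ m / fact m * g m 0) has_real_derivative (\<Sum>m<N. v ^ m / fact m * g (Suc m) 0)) (at v within {0..u})"
  proof -
   have "((\<lambda>v. v ^ Suc m / fact (Suc m) * g (Suc m) 0) has_real_derivative v ^ m / fact m * g (Suc m) 0) (at v within {0..u})" for m
   proof -
    have "((\<lambda>v. v ^ Suc m) has_real_derivative real (Suc m) * v ^ m) (at v within {0..u})" using DERIV_pow[of "Suc m" v] by simp
    from DERIV_cmult_right[OF this, of "g (Suc m) 0 / fact (Suc m)"]
    have "((\<lambda>v. v ^ Suc m / fact (Suc m) * g (Suc m) 0) has_real_derivative real (Suc m) * v ^ m * (g (Suc m) 0 / fact (Suc m))) (at v within {0..u})"
     by simp
    moreover have "real (Suc m) * v ^ m * (g (Suc m) 0 / fact (Suc m)) = v ^ m / fact m * g (Suc m) 0"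
     by (simp only: fact_Suc) (simp add: divide_simps)
    ultimately show ?thesis by simp
   qed
   then have "((\<lambda>v. \<Sum>m<N. v ^ Suc m / fact (Suc m) * g (Suc m) 0) has_real_derivative (\<Sum>m<N. v ^ m / fact m * g (Suc m) 0)) (at v within {0..u})"
    by (intro DERIV_sum)
   then have "((\<lambda>v. g 0 0 + (\<Sum>m<N. v ^ Suc m / fact (Suc m) * g (Suc m) 0)) has_real_derivative (\<Sum>m<N. v ^ m / fact m * g (Suc m) 0)) (at v within {0..u})"
    using DERIV_add[OF DERIV_const] by fastforce
   then show ?thesis by (simp only: sum.lessThan_Suc_shift power_0 fact_0 div_by_1 mult_1)
  qed
  ultimately show ?thesis unfolding R_def R'_def by (intro DERIV_diff)
 qed
 have "norm (R u - R 0) \<le> (B * u ^ N) * norm (u - 0)"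
 proof (rule field_differentiable_bound[where S = "{0..u}" and f' = R'])
  show "norm (R' v) \<le> B * u ^ N" if "v \<in> {0..u}" for v
  proof -
   have "B * v ^ N \<le> B * u ^ N" using that B by (intro mult_left_mono power_mono) auto
   then show ?thesis using bound[of v] that Suc.prems(3) by auto
  qed
 qed (use der Suc.prems(3) in auto)
 moreover have "R 0 = 0" by (simp add: R_def sum.lessThan_Suc_shift del: sum.lessThan_Suc)
 ultimately show ?case using Suc.prems(3) by (simp add: R_def mult_ac)
qed

text \<open>A vanishing combination of powers of \<open>ln u\<close> with smooth coefficients has coefficients which
 are flat at \<open>0\<close>: divide by the lowest power of \<open>u\<close> that occurs and let \<open>u\<close> tend to \<open>0\<close>.\<close>

lemma log_relation_1d:
 fixes \<phi> :: "nat \<Rightarrow> nat \<Rightarrow> real \<Rightarrow> real"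
 assumes b: "0 < b"
  and der: "\<And>d m u. u \<in> {0..b} ==> (\<phi> d m has_real_derivative \<phi> d (Suc m) u) (at u within {0..b})"
  and rel: "\<And>u. 0 < u ==> u \<le> b ==> (\<Sum>d\<le>M. \<phi> d 0 u * ln u ^ d) = 0"
 shows "d \<le> M ==> \<phi> d m 0 = 0"
proof (induction m arbitrary: d rule: less_induct)
 case (less m)
 have "\<exists>B. \<forall>u\<in>{0..b}. \<bar>\<phi> d (Suc m) u\<bar> \<le> B" for d
 proof -
  have "continuous_on {0..b} (\<phi> d (Suc m))" using der by (meson DERIV_continuous continuous_on_eq_continuous_within)
  then have "bounded (\<phi> d (Suc m) ` {0..b})" by (intro compact_imp_bounded compact_continuous_image) auto
  then show ?thesis unfolding bounded_iff by auto
 qed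
 then obtain B where B: "\<And>d u. u \<in> {0..b} ==> \<bar>\<phi> d (Suc m) u\<bar> \<le> B d" by metis
 \<comment> \<open>By the induction hypothesis the Taylor coefficients below order \<open>m\<close>
   vanish for every exponent \<open>d\<close>, so a single term of the expansion remains.\<close>
 have tay: "\<bar>\<phi> d 0 u - u ^ m / fact m * \<phi> d m 0\<bar> \<le> B d * u ^ Suc m" if "d \<le> M" "u \<in> {0..b}" for d u
 proof -
  have "(\<Sum>l<Suc m. u ^ l / fact l * \<phi> d l 0) = u ^ m / fact m * \<phi> d m 0" using less.IH that(1) by simp
  then show ?thesis using taylor_within[where g = "\<phi> d" and N = "Suc m" and b = b and B = "B d", OF der B that(2)] by simp
 qed
 define c where "c d = \<phi> d m 0 / fact m" for d
 have "((\<lambda>u. \<Sum>d\<le>M. c d * ln u ^ d) \<longlongrightarrow> 0) (at_right 0)"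
 proof (rule Lim_null_comparison)
  have "((\<lambda>u::real. u * \<bar>ln u\<bar> ^ d) \<longlongrightarrow> 0) (at_right 0)" for d by real_asymp
  then have "((\<lambda>u. \<Sum>d\<le>M. B d * (u * \<bar>ln u\<bar> ^ d)) \<longlongrightarrow> (\<Sum>d\<le>M. B d * 0)) (at_right 0)" by (intro tendsto_intros)
  then show "((\<lambda>u. \<Sum>d\<le>M. B d * (u * \<bar>ln u\<bar> ^ d)) \<longlongrightarrow> 0) (at_right 0)" by simp
  have "\<forall>\<^sub>F u in at_right 0. 0 < u \<and> u < b" using b by (simp add: eventually_at_right_field) (metis)
  then show "\<forall>\<^sub>F u in at_right 0. norm (\<Sum>d\<le>M. c d * ln u ^ d) \<le> (\<Sum>d\<le>M. B d * (u * \<bar>ln u\<bar> ^ d))"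
  proof (rule eventually_mono)
   fix u assume u: "0 < u \<and> u < b"
   have um: "u ^ m > 0" using u by simp
   have "(\<Sum>d\<le>M. c d * ln u ^ d) * u ^ m = (\<Sum>d\<le>M. (u ^ m / fact m * \<phi> d m 0) * ln u ^ d)"
    unfolding c_def sum_distrib_right by (intro sum.cong) (simp_all add: mult_ac)
   also have "\<dots> = - (\<Sum>d\<le>M. (\<phi> d 0 u - u ^ m / fact m * \<phi> d m 0) * ln u ^ d)"
    using rel[of u] u by (simp add: left_diff_distrib sum_subtractf)
   finally have eq: "(\<Sum>d\<le>M. c d * ln u ^ d) * u ^ m = - (\<Sum>d\<le>M. (\<phi> d 0 u - u ^ m / fact m * \<phi> d m 0) * ln u ^ d)" .
   have "\<bar>\<Sum>d\<le>M. c d * ln u ^ d\<bar> * u ^ m = \<bar>(\<Sum>d\<le>M. c d * ln u ^ d) * u ^ m\<bar>" using um by (simp only: abs_mult abs_of_pos)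
   also have "\<dots> = \<bar>\<Sum>d\<le>M. (\<phi> d 0 u - u ^ m / fact m * \<phi> d m 0) * ln u ^ d\<bar>" unfolding eq by (rule abs_minus_cancel)
   also have "\<dots> \<le> (\<Sum>d\<le>M. \<bar>\<phi> d 0 u - u ^ m / fact m * \<phi> d m 0\<bar> * \<bar>ln u\<bar> ^ d)"
    using sum_abs[of "\<lambda>d. (\<phi> d 0 u - u ^ m / fact m * \<phi> d m 0) * ln u ^ d" "{..M}"] by (simp add: abs_mult power_abs)
   also have "\<dots> \<le> (\<Sum>d\<le>M. (B d * u ^ Suc m) * \<bar>ln u\<bar> ^ d)" using tay u by (intro sum_mono mult_right_mono) auto
   also have "\<dots> = (\<Sum>d\<le>M. B d * (u * \<bar>ln u\<bar> ^ d)) * u ^ m" unfolding sum_distrib_right by (intro sum.cong) (simp_all add: mult_ac)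
   finally show "norm (\<Sum>d\<le>M. c d * ln u ^ d) \<le> (\<Sum>d\<le>M. B d * (u * \<bar>ln u\<bar> ^ d))" using um by (simp add: mult_le_cancel_right)
  qed
 qed
 moreover have "filterlim (ln :: real \<Rightarrow> real) at_infinity (at_right 0)"
  using ln_at_0 by (rule filterlim_mono[OF _ at_bot_le_at_infinity order_refl])
 ultimately have "c d = 0" by (rule lim_poly_zero) (use less.prems in auto)
 then show ?case by (simp add: c_def)
qed

section \<open>Smooth relations between logarithms\<close>

text \<open>A family \<open>F\<close> stands for the sum of F_I (log x)^I. One step adds g log x_i
  (log x)^I - h (log x)^I, where h equals g log x_i: a monomial multiple of a relation of the second
  kind. Hence these are the families that vanish as a consequence of such relations, with
  coefficients compared on \<open>D\<close> only.\<close>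

inductive log_null :: "nat \<Rightarrow> (nat \<Rightarrow> real) set \<Rightarrow> (nat multiset \<Rightarrow> (nat \<Rightarrow> real) \<Rightarrow> real) \<Rightarrow> bool" for n D where
 zero: "(\<And>I x. x \<in> D ==> F I x = 0) ==> log_null n D F"
| step: "log_null n D F ==> i < n ==> set_mset I \<subseteq> {..<n} ==> smooth n D g ==> smooth n D h ==>
  (\<And>x. x \<in> D ==> 0 < x i ==> h x = g x * ln (x i)) ==>
  (\<And>J x. x \<in> D ==> F' J x = F J x + (if J = add_mset i I then g x else 0) - (if J = I then h x else 0)) ==>
  log_null n D F'"

lemma log_null_cong: "log_null n D F ==> (\<And>I x. x \<in> D ==> F I x = G I x) ==> log_null n D G"
proof (induction arbitrary: G rule: log_null.induct)
 case (zero F) then show ?case by (intro log_null.zero) auto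
next
 case (step F i I g h F')
 show ?case by (rule log_null.step[OF step.hyps(1-6)]) (use step.hyps step.prems in auto)
qed

lemma log_null_add: "log_null n D F ==> log_null n D G ==> log_null n D (\<lambda>I x. F I x + G I x)"
proof (induction rule: log_null.induct)
 case (zero F) then show ?case by (intro log_null_cong[OF zero(2)]) auto
next
 case (step F i I g h F')
 show ?case by (rule log_null.step[OF step.IH[OF step.prems] step.hyps(2-6)]) (use step.hyps in auto)
qed

lemma log_null_sum:
 "finite A ==> (\<And>a. a \<in> A ==> log_null n D (F a)) ==> log_null n D (\<lambda>I x. \<Sum>a\<in>A. F a I x)"
proof (induction A rule: finite_induct)
 case empty show ?case by (rule log_null.zero) simp
next
 case (insert a A) then show ?case using log_null_add[of n D "F a" "\<lambda>I x. \<Sum>a\<in>A. F a I x"] by simp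
qed

text \<open>The box is closed so that continuous functions on it are bounded. It meets the
  hyperplane x_i = 0 if \<open>lo i\<close> is 0 and stays away from it if \<open>lo i\<close> is
  positive.\<close>

locale corner_box =
 fixes n :: nat and lo hi :: "nat \<Rightarrow> real"
 assumes lo_hi: "\<And>i. i < n ==> 0 \<le> lo i \<and> lo i < hi i"
begin

definition D :: "(nat \<Rightarrow> real) set" where "D = {x \<in> espace n. \<forall>i<n. lo i \<le> x i \<and> x i \<le> hi i}"

text \<open>The coordinates are non-negative on the box, so this is comparable to the distance from
  the stratum where all coordinates in \<open>K\<close> vanish. For empty \<open>K\<close> it is
  0.\<close>

definition rho :: "nat set \<Rightarrow> (nat \<Rightarrow> real) \<Rightarrow> real" where "rho K x = (\<Sum>i\<in>K. x i)"

definition decay :: "nat set \<Rightarrow> rfun \<Rightarrow> bool" where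
 "decay K f \<longleftrightarrow> (\<forall>N. \<exists>C\<ge>0. \<forall>x\<in>D. \<bar>f x\<bar> \<le> C * rho K x ^ N)"

definition flat :: "nat set \<Rightarrow> rfun \<Rightarrow> bool" where
 "flat K f \<longleftrightarrow> continuous_on D f \<and> decay K f"

definition off :: "nat set \<Rightarrow> (nat \<Rightarrow> real) set" where "off K = {x \<in> D. 0 < rho K x}"

text \<open>Growth at most polynomial in \<open>1 / rho\<close>: multipliers that preserve vanishing
  to infinite order. Nothing is asked on the stratum itself, where the multipliers of interest are
  singular.\<close>

definition tame :: "nat set \<Rightarrow> rfun \<Rightarrow> bool" where
 "tame K f \<longleftrightarrow> continuous_on (off K) f \<and> (\<exists>N. \<exists>C\<ge>0. \<forall>x\<in>off K. \<bar>f x\<bar> * rho K x ^ N \<le> C)"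

lemma compact_D: "compact D" unfolding D_def by (rule compact_espace_box)

lemma D_nonneg: "x \<in> D ==> i < n ==> 0 \<le> x i" using lo_hi by (force simp: D_def)

lemma upd_D: "x \<in> D ==> i < n ==> x(i := u) \<in> D \<longleftrightarrow> lo i \<le> u \<and> u \<le> hi i" by (auto simp: D_def)

lemma slice_D: "x \<in> D ==> i < n ==> {u. x(i := u) \<in> D} = {lo i..hi i}" using upd_D by auto

lemma slices_fat_D: "slices_fat n D"
proof (rule slices_fat_box)
 fix x i assume "x \<in> D" "i < n"
 then show "\<exists>a b. a < b \<and> a \<le> x i \<and> x i \<le> b \<and> (\<forall>u\<in>{a..b}. x(i := u) \<in> D)"
  using lo_hi[of i] upd_D[of x i] by (intro exI[of _ "lo i"] exI[of _ "hi i"]) (auto simp: D_def)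
qed

lemma bounded_D:
 fixes f :: rfun
 assumes "continuous_on D f" obtains B where "B \<ge> 0" "\<And>x. x \<in> D ==> \<bar>f x\<bar> \<le> B"
proof -
 have "bounded (f ` D)" using assms compact_D by (intro compact_imp_bounded compact_continuous_image)
 then obtain B where "\<forall>x\<in>D. \<bar>f x\<bar> \<le> B" unfolding bounded_iff by auto
 then show ?thesis by (intro that[of "max B 0"]) auto
qed

lemma rho_nonneg: "K \<subseteq> {..<n} ==> x \<in> D ==> 0 \<le> rho K x" unfolding rho_def using D_nonneg by (intro sum_nonneg) auto

lemma continuous_rho: "continuous_on S (rho K)" unfolding rho_def by (intro continuous_intros continuous_on_coord)

lemma rho_bound: obtains R where "R \<ge> 1" "\<And>x. x \<in> D ==> rho K x \<le> R"
proof -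
 obtain B where "\<And>x. x \<in> D ==> \<bar>rho K x\<bar> \<le> B" using bounded_D[OF continuous_rho] by blast
 then show ?thesis by (intro that[of "max B 1"]) force+
qed

lemma rho_upd:
 assumes "K \<subseteq> {..<n}"
 shows "rho K (x(i := u)) \<le> rho K x + \<bar>u - x i\<bar>"
proof -
 have fin: "finite K" using assms finite_subset by blast
 show ?thesis
 proof (cases "i \<in> K")
  case True
  then have "rho K (x(i := u)) = u + (\<Sum>j\<in>K - {i}. x j)" "rho K x = x i + (\<Sum>j\<in>K - {i}. x j)"
   unfolding rho_def using fin by (auto simp: sum.remove[OF fin True])
  then show ?thesis by linarith
 next
  case False
  then have "rho K (x(i := u)) = rho K x" unfolding rho_def by (intro sum.cong) auto
  then show ?thesis by simp
 qed
qed

lemma decayE: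
 assumes "decay K f" obtains C where "C \<ge> 0" "\<And>x. x \<in> D ==> \<bar>f x\<bar> \<le> C * rho K x ^ N" using assms unfolding decay_def by blast

lemma decayI:
 assumes K: "K \<subseteq> {..<n}" and "\<And>N. \<exists>C\<ge>0. \<forall>x\<in>D. \<bar>f x\<bar> \<le> C * rho K x ^ Suc N"
 shows "decay K f" unfolding decay_def
proof
 fix N :: nat
 obtain R where R: "R \<ge> 1" "\<And>x. x \<in> D ==> rho K x \<le> R" using rho_bound[of K] by blast
 obtain C where C: "C \<ge> 0" "\<And>x. x \<in> D ==> \<bar>f x\<bar> \<le> C * rho K x ^ Suc N" using assms(2) by blast
 have "\<bar>f x\<bar> \<le> (C * R) * rho K x ^ N" if x: "x \<in> D" for x
 proof -
  have "C * rho K x ^ Suc N = C * rho K x * rho K x ^ N" by simp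
  also have "\<dots> \<le> C * R * rho K x ^ N" using C R(2)[OF x] rho_nonneg[OF K x] by (intro mult_right_mono mult_left_mono) auto
  finally show ?thesis using C(2)[OF x] by linarith
 qed
 then show "\<exists>C\<ge>0. \<forall>x\<in>D. \<bar>f x\<bar> \<le> C * rho K x ^ N" using C R by (intro exI[of _ "C * R"]) auto
qed

lemma decay_add: "decay K f ==> decay K g ==> decay K (\<lambda>x. f x + g x)" unfolding decay_def
proof
 fix N :: nat assume f: "\<forall>N. \<exists>C\<ge>0. \<forall>x\<in>D. \<bar>f x\<bar> \<le> C * rho K x ^ N" and g: "\<forall>N. \<exists>C\<ge>0. \<forall>x\<in>D. \<bar>g x\<bar> \<le> C * rho K x ^ N"
 obtain C where C: "C \<ge> 0" "\<And>x. x \<in> D ==> \<bar>f x\<bar> \<le> C * rho K x ^ N" using f by blast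
 obtain C' where C': "C' \<ge> 0" "\<And>x. x \<in> D ==> \<bar>g x\<bar> \<le> C' * rho K x ^ N" using g by blast
 have "\<bar>f x + g x\<bar> \<le> (C + C') * rho K x ^ N" if "x \<in> D" for x using C(2)[OF that] C'(2)[OF that] by (simp add: distrib_right)
 then show "\<exists>C\<ge>0. \<forall>x\<in>D. \<bar>f x + g x\<bar> \<le> C * rho K x ^ N" using C C' by (intro exI[of _ "C + C'"]) auto
qed

lemma flat_closed_add: "closed_add (flat K)" unfolding closed_add_def flat_def by (simp add: decay_add continuous_on_add)

text \<open>Interpolation: a second order Taylor bound with step \<open>h\<close> comparable to a high power of the
 distance shows that decay passes to first derivatives.\<close>

lemma decay_partial:
 assumes K: "K \<subseteq> {..<n}" and i: "i < n" and f: "smooth n D f" "decay K f" and f': "has_partial i D f f'" "smooth n D f'"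
 shows "decay K f'"
proof (rule decayI[OF K])
 fix N :: nat
 obtain f'' where f'': "has_partial i D f' f''" "smooth n D f''" using smooth_partial[OF slices_fat_D f'(2) i] .
 obtain M where M: "M \<ge> 0" "\<And>x. x \<in> D ==> \<bar>f'' x\<bar> \<le> M" using bounded_D[OF smooth_continuous[OF f''(2)]] by blast
 obtain R where R: "R \<ge> 1" "\<And>x. x \<in> D ==> rho K x \<le> R" using rho_bound[of K] by blast
 define L where "L = (hi i - lo i) / 2"
 have L: "L > 0" using lo_hi[OF i] by (simp add: L_def)
 have taylor: "\<bar>f (x(i := u)) - f x - f' x * (u - x i)\<bar> \<le> M * (u - x i)\<^sup>2" if x: "x \<in> D" and u: "u \<in> {lo i..hi i}" for x u
 proof -
  define S where "S = closed_segment (x i) u"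
  have xi: "x i \<in> {lo i..hi i}" using x i by (auto simp: D_def)
  have S: "S \<subseteq> {lo i..hi i}" unfolding S_def using xi u by (intro closed_segment_subset) auto
  have d1: "((\<lambda>v. f (x(i := v))) has_real_derivative f' (x(i := v))) (at v within S)" if "v \<in> S" for v
  proof -
   have vD: "x(i := v) \<in> D" using that S upd_D[OF x i] by auto
   have "((\<lambda>w. f ((x(i := v))(i := w))) has_real_derivative f' (x(i := v))) (at ((x(i := v)) i) within {w. (x(i := v))(i := w) \<in> D})"
    using f'(1) vD unfolding has_partial_def by blast
   then show ?thesis using S slice_D[OF vD i] by (auto intro: DERIV_subset)
  qed
  have d2: "((\<lambda>v. f' (x(i := v))) has_real_derivative f'' (x(i := v))) (at v within S)" if "v \<in> S" for v
  proof -
   have vD: "x(i := v) \<in> D" using that S upd_D[OF x i] by auto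
   have "((\<lambda>w. f' ((x(i := v))(i := w))) has_real_derivative f'' (x(i := v))) (at ((x(i := v)) i) within {w. (x(i := v))(i := w) \<in> D})"
    using f''(1) vD unfolding has_partial_def by blast
   then show ?thesis using S slice_D[OF vD i] by (auto intro: DERIV_subset)
  qed
  have b2: "\<bar>f' (x(i := v)) - f' x\<bar> \<le> M * \<bar>u - x i\<bar>" if v: "v \<in> S" for v
  proof -
   have "norm (f' (x(i := v)) - f' (x(i := x i))) \<le> M * norm (v - x i)"
   proof (rule field_differentiable_bound[where S = S and f' = "\<lambda>v. f'' (x(i := v))"])
    show "norm (f'' (x(i := w))) \<le> M" if "w \<in> S" for w using M(2)[of "x(i := w)"] upd_D[OF x i] S that by auto
    show "((\<lambda>v. f' (x(i := v))) has_real_derivative f'' (x(i := w))) (at w within S)" if "w \<in> S" for w using d2[OF that] .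
   qed (use v in \<open>auto simp: S_def\<close>)
   moreover have "\<bar>v - x i\<bar> \<le> \<bar>u - x i\<bar>" using v by (auto simp: S_def closed_segment_eq_real_ivl split: if_splits)
   ultimately show ?thesis using M(1) mult_left_mono[of "\<bar>v - x i\<bar>" "\<bar>u - x i\<bar>" M] by simp
  qed
  have "norm ((f (x(i := u)) - f' x * u) - (f (x(i := x i)) - f' x * x i)) \<le> (M * \<bar>u - x i\<bar>) * norm (u - x i)"
  proof (rule field_differentiable_bound[where S = S and f' = "\<lambda>v. f' (x(i := v)) - f' x"])
   show "((\<lambda>v. f (x(i := v)) - f' x * v) has_real_derivative f' (x(i := v)) - f' x) (at v within S)" if "v \<in> S" for v
    using d1[OF that] by (auto intro!: derivative_eq_intros)
  qed (use b2 in \<open>auto simp: S_def\<close>)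
  then show ?thesis by (simp add: algebra_simps power2_eq_square)
 qed
 have key: "\<bar>f' x\<bar> * h \<le> C * rho K x ^ P + C * (rho K x + h) ^ P + M * h\<^sup>2"
  if x: "x \<in> D" and h: "0 < h" "h \<le> L" and C: "C \<ge> 0" "\<And>x. x \<in> D ==> \<bar>f x\<bar> \<le> C * rho K x ^ P" for x h C and P :: nat
 proof -
  \<comment> \<open>One of the two directions stays in the box because \<open>h\<close> is at most
    half its length in that coordinate.\<close>
  obtain u where u: "u \<in> {lo i..hi i}" "\<bar>u - x i\<bar> = h"
  proof (cases "x i + h \<le> hi i")
   case True then show ?thesis using that[of "x i + h"] x i h by (auto simp: D_def)
  next
   case False
   then have "lo i \<le> x i - h" using h x i unfolding L_def D_def by (auto simp: field_simps)
   then show ?thesis using that[of "x i - h"] x i h by (auto simp: D_def)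
  qed
  have uD: "x(i := u) \<in> D" using u upd_D[OF x i] by auto
  have "\<bar>f' x\<bar> * h = \<bar>f' x * (u - x i)\<bar>" using u(2) by (simp add: abs_mult)
  also have "\<dots> \<le> \<bar>f (x(i := u))\<bar> + \<bar>f x\<bar> + M * (u - x i)\<^sup>2" using taylor[OF x u(1)] by linarith
  also have "(u - x i)\<^sup>2 = h\<^sup>2" using u(2) by (metis power2_abs)
  also have "\<bar>f (x(i := u))\<bar> \<le> C * (rho K x + h) ^ P"
  proof -
   have "rho K (x(i := u)) ^ P \<le> (rho K x + h) ^ P" using rho_upd[OF K, of x i u] u(2) rho_nonneg[OF K uD] by (intro power_mono) auto
   then show ?thesis using C(2)[OF uD] mult_left_mono[OF _ C(1)] by fastforce
  qed
  finally show ?thesis using C(2)[OF x] by linarith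
 qed
 \<comment> \<open>On the stratum the estimate with \<open>P = 2\<close> holds for all small
   \<open>h\<close> and has a right-hand side quadratic in \<open>h\<close>, which forces the
   derivative to be 0.\<close>
 have zero: "f' x = 0" if x: "x \<in> D" "rho K x = 0" for x
 proof -
  obtain C where C: "C \<ge> 0" "\<And>x. x \<in> D ==> \<bar>f x\<bar> \<le> C * rho K x ^ 2" using decayE[OF f(2), of 2] by blast
  have "\<bar>f' x\<bar> \<le> (C + M) * h" if "0 < h" "h \<le> L" for h
  proof -
   have "\<bar>f' x\<bar> * h \<le> ((C + M) * h) * h" using key[OF x(1) that C] x(2) by (simp add: power2_eq_square algebra_simps)
   then show ?thesis using that by (simp add: mult_le_cancel_right)
  qed
  note le = this
  show ?thesis
  proof (rule ccontr)
   assume "f' x \<noteq> 0"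
   define h where "h = min L (\<bar>f' x\<bar> / (2 * (C + M + 1)))"
   have pos: "0 < h" "h \<le> L" using L \<open>f' x \<noteq> 0\<close> C M by (auto simp: h_def)
   have "(C + M) * h \<le> (C + M + 1) * (\<bar>f' x\<bar> / (2 * (C + M + 1)))" using C M pos by (intro mult_mono) (auto simp: h_def)
   also have "\<dots> = \<bar>f' x\<bar> / 2" using C M by (simp add: field_simps)
   finally show False using le[OF pos] \<open>f' x \<noteq> 0\<close> by simp
  qed
 qed
 \<comment> \<open>For a step \<open>h\<close> of size \<open>rho ^ Suc N\<close>, both
   \<open>rho ^ P / h\<close> and \<open>h\<close> are then of order \<open>Suc N\<close> in
   \<open>rho\<close>.\<close>
 define P where "P = 2 * N + 2"
 obtain C where C: "C \<ge> 0" "\<And>x. x \<in> D ==> \<bar>f x\<bar> \<le> C * rho K x ^ P" using decayE[OF f(2), of P] by blast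
 \<comment> \<open>\<open>R\<close> bounds \<open>rho\<close>, so \<open>h = c * rho ^ Suc N\<close>
   is at most \<open>L\<close>, hence an admissible step, and at most \<open>rho\<close>, hence
   \<open>rho + h\<close> is at most \<open>2 * rho\<close>.\<close>
 define c where "c = min L 1 / R ^ Suc N"
 have RN: "R ^ Suc N \<ge> 1" using R(1) by (rule one_le_power)
 have c: "c > 0" "c \<le> 1" "c * R ^ Suc N \<le> L" "c * R ^ Suc N \<le> 1"
 proof -
  show "c > 0" using L RN by (simp add: c_def)
  have e: "c * R ^ Suc N = min L 1" using R(1) by (simp add: c_def)
  then show "c * R ^ Suc N \<le> L" "c * R ^ Suc N \<le> 1" by auto
  have "c * 1 \<le> c * R ^ Suc N" using \<open>c > 0\<close> RN by (intro mult_left_mono) auto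
  then show "c \<le> 1" using e by simp
 qed
 define C' where "C' = (C + C * 2 ^ P) / c + M * c"
 have "\<bar>f' x\<bar> \<le> C' * rho K x ^ Suc N" if x: "x \<in> D" for x
 proof (cases "rho K x = 0")
  case True then show ?thesis using zero[OF x True] by simp
 next
  case False
  define r where "r = rho K x"
  have r: "0 < r" "r \<le> R" using False rho_nonneg[OF K x] R(2)[OF x] by (auto simp: r_def)
  define h where "h = c * r ^ Suc N"
  have rN: "r ^ Suc N \<le> R ^ Suc N" using r by (intro power_mono) auto
  have h0: "0 < h" using c r by (simp add: h_def)
  have hL: "h \<le> L" using mult_left_mono[OF rN, of c] c unfolding h_def by linarith
  have hr: "h \<le> r"
  proof -
   have "c * r ^ N \<le> c * R ^ N" using c r by (intro mult_left_mono power_mono) auto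
   also have "\<dots> \<le> c * R ^ Suc N" using c R(1) by (intro mult_left_mono power_increasing) auto
   finally have "c * r ^ N \<le> 1" using c by linarith
   then have "(c * r ^ N) * r \<le> 1 * r" using r by (intro mult_right_mono) auto
   then show ?thesis by (simp add: h_def mult_ac)
  qed
  have "\<bar>f' x\<bar> * h \<le> C * r ^ P + C * (r + h) ^ P + M * h\<^sup>2" using key[OF x h0 hL C] by (simp add: r_def)
  also have "(r + h) ^ P \<le> (2 * r) ^ P" using hr h0 r by (intro power_mono) auto
  then have "C * r ^ P + C * (r + h) ^ P + M * h\<^sup>2 \<le> C * r ^ P + C * (2 * r) ^ P + M * h\<^sup>2" using C(1) by (simp add: mult_left_mono)
  also have "\<dots> = (C' * r ^ Suc N) * h"
  proof -
   have "r ^ P = r ^ Suc N * r ^ Suc N" unfolding P_def by (simp add: power_add[symmetric] mult_2)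
   then show ?thesis using c(1) by (simp add: C'_def h_def power_mult_distrib power2_eq_square field_simps)
  qed
  finally show ?thesis using h0 by (simp add: r_def mult_le_cancel_right)
 qed
 moreover have "C' \<ge> 0" unfolding C'_def using C M c by simp
 ultimately show "\<exists>C\<ge>0. \<forall>x\<in>D. \<bar>f' x\<bar> \<le> C * rho K x ^ Suc N" by blast
qed

text \<open>Interpolation passes decay to the first partials; iterating it covers all
  orders.\<close>

lemma smooth_with_flat:
 assumes K: "K \<subseteq> {..<n}" and f: "smooth n D f" "decay K f"
 shows "partials (flat K) n D k f" using f
proof (induction k arbitrary: f)
 case 0 then show ?case by (simp add: flat_def smooth_continuous)
next
 case (Suc k)
 show ?case
 proof (rule partials_SucI[where P = "flat K"])
  show "flat K f" using Suc.prems by (simp add: flat_def smooth_continuous)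
  fix i assume i: "i < n"
  obtain f' where f': "has_partial i D f f'" "smooth n D f'" using smooth_partial[OF slices_fat_D Suc.prems(1) i] .
  show "\<exists>f'. has_partial i D f f' \<and> partials (flat K) n D k f'" using Suc.IH[OF f'(2) decay_partial[OF K i Suc.prems f']] f'(1) by blast
 qed
qed

end

section \<open>Multiplication of flat functions by singular factors\<close>

context corner_box
begin

lemma off_Int: "off K = D \<inter> {x. 0 < rho K x}" by (auto simp: off_def)

lemma open_rho: "open {x. 0 < rho K x}" by (intro open_Collect_less continuous_on_const continuous_rho)

lemma decay_zero: "decay K f ==> x \<in> D ==> rho K x = 0 ==> f x = 0" by (rule decayE[of K f 1]) (fastforce+)

text \<open>Decay of order \<open>N + L\<close> pays for growth of order \<open>L\<close>. On the
  stratum \<open>f\<close> is 0, so the product is 0 whatever value \<open>g\<close> takes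
  there.\<close>

lemma decay_mult_tame:
 assumes K: "K \<subseteq> {..<n}" and f: "decay K f" and g: "tame K g"
 shows "decay K (\<lambda>x. f x * g x)" unfolding decay_def
proof
 fix N :: nat
 obtain L C where C: "C \<ge> 0" "\<And>x. x \<in> off K ==> \<bar>g x\<bar> * rho K x ^ L \<le> C" using g unfolding tame_def by blast
 obtain C' where C': "C' \<ge> 0" "\<And>x. x \<in> D ==> \<bar>f x\<bar> \<le> C' * rho K x ^ (N + L)" using decayE[OF f] by blast
 have "\<bar>f x * g x\<bar> \<le> (C' * C) * rho K x ^ N" if x: "x \<in> D" for x
 proof (cases "rho K x = 0")
  case True then show ?thesis using decay_zero[OF f x True] C C' by simp
 next
  case False
  then have xo: "x \<in> off K" "0 < rho K x" using x rho_nonneg[OF K x] by (auto simp: off_def)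
  have "\<bar>f x * g x\<bar> \<le> C' * rho K x ^ (N + L) * \<bar>g x\<bar>" using C'(2)[OF x] by (simp add: abs_mult mult_right_mono)
  also have "\<dots> = C' * rho K x ^ N * (\<bar>g x\<bar> * rho K x ^ L)" by (simp add: power_add mult_ac)
  also have "\<dots> \<le> C' * rho K x ^ N * C" using C(2)[OF xo(1)] C' xo by (intro mult_left_mono) auto
  finally show ?thesis by (simp add: mult_ac)
 qed
 then show "\<exists>C\<ge>0. \<forall>x\<in>D. \<bar>f x * g x\<bar> \<le> C * rho K x ^ N" using C C' by (intro exI[of _ "C' * C"]) auto
qed

lemma decay_isCont:
 assumes K: "K \<subseteq> {..<n}" and f: "decay K f" and x: "x \<in> D" "rho K x = 0"
 shows "continuous (at x within D) f"
proof -
 obtain C where C: "C \<ge> 0" "\<And>x. x \<in> D ==> \<bar>f x\<bar> \<le> C * rho K x" using decayE[OF f, of 1] by auto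
 have "(f \<longlongrightarrow> 0) (at x within D)"
 proof (rule Lim_null_comparison)
  have "(rho K \<longlongrightarrow> 0) (at x within D)" using continuous_rho[of D K] x by (auto simp: continuous_on_def)
  then show "((\<lambda>y. C * rho K y) \<longlongrightarrow> 0) (at x within D)" by (rule tendsto_mult_right_zero)
  show "\<forall>\<^sub>F y in at x within D. norm (f y) \<le> C * rho K y" unfolding eventually_at_filter using C(2) by (auto intro: always_eventually)
 qed
 then show ?thesis using decay_zero[OF f x] by (simp add: continuous_within)
qed

lemma flat_mult_tame:
 assumes K: "K \<subseteq> {..<n}" and f: "flat K f" and g: "tame K g"
 shows "flat K (\<lambda>x. f x * g x)"
proof -
 have d: "decay K (\<lambda>x. f x * g x)" using decay_mult_tame[OF K] f g by (simp add: flat_def)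
 have "continuous (at x within D) (\<lambda>x. f x * g x)" if x: "x \<in> D" for x
 proof (cases "rho K x = 0")
  case True then show ?thesis by (rule decay_isCont[OF K d x])
 next
  case False
  then have xo: "x \<in> off K" using x rho_nonneg[OF K x] by (auto simp: off_def)
  have "continuous_on (off K) (\<lambda>x. f x * g x)"
   using f g unfolding flat_def tame_def by (intro continuous_on_mult) (auto intro: continuous_on_subset simp: off_def)
  then have "continuous (at x within off K) (\<lambda>x. f x * g x)" using xo by (simp add: continuous_on_eq_continuous_within)
  moreover have "at x within off K = at x within D" using at_within_nhd[OF _ open_rho, of x K "off K" D] xo by (auto simp: off_def)
  ultimately show ?thesis by simp
 qed
 then show ?thesis using d by (simp add: flat_def continuous_on_eq_continuous_within)
qed

text \<open>Off the stratum this is the Leibniz rule. On it the product is bounded by a multiple of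
  \<open>rho\<close> squared, and moving one coordinate by a given amount raises \<open>rho\<close>
  at most by that amount, so the difference quotient tends to 0; the claimed derivative is 0 there
  because \<open>f\<close> and \<open>f'\<close> are.\<close>

lemma has_partial_flat_mult:
 assumes K: "K \<subseteq> {..<n}" and i: "i < n" and f: "flat K f" "flat K f'" and g: "tame K g"
  and df: "has_partial i D f f'" and dg: "has_partial i (off K) g g'"
 shows "has_partial i D (\<lambda>x. f x * g x) (\<lambda>x. f x * g' x + f' x * g x)" unfolding has_partial_def
proof
 fix x assume x: "x \<in> D"
 show "((\<lambda>u. f (x(i := u)) * g (x(i := u))) has_real_derivative f x * g' x + f' x * g x) (at (x i) within {u. x(i := u) \<in> D})"
 proof (cases "rho K x = 0")
  case False
  then have xo: "x \<in> off K" "x \<in> {x. 0 < rho K x}" using x rho_nonneg[OF K x] by (auto simp: off_def)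
  have "has_partial i (off K) f f'" by (rule has_partial_subset[OF df]) (auto simp: off_def)
  from has_partial_mult[OF this dg] xo(1)
  have "((\<lambda>u. f (x(i := u)) * g (x(i := u))) has_real_derivative f x * g' x + f' x * g x) (at (x i) within {u. x(i := u) \<in> off K})"
   unfolding has_partial_def by blast
  then show ?thesis unfolding off_Int using at_slice_open[OF open_rho xo(2), of i D] by simp
 next
  case True
  have d: "decay K (\<lambda>x. f x * g x)" using decay_mult_tame[OF K] f g by (simp add: flat_def)
  obtain C where C: "C \<ge> 0" "\<And>x. x \<in> D ==> \<bar>f x * g x\<bar> \<le> C * rho K x ^ 2" using decayE[OF d, of 2] by blast
  have z: "f x = 0" "f' x = 0" using f decay_zero x True by (auto simp: flat_def)
  have "((\<lambda>u. (f (x(i := u)) * g (x(i := u)) - f (x(i := x i)) * g (x(i := x i))) / (u - x i)) \<longlongrightarrow> 0) (at (x i) within {u. x(i := u) \<in> D})"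
  proof (rule Lim_null_comparison)
   show "((\<lambda>u. C * \<bar>u - x i\<bar>) \<longlongrightarrow> 0) (at (x i) within {u. x(i := u) \<in> D})" by (rule tendsto_mult_right_zero) (auto intro!: tendsto_eq_intros)
   have "norm ((f (x(i := u)) * g (x(i := u)) - f (x(i := x i)) * g (x(i := x i))) / (u - x i)) \<le> C * \<bar>u - x i\<bar>"
    if u: "x(i := u) \<in> D" "u \<noteq> x i" for u
   proof -
    have "rho K (x(i := u)) ^ 2 \<le> \<bar>u - x i\<bar> ^ 2" using rho_upd[OF K, of x i u] True rho_nonneg[OF K u(1)] by (intro power_mono) auto
    then have "\<bar>f (x(i := u)) * g (x(i := u))\<bar> \<le> C * \<bar>u - x i\<bar> ^ 2" using C(2)[OF u(1)] mult_left_mono[OF _ C(1)] by fastforce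
    then have "\<bar>f (x(i := u)) * g (x(i := u))\<bar> / \<bar>u - x i\<bar> \<le> C * \<bar>u - x i\<bar>"
     using u(2) by (simp add: divide_le_eq power2_eq_square mult.assoc)
    then show ?thesis using z by (simp add: abs_divide)
   qed
   then show "\<forall>\<^sub>F u in at (x i) within {u. x(i := u) \<in> D}. norm ((f (x(i := u)) * g (x(i := u)) - f (x(i := x i)) * g (x(i := x i))) / (u - x i)) \<le> C * \<bar>u - x i\<bar>"
    unfolding eventually_at_filter by (auto intro!: always_eventually)
  qed
  then show ?thesis using z by (simp add: has_field_derivative_iff)
 qed
qed

lemma partials_flat_mult:
 assumes K: "K \<subseteq> {..<n}"
 shows "partials (flat K) n D k f ==> partials (tame K) n (off K) k g ==>
  partials (flat K) n D k (\<lambda>x. f x * g x)"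
proof (induction k arbitrary: f g)
 case 0 then show ?case using flat_mult_tame[OF K] by simp
next
 case (Suc k)
 have fg: "flat K f" "tame K g" using Suc.prems by simp_all
 show ?case
 proof (rule partials_SucI[where P = "flat K"])
  show "flat K (\<lambda>x. f x * g x)" by (rule flat_mult_tame[OF K fg])
  fix i assume i: "i < n"
  obtain f' where f': "has_partial i D f f'" "partials (flat K) n D k f'" by (rule partials_SucE[OF Suc.prems(1) i])
  obtain g' where g': "has_partial i (off K) g g'" "partials (tame K) n (off K) k g'" by (rule partials_SucE[OF Suc.prems(2) i])
  have "partials (flat K) n D k (\<lambda>x. f x * g' x + f' x * g x)"
   by (intro partials_add[OF flat_closed_add] Suc.IH f'(2) g'(2) partials_SucD[OF Suc.prems(1)]
     partials_SucD[OF Suc.prems(2)])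
  moreover have "has_partial i D (\<lambda>x. f x * g x) (\<lambda>x. f x * g' x + f' x * g x)"
   by (rule has_partial_flat_mult[OF K i fg(1) partials_imp[OF f'(2)] fg(2) f'(1) g'(1)])
  ultimately show "\<exists>h. has_partial i D (\<lambda>x. f x * g x) h \<and> partials (flat K) n D k h" by blast
 qed
qed

text \<open>The source of every smooth function below that contains a logarithm or a cutoff: all
  partials of the product are again products of a flat and a tame function, and these extend
  continuously over the stratum.\<close>

lemma smooth_flat_mult:
 assumes K: "K \<subseteq> {..<n}" and f: "smooth n D f" "decay K f" and g: "smooth_with (tame K) n (off K) g"
 shows "smooth n D (\<lambda>x. f x * g x)" "decay K (\<lambda>x. f x * g x)"
proof -
 have it: "partials (flat K) n D k (\<lambda>x. f x * g x)" for k
  using partials_flat_mult[OF K smooth_with_flat[OF K f]] g unfolding smooth_with_def by blast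
 have imp: "flat K f ==> continuous_on D f" for f by (simp add: flat_def)
 show "smooth n D (\<lambda>x. f x * g x)"
  unfolding smooth_with_def using partials_mono[where P = "flat K" and Q = "continuous_on D", OF it imp] by simp
 show "decay K (\<lambda>x. f x * g x)" using it[of 0] by (simp add: flat_def)
qed

lemma tameI: "continuous_on (off K) f ==> C \<ge> 0 ==> (\<And>x. x \<in> off K ==> \<bar>f x\<bar> * rho K x ^ N \<le> C) ==> tame K f" unfolding tame_def by blast

lemma tame_closed_add:
 assumes K: "K \<subseteq> {..<n}" shows "closed_add (tame K)" unfolding closed_add_def
proof (intro allI impI)
 fix f g assume f: "tame K f" and g: "tame K g"
 obtain N C where C: "C \<ge> 0" "\<And>x. x \<in> off K ==> \<bar>f x\<bar> * rho K x ^ N \<le> C" using f unfolding tame_def by blast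
 obtain N' C' where C': "C' \<ge> 0" "\<And>x. x \<in> off K ==> \<bar>g x\<bar> * rho K x ^ N' \<le> C'" using g unfolding tame_def by blast
 obtain R where R: "R \<ge> 1" "\<And>x. x \<in> D ==> rho K x \<le> R" using rho_bound[of K] by blast
 show "tame K (\<lambda>x. f x + g x)"
 proof (rule tameI)
  show "continuous_on (off K) (\<lambda>x. f x + g x)" using f g by (auto simp: tame_def intro: continuous_on_add)
  show "0 \<le> C * R ^ N' + C' * R ^ N" using C C' R by simp
  fix x assume x: "x \<in> off K"
  have r: "0 < rho K x" "rho K x \<le> R" using x R by (auto simp: off_def)
  have rp: "rho K x ^ l \<le> R ^ l" for l using r by (intro power_mono) auto
  have "\<bar>f x + g x\<bar> * rho K x ^ (N + N') \<le> (\<bar>f x\<bar> + \<bar>g x\<bar>) * rho K x ^ (N + N')" using r by (intro mult_right_mono) auto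
  also have "\<dots> = (\<bar>f x\<bar> * rho K x ^ N) * rho K x ^ N' + (\<bar>g x\<bar> * rho K x ^ N') * rho K x ^ N" by (simp add: power_add algebra_simps)
  also have "\<dots> \<le> C * R ^ N' + C' * R ^ N" using C C' rp x r by (intro add_mono mult_mono) auto
  finally show "\<bar>f x + g x\<bar> * rho K x ^ (N + N') \<le> C * R ^ N' + C' * R ^ N" .
 qed
qed

lemma tame_closed_mult:
 assumes K: "K \<subseteq> {..<n}" shows "closed_mult (tame K) (tame K) (tame K)" unfolding closed_mult_def
proof (intro allI impI)
 fix f g assume f: "tame K f" and g: "tame K g"
 obtain N C where C: "C \<ge> 0" "\<And>x. x \<in> off K ==> \<bar>f x\<bar> * rho K x ^ N \<le> C" using f unfolding tame_def by blast
 obtain N' C' where C': "C' \<ge> 0" "\<And>x. x \<in> off K ==> \<bar>g x\<bar> * rho K x ^ N' \<le> C'" using g unfolding tame_def by blast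
 show "tame K (\<lambda>x. f x * g x)"
 proof (rule tameI)
  show "continuous_on (off K) (\<lambda>x. f x * g x)" using f g by (auto simp: tame_def intro: continuous_on_mult)
  show "0 \<le> C * C'" using C C' by simp
  fix x assume x: "x \<in> off K"
  have r: "0 < rho K x" using x by (auto simp: off_def)
  have "\<bar>f x * g x\<bar> * rho K x ^ (N + N') = (\<bar>f x\<bar> * rho K x ^ N) * (\<bar>g x\<bar> * rho K x ^ N')" by (simp add: abs_mult power_add mult_ac)
  also have "\<dots> \<le> C * C'" using C C' x r by (intro mult_mono) auto
  finally show "\<bar>f x * g x\<bar> * rho K x ^ (N + N') \<le> C * C'" .
 qed
qed

lemma tame_bounded:
 assumes "continuous_on (off K) f" "\<And>x. x \<in> off K ==> \<bar>f x\<bar> \<le> C"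
 shows "tame K f" by (rule tameI[where C = "max C 0" and N = 0]) (use assms in fastforce)+

lemma tame_const: "tame K (\<lambda>x. c)" by (rule tame_bounded[where C = "\<bar>c\<bar>"]) auto

lemma smooth_imp_tame: "smooth n D f ==> smooth_with (tame K) n (off K) f" unfolding smooth_with_def
proof
 fix k assume f: "\<forall>k. partials (continuous_on D) n D k f"
 have imp: "continuous_on D g ==> tame K g" for g
 proof -
  assume g: "continuous_on D g"
  obtain B where "\<And>x. x \<in> D ==> \<bar>g x\<bar> \<le> B" using bounded_D[OF g] by blast
  then show "tame K g" using g by (intro tame_bounded) (auto simp: off_def intro: continuous_on_subset)
 qed
 show "partials (tame K) n (off K) k f" by (rule partials_subset[OF f[rule_format] _ imp]) (auto simp: off_def)
qed

text \<open>The basic singular factor: it is the derivative of log x_a when \<open>K\<close> is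
  \<open>{a}\<close>, and it forms the ratios x_a / rho on which the cutoffs depend.\<close>

lemma tame_inverse_rho: "smooth_with (tame K) n (off K) (\<lambda>x. 1 / rho K x)" if K: "K \<subseteq> {..<n}" unfolding smooth_with_def
proof
 fix k
 show "partials (tame K) n (off K) k (\<lambda>x. 1 / rho K x)"
 proof (rule partials_inverse[where P = "tame K", OF tame_closed_mult[OF K] tame_closed_add[OF K] tame_const])
  have c: "continuous_on (off K) (\<lambda>x. 1 / rho K x)" by (intro continuous_on_divide continuous_on_const continuous_rho) (auto simp: off_def)
  show "tame K (\<lambda>x. 1 / rho K x)" by (rule tameI[OF c, where C = 1 and N = 1]) (auto simp: off_def)
  show "rho K x \<noteq> 0" if "x \<in> off K" for x using that by (auto simp: off_def)
  have "smooth n D (rho K)" unfolding rho_def[abs_def] by (intro smooth_sum smooth_coord)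
  then show "partials (tame K) n (off K) k (rho K)" using smooth_imp_tame unfolding smooth_with_def by blast
 qed
qed

text \<open>The product of x_a with its logarithm is bounded on the box, and the first partial is
  \<open>1 / rho {a} x\<close>, already tame together with all its partials.\<close>

lemma tame_ln: "smooth_with (tame {a}) n (off {a}) (\<lambda>x. ln (x a))" if a: "a < n"
proof -
 have K: "{a} \<subseteq> {..<n}" using a by simp
 have rho: "rho {a} x = x a" for x by (simp add: rho_def)
 have pos: "0 < x a" if "x \<in> off {a}" for x using that by (simp add: off_def rho)
 obtain R where R: "R \<ge> 1" "\<And>x. x \<in> D ==> rho {a} x \<le> R" using rho_bound[of "{a}"] by blast
 have t: "tame {a} (\<lambda>x. ln (x a))"
 proof (rule tameI[where N = 1 and C = "R * R + 1"])
  show "continuous_on (off {a}) (\<lambda>x. ln (x a))" by (intro continuous_on_ln continuous_on_coord) (use pos in force)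
  fix x assume x: "x \<in> off {a}"
  have xa: "0 < x a" "x a \<le> R" using pos[OF x] R(2)[of x] x by (auto simp: rho off_def)
  have "ln (x a) * x a \<le> R * R" using ln_le_minus_one[OF xa(1)] xa R(1) by (intro mult_mono) auto
  moreover have "- ln (x a) * x a \<le> 1"
  proof -
   have "ln (1 / x a) \<le> 1 / x a - 1" using xa by (intro ln_le_minus_one) simp
   then have "- ln (x a) \<le> 1 / x a" using xa by (simp add: ln_div)
   then have "- ln (x a) * x a \<le> 1 / x a * x a" using xa by (intro mult_right_mono) auto
   then show ?thesis using xa by simp
  qed
  moreover have "0 \<le> R * R" by simp
  ultimately have "\<bar>ln (x a) * x a\<bar> \<le> R * R + 1" by linarith
  then have "\<bar>ln (x a)\<bar> * x a \<le> R * R + 1" using xa by (simp add: abs_mult)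
  then show "\<bar>ln (x a)\<bar> * rho {a} x ^ 1 \<le> R * R + 1" by (simp add: rho)
 qed (use R in auto)
 show ?thesis
 proof (rule smooth_withI[where P = "tame {a}"])
  show "tame {a} (\<lambda>x. ln (x a))" by (rule t)
  fix i assume "i < n"
  show "\<exists>f'. has_partial i (off {a}) (\<lambda>x. ln (x a)) f' \<and> smooth_with (tame {a}) n (off {a}) f'"
  proof (cases "i = a")
   case True
   have "has_partial i (off {a}) (\<lambda>x. ln (x a)) (\<lambda>x. 1 / rho {a} x)"
    unfolding has_partial_def using True pos by (auto intro!: derivative_eq_intros simp: rho)
   then show ?thesis using tame_inverse_rho[OF K] by blast
  next
   case False
   then have "has_partial i (off {a}) (\<lambda>x. ln (x a)) (\<lambda>x. 0)" by (auto simp: has_partial_def)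
   moreover have "smooth_with (tame {a}) n (off {a}) (\<lambda>x. 0)"
    unfolding smooth_with_def using partials_const[where P = "tame {a}", OF tame_const tame_const] by simp
   ultimately show ?thesis by blast
  qed
 qed
qed

text \<open>Provides the smooth side of a relation of the second kind. One logarithm is absorbed at
  a time, since the product decays again; where x_a = 0 the product is 0 irrespective of the value
  of \<open>ln\<close> at 0.\<close>

lemma flat_mult_ln_power:
 assumes a: "a < n" and f: "smooth n D f" "decay {a} f"
 shows "smooth n D (\<lambda>x. f x * ln (x a) ^ m)" "decay {a} (\<lambda>x. f x * ln (x a) ^ m)"
proof -
 have "smooth n D (\<lambda>x. f x * ln (x a) ^ m) \<and> decay {a} (\<lambda>x. f x * ln (x a) ^ m)"
 proof (induction m)
  case (Suc m)
  have "(\<lambda>x. f x * ln (x a) ^ Suc m) = (\<lambda>x. (f x * ln (x a) ^ m) * ln (x a))" by (simp add: mult_ac)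
  then show ?case using smooth_flat_mult[OF _ _ _ tame_ln[OF a], of "\<lambda>x. f x * ln (x a) ^ m"] Suc a by simp
 qed (use f in simp)
 then show "smooth n D (\<lambda>x. f x * ln (x a) ^ m)" "decay {a} (\<lambda>x. f x * ln (x a) ^ m)" by auto
qed

lemma flat_exp_bounded: obtains B where "B \<ge> 0" "\<And>y. 0 \<le> y ==> y \<le> 1 ==> \<bar>flat_exp m y\<bar> \<le> B"
proof -
 have "bounded (flat_exp m ` {0..1})" by (intro compact_imp_bounded compact_continuous_image continuous_on_flat_exp) auto
 then obtain B where "\<forall>y\<in>{0..1}. \<bar>flat_exp m y\<bar> \<le> B" unfolding bounded_iff by auto
 then show ?thesis by (intro that[of "max B 0"]) (auto intro: order_trans[OF _ max.cobounded1])
qed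

text \<open>The partition of unity: the cutoff for \<open>a\<close> is a function of degree \<open>0\<close> in the coordinates of
 \<open>K\<close> which vanishes to infinite order along the hyperplane \<open>x a = 0\<close> relative to the distance from
 the stratum where all of these coordinates vanish.\<close>

definition weight :: "nat set \<Rightarrow> nat \<Rightarrow> (nat \<Rightarrow> real) \<Rightarrow> real" where
 "weight K a x = flat_exp 0 (x a * (1 / rho K x))"

definition cutoff :: "nat set \<Rightarrow> nat \<Rightarrow> (nat \<Rightarrow> real) \<Rightarrow> real" where
 "cutoff K a x = weight K a x * (1 / (\<Sum>b\<in>K. weight K b x))"

lemma ratio_bounds:
 assumes K: "K \<subseteq> {..<n}" and x: "x \<in> off K" and a: "a \<in> K"
 shows "0 \<le> x a * (1 / rho K x)" "x a * (1 / rho K x) \<le> 1"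
proof -
 have xD: "x \<in> D" "0 < rho K x" using x by (auto simp: off_def)
 have fin: "finite K" using K finite_subset by blast
 have "x a \<le> rho K x" unfolding rho_def using D_nonneg[OF xD(1)] K fin a by (intro member_le_sum) auto
 then show "x a * (1 / rho K x) \<le> 1" using xD by simp
 show "0 \<le> x a * (1 / rho K x)" using D_nonneg[OF xD(1), of a] K a xD by auto
qed

lemma weight_nonneg: "0 \<le> weight K a x" by (simp add: weight_def flat_exp_def)

text \<open>Some coordinate in \<open>K\<close> is at least the average
  \<open>rho K x / card K\<close>, and its weight alone is at least
  \<open>exp (- real (card K))\<close>.\<close>

lemma sum_weight_lower:
 assumes K: "K \<subseteq> {..<n}" and x: "x \<in> off K"
 shows "exp (- real (card K)) \<le> (\<Sum>b\<in>K. weight K b x)"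
proof -
 have xD: "x \<in> D" "0 < rho K x" using x by (auto simp: off_def)
 have fin: "finite K" using K finite_subset by blast
 have ne: "K \<noteq> {}" using xD by (auto simp: rho_def)
 have "\<exists>b\<in>K. rho K x \<le> real (card K) * x b"
 proof (rule ccontr)
  assume "\<not> ?thesis"
  then have "real (card K) * x b < rho K x" if "b \<in> K" for b using that by force
  then have "(\<Sum>b\<in>K. real (card K) * x b) < (\<Sum>b\<in>K. rho K x)" using fin ne by (intro sum_strict_mono) auto
  then show False by (simp add: rho_def sum_distrib_left)
 qed
 then obtain b where b: "b \<in> K" "rho K x \<le> real (card K) * x b" by blast
 have xb: "0 < x b" using b(2) xD(2) by (smt (verit) mult_nonneg_nonpos of_nat_0_le_iff)
 have "rho K x / x b \<le> real (card K)" using b xb by (simp add: divide_le_eq)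
 then have "exp (- real (card K)) \<le> weight K b x" using xb xD by (simp add: weight_def flat_exp_def)
 also have "\<dots> \<le> (\<Sum>b\<in>K. weight K b x)" using fin b weight_nonneg by (intro member_le_sum) auto
 finally show ?thesis .
qed

lemma sum_cutoff:
 assumes K: "K \<subseteq> {..<n}" and x: "x \<in> off K" shows "(\<Sum>a\<in>K. cutoff K a x) = 1"
proof -
 have "0 < (\<Sum>b\<in>K. weight K b x)" using sum_weight_lower[OF assms] exp_gt_zero[of "- real (card K)"] by linarith
 then show ?thesis unfolding cutoff_def by (simp add: sum_divide_distrib[symmetric])
qed

text \<open>The ratios x_a / rho lie in [0, 1], where every \<open>flat_exp m\<close> is bounded, so
  the weights are tame with all their partials. The lower bound on their sum takes care of the
  reciprocal.\<close>

lemma tame_cutoff: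
 assumes K: "K \<subseteq> {..<n}" and a: "a \<in> K"
 shows "smooth_with (tame K) n (off K) (cutoff K a)" unfolding smooth_with_def
proof
 fix k
 have w: "partials (tame K) n (off K) k (weight K b)" if b: "b \<in> K" for b k
 proof -
  have y: "partials (tame K) n (off K) k (\<lambda>x. x b * (1 / rho K x))" by (rule partials_mult[OF tame_closed_mult[OF K] tame_closed_add[OF K]
      smooth_imp_tame[OF smooth_coord[where j = b], unfolded smooth_with_def, rule_format]
      tame_inverse_rho[OF K, unfolded smooth_with_def, rule_format]])
  have c: "continuous_on (off K) (\<lambda>x. x b * (1 / rho K x))"
   by (intro continuous_on_mult continuous_on_coord continuous_on_divide continuous_on_const continuous_rho) (auto simp: off_def)
  have t: "tame K (\<lambda>x. flat_exp m (x b * (1 / rho K x)))" for m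
  proof -
   obtain B where B: "\<And>y. 0 \<le> y ==> y \<le> 1 ==> \<bar>flat_exp m y\<bar> \<le> B" using flat_exp_bounded[of m] by blast
   show ?thesis by (rule tame_bounded[OF continuous_on_compose2[OF continuous_on_flat_exp c subset_UNIV], where C = B])
     (use B ratio_bounds[OF K _ b] in blast)
  qed
  show ?thesis unfolding weight_def[abs_def] by (rule partials_flat_exp[where P = "tame K" and y = "\<lambda>x. x b * (1 / rho K x)",
      OF tame_closed_mult[OF K] tame_closed_add[OF K] tame_const t y])
 qed
 have "partials (tame K) n (off K) k (\<lambda>x. \<Sum>b\<in>L. weight K b x)" if "L \<subseteq> K" for L
 proof -
  have "finite L" by (rule finite_subset[OF that finite_subset[OF K finite_lessThan]])
  then show ?thesis using that
  proof (induction L rule: finite_induct)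
   case empty
   show ?case unfolding sum.empty by (rule partials_const[where P = "tame K", OF tame_const tame_const])
  next
   case (insert b L)
   then have "b \<in> K" "L \<subseteq> K" by auto
   show ?case unfolding sum.insert[OF insert.hyps] by (rule partials_add[OF tame_closed_add[OF K] w[OF \<open>b \<in> K\<close>] insert.IH[OF \<open>L \<subseteq> K\<close>]])
  qed
 qed
 then have s: "partials (tame K) n (off K) k (\<lambda>x. \<Sum>b\<in>K. weight K b x)" by blast
 have nz: "0 < (\<Sum>b\<in>K. weight K b x)" if "x \<in> off K" for x using sum_weight_lower[OF K that] exp_gt_zero[of "- real (card K)"] by linarith
 have ts: "tame K (\<lambda>x. \<Sum>b\<in>K. weight K b x)" by (rule partials_imp[OF s])
 have "partials (tame K) n (off K) k (\<lambda>x. 1 / (\<Sum>b\<in>K. weight K b x))"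
 proof (rule partials_inverse[where P = "tame K", OF tame_closed_mult[OF K] tame_closed_add[OF K] tame_const])
  show "tame K (\<lambda>x. 1 / (\<Sum>b\<in>K. weight K b x))"
  proof (rule tame_bounded[where C = "exp (real (card K))"])
   show "continuous_on (off K) (\<lambda>x. 1 / (\<Sum>b\<in>K. weight K b x))"
    using ts nz by (intro continuous_on_divide continuous_on_const) (auto simp: tame_def less_imp_neq[symmetric])
   fix x assume x: "x \<in> off K"
   have "1 / (\<Sum>b\<in>K. weight K b x) \<le> 1 / exp (- real (card K))"
    using sum_weight_lower[OF K x] by (intro divide_left_mono) (auto intro!: mult_pos_pos nz x)
   then show "\<bar>1 / (\<Sum>b\<in>K. weight K b x)\<bar> \<le> exp (real (card K))" using nz[OF x] by (simp add: exp_minus field_simps)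
  qed
  show "(\<Sum>b\<in>K. weight K b x) \<noteq> 0" if "x \<in> off K" for x using nz[OF that] by simp
 qed (rule s)
 then show "partials (tame K) n (off K) k (cutoff K a)"
  unfolding cutoff_def[abs_def] by (intro partials_mult[OF tame_closed_mult[OF K] tame_closed_add[OF K] w[OF a]])
qed

text \<open>One kind of vanishing is traded for another. With y = x_a / rho the cutoff is bounded by
  a multiple of y^N, and rho^N y^N = x_a^N; so decay at the corner becomes decay along the whole
  hyperplane x_a = 0.\<close>

lemma decay_cutoff:
 assumes K: "K \<subseteq> {..<n}" and a: "a \<in> K" and f: "decay K f"
 shows "decay {a} (\<lambda>x. f x * cutoff K a x)" unfolding decay_def
proof
 fix N :: nat
 obtain B where B: "B \<ge> 0" "\<And>y. 0 \<le> y ==> y \<le> 1 ==> \<bar>flat_exp N y\<bar> \<le> B" using flat_exp_bounded[of N] by blast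
 obtain C where C: "C \<ge> 0" "\<And>x. x \<in> D ==> \<bar>f x\<bar> \<le> C * rho K x ^ N" using decayE[OF f] by blast
 define E where "E = exp (real (card K))"
 have "\<bar>f x * cutoff K a x\<bar> \<le> (C * B * E) * rho {a} x ^ N" if x: "x \<in> D" for x
 proof (cases "rho K x = 0")
  case True
  have "0 \<le> rho {a} x" using rho_nonneg[of "{a}" x] K a x by auto
  then show ?thesis using decay_zero[OF f x True] C B by (simp add: E_def)
 next
  case False
  then have xo: "x \<in> off K" "0 < rho K x" using x rho_nonneg[OF K x] by (auto simp: off_def)
  define y where "y = x a * (1 / rho K x)"
  have y: "0 \<le> y" "y \<le> 1" using ratio_bounds[OF K xo(1) a] by (auto simp: y_def)
  have "weight K a x = flat_exp 0 y" by (simp only: weight_def y_def)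
  \<comment> \<open>The exponential yields any power of \<open>y\<close>; what remains is bounded on
    [0, 1].\<close>
  also have "\<dots> = flat_exp N y * y ^ N" using y by (auto simp: flat_exp_def)
  finally have "weight K a x = flat_exp N y * y ^ N" .
  moreover have "flat_exp N y * y ^ N \<le> B * y ^ N" using B(2)[OF y] y by (intro mult_right_mono) auto
  ultimately have w: "weight K a x \<le> B * y ^ N" by simp
  have s: "exp (- real (card K)) \<le> (\<Sum>b\<in>K. weight K b x)" by (rule sum_weight_lower[OF K xo(1)])
  then have s0: "0 < (\<Sum>b\<in>K. weight K b x)" using exp_gt_zero[of "- real (card K)"] by linarith
  have "1 / (\<Sum>b\<in>K. weight K b x) \<le> E" using s s0 unfolding E_def by (simp add: exp_minus divide_simps mult.commute)
  then have "cutoff K a x \<le> (B * y ^ N) * E" unfolding cutoff_def using w s0 B y by (intro mult_mono) auto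
  moreover have "0 \<le> cutoff K a x" unfolding cutoff_def using weight_nonneg s0 by simp
  ultimately have "\<bar>f x * cutoff K a x\<bar> \<le> (C * rho K x ^ N) * ((B * y ^ N) * E)"
   unfolding abs_mult using C(2)[OF x] C xo by (intro mult_mono) auto
  also have "\<dots> = (C * B * E) * (rho K x * y) ^ N" by (simp add: power_mult_distrib mult_ac)
  also have "rho K x * y = rho {a} x" using xo by (simp add: y_def rho_def)
  finally show ?thesis .
 qed
 then show "\<exists>C\<ge>0. \<forall>x\<in>D. \<bar>f x * cutoff K a x\<bar> \<le> C * rho {a} x ^ N" using C B by (intro exI[of _ "C * B * E"]) (auto simp: E_def)
qed

end

section \<open>Relations between monomials in the logarithms\<close>

context corner_box
begin

definition inner :: "(nat \<Rightarrow> real) set" where "inner = {x \<in> D. \<forall>i<n. 0 < x i}"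

text \<open>Every point of the box is a limit of points shifted towards the corner
  \<open>hi\<close>, whose coordinates are positive.\<close>

lemma zero_if_zero_inner:
 assumes f: "continuous_on D f" and z: "\<And>x. x \<in> inner ==> f x = (0::real)" and x: "x \<in> D"
 shows "f x = 0"
proof -
 define y where "y m = (\<lambda>i. if i < n then x i + (hi i - x i) / real (Suc m) else 0)" for m
 have yD: "y m \<in> inner" for m
 proof -
  have "0 < y m i \<and> lo i \<le> y m i \<and> y m i \<le> hi i" if i: "i < n" for i
  proof -
   have b: "lo i \<le> x i" "x i \<le> hi i" "0 \<le> lo i" "lo i < hi i" using x i lo_hi[OF i] by (auto simp: D_def)
   define w where "w = (hi i - x i) / real (Suc m)"
   have "w \<le> hi i - x i" unfolding w_def using b by (simp add: divide_le_eq mult_le_cancel_left1)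
   moreover have "0 \<le> w" unfolding w_def using b by simp
   moreover have "0 < w" if "x i < hi i" unfolding w_def using that by simp
   moreover have "y m i = x i + w" using i by (simp add: y_def w_def)
   ultimately show ?thesis using b by (cases "x i < hi i") linarith+
  qed
  then show ?thesis by (auto simp: inner_def D_def espace_def y_def)
 qed
 have lim: "y \<longlonglongrightarrow> x"
 proof -
  have "(\<lambda>m. y m i) \<longlonglongrightarrow> x i" for i
  proof (cases "i < n")
   case True
   have "(\<lambda>m. x i + (hi i - x i) / real (Suc m)) \<longlonglongrightarrow> x i + 0" by (intro tendsto_add tendsto_const LIMSEQ_Suc[OF lim_const_over_n])
   then show ?thesis using True by (simp add: y_def)
  next
   case False then show ?thesis using x by (simp add: y_def D_def espace_def)
  qed
  then have "limitin (product_topology (\<lambda>_. euclideanreal) UNIV) y x sequentially" by (simp add: limitin_componentwise)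
  then show ?thesis by (simp add: euclidean_product_topology)
 qed
 have "(\<lambda>m. f (y m)) \<longlonglongrightarrow> f x" using continuous_on_tendsto_compose[OF f lim x] yD by (auto simp: inner_def)
 moreover have "(\<lambda>m. f (y m)) = (\<lambda>m. 0)" using z yD by auto
 ultimately show ?thesis using LIMSEQ_unique tendsto_const by metis
qed

text \<open>Taylor coefficients in x_a are functions on the face x_a = 0. Extending them constantly
  in x_a keeps them on the same box, so that an induction over the set of coordinates need not
  change the domain.\<close>

lemma smooth_subst_zero:
 assumes a: "a < n" "lo a = 0" and f: "smooth n D f" shows "smooth n D (\<lambda>x. f (x(a := 0)))"
proof -
 have inD: "x(a := 0) \<in> D" if "x \<in> D" for x using upd_D[OF that a(1)] a lo_hi[OF a(1)] by auto
 have "partials (continuous_on D) n D k (\<lambda>x. f (x(a := 0)))" if "smooth n D f" for k f using that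
 proof (induction k arbitrary: f)
  case 0
  show ?case unfolding partials.simps
   by (rule continuous_on_compose2[OF smooth_continuous[OF 0] continuous_on_upd_const]) (use inD in blast)
 next
  case (Suc k)
  show ?case
  proof (rule partials_SucI[where P = "continuous_on D"])
   show "continuous_on D (\<lambda>x. f (x(a := 0)))"
    by (rule continuous_on_compose2[OF smooth_continuous[OF Suc.prems] continuous_on_upd_const]) (use inD in blast)
   fix i assume i: "i < n"
   obtain f' where f': "has_partial i D f f'" "smooth n D f'" using smooth_partial[OF slices_fat_D Suc.prems i] .
   show "\<exists>g. has_partial i D (\<lambda>x. f (x(a := 0))) g \<and> partials (continuous_on D) n D k g"
   proof (cases "i = a")
    case True
    then have "has_partial i D (\<lambda>x. f (x(a := 0))) (\<lambda>x. 0)" by (auto simp: has_partial_def)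
    moreover have "partials (continuous_on D) n D k (\<lambda>x. 0)"
     by (rule partials_const[where P = "continuous_on D", OF continuous_on_const continuous_on_const])
    ultimately show ?thesis by blast
   next
    case False
    have "has_partial i D (\<lambda>x. f (x(a := 0))) (\<lambda>x. f' (x(a := 0)))" unfolding has_partial_def
    proof
     fix x assume x: "x \<in> D"
     have "((\<lambda>u. f ((x(a := 0))(i := u))) has_real_derivative f' (x(a := 0)))
       (at ((x(a := 0)) i) within {u. (x(a := 0))(i := u) \<in> D})" using f'(1) inD[OF x] unfolding has_partial_def by blast
     then have "((\<lambda>u. f ((x(a := 0))(i := u))) has_real_derivative f' (x(a := 0))) (at (x i) within {lo i..hi i})"
      using slice_D[OF inD[OF x] i] False by simp
     moreover have "(x(a := 0))(i := u) = (x(i := u))(a := 0)" for u using False by (simp add: fun_upd_twist)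
     ultimately show "((\<lambda>u. f ((x(i := u))(a := 0))) has_real_derivative f' (x(a := 0))) (at (x i) within {u. x(i := u) \<in> D})"
      using slice_D[OF x i] by simp
    qed
    then show ?thesis using Suc.IH[OF f'(2)] by blast
   qed
  qed
 qed
 then show ?thesis using f by (simp add: smooth_with_def)
qed

text \<open>A coordinate bounded away from 0 bounds \<open>rho\<close> from below; the box then
  misses the stratum and a bounded function satisfies the estimates with large constants.\<close>

lemma decay_trivial:
 assumes K: "K \<subseteq> {..<n}" and i: "i \<in> K" "0 < lo i" and f: "continuous_on D f"
 shows "decay K f" unfolding decay_def
proof
 fix N :: nat
 obtain B where B: "B \<ge> 0" "\<And>x. x \<in> D ==> \<bar>f x\<bar> \<le> B" using bounded_D[OF f] by blast
 have "\<bar>f x\<bar> \<le> (B / lo i ^ N) * rho K x ^ N" if x: "x \<in> D" for x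
 proof -
  have fin: "finite K" using K finite_subset by blast
  have "x i \<le> rho K x" unfolding rho_def using D_nonneg[OF x] K fin i by (intro member_le_sum) auto
  moreover have "lo i \<le> x i" using x i K by (auto simp: D_def)
  ultimately have "lo i ^ N \<le> rho K x ^ N" using i by (intro power_mono) auto
  then have "(B / lo i ^ N) * lo i ^ N \<le> (B / lo i ^ N) * rho K x ^ N" using B i by (intro mult_left_mono) auto
  then show ?thesis using B(2)[OF x] i by simp
 qed
 then show "\<exists>C\<ge>0. \<forall>x\<in>D. \<bar>f x\<bar> \<le> C * rho K x ^ N" using B i by (intro exI[of _ "B / lo i ^ N"]) auto
qed

text \<open>Coefficients of a relation between monomials in the logarithms are flat along the stratum
 where all of the coordinates involved vanish. Restricting the Taylor coefficients in one
 coordinate gives relations in the remaining ones.\<close>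

lemma relation_decay:
 fixes f :: "'i \<Rightarrow> (nat \<Rightarrow> real) \<Rightarrow> real" and e :: "'i \<Rightarrow> nat \<Rightarrow> nat"
 assumes "finite K" "K \<subseteq> {..<n}" "finite A"
  and "\<And>I J. I \<in> A ==> J \<in> A ==> (\<And>i. i \<in> K ==> e I i = e J i) ==> I = J"
  and "\<And>I. I \<in> A ==> smooth n D (f I)"
  and "\<And>x. x \<in> inner ==> (\<Sum>I\<in>A. f I x * (\<Prod>i\<in>K. ln (x i) ^ e I i)) = 0"
  and "I \<in> A"
 shows "decay K (f I)" using assms
proof (induction K arbitrary: A f I rule: finite_induct)
 case empty
 have "A = {I}" using empty.prems by blast
 then have "f I x = 0" if "x \<in> inner" for x using empty.prems(5)[OF that] by simp
 then have "f I x = 0" if "x \<in> D" for x using zero_if_zero_inner[OF smooth_continuous[OF empty.prems(4)[OF empty.prems(6)]] _ that] by blast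
 then show ?case unfolding decay_def by auto
next
 case (insert a K)
 have a: "a < n" and K: "K \<subseteq> {..<n}" using insert.prems(1) by auto
 have fin: "finite A" by fact
 show ?case
 proof (cases "0 < lo a")
  case True
  show ?thesis by (rule decay_trivial[OF insert.prems(1) _ True smooth_continuous[OF insert.prems(4)[OF insert.prems(6)]]]) simp
 next
  case False
  then have lo: "lo a = 0" "0 < hi a" using lo_hi[OF a] by auto
  \<comment> \<open>The iterated partials in direction \<open>a\<close> are fixed once and for all,
    as their values at x_a = 0 will serve as Taylor coefficients.\<close>
  have "\<exists>g. g 0 = f J \<and> (\<forall>m. smooth n D (g m) \<and> has_partial a D (g m) (g (Suc m)))" if J: "J \<in> A" for J
  proof -
   have "\<exists>g. \<forall>m. (smooth n D (g m) \<and> (m = 0 \<longrightarrow> g m = f J)) \<and> has_partial a D (g m) (g (Suc m))"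
   proof (rule dependent_nat_choice)
    show "\<exists>x. smooth n D x \<and> (0 = (0::nat) \<longrightarrow> x = f J)" using insert.prems(4)[OF J] by blast
    show "\<exists>y. (smooth n D y \<and> (Suc m = 0 \<longrightarrow> y = f J)) \<and> has_partial a D x y"
     if "smooth n D x \<and> (m = 0 \<longrightarrow> x = f J)" for x m using smooth_partial[OF slices_fat_D _ a, of x] that by (metis nat.distinct(1))
   qed
   then show ?thesis by blast
  qed
  then obtain g where g: "\<And>J. J \<in> A ==> g J 0 = f J" "\<And>J m. J \<in> A ==> smooth n D (g J m)"
    "\<And>J m. J \<in> A ==> has_partial a D (g J m) (g J (Suc m))" by metis
  define M where "M = Max (insert 0 ((\<lambda>J. e J a) ` A))"
  have M: "e J a \<le> M" if "J \<in> A" for J using fin that unfolding M_def by (intro Max_ge) auto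
  have line: "((\<lambda>u. g J m (x(a := u))) has_real_derivative g J (Suc m) (x(a := u))) (at u within {0..hi a})"
   if J: "J \<in> A" and x: "x \<in> D" and u: "u \<in> {0..hi a}" for J m x u
  proof -
   have uD: "x(a := u) \<in> D" using upd_D[OF x a] u lo by simp
   have "((\<lambda>w. g J m ((x(a := u))(a := w))) has_real_derivative g J (Suc m) (x(a := u))) (at ((x(a := u)) a) within {w. (x(a := u))(a := w) \<in> D})"
    using g(3)[OF J] uD unfolding has_partial_def by blast
   then show ?thesis using slice_D[OF uD a] lo by simp
  qed
  \<comment> \<open>On the line through \<open>x\<close> in direction \<open>a\<close> the relation
    becomes one between powers of \<open>ln u\<close>. Its coefficients collect the terms with the
    same exponent \<open>d\<close> at \<open>a\<close>, and the one-variable result makes each of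
    their derivatives vanish at 0.\<close>
  have rel0: "(\<Sum>J\<in>{J \<in> A. e J a = d}. g J m (x(a := 0)) * (\<Prod>i\<in>K. ln (x i) ^ e J i)) = 0"
   if x: "x \<in> inner" for x d m
  proof (cases "d \<le> M")
   case False
   then have "{J \<in> A. e J a = d} = {}" using M by auto
   then show ?thesis by (simp only: sum.empty)
  next
   case True
   define c where "c J = (\<Prod>i\<in>K. ln (x i) ^ e J i)" for J
   define \<phi> where "\<phi> d m u = (\<Sum>J\<in>{J \<in> A. e J a = d}. g J m (x(a := u)) * c J)" for d m u
   have xD: "x \<in> D" using x by (simp add: inner_def)
   have "\<phi> d m 0 = 0"
   proof (rule log_relation_1d[OF lo(2) _ _ True])
    show "(\<phi> d m has_real_derivative \<phi> d (Suc m) u) (at u within {0..hi a})" if "u \<in> {0..hi a}" for d m u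
     unfolding \<phi>_def by (intro DERIV_sum DERIV_cmult_right line) (use xD that in auto)
    fix u assume u: "0 < u" "u \<le> hi a"
    have ui: "x(a := u) \<in> inner" using x u upd_D[OF xD a] lo by (auto simp: inner_def)
    have "(\<Sum>d\<le>M. \<phi> d 0 u * ln u ^ d) = (\<Sum>d\<le>M. \<Sum>J\<in>{J \<in> A. e J a = d}. f J (x(a := u)) * c J * ln u ^ e J a)"
     unfolding \<phi>_def sum_distrib_right by (intro sum.cong) (auto simp: g(1))
    also have "\<dots> = (\<Sum>J\<in>A. f J (x(a := u)) * c J * ln u ^ e J a)" by (rule sum.group) (use fin M in auto)
    also have "\<dots> = (\<Sum>J\<in>A. f J (x(a := u)) * (\<Prod>i\<in>insert a K. ln ((x(a := u)) i) ^ e J i))"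
    proof (rule sum.cong)
     fix J
     have "(\<Prod>i\<in>K. ln ((x(a := u)) i) ^ e J i) = c J" unfolding c_def using insert.hyps by (intro prod.cong) auto
     then show "f J (x(a := u)) * c J * ln u ^ e J a = f J (x(a := u)) * (\<Prod>i\<in>insert a K. ln ((x(a := u)) i) ^ e J i)"
      using insert.hyps by (simp add: mult_ac)
    qed simp
    also have "\<dots> = 0" by (rule insert.prems(5)[OF ui])
    finally show "(\<Sum>d\<le>M. \<phi> d 0 u * ln u ^ d) = 0" .
   qed
   then show ?thesis by (simp add: \<phi>_def c_def)
  qed
  \<comment> \<open>Among terms with equal exponent at \<open>a\<close> the exponents on
    \<open>K\<close> alone still separate the terms, so the induction hypothesis applies.\<close>
  have dec: "decay K (\<lambda>x. g J m (x(a := 0)))" if J: "J \<in> A" for J m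
  proof (rule insert.IH[where A = "{J' \<in> A. e J' a = e J a}" and f = "\<lambda>J x. g J m (x(a := 0))"])
   show "(\<Sum>J'\<in>{J' \<in> A. e J' a = e J a}. g J' m (x(a := 0)) * (\<Prod>i\<in>K. ln (x i) ^ e J' i)) = 0" if "x \<in> inner" for x by (rule rel0[OF that])
   show "smooth n D (\<lambda>x. g J' m (x(a := 0)))" if "J' \<in> {J' \<in> A. e J' a = e J a}" for J'
    using that by (intro smooth_subst_zero[OF a lo(1)] g(2)) auto
   show "I' = J'" if "I' \<in> {J' \<in> A. e J' a = e J a}" "J' \<in> {J' \<in> A. e J' a = e J a}" "\<And>i. i \<in> K ==> e I' i = e J' i" for I' J'
    by (rule insert.prems(3)) (use that in auto)
  qed (use K fin J in auto)
  have I: "I \<in> A" by fact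
  show ?thesis unfolding decay_def
  proof
   fix N :: nat
   have "\<exists>C. \<forall>m. C m \<ge> 0 \<and> (\<forall>x\<in>D. \<bar>g I m (x(a := 0))\<bar> \<le> C m * rho K x ^ N)" using dec[OF I] unfolding decay_def by meson
   then obtain C where C: "\<And>m. C m \<ge> (0::real)" "\<And>m x. x \<in> D ==> \<bar>g I m (x(a := 0))\<bar> \<le> C m * rho K x ^ N" by blast
   obtain B where B: "B \<ge> 0" "\<And>x. x \<in> D ==> \<bar>g I N x\<bar> \<le> B" using bounded_D[OF smooth_continuous[OF g(2)[OF I]]] by blast
   \<comment> \<open>The Taylor coefficients on the face decay with \<open>rho K\<close>, the
     remainder is of order \<open>x a ^ N\<close>, and both \<open>rho K x\<close> and
     \<open>x a\<close> are at most \<open>rho (insert a K) x\<close>.\<close>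
   define E where "E = (\<Sum>m<N. hi a ^ m / fact m * C m) + B"
   have "\<bar>f I x\<bar> \<le> E * rho (insert a K) x ^ N" if x: "x \<in> D" for x
   proof -
    have xa: "x a \<in> {0..hi a}" using x a lo by (auto simp: D_def)
    have rho: "rho (insert a K) x = x a + rho K x" using insert.hyps by (simp add: rho_def)
    have rK: "0 \<le> rho K x" by (rule rho_nonneg[OF K x])
    have p1: "rho K x ^ N \<le> rho (insert a K) x ^ N" and p2: "x a ^ N \<le> rho (insert a K) x ^ N"
     unfolding rho using xa rK by (auto intro!: power_mono)
    have "\<bar>g I 0 (x(a := x a)) - (\<Sum>m<N. x a ^ m / fact m * g I m (x(a := 0)))\<bar> \<le> B * x a ^ N"
    proof (rule taylor_within[where g = "\<lambda>m u. g I m (x(a := u))" and b = "hi a"])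
     show "\<bar>g I N (x(a := u))\<bar> \<le> B" if "u \<in> {0..hi a}" for u using B(2) upd_D[OF x a] that lo by simp
    qed (use line[OF I x] xa in auto)
    then have "\<bar>f I x\<bar> \<le> \<bar>\<Sum>m<N. x a ^ m / fact m * g I m (x(a := 0))\<bar> + B * x a ^ N" using g(1)[OF I] by simp
    also have "\<bar>\<Sum>m<N. x a ^ m / fact m * g I m (x(a := 0))\<bar> \<le> (\<Sum>m<N. \<bar>x a ^ m / fact m * g I m (x(a := 0))\<bar>)" by (rule sum_abs)
    also have "\<dots> \<le> (\<Sum>m<N. (hi a ^ m / fact m * C m) * rho K x ^ N)"
    proof (rule sum_mono)
     fix m
     have "\<bar>x a ^ m / fact m\<bar> * \<bar>g I m (x(a := 0))\<bar> \<le> (hi a ^ m / fact m) * (C m * rho K x ^ N)"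
      using C xa x by (intro mult_mono) (auto intro!: divide_right_mono power_mono)
     then show "\<bar>x a ^ m / fact m * g I m (x(a := 0))\<bar> \<le> (hi a ^ m / fact m * C m) * rho K x ^ N" by (simp only: abs_mult mult.assoc)
    qed
    also have "\<dots> = (\<Sum>m<N. hi a ^ m / fact m * C m) * rho K x ^ N" by (simp add: sum_distrib_right)
    also have "\<dots> \<le> (\<Sum>m<N. hi a ^ m / fact m * C m) * rho (insert a K) x ^ N" using p1 C lo by (intro mult_left_mono sum_nonneg) auto
    also have "B * x a ^ N \<le> B * rho (insert a K) x ^ N" using p2 B by (intro mult_left_mono)
    finally show ?thesis by (simp add: E_def distrib_right)
   qed
   moreover have "E \<ge> 0" unfolding E_def using B C lo by (intro add_nonneg_nonneg sum_nonneg) auto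
   ultimately show "\<exists>C\<ge>0. \<forall>x\<in>D. \<bar>f I x\<bar> \<le> C * rho (insert a K) x ^ N" by blast
  qed
 qed
qed

abbreviation single_term :: "nat multiset \<Rightarrow> rfun \<Rightarrow> nat multiset \<Rightarrow> (nat \<Rightarrow> real) \<Rightarrow> real" where
 "single_term I g \<equiv> (\<lambda>J x. if J = I then g x else 0)"

text \<open>Since g log x_a is again smooth and decays along x_a = 0, it can take the place of
  \<open>g\<close>; thus the powers of log x_a are absorbed one after another, each by one
  elementary relation.\<close>

lemma log_null_eliminate:
 assumes a: "a < n" and g: "smooth n D g" "decay {a} g" and I: "set_mset I \<subseteq> {..<n}"
 shows "log_null n D (\<lambda>J x. single_term (I + replicate_mset c a) g J x - single_term I (\<lambda>x. g x * ln (x a) ^ c) J x)" using g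
proof (induction c arbitrary: g)
 case 0 show ?case by (rule log_null.zero) simp
next
 case (Suc c)
 note g = Suc.prems
 have hd: "log_null n D (\<lambda>J x. single_term (I + replicate_mset (Suc c) a) g J x - single_term (I + replicate_mset c a) (\<lambda>x. g x * ln (x a)) J x)"
 proof (rule log_null.step[OF log_null.zero[of D "\<lambda>I x. 0"] a])
  show "set_mset (I + replicate_mset c a) \<subseteq> {..<n}" using I a by (auto split: if_splits)
  show "smooth n D g" "smooth n D (\<lambda>x. g x * ln (x a))" using g flat_mult_ln_power[OF a g, of 1] by auto
 qed auto
 have "log_null n D (\<lambda>J x. single_term (I + replicate_mset c a) (\<lambda>x. g x * ln (x a)) J x - single_term I (\<lambda>x. (g x * ln (x a)) * ln (x a) ^ c) J x)"
  using Suc.IH[of "\<lambda>x. g x * ln (x a)"] flat_mult_ln_power[OF a g, of 1] by simp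
 from log_null_add[OF hd this] show ?case by (rule log_null_cong) (simp add: mult_ac)
qed

text \<open>A relation multiplied by a cutoff is still a relation, because the sum is zero at every
  point separately. So each summand of the split coefficients can be treated by itself, with its own
  coordinate eliminated.\<close>

theorem log_relation_null:
 assumes "K \<subseteq> {..<n}" "finite A" "\<And>I. I \<in> A ==> set_mset I \<subseteq> K" "\<And>I. I \<in> A ==> smooth n D (f I)"
  and "\<And>x. x \<in> inner ==> (\<Sum>I\<in>A. f I x * (\<Prod>i\<in>K. ln (x i) ^ count I i)) = 0"
 shows "log_null n D (\<lambda>I x. if I \<in> A then f I x else 0)" using assms
proof (induction "card K" arbitrary: K A f rule: less_induct)
 case less
 have finK: "finite K" using less.prems(1) finite_subset by blast
 have dec: "decay K (f I)" if "I \<in> A" for I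
 proof (rule relation_decay[where e = count and A = A])
  show "I' = J'" if "I' \<in> A" "J' \<in> A" "\<And>i. i \<in> K ==> count I' i = count J' i" for I' J'
  proof (rule multiset_eqI)
   fix i show "count I' i = count J' i"
   proof (cases "i \<in> K")
    case False
    then have "i \<notin># I'" "i \<notin># J'" using less.prems(3) that(1,2) by blast+
    then show ?thesis by (simp add: not_in_iff)
   qed (use that(3) in simp)
  qed
 qed (use less.prems finK that in auto)
 show ?case
 proof (cases "K = {}")
  case True
  \<comment> \<open>For empty \<open>K\<close> the function \<open>rho\<close> is 0, so decay says
    that the coefficient is identically 0.\<close>
  have "f I x = 0" if "I \<in> A" "x \<in> D" for I x using decay_zero[OF dec[OF that(1)] that(2)] True by (simp add: rho_def)
  then show ?thesis by (intro log_null.zero) auto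
 next
  case False
  define h where "h a I x = f I x * cutoff K a x" for a I x
  define rest where "rest a I = filter_mset (\<lambda>i. i \<noteq> a) I" for a and I :: "nat multiset"
  define t where "t a I x = h a I x * ln (x a) ^ count I a" for a I x
  have aK: "a < n" if "a \<in> K" for a using that less.prems(1) by auto
  have hs: "smooth n D (h a I)" "decay {a} (h a I)" if "I \<in> A" "a \<in> K" for a I unfolding h_def[abs_def]
   using smooth_flat_mult[OF less.prems(1) less.prems(4)[OF that(1)] dec[OF that(1)] tame_cutoff[OF less.prems(1) that(2)]]
    decay_cutoff[OF less.prems(1) that(2) dec[OF that(1)]] by auto
  have ts: "smooth n D (t a I)" if "I \<in> A" "a \<in> K" for a I
   unfolding t_def[abs_def] by (rule flat_mult_ln_power[OF aK[OF that(2)] hs[OF that]])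
  have split: "I = rest a I + replicate_mset (count I a) a" for a I by (rule multiset_eqI) (auto simp: rest_def)
  have N1: "log_null n D (\<lambda>J x. \<Sum>I\<in>A. single_term I (h a I) J x - single_term (rest a I) (t a I) J x)" if a: "a \<in> K" for a
  proof (rule log_null_sum[OF less.prems(2)])
   fix I assume I: "I \<in> A"
   have "set_mset (rest a I) \<subseteq> {..<n}" using less.prems(1) less.prems(3)[OF I] by (auto simp: rest_def)
   from log_null_eliminate[OF aK[OF a] hs[OF I a] this, of "count I a"]
   show "log_null n D (\<lambda>J x. single_term I (h a I) J x - single_term (rest a I) (t a I) J x)" unfolding split[symmetric] t_def .
  qed
  \<comment> \<open>What elimination leaves is grouped by the monomial in the other logarithms. On
    the interior it is the original relation times the cutoff for \<open>a\<close>, now written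
    without log x_a.\<close>
  have N2: "log_null n D (\<lambda>J x. if J \<in> rest a ` A then \<Sum>I\<in>{I \<in> A. rest a I = J}. t a I x else 0)" if a: "a \<in> K" for a
  proof (rule less.hyps[where K = "K - {a}"])
   show "card (K - {a}) < card K" using finK a by (rule card_Diff1_less)
   show "set_mset J \<subseteq> K - {a}" if J: "J \<in> rest a ` A" for J
   proof -
    obtain I where "I \<in> A" "J = rest a I" using J by blast
    then show ?thesis using less.prems(3)[of I] by (auto simp: rest_def)
   qed
   show "smooth n D (\<lambda>x. \<Sum>I\<in>{I \<in> A. rest a I = J}. t a I x)" for J by (intro smooth_sum ts) (use a in auto)
   fix x assume x: "x \<in> inner"
   have "(\<Sum>J\<in>rest a ` A. (\<Sum>I\<in>{I \<in> A. rest a I = J}. t a I x) * (\<Prod>i\<in>K - {a}. ln (x i) ^ count J i)) =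
     (\<Sum>J\<in>rest a ` A. \<Sum>I\<in>{I \<in> A. rest a I = J}. t a I x * (\<Prod>i\<in>K - {a}. ln (x i) ^ count (rest a I) i))"
    unfolding sum_distrib_right by (intro sum.cong) auto
   also have "\<dots> = (\<Sum>I\<in>A. t a I x * (\<Prod>i\<in>K - {a}. ln (x i) ^ count (rest a I) i))" by (rule sum.group) (use less.prems(2) in auto)
   also have "\<dots> = (\<Sum>I\<in>A. f I x * (\<Prod>i\<in>K. ln (x i) ^ count I i) * cutoff K a x)"
   proof (rule sum.cong)
    fix I
    have "(\<Prod>i\<in>K - {a}. ln (x i) ^ count (rest a I) i) = (\<Prod>i\<in>K - {a}. ln (x i) ^ count I i)" by (intro prod.cong) (auto simp: rest_def)
    moreover have "(\<Prod>i\<in>K. ln (x i) ^ count I i) = ln (x a) ^ count I a * (\<Prod>i\<in>K - {a}. ln (x i) ^ count I i)"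
     by (rule prod.remove[OF finK a])
    ultimately show "t a I x * (\<Prod>i\<in>K - {a}. ln (x i) ^ count (rest a I) i) = f I x * (\<Prod>i\<in>K. ln (x i) ^ count I i) * cutoff K a x"
     by (simp add: t_def h_def mult_ac)
   qed simp
   also have "\<dots> = 0" using less.prems(5)[OF x] by (simp add: sum_distrib_right[symmetric])
   finally show "(\<Sum>J\<in>rest a ` A. (\<Sum>I\<in>{I \<in> A. rest a I = J}. t a I x) * (\<Prod>i\<in>K - {a}. ln (x i) ^ count J i)) = 0" .
  qed (use less.prems in auto)
  have "log_null n D (\<lambda>J x. \<Sum>a\<in>K. (\<Sum>I\<in>A. single_term I (h a I) J x - single_term (rest a I) (t a I) J x) +
    (if J \<in> rest a ` A then \<Sum>I\<in>{I \<in> A. rest a I = J}. t a I x else 0))" by (intro log_null_sum[OF finK] log_null_add N1 N2)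
  then show ?thesis
  proof (rule log_null_cong)
   fix J x assume x: "x \<in> D"
   have "(\<Sum>I\<in>A. single_term I (h a I) J x - single_term (rest a I) (t a I) J x) +
    (if J \<in> rest a ` A then \<Sum>I\<in>{I \<in> A. rest a I = J}. t a I x else 0) = (if J \<in> A then h a J x else 0)" for a
   proof -
    have "(\<Sum>I\<in>A. single_term (rest a I) (t a I) J x) = (\<Sum>I\<in>{I \<in> A. rest a I = J}. t a I x)"
     using less.prems(2) by (subst sum.inter_filter) (auto intro!: sum.cong)
    moreover have "(\<Sum>I\<in>{I \<in> A. rest a I = J}. t a I x) = 0" if "J \<notin> rest a ` A"
    proof -
     have "{I \<in> A. rest a I = J} = {}" using that by auto
     then show ?thesis by (simp only: sum.empty)
    qed
    ultimately show ?thesis using less.prems(2) by (simp add: sum_subtractf)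
   qed
   then have "(\<Sum>a\<in>K. (\<Sum>I\<in>A. single_term I (h a I) J x - single_term (rest a I) (t a I) J x) +
    (if J \<in> rest a ` A then \<Sum>I\<in>{I \<in> A. rest a I = J}. t a I x else 0)) = (if J \<in> A then f J x * (\<Sum>a\<in>K. cutoff K a x) else 0)"
    by (simp add: h_def sum_distrib_left)
   also have "\<dots> = (if J \<in> A then f J x else 0)"
   \<comment> \<open>The cutoffs sum to 1 only off the stratum; on it the coefficient itself is
     0.\<close>
   proof (cases "rho K x = 0")
    case True then show ?thesis using decay_zero[OF dec x True] by simp
   next
    case False
    then have "x \<in> off K" using x rho_nonneg[OF less.prems(1) x] by (auto simp: off_def)
    then show ?thesis using sum_cutoff[OF less.prems(1)] by simp
   qed
   finally show "(\<Sum>a\<in>K. (\<Sum>I\<in>A. single_term I (h a I) J x - single_term (rest a I) (t a I) J x) +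
    (if J \<in> rest a ` A then \<Sum>I\<in>{I \<in> A. rest a I = J}. t a I x else 0)) = (if J \<in> A then f J x else 0)" .
  qed
 qed
qed

end

section \<open>Smooth functions on a manifold with corners\<close>

definition pull :: "'p set \<Rightarrow> ('p \<Rightarrow> nat \<Rightarrow> real) \<Rightarrow> ('p \<Rightarrow> real) \<Rightarrow> (nat \<Rightarrow> real) \<Rightarrow> real" where
 "pull U \<phi> f = f \<circ> inv_into U \<phi>"

locale mwc =
 fixes \<T> :: "'p topology" and \<A> :: "'p chart set"
 assumes mfd: "manifold_with_corners \<T> \<A>"
begin

lemma chart: "(n, U, \<phi>) \<in> \<A> ==> is_chart \<T> (n, U, \<phi>)" using mfd unfolding manifold_with_corners_def by blast

lemma chart_open: "(n, U, \<phi>) \<in> \<A> ==> openin \<T> U" using chart[of n U \<phi>] by (simp add: is_chart_def)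

lemma topspace_sub: "(n, U, \<phi>) \<in> \<A> ==> U \<subseteq> topspace \<T>" by (rule openin_subset[OF chart_open])

lemma chart_image_open: "(n, U, \<phi>) \<in> \<A> ==> openin (orthant n) (\<phi> ` U)" using chart[of n U \<phi>] by (simp add: is_chart_def)

lemma chart_image_subset: "(n, U, \<phi>) \<in> \<A> ==> \<phi> ` U \<subseteq> orth n" using openin_subset[OF chart_image_open] by (simp add: orthant_top_of_set)

lemma chart_homeo: "(n, U, \<phi>) \<in> \<A> ==> homeomorphic_map (subtopology \<T> U) (subtopology (orthant n) (\<phi> ` U)) \<phi>"
 using chart[of n U \<phi>] by (simp add: is_chart_def)

lemma chart_inj: "(n, U, \<phi>) \<in> \<A> ==> inj_on \<phi> U" using homeomorphic_imp_injective_map[OF chart_homeo, of n U \<phi>] topspace_sub[of n U \<phi>]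
 by (simp add: Int_absorb1)

lemma chart_image_openin:
 assumes c: "(n, U, \<phi>) \<in> \<A>" and V: "openin \<T> V" "V \<subseteq> U"
 shows "openin (orthant n) (\<phi> ` V)"
proof -
 have "openin (subtopology \<T> U) V" using V by (simp add: openin_open_subtopology chart_open[OF c])
 then have "openin (subtopology (orthant n) (\<phi> ` U)) (\<phi> ` V)"
  using homeomorphic_imp_open_map[OF chart_homeo[OF c]] by (simp add: open_map_def)
 then show ?thesis using chart_image_open[OF c] by (simp add: openin_open_subtopology)
qed

lemma chart_preimage_openin:
 assumes c: "(n, U, \<phi>) \<in> \<A>" and N: "openin (orthant n) N" "N \<subseteq> \<phi> ` U"
 shows "openin \<T> (U \<inter> \<phi> -` N)"
proof -
 have "openin (subtopology (orthant n) (\<phi> ` U)) N" using N by (simp add: openin_open_subtopology chart_image_open[OF c])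
 then have "openin (subtopology \<T> U) {x \<in> topspace (subtopology \<T> U). \<phi> x \<in> N}"
  by (rule openin_continuous_map_preimage[OF homeomorphic_imp_continuous_map[OF chart_homeo[OF c]]])
 moreover have "{x \<in> topspace (subtopology \<T> U). \<phi> x \<in> N} = U \<inter> \<phi> -` N" using topspace_sub[OF c] by (auto simp: topspace_subtopology_subset)
 ultimately show ?thesis using chart_open[OF c] by (simp add: openin_open_subtopology)
qed

lemma pull_chart: "(n, U, \<phi>) \<in> \<A> ==> p \<in> U ==> pull U \<phi> f (\<phi> p) = f p" using chart_inj by (simp add: pull_def)

lemma compatible: "c \<in> \<A> ==> d \<in> \<A> ==> chart_compatible c d" using mfd unfolding manifold_with_corners_def by blast

lemma transition_smooth:
 assumes "(n, U, \<phi>) \<in> \<A>" "(m, V, \<psi>) \<in> \<A>" "j < m"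
 shows "smooth n (\<phi> ` (U \<inter> V)) (\<lambda>x. \<psi> (inv_into U \<phi> x) j)" using compatible[OF assms(1,2)] assms(3)
 by (auto simp: chart_compatible_def smooth_map_on_def o_def intro: smooth_on_imp_smooth)

lemma smooth_on_subset: "smooth_on n A f ==> B \<subseteq> A ==> smooth_on n B f" unfolding smooth_on_def by blast

lemma inv_into_restrict:
 assumes "inj_on \<phi> U" "V \<subseteq> U" "x \<in> \<phi> ` V" shows "inv_into V \<phi> x = inv_into U \<phi> x"
 using assms by (metis inv_into_f_f image_iff inj_on_subset subsetD)

lemma smooth_on_cong: "smooth_on n A f ==> (\<And>x. x \<in> A ==> f x = g x) ==> smooth_on n A g" unfolding smooth_on_def by metis

text \<open>The restriction is compatible with every chart of the atlas, so maximality puts it into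
  the atlas.\<close>

lemma chart_restrict:
 assumes c: "(n, U, \<phi>) \<in> \<A>" and V: "openin \<T> V" "V \<subseteq> U"
 shows "(n, V, \<phi>) \<in> \<A>"
proof -
 have "is_chart \<T> (n, V, \<phi>)"
 proof -
  have "homeomorphic_map (subtopology (subtopology \<T> U) V) (subtopology (subtopology (orthant n) (\<phi> ` U)) (\<phi> ` V)) \<phi>"
   using homeomorphic_map_subtopologies[OF chart_homeo[OF c], of V "\<phi> ` V"] V chart_inj[OF c] topspace_sub[OF c]
    chart_image_subset[OF c] by (simp add: topspace_subtopology_subset orthant_top_of_set Int_absorb1 image_mono Int_absorb2)
  then show ?thesis using V chart_image_openin[OF c V]
   by (simp add: is_chart_def subtopology_subtopology Int_absorb1 image_mono Int_absorb2)
 qed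
 moreover have "chart_compatible (n, V, \<phi>) d" if d: "d \<in> \<A>" for d
 proof -
  obtain m U' \<psi> where d': "d = (m, U', \<psi>)" by (cases d)
  have cc: "chart_compatible (n, U, \<phi>) (m, U', \<psi>)" using compatible[OF c] d d' by simp
  have "smooth_on n (\<phi> ` (V \<inter> U')) (\<lambda>x. (\<psi> \<circ> inv_into V \<phi>) x j)" if "j < m" for j
  proof (rule smooth_on_cong)
   show "smooth_on n (\<phi> ` (V \<inter> U')) (\<lambda>x. (\<psi> \<circ> inv_into U \<phi>) x j)"
    using cc that V by (auto simp: chart_compatible_def smooth_map_on_def intro: smooth_on_subset)
   fix x assume "x \<in> \<phi> ` (V \<inter> U')"
   then have "x \<in> \<phi> ` V" by blast
   then show "(\<psi> \<circ> inv_into U \<phi>) x j = (\<psi> \<circ> inv_into V \<phi>) x j" using inv_into_restrict[OF chart_inj[OF c] V(2)] by simp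
  qed
  moreover have "smooth_on m (\<psi> ` (V \<inter> U')) (\<lambda>x. (\<phi> \<circ> inv_into U' \<psi>) x j)" if "j < n" for j
   using cc that V by (auto simp: chart_compatible_def smooth_map_on_def intro: smooth_on_subset)
  ultimately show ?thesis by (simp add: d' chart_compatible_def smooth_map_on_def)
 qed
 ultimately show ?thesis using mfd unfolding manifold_with_corners_def by blast
qed

lemma slices_fat_chart: "(n, U, \<phi>) \<in> \<A> ==> openin \<T> V ==> V \<subseteq> U ==> slices_fat n (\<phi> ` V)"
 using slices_fat_openin_orthant chart_image_openin by blast

text \<open>Near each point the function extends smoothly in some chart. The extension, defined on
  an open set, is composed with the transition map, and the local results are glued.\<close>

lemma smooth_fun_imp_smooth:
 assumes f: "smooth_fun \<A> V f" and c: "(n, U, \<phi>) \<in> \<A>" and V: "openin \<T> V"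
 shows "smooth n (\<phi> ` (U \<inter> V)) (pull U \<phi> f)"
proof (rule smooth_local)
 have UV: "openin \<T> (U \<inter> V)" using V chart_open[OF c] by blast
 show "slices_fat n (\<phi> ` (U \<inter> V))" by (rule slices_fat_chart[OF c UV]) simp
 fix x assume "x \<in> \<phi> ` (U \<inter> V)"
 then obtain p where p: "p \<in> U" "p \<in> V" "x = \<phi> p" by blast
 obtain m U' \<psi> where d: "(m, U', \<psi>) \<in> \<A>" "p \<in> U'" "U' \<subseteq> V" "smooth_on m (\<psi> ` U') (f \<circ> inv_into U' \<psi>)"
  using f p(2) unfolding smooth_fun_def by blast
 obtain W F where W: "openin (Euclidean_space m) W" "\<psi> ` U' \<subseteq> W" "\<forall>k. Ck k m W F" "\<forall>x\<in>\<psi> ` U'. F x = (f \<circ> inv_into U' \<psi>) x"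
  using d(4) unfolding smooth_on_def by blast
 have Wsub: "W \<subseteq> espace m" using W openin_subset by (fastforce simp: topspace_Euclidean_space espace_def)
 have F: "smooth m W F" using W(3) partials_Ck[OF Wsub] unfolding smooth_with_def by simp
 have sm: "smooth n (\<phi> ` (U \<inter> U')) (\<lambda>x. F (\<psi> (inv_into U \<phi> x)))"
 proof (rule smooth_compose[OF W(1) F])
  fix y assume "y \<in> \<phi> ` (U \<inter> U')"
  then show "\<psi> (inv_into U \<phi> y) \<in> W" using W(2) chart_inj[OF c] by auto
 qed (rule transition_smooth[OF c d(1)])
 have sm': "smooth n (\<phi> ` (U \<inter> U')) (pull U \<phi> f)"
 proof (rule smooth_cong[OF sm])
  fix y assume "y \<in> \<phi> ` (U \<inter> U')"
  then obtain q where q: "q \<in> U" "q \<in> U'" "y = \<phi> q" by blast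
  then show "F (\<psi> (inv_into U \<phi> y)) = pull U \<phi> f y" using W(4) chart_inj[OF c] chart_inj[OF d(1)] by (simp add: pull_def)
 qed
 have "openin (orthant n) (\<phi> ` (U \<inter> U'))" using chart_open[OF c] chart_open[OF d(1)] by (intro chart_image_openin[OF c]) auto
 then obtain O' where O': "open O'" "\<phi> ` (U \<inter> U') = orth n \<inter> O'" unfolding orthant_top_of_set openin_open by blast
 have "\<phi> ` (U \<inter> V) \<inter> O' \<subseteq> \<phi> ` (U \<inter> U')" using chart_image_subset[OF c] O'(2) by blast
 moreover have "x \<in> O'" using p d(2) O'(2) by blast
 ultimately show "\<exists>O'. open O' \<and> x \<in> O' \<and> smooth n (\<phi> ` (U \<inter> V) \<inter> O') (pull U \<phi> f)" using O'(1) smooth_subset[OF sm'] by blast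
qed

text \<open>Here reflection enters: one-sided smoothness gives a smooth extension near the image of
  \<open>p\<close>, and the chart is shrunk to the set where it is available. Consequently
  smoothness of functions may be tested by one-sided derivatives in charts.\<close>

lemma smooth_imp_smooth_fun:
 assumes V: "openin \<T> V"
  and f: "\<And>p. p \<in> V ==> \<exists>n U \<phi>. (n, U, \<phi>) \<in> \<A> \<and> p \<in> U \<and> smooth n (\<phi> ` (U \<inter> V)) (pull U \<phi> f)"
 shows "smooth_fun \<A> V f" unfolding smooth_fun_def
proof
 fix p assume p: "p \<in> V"
 then obtain n U \<phi> where c: "(n, U, \<phi>) \<in> \<A>" "p \<in> U" "smooth n (\<phi> ` (U \<inter> V)) (pull U \<phi> f)" using f by blast
 have UV: "openin \<T> (U \<inter> V)" using V chart_open[OF c(1)] by blast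
 have "openin (orthant n) (\<phi> ` (U \<inter> V))" by (rule chart_image_openin[OF c(1) UV]) simp
 from smooth_imp_locally_smooth_on[OF this c(3), of "\<phi> p"] obtain N where
  N: "openin (orthant n) N" "\<phi> p \<in> N" "N \<subseteq> \<phi> ` (U \<inter> V)" "smooth_on n N (pull U \<phi> f)" using c(2) p by blast
 define U' where "U' = U \<inter> \<phi> -` N"
 have U': "openin \<T> U'" unfolding U'_def using chart_preimage_openin[OF c(1) N(1)] N(3) by blast
 have img: "\<phi> ` U' = N" using N(3) by (auto simp: U'_def)
 have sub: "U' \<subseteq> U \<inter> V" using N(3) chart_inj[OF c(1)] unfolding U'_def by (auto dest: inj_onD)
 have "(n, U', \<phi>) \<in> \<A>" using chart_restrict[OF c(1) U'] sub by blast
 moreover have "smooth_on n (\<phi> ` U') (f \<circ> inv_into U' \<phi>)" unfolding img by (rule smooth_on_cong[OF N(4)])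
   (use inv_into_restrict[OF chart_inj[OF c(1)], of U'] sub img in \<open>auto simp: pull_def\<close>)
 moreover have "p \<in> U'" using c(2) N(2) by (simp add: U'_def)
 ultimately show "\<exists>(n, U, \<phi>)\<in>\<A>. p \<in> U \<and> U \<subseteq> V \<and> smooth_on n (\<phi> ` U) (f \<circ> inv_into U \<phi>)"
  using sub by (intro bexI[of _ "(n, U', \<phi>)"]) simp_all
qed

lemma chart_exists: "p \<in> topspace \<T> ==> \<exists>n U \<phi>. (n, U, \<phi>) \<in> \<A> \<and> p \<in> U" using mfd unfolding manifold_with_corners_def by fast

lemma smooth_fun_iff:
 assumes V: "openin \<T> V"
 shows "smooth_fun \<A> V f \<longleftrightarrow> (\<forall>(n, U, \<phi>)\<in>\<A>. smooth n (\<phi> ` (U \<inter> V)) (pull U \<phi> f))"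
proof
 assume "smooth_fun \<A> V f"
 then show "\<forall>(n, U, \<phi>)\<in>\<A>. smooth n (\<phi> ` (U \<inter> V)) (pull U \<phi> f)" by (simp add: split_beta smooth_fun_imp_smooth[OF _ _ V])
next
 assume *: "\<forall>(n, U, \<phi>)\<in>\<A>. smooth n (\<phi> ` (U \<inter> V)) (pull U \<phi> f)"
 show "smooth_fun \<A> V f"
 proof (rule smooth_imp_smooth_fun[OF V])
  fix p assume "p \<in> V"
  then have "p \<in> topspace \<T>" using openin_subset[OF V] by blast
  from chart_exists[OF this] obtain n U \<phi> where "(n, U, \<phi>) \<in> \<A>" "p \<in> U" by blast
  moreover from this(1) have "smooth n (\<phi> ` (U \<inter> V)) (pull U \<phi> f)" using bspec[OF *, of "(n, U, \<phi>)"] by simp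
  ultimately show "\<exists>n U \<phi>. (n, U, \<phi>) \<in> \<A> \<and> p \<in> U \<and> smooth n (\<phi> ` (U \<inter> V)) (pull U \<phi> f)" by blast
 qed
qed

lemma smooth_fun_chart_iff:
 assumes V: "openin \<T> V" and c: "(n, U, \<phi>) \<in> \<A>" "V \<subseteq> U"
 shows "smooth_fun \<A> V f \<longleftrightarrow> smooth n (\<phi> ` V) (pull U \<phi> f)"
proof -
 have "U \<inter> V = V" using c by auto
 show ?thesis
 proof
  show "smooth_fun \<A> V f ==> smooth n (\<phi> ` V) (pull U \<phi> f)" using smooth_fun_imp_smooth[OF _ c(1) V, of f] \<open>U \<inter> V = V\<close> by simp
  assume s: "smooth n (\<phi> ` V) (pull U \<phi> f)"
  show "smooth_fun \<A> V f"
  proof (rule smooth_imp_smooth_fun[OF V])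
   fix p assume "p \<in> V"
   then show "\<exists>n U \<phi>. (n, U, \<phi>) \<in> \<A> \<and> p \<in> U \<and> smooth n (\<phi> ` (U \<inter> V)) (pull U \<phi> f)"
    using s c \<open>U \<inter> V = V\<close> by (intro exI[of _ n] exI[of _ U] exI[of _ \<phi>]) auto
  qed
 qed
qed

lemma smooth_fun_cong:
 assumes V: "openin \<T> V" and "smooth_fun \<A> V f" "\<And>p. p \<in> V ==> f p = g p"
 shows "smooth_fun \<A> V g" unfolding smooth_fun_iff[OF V]
proof clarify
 fix n U \<phi> assume c: "(n, U, \<phi>) \<in> \<A>"
 have "smooth n (\<phi> ` (U \<inter> V)) (pull U \<phi> f)" by (rule smooth_fun_imp_smooth[OF assms(2) c V])
 then show "smooth n (\<phi> ` (U \<inter> V)) (pull U \<phi> g)" by (rule smooth_cong) (use assms(3) pull_chart[OF c] in auto)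
qed

lemma smooth_fun_subset:
 assumes f: "smooth_fun \<A> V f" and VW: "openin \<T> V" "openin \<T> W" "W \<subseteq> V"
 shows "smooth_fun \<A> W f" unfolding smooth_fun_iff[OF VW(2)]
proof clarify
 fix n U \<phi> assume c: "(n, U, \<phi>) \<in> \<A>"
 show "smooth n (\<phi> ` (U \<inter> W)) (pull U \<phi> f)" by (rule smooth_subset[OF smooth_fun_imp_smooth[OF f c VW(1)]]) (use VW in auto)
qed

lemma smooth_fun_op:
 assumes V: "openin \<T> V" and f: "smooth_fun \<A> V f" and g: "smooth_fun \<A> V g"
 shows "smooth_fun \<A> V (\<lambda>p. f p + g p)" "smooth_fun \<A> V (\<lambda>p. f p * g p)" "smooth_fun \<A> V (\<lambda>p. - f p)"
  "smooth_fun \<A> V (\<lambda>p. c)" "(\<And>p. p \<in> V ==> 0 < f p) ==> smooth_fun \<A> V (\<lambda>p. ln (f p))"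
  "(\<And>p. p \<in> V ==> f p \<noteq> 0) ==> smooth_fun \<A> V (\<lambda>p. g p / f p)"
proof -
 have p: "pull U \<phi> (\<lambda>p. h (f p) (g p)) = (\<lambda>x. h (pull U \<phi> f x) (pull U \<phi> g x))" for U \<phi> and h :: "real \<Rightarrow> real \<Rightarrow> real"
  by (auto simp: pull_def)
 note s = smooth_fun_imp_smooth[OF f _ V] smooth_fun_imp_smooth[OF g _ V]
 show "smooth_fun \<A> V (\<lambda>p. f p + g p)" unfolding smooth_fun_iff[OF V] p by (auto intro!: smooth_add s)
 show "smooth_fun \<A> V (\<lambda>p. f p * g p)" unfolding smooth_fun_iff[OF V] p by (auto intro!: smooth_mult s)
 show "smooth_fun \<A> V (\<lambda>p. - f p)" unfolding smooth_fun_iff[OF V] p[of _ _ "\<lambda>a b. - a"] by (auto intro!: smooth_minus s)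
 show "smooth_fun \<A> V (\<lambda>p. c)" unfolding smooth_fun_iff[OF V] p[of _ _ "\<lambda>a b. c"] by (auto intro!: smooth_const)
 show "smooth_fun \<A> V (\<lambda>p. ln (f p))" if pos: "\<And>p. p \<in> V ==> 0 < f p" unfolding smooth_fun_iff[OF V] p[of _ _ "\<lambda>a b. ln a"]
  by (auto intro!: smooth_ln s) (use pos pull_chart in force)
 show "smooth_fun \<A> V (\<lambda>p. g p / f p)" if nz: "\<And>p. p \<in> V ==> f p \<noteq> 0" unfolding smooth_fun_iff[OF V] p[of _ _ "\<lambda>a b. b / a"]
  by (auto intro!: smooth_divide s) (use nz pull_chart in force)
qed

text \<open>At a point where \<open>\<phi>\<close> has a vanishing coordinate, that coordinate has a minimum; read in a chart
 which maps the point to the interior, all its partials vanish, contradicting the chain rule.\<close>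

lemma interior_chart_iff:
 assumes c: "(n, U, \<phi>) \<in> \<A>" and p: "p \<in> U"
 shows "p \<in> mfd_interior \<A> \<longleftrightarrow> (\<forall>i<n. 0 < \<phi> p i)"
proof
 assume "\<forall>i<n. 0 < \<phi> p i"
 then show "p \<in> mfd_interior \<A>" using c p unfolding mfd_interior_def by blast
next
 assume "p \<in> mfd_interior \<A>"
 then obtain m U' \<psi> where d: "(m, U', \<psi>) \<in> \<A>" "p \<in> U'" "\<forall>i<m. 0 < \<psi> p i" unfolding mfd_interior_def by blast
 show "\<forall>i<n. 0 < \<phi> p i"
 proof (rule ccontr)
  assume "\<not> ?thesis"
  then obtain i where i': "i < n" "\<not> 0 < \<phi> p i" by blast
  have nn: "0 \<le> \<phi> q i" if "q \<in> U" "i < n" for q i using chart_image_subset[OF c] that by (auto simp: orth_def)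
  have i: "i < n" "\<phi> p i = 0" using i' nn[OF p, of i] by auto
  define q where "q = \<psi> p"
  have open_im: "openin (orthant m) (\<psi> ` (U \<inter> U'))" using chart_open[OF c] chart_open[OF d(1)] by (intro chart_image_openin[OF d(1)]) auto
  define F where "F x = \<phi> (inv_into U' \<psi> x) i" for x
  have F: "smooth m (\<psi> ` (U' \<inter> U)) F" unfolding F_def by (rule transition_smooth[OF d(1) c i(1)])
  \<comment> \<open>Where all coordinates of \<open>\<psi>\<close> are positive, the image is open
    in the whole Euclidean space, so \<open>F\<close> has two-sided partials at its minimum
    \<open>q\<close>.\<close>
  define P where "P = {x :: nat \<Rightarrow> real. \<forall>j<m. 0 < x j}"
  have "open (\<Inter>j\<in>{..<m}. {x :: nat \<Rightarrow> real. 0 < x j})"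
   by (intro open_INT finite_lessThan ballI open_Collect_less continuous_intros continuous_on_coord)
  moreover have "(\<Inter>j\<in>{..<m}. {x :: nat \<Rightarrow> real. 0 < x j}) = P" by (auto simp: P_def)
  ultimately have P: "open P" by simp
  define W where "W = \<psi> ` (U' \<inter> U) \<inter> P"
  obtain O' where O': "open O'" "\<psi> ` (U \<inter> U') = orth m \<inter> O'" using open_im unfolding orthant_top_of_set openin_open by blast
  have "W = espace m \<inter> (O' \<inter> P)" using O'(2) by (auto simp: W_def P_def orth_def Int_commute less_imp_le)
  then have W: "openin (Euclidean_space m) W" unfolding Euclidean_space_top_of_set using O' P by (auto simp: openin_open)
  have qW: "q \<in> W" using d p by (auto simp: W_def P_def q_def)
  have FW: "smooth m W F" by (rule smooth_subset[OF F]) (auto simp: W_def)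
  have "\<exists>g. has_partial j W F g \<and> smooth m W g" if "j < m" for j using smooth_partial[OF slices_fat_openin[OF W] FW that] by metis
  then obtain g where g: "\<And>j. j < m ==> has_partial j W F (g j)" "\<And>j. j < m ==> smooth m W (g j)" by metis
  have F0: "F q = 0" using i d chart_inj[OF d(1)] by (simp add: F_def q_def)
  have Fnn: "0 \<le> F x" if "x \<in> W" for x using that nn i chart_inj[OF d(1)] by (auto simp: W_def F_def)
  have g0: "g j q = 0" if j: "j < m" for j
  proof -
   have "((\<lambda>u. F (q(j := u))) has_real_derivative g j q) (at (q j))"
    using g(1)[OF j] qW slice_at_open[OF W qW j] unfolding has_partial_def by metis
   moreover obtain e where e: "e > 0" "\<forall>u. \<bar>q j - u\<bar> < e \<longrightarrow> q(j := u) \<in> W"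
   proof -
    obtain O2 where O2: "open O2" "W = espace m \<inter> O2" using open_relE[OF W] .
    have "q \<in> espace m" "q \<in> O2" using qW O2 by auto
    then obtain r where r: "r > 0" "espace m \<inter> ebox m q r \<subseteq> O2" using ebox_subset_open[OF O2(1)] by metis
    have "q(j := u) \<in> W" if "\<bar>q j - u\<bar> < r" for u
     using that r O2 \<open>q \<in> espace m\<close> j by (auto simp: ebox_def abs_minus_commute intro!: subsetD[OF r(2)])
    then show ?thesis using that r(1) by blast
   qed
   moreover have "\<forall>u. \<bar>q j - u\<bar> < e \<longrightarrow> F (q(j := q j)) \<le> F (q(j := u))" using e F0 Fnn by simp
   ultimately show ?thesis using DERIV_local_min[of "\<lambda>u. F (q(j := u))"] by blast
  qed
  define T where "T = {u. (\<phi> p)(i := u) \<in> \<phi> ` (U \<inter> U') \<and> \<psi> (inv_into U \<phi> ((\<phi> p)(i := u))) \<in> W}"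
  define \<gamma> where "\<gamma> u = \<psi> (inv_into U \<phi> ((\<phi> p)(i := u)))" for u
  \<comment> \<open>The slice of the image of \<open>\<phi>\<close> may be one-sided here;
    \<open>D\<close> is chosen so that its points are carried into \<open>W\<close>, where the chain
    rule applies.\<close>
  define D where "D = {x \<in> \<phi> ` (U \<inter> U'). \<psi> (inv_into U \<phi> x) \<in> W}"
  have inv: "inv_into U \<phi> (\<phi> r) = r" if "r \<in> U" for r using that chart_inj[OF c] by simp
  have Dopen: "openin (orthant n) D"
  proof -
   have "D = \<phi> ` (U \<inter> (U' \<inter> \<psi> -` W))" using inv by (auto simp: D_def)
   moreover have "openin (orthant m) W"
    using O'(1,2) P unfolding orthant_top_of_set W_def by (auto simp: openin_open Int_commute Int_left_commute intro!: exI[of _ "O' \<inter> P"])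
   then have "openin \<T> (U' \<inter> \<psi> -` W)" by (rule chart_preimage_openin[OF d(1)]) (auto simp: W_def)
   ultimately show ?thesis using chart_open[OF c] by (auto intro!: chart_image_openin[OF c])
  qed
  have pD: "\<phi> p \<in> D" using p d qW inv by (auto simp: D_def q_def)
  have fat: "at (\<phi> p i) within {u. (\<phi> p)(i := u) \<in> D} \<noteq> bot"
   using slices_fat_openin_orthant[OF Dopen] pD i(1) unfolding slices_fat_def by blast
  have "\<exists>h. has_partial i D (\<lambda>x. \<psi> (inv_into U \<phi> x) j) h" if "j < m" for j
  proof -
   have "smooth n D (\<lambda>x. \<psi> (inv_into U \<phi> x) j)" by (rule smooth_subset[OF transition_smooth[OF c d(1) that]]) (auto simp: D_def)
   then show ?thesis using smooth_partial[OF slices_fat_openin_orthant[OF Dopen] _ i(1)] by metis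
  qed
  then obtain h where h: "\<And>j. j < m ==> has_partial i D (\<lambda>x. \<psi> (inv_into U \<phi> x) j) (h j)" by metis
  have "((\<lambda>u. F (\<gamma> u)) has_real_derivative (\<Sum>j<m. g j (\<gamma> (\<phi> p i)) * h j (\<phi> p))) (at (\<phi> p i) within {u. (\<phi> p)(i := u) \<in> D})"
  proof (rule chain_curve[OF W g(1)])
   show "continuous_on W (g j)" if "j < m" for j using smooth_continuous[OF g(2)[OF that]] .
   show "((\<lambda>t. \<gamma> t j) has_real_derivative h j (\<phi> p)) (at (\<phi> p i) within {u. (\<phi> p)(i := u) \<in> D})" if "j < m" for j
    using h[OF that] pD unfolding has_partial_def \<gamma>_def by blast
  qed (use pD in \<open>auto simp: D_def \<gamma>_def\<close>)
  moreover have "\<gamma> (\<phi> p i) = q" using inv[OF p] by (simp add: \<gamma>_def q_def)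
  ultimately have "((\<lambda>u. F (\<gamma> u)) has_real_derivative 0) (at (\<phi> p i) within {u. (\<phi> p)(i := u) \<in> D})" using g0 by simp
  \<comment> \<open>\<open>F\<close> returns the i-th coordinate of \<open>\<phi>\<close>, so along
    the slice it is the identity in \<open>u\<close>, contrary to the derivative 0 just
    found.\<close>
  moreover have "((\<lambda>u. F (\<gamma> u)) has_real_derivative 1) (at (\<phi> p i) within {u. (\<phi> p)(i := u) \<in> D})"
  proof -
   have "((\<lambda>u. u) has_derivative (*) 1) (at (\<phi> p i) within {u. (\<phi> p)(i := u) \<in> D})" by (auto intro!: derivative_eq_intros)
   then have "((\<lambda>u. F (\<gamma> u)) has_derivative (*) 1) (at (\<phi> p i) within {u. (\<phi> p)(i := u) \<in> D})"
   proof (rule has_derivative_transform[rotated 2])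
    fix u assume "u \<in> {u. (\<phi> p)(i := u) \<in> D}"
    then obtain r where r: "r \<in> U" "r \<in> U'" "(\<phi> p)(i := u) = \<phi> r" by (auto simp: D_def)
    then have "F (\<gamma> u) = \<phi> r i" using inv chart_inj[OF d(1)] by (simp add: F_def \<gamma>_def)
    also have "\<dots> = u" using r(3) by (metis fun_upd_same)
    finally show "F (\<gamma> u) = u" .
   qed (use pD in simp)
   then show ?thesis by (simp add: has_field_derivative_def)
  qed
  ultimately have "(0::real) = 1" using tendsto_unique[OF fat] unfolding has_field_derivative_iff by blast
  then show False by simp
 qed
qed

end

section \<open>Polynomials with smooth coefficients, evaluated at points\<close>

abbreviation coef :: "('a \<Rightarrow>\<^sub>0 'b::zero) \<Rightarrow> 'a \<Rightarrow> 'b" where "coef \<equiv> Poly_Mapping.lookup"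
abbreviation keys :: "('a \<Rightarrow>\<^sub>0 'b::zero) \<Rightarrow> 'a set" where "keys \<equiv> Poly_Mapping.keys"

text \<open>The homomorphism of real polynomial algebras that sends the variable \<open>x\<close> to
  \<open>v x\<close>. Polynomials are finitely supported maps on multisets, so the ring structure of
  the type is the polynomial one.\<close>

definition subst_poly :: "('c \<Rightarrow> 'd multiset \<Rightarrow>\<^sub>0 real) \<Rightarrow> ('c multiset \<Rightarrow>\<^sub>0 real) \<Rightarrow> 'd multiset \<Rightarrow>\<^sub>0 real" where
 "subst_poly v p = (\<Sum>m\<in>keys p. Poly_Mapping.single 0 (coef p m) * prod_mset (image_mset v m))"

abbreviation pconst :: "real \<Rightarrow> 'd multiset \<Rightarrow>\<^sub>0 real" where "pconst c \<equiv> Poly_Mapping.single 0 c"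
abbreviation pvar :: "'d \<Rightarrow> 'd multiset \<Rightarrow>\<^sub>0 real" where "pvar x \<equiv> Poly_Mapping.single {#x#} 1"

lemma subst_poly_superset:
 assumes "finite S" "keys p \<subseteq> S"
 shows "subst_poly v p = (\<Sum>m\<in>S. pconst (coef p m) * prod_mset (image_mset v m))" unfolding subst_poly_def
 by (rule sum.mono_neutral_left) (use assms in \<open>auto simp: in_keys_iff\<close>)

lemma subst_poly_add: "subst_poly v (p + q) = subst_poly v p + subst_poly v q"
proof -
 let ?S = "keys p \<union> keys q"
 have "keys (p + q) \<subseteq> ?S" by (rule Poly_Mapping.keys_add)
 then show ?thesis by (simp add: subst_poly_superset[of ?S] lookup_add single_add distrib_right sum.distrib)
qed

lemma subst_poly_zero [simp]: "subst_poly v 0 = 0" by (simp add: subst_poly_def)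

lemma subst_poly_sum: "subst_poly v (sum f A) = (\<Sum>a\<in>A. subst_poly v (f a))"
 by (induction A rule: infinite_finite_induct) (auto simp: subst_poly_add)

lemma subst_poly_single: "subst_poly v (Poly_Mapping.single m c) = pconst c * prod_mset (image_mset v m)"
 by (cases "c = 0") (auto simp: subst_poly_def)

lemma poly_mapping_sum_single:
 fixes p :: "'a \<Rightarrow>\<^sub>0 'b::comm_monoid_add"
 shows "p = (\<Sum>m\<in>keys p. Poly_Mapping.single m (coef p m))"
proof (rule poly_mapping_eqI)
 fix k
 show "coef p k = coef (\<Sum>m\<in>keys p. Poly_Mapping.single m (coef p m)) k"
  by (simp add: lookup_sum lookup_single when_def in_keys_iff sum.delta)
qed

lemma poly_mapping_mult_expand:
 fixes p q :: "'a::monoid_add \<Rightarrow>\<^sub>0 'b::semiring_0"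
 shows "p * q = (\<Sum>m\<in>keys p. \<Sum>l\<in>keys q.
   Poly_Mapping.single (m + l) (coef p m * coef q l))"
proof -
 have "p * q = (\<Sum>m\<in>keys p. Poly_Mapping.single m (coef p m)) *
  (\<Sum>l\<in>keys q. Poly_Mapping.single l (coef q l))" using poly_mapping_sum_single[of p] poly_mapping_sum_single[of q] by simp
 then show ?thesis by (simp add: sum_product mult_single)
qed

lemma subst_poly_mult:
 fixes v :: "'c \<Rightarrow> 'd multiset \<Rightarrow>\<^sub>0 real"
 shows "subst_poly v (p * q) = subst_poly v p * subst_poly v q"
proof -
 have "subst_poly v (p * q) = (\<Sum>m\<in>keys p. \<Sum>l\<in>keys q.
   pconst (coef p m * coef q l) * prod_mset (image_mset v (m + l)))"
  by (simp only: poly_mapping_mult_expand[of p q] subst_poly_sum subst_poly_single)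
 also have "\<dots> = subst_poly v p * subst_poly v q" unfolding subst_poly_def sum_product
 proof (intro sum.cong refl)
  fix m l
  have "pconst (coef p m * coef q l) = pconst (coef p m) * (pconst (coef q l) :: 'd multiset \<Rightarrow>\<^sub>0 real)" by (simp add: mult_single)
  then show "pconst (coef p m * coef q l) * prod_mset (image_mset v (m + l)) =
   pconst (coef p m) * prod_mset (image_mset v m) * (pconst (coef q l) * prod_mset (image_mset v l))" by (simp add: mult_ac)
 qed
 finally show ?thesis .
qed

lemma subst_poly_one [simp]: "subst_poly v 1 = 1" using subst_poly_single[of v 0 1] by simp

lemma subst_poly_const [simp]: "subst_poly v (pconst c) = pconst c" by (simp add: subst_poly_single)

lemma subst_poly_var [simp]: "subst_poly v (pvar x) = v x" by (simp add: subst_poly_single)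

lemma subst_poly_prod_mset: "subst_poly v (prod_mset (image_mset w m)) = prod_mset (image_mset (\<lambda>x. subst_poly v (w x)) m)"
 by (induction m) (auto simp: subst_poly_mult)

lemma subst_poly_compose: "subst_poly v (subst_poly w p) = subst_poly (\<lambda>x. subst_poly v (w x)) p"
proof -
 have "subst_poly v (subst_poly w p) = (\<Sum>m\<in>keys p. subst_poly v (pconst (coef p m) * prod_mset (image_mset w m)))"
  by (simp add: subst_poly_def[of w p] subst_poly_sum)
 then show ?thesis by (simp add: subst_poly_mult subst_poly_prod_mset subst_poly_def[of _ p])
qed

lemma subst_poly_minus: "subst_poly v (- p) = - subst_poly v p"
 using subst_poly_add[of v p "- p"] by (simp add: eq_neg_iff_add_eq_0 add.commute)

lemma subst_poly_diff: "subst_poly v (p - q) = subst_poly v p - subst_poly v q"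
 using subst_poly_add[of v p "- q"] by (simp add: subst_poly_minus)

lemma subst_poly_cong:
 assumes "\<And>m x. m \<in> keys p ==> x \<in># m ==> v x = w x" shows "subst_poly v p = subst_poly w p" unfolding subst_poly_def
 by (intro sum.cong refl arg_cong2[where f = times] arg_cong[where f = prod_mset] image_mset_cong assms) auto

lemma prod_mset_pvar: "prod_mset (image_mset pvar m) = Poly_Mapping.single m 1"
 by (induction m) (auto simp: mult_single simp flip: single_one)

lemma finite_submultisets: "finite {a. a \<subseteq># (m :: 'a multiset)}"
proof (rule finite_subset)
 show "{a. a \<subseteq># m} \<subseteq> mset ` {xs. set xs \<subseteq> set_mset m \<and> length xs \<le> size m}"
 proof
  fix a assume "a \<in> {a. a \<subseteq># m}"
  then have a: "a \<subseteq># m" by simp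
  obtain xs where xs: "mset xs = a" using ex_mset by blast
  have "set xs \<subseteq> set_mset m" using xs set_mset_mono[OF a] by (metis set_mset_mset)
  moreover have "length xs \<le> size m" using xs size_mset_mono[OF a] by (metis size_mset)
  ultimately show "a \<in> mset ` {xs. set xs \<subseteq> set_mset m \<and> length xs \<le> size m}" using xs by blast
 qed
 show "finite (mset ` {xs. set xs \<subseteq> set_mset m \<and> length xs \<le> size m})" by (intro finite_imageI finite_lists_length_le) simp
qed

text \<open>Convolution over the monoid of multisets, brought into the form by which
  \<open>mpoly_ring\<close> multiplies; this links the two encodings of polynomials.\<close>

lemma lookup_mult_mset:
 fixes p q :: "'c multiset \<Rightarrow>\<^sub>0 real"
 shows "coef (p * q) m = (\<Sum>a\<in>{a. a \<subseteq># m}. coef p a * coef q (m - a))"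
proof -
 let ?P = "keys p" and ?Q = "keys q"
 have "coef (p * q) m = (\<Sum>a\<in>?P. \<Sum>b\<in>?Q. if a + b = m then coef p a * coef q b else 0)"
  by (simp add: poly_mapping_mult_expand[of p q] lookup_sum lookup_single when_def)
 also have "\<dots> = (\<Sum>a\<in>?P. if a \<subseteq># m then coef p a * coef q (m - a) else 0)"
 proof (rule sum.cong)
  fix a
  have "(\<Sum>b\<in>?Q. if a + b = m then coef p a * coef q b else 0) =
   (\<Sum>b\<in>?Q. if b = m - a then (if a \<subseteq># m then coef p a * coef q (m - a) else 0) else 0)"
  proof (rule sum.cong)
   fix b
   show "(if a + b = m then coef p a * coef q b else 0) =
    (if b = m - a then (if a \<subseteq># m then coef p a * coef q (m - a) else 0) else 0)" by (auto simp: subset_mset.add_diff_inverse)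
  qed simp
  then show "(\<Sum>b\<in>?Q. if a + b = m then coef p a * coef q b else 0) =
    (if a \<subseteq># m then coef p a * coef q (m - a) else 0)" by (simp add: sum.delta in_keys_iff)
 qed simp
 also have "\<dots> = (\<Sum>a\<in>{a \<in> ?P. a \<subseteq># m}. coef p a * coef q (m - a))" by (simp add: sum.inter_filter)
 also have "\<dots> = (\<Sum>a\<in>{a. a \<subseteq># m}. coef p a * coef q (m - a))"
  by (rule sum.mono_neutral_left[OF finite_submultisets]) (auto simp: in_keys_iff)
 finally show ?thesis .
qed

section \<open>Polynomial rings with an explicit carrier\<close>

context ring
begin

definition poly_monom :: "'c multiset \<Rightarrow> 'a \<Rightarrow> 'c multiset \<Rightarrow> 'a" where
 "poly_monom m c = (\<lambda>l. if l = m then c else \<zero>)"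

lemma poly_monom_in_pset:
 fixes m :: "'c multiset"
 shows "set_mset m \<subseteq> I ==> c \<in> carrier R ==> poly_monom m c \<in> indexed_pset I (carrier R)"
proof (induction m)
 case empty
 have "poly_monom {#} c = (indexed_const c :: 'c multiset \<Rightarrow> 'a)" by (auto simp: poly_monom_def indexed_const_def)
 then show ?case using indexed_pset.indexed_const[OF empty.prems(2)] by simp
next
 case (add x m)
 have "poly_monom (add_mset x m) c = indexed_pmult (poly_monom m c) x"
  by (auto simp: poly_monom_def indexed_pmult_def fun_eq_iff dest!: multi_member_split)
 then show ?case using indexed_pset.indexed_pmult[of "poly_monom m c" I "carrier R" x] add by simp
qed

text \<open>Turns the inductive generation by constants, sums and multiplication by variables into a
  description by supports: a finite family is the sum of its monomials, and each monomial is built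
  from a constant.\<close>

lemma indexed_pset_iff:
 fixes P :: "'c multiset \<Rightarrow> 'a"
 shows "P \<in> indexed_pset I (carrier R) \<longleftrightarrow>
  finite {m. P m \<noteq> \<zero>} \<and> (\<forall>m. P m \<in> carrier R) \<and> (\<forall>m. P m \<noteq> \<zero> \<longrightarrow> set_mset m \<subseteq> I)" (is "?L = ?R")
proof
 assume ?L
 then show ?R
 proof (induction rule: indexed_pset.induct)
  case (indexed_const k)
  have "{m. indexed_const k m \<noteq> \<zero>} \<subseteq> {{#}}" by (auto simp: indexed_const_def)
  then show ?case using indexed_const finite_subset by (auto simp: indexed_const_def split: if_splits)
 next
  case (indexed_padd P Q)
  have "{m. indexed_padd P Q m \<noteq> \<zero>} \<subseteq> {m. P m \<noteq> \<zero>} \<union> {m. Q m \<noteq> \<zero>}" by (auto simp: indexed_padd_def)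
  then have "finite {m. indexed_padd P Q m \<noteq> \<zero>}" using indexed_padd.IH by (meson finite_UnI finite_subset)
  moreover have "set_mset m \<subseteq> I" if "indexed_padd P Q m \<noteq> \<zero>" for m
   using that indexed_padd.IH by (cases "P m = \<zero>") (auto simp: indexed_padd_def)
  ultimately show ?case using indexed_padd.IH by (simp add: indexed_padd_def)
 next
  case (indexed_pmult P i)
  have sub: "{m. indexed_pmult P i m \<noteq> \<zero>} \<subseteq> add_mset i ` {m. P m \<noteq> \<zero>}"
  proof
   fix m assume "m \<in> {m. indexed_pmult P i m \<noteq> \<zero>}"
   then have m: "i \<in># m" "P (m - {#i#}) \<noteq> \<zero>" by (auto simp: indexed_pmult_def split: if_splits)
   show "m \<in> add_mset i ` {m. P m \<noteq> \<zero>}" by (rule image_eqI[of _ _ "m - {#i#}"]) (use m in auto)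
  qed
  have fin: "finite {m. indexed_pmult P i m \<noteq> \<zero>}" by (rule finite_subset[OF sub finite_imageI]) (use indexed_pmult.IH in blast)
  have "set_mset m \<subseteq> I" if "indexed_pmult P i m \<noteq> \<zero>" for m
  proof -
   have m: "i \<in># m" "P (m - {#i#}) \<noteq> \<zero>" using that by (auto simp: indexed_pmult_def split: if_splits)
   then have "set_mset (m - {#i#}) \<subseteq> I" using indexed_pmult.IH by blast
   moreover have "m = add_mset i (m - {#i#})" using m by simp
   ultimately show ?thesis using indexed_pmult.hyps(2) by (metis insert_subset set_mset_add_mset_insert)
  qed
  then show ?case using fin indexed_pmult.IH by (simp add: indexed_pmult_def)
 qed
next
 assume R: ?R
 have "(\<lambda>m. if m \<in> S then P m else \<zero>) \<in> indexed_pset I (carrier R)" if "finite S" "S \<subseteq> {m. P m \<noteq> \<zero>}" for S using that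
 proof (induction S rule: finite_induct)
  case empty
  have "(\<lambda>m. \<zero>) = (indexed_const \<zero> :: 'c multiset \<Rightarrow> 'a)" by (simp add: indexed_zero_def)
  then show ?case using indexed_pset.indexed_const[of "\<zero>" "carrier R" I] by simp
 next
  case (insert s S)
  have "(\<lambda>m. if m \<in> insert s S then P m else \<zero>) = indexed_padd (poly_monom s (P s)) (\<lambda>m. if m \<in> S then P m else \<zero>)"
   using insert.hyps R by (auto simp: indexed_padd_def poly_monom_def fun_eq_iff)
  moreover have "poly_monom s (P s) \<in> indexed_pset I (carrier R)" using insert.prems R by (intro poly_monom_in_pset) auto
  ultimately show ?case using indexed_pset.indexed_padd insert by auto
 qed
 from this[of "{m. P m \<noteq> \<zero>}"] R
 have "(\<lambda>m. if m \<in> {m. P m \<noteq> \<zero>} then P m else \<zero>) \<in> indexed_pset I (carrier R)" by simp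
 moreover have "(\<lambda>m. if m \<in> {m. P m \<noteq> \<zero>} then P m else \<zero>) = P" by auto
 ultimately show ?L by simp
qed

end

lemma lookup_mult_pvar:
 "coef (p * pvar i) m = (if i \<in># m then coef p (m - {#i#}) else 0)"
proof -
 have e: "m - a = {#i#} \<longleftrightarrow> i \<in># m \<and> a = m - {#i#}" if "a \<subseteq># m" for a
 proof
  assume "m - a = {#i#}"
  then have "m = add_mset i a" using that by (metis add_mset_add_single subset_mset.diff_add union_commute)
  then show "i \<in># m \<and> a = m - {#i#}" by simp
 next
  assume "i \<in># m \<and> a = m - {#i#}"
  then show "m - a = {#i#}" by (metis add_diff_cancel_right' insert_DiffM add_mset_add_single union_commute)
 qed
 have "coef (p * pvar i) m = (\<Sum>a\<in>{a. a \<subseteq># m}. coef p a * coef (pvar i) (m - a))" by (rule lookup_mult_mset)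
 also have "\<dots> = (\<Sum>a\<in>{a. a \<subseteq># m}. if a = m - {#i#} then (if i \<in># m then coef p (m - {#i#}) else 0) else 0)"
 proof (rule sum.cong[OF refl])
  fix a assume "a \<in> {a. a \<subseteq># m}"
  then have "m - a = {#i#} \<longleftrightarrow> i \<in># m \<and> a = m - {#i#}" using e by blast
  then show "coef p a * coef (pvar i) (m - a) =
    (if a = m - {#i#} then (if i \<in># m then coef p (m - {#i#}) else 0) else 0)" by (auto simp: lookup_single when_def)
 qed
 also have "\<dots> = (if i \<in># m then coef p (m - {#i#}) else 0)" using finite_submultisets[of m] by (simp add: sum.delta)
 finally show ?thesis .
qed

text \<open>The ring axioms are pulled back along a jointly injective family of evaluations into a
  ring of the type class. It serves the rings of smooth functions as well as the polynomial rings
  over them.\<close>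

lemma cring_pointwise:
 fixes G (structure) and e :: "'q \<Rightarrow> 'a \<Rightarrow> 'b::comm_ring_1"
 assumes ext: "\<And>x y. x \<in> carrier G ==> y \<in> carrier G ==> (\<And>q. q \<in> V ==> e q x = e q y) ==> x = y"
  and closed: "\<And>x y. x \<in> carrier G ==> y \<in> carrier G ==> x \<oplus> y \<in> carrier G"
   "\<And>x y. x \<in> carrier G ==> y \<in> carrier G ==> x \<otimes> y \<in> carrier G" "\<zero> \<in> carrier G" "\<one> \<in> carrier G"
  and ops: "\<And>q x y. q \<in> V ==> x \<in> carrier G ==> y \<in> carrier G ==> e q (x \<oplus> y) = e q x + e q y"
   "\<And>q x y. q \<in> V ==> x \<in> carrier G ==> y \<in> carrier G ==> e q (x \<otimes> y) = e q x * e q y"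
   "\<And>q. q \<in> V ==> e q \<zero> = 0" "\<And>q. q \<in> V ==> e q \<one> = 1"
  and neg: "\<And>x. x \<in> carrier G ==> \<exists>y\<in>carrier G. \<forall>q\<in>V. e q y = - e q x"
 shows "cring G"
proof (rule cringI)
 show "abelian_group G"
 proof (rule abelian_groupI)
  show "\<exists>y\<in>carrier G. y \<oplus> x = \<zero>" if x: "x \<in> carrier G" for x
  proof -
   obtain y where y: "y \<in> carrier G" "\<forall>q\<in>V. e q y = - e q x" using neg[OF x] by (rule bexE)
   have "y \<oplus> x = \<zero>" by (rule ext) (use x y in \<open>simp_all add: closed ops\<close>)
   then show ?thesis using y(1) by (rule bexI)
  qed
 qed ((rule ext)?, simp_all add: closed ops algebra_simps)+
 show "comm_monoid G" by (rule comm_monoidI) ((rule ext)?, simp_all add: closed ops algebra_simps)+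
 show "(x \<oplus> y) \<otimes> z = x \<otimes> z \<oplus> y \<otimes> z" if "x \<in> carrier G" "y \<in> carrier G" "z \<in> carrier G" for x y z
  by (rule ext) (use that in \<open>simp_all add: closed ops algebra_simps\<close>)
qed

section \<open>Smooth functions and polynomials over them, compared at points\<close>

context mwc
begin

abbreviation opn :: "'p set \<Rightarrow> bool" where "opn V \<equiv> openin \<T> V"

abbreviation R :: "'p set \<Rightarrow> ('p \<Rightarrow> real) ring" where "R V \<equiv> smooth_ring \<A> V"

lemma R_simps [simp]:
 "f \<otimes>\<^bsub>R V\<^esub> g = (\<lambda>p\<in>V. f p * g p)" "\<one>\<^bsub>R V\<^esub> = (\<lambda>p\<in>V. 1)" "\<zero>\<^bsub>R V\<^esub> = (\<lambda>p\<in>V. 0)"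
 "f \<oplus>\<^bsub>R V\<^esub> g = (\<lambda>p\<in>V. f p + g p)" by (simp_all add: smooth_ring_def)

lemma R_carrier: "f \<in> carrier (R V) \<longleftrightarrow> f \<in> extensional V \<and> smooth_fun \<A> V f" by (simp add: smooth_ring_def)

lemma R_memI:
 assumes "opn V" "smooth_fun \<A> V f" shows "restrict f V \<in> carrier (R V)" using assms by (auto simp: R_carrier intro: smooth_fun_cong)

lemma R_restrict: "opn V ==> opn W ==> W \<subseteq> V ==> f \<in> carrier (R V) ==> restrict f W \<in> carrier (R W)"
 by (rule R_memI) (auto simp: R_carrier intro: smooth_fun_subset)

lemma R_ext: "f \<in> carrier (R V) ==> g \<in> carrier (R V) ==> (\<And>p. p \<in> V ==> f p = g p) ==> f = g" by (auto simp: R_carrier intro: extensionalityI)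

lemma smooth_fun_const: "opn V ==> smooth_fun \<A> V (\<lambda>p. c)"
proof -
 assume V: "opn V"
 have "pull U \<phi> (\<lambda>p. c) = (\<lambda>x. c)" for U :: "'p set" and \<phi> by (simp add: pull_def o_def)
 then show ?thesis unfolding smooth_fun_iff[OF V] using smooth_const by auto
qed

lemma R_closed:
 assumes V: "opn V"
 shows "(\<lambda>p\<in>V. c) \<in> carrier (R V)"
  "f \<in> carrier (R V) ==> g \<in> carrier (R V) ==> (\<lambda>p\<in>V. f p + g p) \<in> carrier (R V)"
  "f \<in> carrier (R V) ==> g \<in> carrier (R V) ==> (\<lambda>p\<in>V. f p * g p) \<in> carrier (R V)"
  "f \<in> carrier (R V) ==> (\<lambda>p\<in>V. - f p) \<in> carrier (R V)"
proof -
 show "(\<lambda>p\<in>V. c) \<in> carrier (R V)" by (rule R_memI[OF V smooth_fun_const[OF V]])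
 show "(\<lambda>p\<in>V. f p + g p) \<in> carrier (R V)" if "f \<in> carrier (R V)" "g \<in> carrier (R V)"
  by (rule R_memI[OF V smooth_fun_op(1)[OF V]]) (use that in \<open>simp_all add: R_carrier\<close>)
 show "(\<lambda>p\<in>V. f p * g p) \<in> carrier (R V)" if "f \<in> carrier (R V)" "g \<in> carrier (R V)"
  by (rule R_memI[OF V smooth_fun_op(2)[OF V]]) (use that in \<open>simp_all add: R_carrier\<close>)
 show "(\<lambda>p\<in>V. - f p) \<in> carrier (R V)" if "f \<in> carrier (R V)"
  by (rule R_memI[OF V smooth_fun_op(3)[OF V, where g = f]]) (use that in \<open>simp_all add: R_carrier\<close>)
qed

lemma cring_R:
 assumes V: "opn V" shows "cring (R V)"
proof (rule cring_pointwise[where V = V and e = "\<lambda>q f. f q"])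
 show "f = g" if "f \<in> carrier (R V)" "g \<in> carrier (R V)" "\<And>q. q \<in> V ==> f q = g q" for f g by (rule R_ext[OF that])
 show "\<exists>g\<in>carrier (R V). \<forall>q\<in>V. g q = - f q" if "f \<in> carrier (R V)" for f by (rule bexI[OF _ R_closed(4)[OF V that]]) simp
qed (use R_closed[OF V] in simp_all)

lemma R_finsum:
 assumes V: "opn V" and "finite S" "\<And>a. a \<in> S ==> f a \<in> carrier (R V)" "q \<in> V"
 shows "(\<Oplus>\<^bsub>R V\<^esub>a\<in>S. f a) q = (\<Sum>a\<in>S. f a q)"
proof -
 interpret cring "R V" by (rule cring_R[OF V])
 show ?thesis using assms(2,3)
 proof (induction S rule: finite_induct)
  case empty then show ?case using assms(4) by simp
 next
  case (insert a S)
  have "(\<Oplus>\<^bsub>R V\<^esub>a\<in>insert a S. f a) = f a \<oplus>\<^bsub>R V\<^esub> (\<Oplus>\<^bsub>R V\<^esub>a\<in>S. f a)" by (rule finsum_insert) (use insert in auto)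
  then show ?case using insert assms(4) by simp
 qed
qed

abbreviation MP :: "'p set \<Rightarrow> 'c set \<Rightarrow> ('c multiset \<Rightarrow> 'p \<Rightarrow> real) ring" where "MP V I \<equiv> mpoly_ring (R V) I"

lemma MP_simps:
 "mult (MP V I) P Q = (\<lambda>m. \<Oplus>\<^bsub>R V\<^esub>a\<in>{a. a \<subseteq># m}. P a \<otimes>\<^bsub>R V\<^esub> Q (m - a))"
 "one (MP V I) = ring.indexed_const (R V) \<one>\<^bsub>R V\<^esub>" "zero (MP V I) = ring.indexed_const (R V) \<zero>\<^bsub>R V\<^esub>"
 "add (MP V I) = ring.indexed_padd (R V)" "carrier (MP V I) = ring.indexed_pset (R V) I (carrier (R V))" by (simp_all add: mpoly_ring_def)

lemma MP_carrier:
 assumes V: "opn V"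
 shows "P \<in> carrier (MP V I) \<longleftrightarrow> finite {m. P m \<noteq> \<zero>\<^bsub>R V\<^esub>} \<and> (\<forall>m. P m \<in> carrier (R V)) \<and> (\<forall>m. P m \<noteq> \<zero>\<^bsub>R V\<^esub> \<longrightarrow> set_mset m \<subseteq> I)"
proof -
 interpret cring "R V" by (rule cring_R[OF V])
 show ?thesis unfolding MP_simps(5) by (rule indexed_pset_iff)
qed

text \<open>The real polynomial obtained by evaluating all coefficients at \<open>q\<close>. It is
  meaningful for finitely supported values only, since \<open>Abs_poly_mapping\<close> is
  unspecified otherwise.\<close>

definition at_pt :: "('c multiset \<Rightarrow> 'p \<Rightarrow> real) \<Rightarrow> 'p \<Rightarrow> 'c multiset \<Rightarrow>\<^sub>0 real" where
 "at_pt P q = Abs_poly_mapping (\<lambda>m. P m q)"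

lemma lookup_at_pt:
 assumes V: "opn V" and P: "P \<in> carrier (MP V I)" and q: "q \<in> V"
 shows "coef (at_pt P q) m = P m q"
proof -
 have "{m. P m q \<noteq> 0} \<subseteq> {m. P m \<noteq> \<zero>\<^bsub>R V\<^esub>}" using q by auto
 then have "finite {m. P m q \<noteq> 0}" using P MP_carrier[OF V] finite_subset by blast
 then show ?thesis by (simp add: at_pt_def)
qed

text \<open>Point evaluations separate polynomials, so identities between them are checked as
  identities of real polynomials.\<close>

lemma MP_ext:
 assumes V: "opn V" and P: "P \<in> carrier (MP V I)" and Q: "Q \<in> carrier (MP V J)"
  and e: "\<And>q. q \<in> V ==> at_pt P q = at_pt Q q"
 shows "P = Q"
proof
 fix m show "P m = Q m"
 proof (rule R_ext[of _ V])
  fix q assume "q \<in> V"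
  then show "P m q = Q m q" using e lookup_at_pt[OF V P] lookup_at_pt[OF V Q] by metis
 qed (use P Q MP_carrier[OF V] in auto)
qed

lemma MP_add:
 assumes V: "opn V" and P: "P \<in> carrier (MP V I)" and Q: "Q \<in> carrier (MP V I)"
 shows "P \<oplus>\<^bsub>MP V I\<^esub> Q \<in> carrier (MP V I)" "q \<in> V ==> at_pt (P \<oplus>\<^bsub>MP V I\<^esub> Q) q = at_pt P q + at_pt Q q"
proof -
 interpret cring "R V" by (rule cring_R[OF V])
 show c: "P \<oplus>\<^bsub>MP V I\<^esub> Q \<in> carrier (MP V I)" using P Q unfolding MP_simps by (rule indexed_pset.indexed_padd)
 show "at_pt (P \<oplus>\<^bsub>MP V I\<^esub> Q) q = at_pt P q + at_pt Q q" if q: "q \<in> V"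
 proof (rule poly_mapping_eqI)
  fix m
  have "(P \<oplus>\<^bsub>MP V I\<^esub> Q) m q = P m q + Q m q" using q by (simp add: MP_simps(4) indexed_padd_def)
  then show "coef (at_pt (P \<oplus>\<^bsub>MP V I\<^esub> Q) q) m = coef (at_pt P q + at_pt Q q) m"
   by (simp only: lookup_at_pt[OF V c q] lookup_at_pt[OF V P q] lookup_at_pt[OF V Q q] lookup_add)
 qed
qed

lemma MP_mult:
 assumes V: "opn V" and P: "P \<in> carrier (MP V I)" and Q: "Q \<in> carrier (MP V I)"
 shows "P \<otimes>\<^bsub>MP V I\<^esub> Q \<in> carrier (MP V I)" "q \<in> V ==> at_pt (P \<otimes>\<^bsub>MP V I\<^esub> Q) q = at_pt P q * at_pt Q q"
proof -
 interpret cring "R V" by (rule cring_R[OF V])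
 have Pc: "P m \<in> carrier (R V)" and Qc: "Q m \<in> carrier (R V)" for m using P Q MP_carrier[OF V] by auto
 have val: "(P \<otimes>\<^bsub>MP V I\<^esub> Q) m q = (\<Sum>a\<in>{a. a \<subseteq># m}. P a q * Q (m - a) q)" if "q \<in> V" for m q
 proof -
  have "(P \<otimes>\<^bsub>MP V I\<^esub> Q) m q = (\<Sum>a\<in>{a. a \<subseteq># m}. (P a \<otimes>\<^bsub>R V\<^esub> Q (m - a)) q)"
   unfolding MP_simps by (rule R_finsum[OF V finite_submultisets m_closed[OF Pc Qc] that])
  then show ?thesis using that by simp
 qed
 have mc: "(P \<otimes>\<^bsub>MP V I\<^esub> Q) m \<in> carrier (R V)" for m unfolding MP_simps by (rule finsum_closed) (simp only: Pi_I m_closed[OF Pc Qc])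
 have nz: "\<exists>a. a \<subseteq># m \<and> P a \<noteq> \<zero>\<^bsub>R V\<^esub> \<and> Q (m - a) \<noteq> \<zero>\<^bsub>R V\<^esub>" if "(P \<otimes>\<^bsub>MP V I\<^esub> Q) m \<noteq> \<zero>\<^bsub>R V\<^esub>" for m
 proof (rule ccontr)
  assume no: "\<not> ?thesis"
  have "(P \<otimes>\<^bsub>MP V I\<^esub> Q) m = \<zero>\<^bsub>R V\<^esub>"
  proof (rule R_ext[OF mc zero_closed])
   fix q assume q: "q \<in> V"
   have "P a q * Q (m - a) q = 0" if "a \<subseteq># m" for a using no that q by (cases "P a = \<zero>\<^bsub>R V\<^esub>") auto
   then have "(\<Sum>a\<in>{a. a \<subseteq># m}. P a q * Q (m - a) q) = 0" by (intro sum.neutral) blast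
   then show "(P \<otimes>\<^bsub>MP V I\<^esub> Q) m q = \<zero>\<^bsub>R V\<^esub> q" unfolding val[OF q] using q by simp
  qed
  then show False using that by simp
 qed
 have "{m. (P \<otimes>\<^bsub>MP V I\<^esub> Q) m \<noteq> \<zero>\<^bsub>R V\<^esub>} \<subseteq> (\<lambda>(a, b). a + b) ` ({m. P m \<noteq> \<zero>\<^bsub>R V\<^esub>} \<times> {m. Q m \<noteq> \<zero>\<^bsub>R V\<^esub>})"
 proof
  fix m assume "m \<in> {m. (P \<otimes>\<^bsub>MP V I\<^esub> Q) m \<noteq> \<zero>\<^bsub>R V\<^esub>}"
  then obtain a where a: "a \<subseteq># m" "P a \<noteq> \<zero>\<^bsub>R V\<^esub>" "Q (m - a) \<noteq> \<zero>\<^bsub>R V\<^esub>" using nz by blast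
  show "m \<in> (\<lambda>(a, b). a + b) ` ({m. P m \<noteq> \<zero>\<^bsub>R V\<^esub>} \<times> {m. Q m \<noteq> \<zero>\<^bsub>R V\<^esub>})"
   by (rule image_eqI[of _ _ "(a, m - a)"]) (use a in \<open>auto simp del: R_simps\<close>)
 qed
 then have fin: "finite {m. (P \<otimes>\<^bsub>MP V I\<^esub> Q) m \<noteq> \<zero>\<^bsub>R V\<^esub>}" by (rule finite_subset) (use P Q MP_carrier[OF V] in blast)
 have "set_mset m \<subseteq> I" if m: "(P \<otimes>\<^bsub>MP V I\<^esub> Q) m \<noteq> \<zero>\<^bsub>R V\<^esub>" for m
 proof -
  from nz[OF m] obtain a where a: "a \<subseteq># m" "P a \<noteq> \<zero>\<^bsub>R V\<^esub>" "Q (m - a) \<noteq> \<zero>\<^bsub>R V\<^esub>" by blast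
  then have "set_mset a \<subseteq> I" "set_mset (m - a) \<subseteq> I" using P Q MP_carrier[OF V] by blast+
  moreover have "set_mset m = set_mset a \<union> set_mset (m - a)" using a(1) by (metis set_mset_union subset_mset.add_diff_inverse)
  ultimately show ?thesis by blast
 qed
 then show c: "P \<otimes>\<^bsub>MP V I\<^esub> Q \<in> carrier (MP V I)" unfolding MP_carrier[OF V] using fin mc by blast
 show "at_pt (P \<otimes>\<^bsub>MP V I\<^esub> Q) q = at_pt P q * at_pt Q q" if q: "q \<in> V" by (rule poly_mapping_eqI)
   (simp only: lookup_at_pt[OF V c q] lookup_at_pt[OF V P q] lookup_at_pt[OF V Q q] lookup_mult_mset val[OF q])
qed

lemma MP_const:
 assumes V: "opn V" and f: "f \<in> carrier (R V)"
 shows "ring.indexed_const (R V) f \<in> carrier (MP V I)" "q \<in> V ==> at_pt (ring.indexed_const (R V) f) q = pconst (f q)"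
proof -
 interpret cring "R V" by (rule cring_R[OF V])
 show c: "indexed_const f \<in> carrier (MP V I)" for I :: "'c set" unfolding MP_simps using f by (rule indexed_pset.indexed_const)
 show "at_pt (indexed_const f) q = pconst (f q)" if q: "q \<in> V"
 proof (rule poly_mapping_eqI)
  fix m :: "'c multiset"
  have "indexed_const f m q = coef (pconst (f q)) m" using q by (simp add: indexed_const_def lookup_single when_def)
  then show "coef (at_pt (indexed_const f) q) m = coef (pconst (f q)) m" by (simp only: lookup_at_pt[OF V c[of UNIV] q])
 qed
qed

lemma MP_var:
 assumes V: "opn V" and i: "i \<in> I"
 shows "ring.indexed_var (R V) i \<in> carrier (MP V I)" "q \<in> V ==> at_pt (ring.indexed_var (R V) i) q = pvar i"
proof -
 interpret cring "R V" by (rule cring_R[OF V])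
 show c: "indexed_var i \<in> carrier (MP V I)" unfolding MP_simps indexed_var_def using i one_closed
  by (intro indexed_pset.indexed_pmult indexed_pset.indexed_const)
 have e: "i \<in># m \<and> m - {#i#} = {#} \<longleftrightarrow> m = {#i#}" for m
  by (metis add_mset_remove_trivial diff_single_trivial insert_DiffM union_single_eq_member multi_self_add_other_not_self)
 show "at_pt (indexed_var i) q = pvar i" if q: "q \<in> V"
 proof (rule poly_mapping_eqI)
  fix m
  have "indexed_var i m q = coef (pvar i) m"
   using q e[of m] by (auto simp: indexed_var_def indexed_pmult_def indexed_const_def lookup_single when_def)
  then show "coef (at_pt (indexed_var i) q) m = coef (pvar i) m" by (simp only: lookup_at_pt[OF V c q])
 qed
qed

lemma MP_one: "opn V ==> \<one>\<^bsub>MP V I\<^esub> \<in> carrier (MP V I)" "opn V ==> q \<in> V ==> at_pt \<one>\<^bsub>MP V I\<^esub> q = 1"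
 "opn V ==> \<zero>\<^bsub>MP V I\<^esub> \<in> carrier (MP V I)" "opn V ==> q \<in> V ==> at_pt \<zero>\<^bsub>MP V I\<^esub> q = 0"
proof -
 assume V: "opn V"
 interpret cring "R V" by (rule cring_R[OF V])
 show "\<one>\<^bsub>MP V I\<^esub> \<in> carrier (MP V I)" "\<zero>\<^bsub>MP V I\<^esub> \<in> carrier (MP V I)"
  unfolding MP_simps(2,3) by (rule MP_const(1)[OF V one_closed], rule MP_const(1)[OF V zero_closed])
 show "at_pt \<one>\<^bsub>MP V I\<^esub> q = 1" "at_pt \<zero>\<^bsub>MP V I\<^esub> q = 0" if q: "q \<in> V"
  unfolding MP_simps(2,3) MP_const(2)[OF V one_closed q] MP_const(2)[OF V zero_closed q] using q by simp_all
qed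

lemma MP_neg:
 assumes V: "opn V" and P: "P \<in> carrier (MP V I)"
 shows "\<exists>Q\<in>carrier (MP V I). \<forall>q\<in>V. at_pt Q q = - at_pt P q"
proof -
 interpret cring "R V" by (rule cring_R[OF V])
 have c: "(\<lambda>p\<in>V. -1) \<in> carrier (R V)" by (rule R_closed(1)[OF V])
 show ?thesis
 proof (intro bexI ballI)
  show "indexed_const (\<lambda>p\<in>V. -1) \<otimes>\<^bsub>MP V I\<^esub> P \<in> carrier (MP V I)" by (rule MP_mult(1)[OF V MP_const(1)[OF V c] P])
  show "at_pt (indexed_const (\<lambda>p\<in>V. -1) \<otimes>\<^bsub>MP V I\<^esub> P) q = - at_pt P q" if q: "q \<in> V" for q
   unfolding MP_mult(2)[OF V MP_const(1)[OF V c] P q] MP_const(2)[OF V c q] using q by (simp add: single_uminus)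
 qed
qed

lemma cring_MP:
 assumes V: "opn V" shows "cring (MP V I)"
proof (rule cring_pointwise[where V = V and e = "\<lambda>q P. at_pt P q"])
 show "P = Q" if "P \<in> carrier (MP V I)" "Q \<in> carrier (MP V I)" "\<And>q. q \<in> V ==> at_pt P q = at_pt Q q" for P Q by (rule MP_ext[OF V that])
 show "\<exists>Q\<in>carrier (MP V I). \<forall>q\<in>V. at_pt Q q = - at_pt P q" if "P \<in> carrier (MP V I)" for P by (rule MP_neg[OF V that])
qed (intro MP_add[OF V] MP_mult[OF V] MP_one[OF V]; assumption)+

lemma MP_minus:
 assumes V: "opn V" and P: "P \<in> carrier (MP V I)" and Q: "Q \<in> carrier (MP V I)" and q: "q \<in> V"
 shows "at_pt (P \<ominus>\<^bsub>MP V I\<^esub> Q) q = at_pt P q - at_pt Q q"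
proof -
 interpret M: cring "MP V I" by (rule cring_MP[OF V])
 have "P = (P \<ominus>\<^bsub>MP V I\<^esub> Q) \<oplus>\<^bsub>MP V I\<^esub> Q" using P Q by (simp add: M.minus_eq M.a_assoc M.l_neg)
 then have "at_pt P q = at_pt (P \<ominus>\<^bsub>MP V I\<^esub> Q) q + at_pt Q q" using MP_add(2)[OF V M.minus_closed[OF P Q] Q q] by simp
 then show ?thesis by simp
qed

text \<open>Monomials identified by \<open>g\<close> have their coefficients added; at a point this
  is the substitution of variables for variables.\<close>

lemma MP_map:
 fixes g :: "'i \<Rightarrow> 'd"
 assumes V: "opn V" and W: "opn W" "W \<subseteq> V" and P: "P \<in> carrier (MP V I)" and g: "\<And>i. i \<in> I ==> g i \<in> I'"
 shows "mpoly_map (R V) (R W) (\<lambda>f. restrict f W) g P \<in> carrier (MP W I')"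
  and "q \<in> W ==> at_pt (mpoly_map (R V) (R W) (\<lambda>f. restrict f W) g P) q = subst_poly (\<lambda>i. pvar (g i)) (at_pt P q)"
proof -
 interpret cring "R W" by (rule cring_R[OF W(1)])
 let ?Q = "mpoly_map (R V) (R W) (\<lambda>f. restrict f W) g P"
 let ?S = "{m. P m \<noteq> \<zero>\<^bsub>R V\<^esub>}"
 have S: "finite ?S" "\<And>m. P m \<in> carrier (R V)" "\<And>m. m \<in> ?S ==> set_mset m \<subseteq> I" using P unfolding MP_carrier[OF V] by blast+
 have rc: "restrict (P a) W \<in> carrier (R W)" for a using R_restrict[OF V W S(2)] .
 have fin: "finite {a. P a \<noteq> \<zero>\<^bsub>R V\<^esub> \<and> image_mset g a = m}" for m by (rule finite_subset[OF _ S(1)]) auto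
 have val: "?Q m q = (\<Sum>a\<in>{a. P a \<noteq> \<zero>\<^bsub>R V\<^esub> \<and> image_mset g a = m}. P a q)" if "q \<in> W" for m q
 proof -
  have "?Q m q = (\<Sum>a\<in>{a. P a \<noteq> \<zero>\<^bsub>R V\<^esub> \<and> image_mset g a = m}. restrict (P a) W q)"
   unfolding mpoly_map_def by (rule R_finsum[OF W(1) fin rc that])
  then show ?thesis using that by simp
 qed
 have Qc: "?Q m \<in> carrier (R W)" for m unfolding mpoly_map_def by (rule finsum_closed) (simp only: Pi_I rc)
 have supp: "\<exists>a\<in>?S. m = image_mset g a" if nz: "?Q m \<noteq> \<zero>\<^bsub>R W\<^esub>" for m
 proof (rule ccontr)
  assume no: "\<not> ?thesis"
  then have e: "{a. P a \<noteq> \<zero>\<^bsub>R V\<^esub> \<and> image_mset g a = m} = {}" by blast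
  have "?Q m = \<zero>\<^bsub>R W\<^esub>" by (rule R_ext[OF Qc zero_closed]) (simp only: val e sum.empty, simp)
  then show False using nz by simp
 qed
 have fQ: "finite {m. ?Q m \<noteq> \<zero>\<^bsub>R W\<^esub>}" by (rule finite_subset[OF _ finite_imageI[OF S(1), of "image_mset g"]]) (use supp in blast)
 have "set_mset m \<subseteq> I'" if nz: "?Q m \<noteq> \<zero>\<^bsub>R W\<^esub>" for m
 proof -
  obtain a where a: "a \<in> ?S" "m = image_mset g a" using supp[OF nz] by blast
  have "set_mset a \<subseteq> I" by (rule S(3)[OF a(1)])
  then show ?thesis using g a(2) by auto
 qed
 then show c: "?Q \<in> carrier (MP W I')" unfolding MP_carrier[OF W(1)] using fQ Qc by blast
 show "at_pt ?Q q = subst_poly (\<lambda>i. pvar (g i)) (at_pt P q)" if q: "q \<in> W"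
 proof (rule poly_mapping_eqI)
  fix m
  have qV: "q \<in> V" using q W by blast
  have keys: "keys (at_pt P q) \<subseteq> ?S" using lookup_at_pt[OF V P qV] qV by (auto simp: in_keys_iff)
  have pm: "prod_mset (image_mset (\<lambda>i. pvar (g i)) a) = (Poly_Mapping.single (image_mset g a) 1 :: 'd multiset \<Rightarrow>\<^sub>0 real)" for a
   using prod_mset_pvar[of "image_mset g a"] by (simp add: image_mset.compositionality o_def)
  have "subst_poly (\<lambda>i. pvar (g i)) (at_pt P q) = (\<Sum>a\<in>?S. Poly_Mapping.single (image_mset g a) (P a q))"
   unfolding subst_poly_superset[OF S(1) keys] pm by (simp add: mult_single lookup_at_pt[OF V P qV])
  then have "coef (subst_poly (\<lambda>i. pvar (g i)) (at_pt P q)) m = (\<Sum>a\<in>?S. if image_mset g a = m then P a q else 0)"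
   by (simp add: lookup_sum lookup_single when_def)
  also have "\<dots> = (\<Sum>a\<in>{a \<in> ?S. image_mset g a = m}. P a q)" by (rule sum.inter_filter[OF S(1), symmetric])
  also have "{a \<in> ?S. image_mset g a = m} = {a. P a \<noteq> \<zero>\<^bsub>R V\<^esub> \<and> image_mset g a = m}" by blast
  also have "(\<Sum>a\<in>{a. P a \<noteq> \<zero>\<^bsub>R V\<^esub> \<and> image_mset g a = m}. P a q) = ?Q m q" by (rule val[OF q, symmetric])
  finally show "coef (at_pt ?Q q) m = coef (subst_poly (\<lambda>i. pvar (g i)) (at_pt P q)) m" using lookup_at_pt[OF W(1) c q] by simp
 qed
qed

lemma MP_pmult:
 assumes V: "opn V" and P: "P \<in> carrier (MP V I)" and i: "i \<in> I"
 shows "ring.indexed_pmult (R V) P i = P \<otimes>\<^bsub>MP V I\<^esub> ring.indexed_var (R V) i"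
proof -
 interpret cring "R V" by (rule cring_R[OF V])
 have c: "indexed_pmult P i \<in> carrier (MP V I)" using P i unfolding MP_simps by (rule indexed_pset.indexed_pmult)
 note v = MP_var[OF V i]
 show ?thesis
 proof (rule MP_ext[OF V c MP_mult(1)[OF V P v(1)]])
  fix q assume q: "q \<in> V"
  show "at_pt (indexed_pmult P i) q = at_pt (P \<otimes>\<^bsub>MP V I\<^esub> indexed_var i) q" unfolding MP_mult(2)[OF V P v(1) q] v(2)[OF q]
  proof (rule poly_mapping_eqI)
   fix m
   have "indexed_pmult P i m q = (if i \<in># m then P (m - {#i#}) q else 0)" using q by (simp add: indexed_pmult_def)
   then show "coef (at_pt (indexed_pmult P i) q) m = coef (at_pt P q * pvar i) m"
    by (simp only: lookup_at_pt[OF V c q] lookup_at_pt[OF V P q] lookup_mult_pvar)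
  qed
 qed
qed

abbreviation "mm V W g \<equiv> mpoly_map (R V) (R W) (\<lambda>f. restrict f W) g"

lemma MP_map_hom:
 assumes V: "opn V" "opn W" "W \<subseteq> V" and g: "\<And>i. i \<in> I ==> g i \<in> I'"
 shows "mm V W g \<in> ring_hom (MP V I) (MP W I')"
proof (rule ring_hom_memI)
 interpret A: cring "MP V I" by (rule cring_MP[OF V(1)])
 interpret B: cring "MP W I'" by (rule cring_MP[OF V(2)])
 note r = MP_map[OF V _ g]
 have WV: "q \<in> W ==> q \<in> V" for q using V by blast
 show "mm V W g P \<in> carrier (MP W I')" if "P \<in> carrier (MP V I)" for P by (rule r(1)[OF that])
 fix P Q assume c: "P \<in> carrier (MP V I)" "Q \<in> carrier (MP V I)"
 show "mm V W g (P \<otimes>\<^bsub>MP V I\<^esub> Q) = mm V W g P \<otimes>\<^bsub>MP W I'\<^esub> mm V W g Q"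
 proof (rule MP_ext[OF V(2) r(1)[OF A.m_closed[OF c]] B.m_closed[OF r(1)[OF c(1)] r(1)[OF c(2)]]])
  fix q assume q: "q \<in> W"
  show "at_pt (mm V W g (P \<otimes>\<^bsub>MP V I\<^esub> Q)) q = at_pt (mm V W g P \<otimes>\<^bsub>MP W I'\<^esub> mm V W g Q) q"
   by (simp only: r(2)[OF A.m_closed[OF c] _ q] MP_mult(2)[OF V(1) c WV[OF q]] MP_mult(2)[OF V(2) r(1)[OF c(1)] r(1)[OF c(2)] q]
    r(2)[OF c(1) _ q] r(2)[OF c(2) _ q] subst_poly_mult)
 qed
 show "mm V W g (P \<oplus>\<^bsub>MP V I\<^esub> Q) = mm V W g P \<oplus>\<^bsub>MP W I'\<^esub> mm V W g Q"
 proof (rule MP_ext[OF V(2) r(1)[OF A.a_closed[OF c]] B.a_closed[OF r(1)[OF c(1)] r(1)[OF c(2)]]])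
  fix q assume q: "q \<in> W"
  show "at_pt (mm V W g (P \<oplus>\<^bsub>MP V I\<^esub> Q)) q = at_pt (mm V W g P \<oplus>\<^bsub>MP W I'\<^esub> mm V W g Q) q"
   by (simp only: r(2)[OF A.a_closed[OF c] _ q] MP_add(2)[OF V(1) c WV[OF q]] MP_add(2)[OF V(2) r(1)[OF c(1)] r(1)[OF c(2)] q]
    r(2)[OF c(1) _ q] r(2)[OF c(2) _ q] subst_poly_add)
 qed
next
 note r = MP_map[OF V _ g]
 note o = MP_one(1,2)[OF V(1), where I = I] MP_one(1,2)[OF V(2), where I = I']
 show "mm V W g \<one>\<^bsub>MP V I\<^esub> = \<one>\<^bsub>MP W I'\<^esub>"
 proof (rule MP_ext[OF V(2) r(1)[OF o(1)] o(3)])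
  fix q assume q: "q \<in> W"
  then have qV: "q \<in> V" using V by blast
  show "at_pt (mm V W g \<one>\<^bsub>MP V I\<^esub>) q = at_pt \<one>\<^bsub>MP W I'\<^esub> q" by (simp only: r(2)[OF o(1) _ q] o(2)[OF qV] o(4)[OF q] subst_poly_one)
 qed
qed

lemma MP_map_const:
 assumes V: "opn V" "opn W" "W \<subseteq> V" and f: "f \<in> carrier (R V)"
 shows "mm V W g (ring.indexed_const (R V) f) = ring.indexed_const (R W) (restrict f W)"
proof (rule MP_ext[OF V(2)])
 show "mm V W g (ring.indexed_const (R V) f) \<in> carrier (MP W UNIV)" by (rule MP_map(1)[OF V MP_const(1)[OF V(1) f, where I = UNIV]]) simp
 show "ring.indexed_const (R W) (restrict f W) \<in> carrier (MP W UNIV)" by (rule MP_const(1)[OF V(2) R_restrict[OF V f]])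
 fix q assume q: "q \<in> W"
 then have qV: "q \<in> V" using V by blast
 have "at_pt (mm V W g (ring.indexed_const (R V) f)) q = subst_poly (\<lambda>i. pvar (g i)) (at_pt (ring.indexed_const (R V) f) q)"
  by (rule MP_map(2)[OF V MP_const(1)[OF V(1) f, where I = UNIV] _ q, where I' = UNIV]) simp
 then show "at_pt (mm V W g (ring.indexed_const (R V) f)) q = at_pt (ring.indexed_const (R W) (restrict f W)) q"
  using q by (simp add: MP_const(2)[OF V(1) f qV] MP_const(2)[OF V(2) R_restrict[OF V f] q])
qed

lemma MP_map_var:
 assumes V: "opn V" "opn W" "W \<subseteq> V"
 shows "mm V W g (ring.indexed_var (R V) i) = ring.indexed_var (R W) (g i)"
proof (rule MP_ext[OF V(2)])
 note v = MP_var[OF V(1), where I = UNIV] and w = MP_var[OF V(2), where I = UNIV]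
 show "mm V W g (ring.indexed_var (R V) i) \<in> carrier (MP W UNIV)" by (rule MP_map(1)[OF V v(1)]) simp_all
 show "ring.indexed_var (R W) (g i) \<in> carrier (MP W UNIV)" by (rule w(1)) simp
 fix q assume q: "q \<in> W"
 then have qV: "q \<in> V" using V by blast
 have "at_pt (mm V W g (ring.indexed_var (R V) i)) q = subst_poly (\<lambda>i. pvar (g i)) (at_pt (ring.indexed_var (R V) i) q)"
  by (rule MP_map(2)[OF V v(1) _ q, where I' = UNIV]) simp_all
 then show "at_pt (mm V W g (ring.indexed_var (R V) i)) q = at_pt (ring.indexed_var (R W) (g i)) q"
  by (simp add: v(2)[OF _ qV] w(2)[OF _ q])
qed

end

section \<open>Germs of presheaves and group completion\<close>

locale set_presheaf =
 fixes \<T> :: "'p topology" and F :: "'p set \<Rightarrow> 's set" and \<rho> :: "'p set \<Rightarrow> 'p set \<Rightarrow> 's \<Rightarrow> 's"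
 assumes restr_closed: "\<And>V W s. openin \<T> V ==> openin \<T> W ==> W \<subseteq> V ==> s \<in> F V ==> \<rho> V W s \<in> F W"
  and restr_comp: "\<And>V W N s. openin \<T> V ==> openin \<T> W ==> openin \<T> N ==> N \<subseteq> W ==> W \<subseteq> V ==> s \<in> F V ==>
   \<rho> W N (\<rho> V W s) = \<rho> V N s"
begin

abbreviation "grm \<equiv> germ \<T> F \<rho>"

definition agree :: "'p \<Rightarrow> 'p set \<Rightarrow> 's \<Rightarrow> 'p set \<Rightarrow> 's \<Rightarrow> bool" where
 "agree p V s W t \<longleftrightarrow> (\<exists>N. openin \<T> N \<and> p \<in> N \<and> N \<subseteq> V \<inter> W \<and> \<rho> V N s = \<rho> W N t)"

lemma mem_germ_iff: "(W, t) \<in> grm V s p \<longleftrightarrow> openin \<T> W \<and> p \<in> W \<and> t \<in> F W \<and> agree p V s W t" by (auto simp: germ_def agree_def)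

lemma agree_shrink:
 assumes "openin \<T> V" "s \<in> F V" "openin \<T> W" "t \<in> F W" "openin \<T> N" "N \<subseteq> V \<inter> W" "\<rho> V N s = \<rho> W N t"
  "openin \<T> N'" "N' \<subseteq> N"
 shows "\<rho> V N' s = \<rho> W N' t"
proof -
 have "\<rho> V N' s = \<rho> N N' (\<rho> V N s)" using assms by (intro restr_comp[symmetric]) auto
 also have "\<dots> = \<rho> N N' (\<rho> W N t)" using assms by simp
 also have "\<dots> = \<rho> W N' t" using assms by (intro restr_comp) auto
 finally show ?thesis .
qed

lemma agree_trans:
 assumes V: "openin \<T> V" "s \<in> F V" and W: "openin \<T> W" "t \<in> F W" and X1: "openin \<T> Y" "u \<in> F Y"
  and a: "agree p V s W t" "agree p W t Y u"
 shows "agree p V s Y u"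
proof -
 obtain N where N: "openin \<T> N" "p \<in> N" "N \<subseteq> V \<inter> W" "\<rho> V N s = \<rho> W N t" using a(1) unfolding agree_def by blast
 obtain M where M: "openin \<T> M" "p \<in> M" "M \<subseteq> W \<inter> Y" "\<rho> W M t = \<rho> Y M u" using a(2) unfolding agree_def by blast
 have o: "openin \<T> (N \<inter> M)" using N(1) M(1) by blast
 have "\<rho> V (N \<inter> M) s = \<rho> W (N \<inter> M) t" by (rule agree_shrink[OF V W N(1,3,4) o]) simp
 moreover have "\<rho> W (N \<inter> M) t = \<rho> Y (N \<inter> M) u" by (rule agree_shrink[OF W X1 M(1,3,4) o]) simp
 ultimately show ?thesis unfolding agree_def using o N M by (intro exI[of _ "N \<inter> M"]) auto
qed

lemma agree_sym: "agree p V s W t ==> agree p W t V s" unfolding agree_def by (metis Int_commute)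

lemma agree_refl: "openin \<T> V ==> p \<in> V ==> agree p V s V s" unfolding agree_def by blast

lemma germ_eq_iff:
 assumes V: "openin \<T> V" "s \<in> F V" "p \<in> V" and W: "openin \<T> W" "t \<in> F W" "p \<in> W"
 shows "grm V s p = grm W t p \<longleftrightarrow> agree p V s W t"
proof
 assume "grm V s p = grm W t p"
 moreover have "(W, t) \<in> grm W t p" using W agree_refl by (simp add: mem_germ_iff)
 ultimately have "(W, t) \<in> grm V s p" by simp
 then show "agree p V s W t" by (simp add: mem_germ_iff)
next
 assume a: "agree p V s W t"
 show "grm V s p = grm W t p"
 proof (rule Set.set_eqI)
  fix x :: "'p set \<times> 's"
  obtain Y u where x: "x = (Y, u)" by (cases x)
  show "x \<in> grm V s p \<longleftrightarrow> x \<in> grm W t p" unfolding x mem_germ_iff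
   using agree_trans[OF V(1,2) W(1,2) _ _ a] agree_trans[OF W(1,2) V(1,2) _ _ agree_sym[OF a]] by blast
 qed
qed

lemma mem_germ: "openin \<T> V ==> s \<in> F V ==> p \<in> V ==> (V, s) \<in> grm V s p" using agree_refl by (simp add: mem_germ_iff)

lemma germ_of_mem:
 assumes "openin \<T> V" "s \<in> F V" "p \<in> V" "(W, t) \<in> grm V s p"
 shows "grm W t p = grm V s p" "openin \<T> W" "p \<in> W" "t \<in> F W"
proof -
 have W: "openin \<T> W" "p \<in> W" "t \<in> F W" "agree p V s W t" using assms(4) by (auto simp: mem_germ_iff)
 then show "openin \<T> W" "p \<in> W" "t \<in> F W" by auto
 show "grm W t p = grm V s p" using germ_eq_iff[OF assms(1-3) W(1,3,2)] W(4) by simp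
qed

lemma germ_restr:
 assumes V: "openin \<T> V" "s \<in> F V" and N: "openin \<T> N" "N \<subseteq> V" "p \<in> N"
 shows "grm N (\<rho> V N s) p = grm V s p"
proof -
 have c: "\<rho> V N s \<in> F N" using V N by (intro restr_closed)
 have "agree p N (\<rho> V N s) V s" unfolding agree_def using V N restr_comp[OF V(1) N(1) N(1) order_refl N(2) V(2)] by (intro exI[of _ N]) auto
 then show ?thesis using germ_eq_iff[OF N(1) c N(3) V] N by blast
qed

lemma germ_eq_of_restr_eq:
 assumes V: "openin \<T> V" "s \<in> F V" and W: "openin \<T> W" "t \<in> F W" and N: "openin \<T> N" "N \<subseteq> V" "N \<subseteq> W" "p \<in> N"
  and e: "\<rho> V N s = \<rho> W N t"
 shows "grm V s p = grm W t p" using germ_restr[OF V N(1,2,4)] germ_restr[OF W N(1,3,4)] e by simp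

lemma section_germ:
 assumes "\<sigma> \<in> sheafify_sections \<T> F \<rho> V" "p \<in> V"
 shows "\<exists>W s. openin \<T> W \<and> p \<in> W \<and> W \<subseteq> V \<and> s \<in> F W \<and> (\<forall>q\<in>W. \<sigma> q = grm W s q)" using assms unfolding sheafify_sections_def by simp

lemma to_sheafify_section:
 assumes "openin \<T> V" "s \<in> F V" shows "to_sheafify \<T> F \<rho> V s \<in> sheafify_sections \<T> F \<rho> V"
proof -
 have "\<exists>W t. openin \<T> W \<and> p \<in> W \<and> W \<subseteq> V \<and> t \<in> F W \<and> (\<forall>q\<in>W. restrict (grm V s) V q = grm W t q)" if "p \<in> V" for p
  by (rule exI[of _ V], rule exI[of _ s]) (use assms that in simp)
 then show ?thesis unfolding sheafify_sections_def to_sheafify_def by simp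
qed

lemma restrict_section:
 assumes s: "\<sigma> \<in> sheafify_sections \<T> F \<rho> V" and VW: "openin \<T> V" "openin \<T> W" "W \<subseteq> V"
 shows "restrict \<sigma> W \<in> sheafify_sections \<T> F \<rho> W" unfolding sheafify_sections_def
proof safe
 show "restrict \<sigma> W \<in> extensional W" by simp
 fix p assume p: "p \<in> W"
 then have "p \<in> V" using VW by blast
 from section_germ[OF s this] obtain N t where
  N: "openin \<T> N" "p \<in> N" "N \<subseteq> V" "t \<in> F N" "\<forall>q\<in>N. \<sigma> q = grm N t q" by blast
 have NW: "openin \<T> (N \<inter> W)" using N VW by blast
 show "\<exists>Wa s. openin \<T> Wa \<and> p \<in> Wa \<and> Wa \<subseteq> W \<and> s \<in> F Wa \<and> (\<forall>q\<in>Wa. restrict \<sigma> W q = grm Wa s q)"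
 proof (intro exI conjI ballI)
  show "\<rho> N (N \<inter> W) t \<in> F (N \<inter> W)" by (rule restr_closed[OF N(1) NW _ N(4)]) simp
  show "restrict \<sigma> W q = grm (N \<inter> W) (\<rho> N (N \<inter> W) t) q" if "q \<in> N \<inter> W" for q using that N germ_restr[OF N(1,4) NW, of q] by simp
 qed (use NW N p in auto)
qed

end

locale presheaf_op = set_presheaf +
 fixes opr
 assumes opr_closed: "\<And>V s t. openin \<T> V ==> s \<in> F V ==> t \<in> F V ==> opr V s t \<in> F V"
  and opr_restr: "\<And>V W s t. openin \<T> V ==> openin \<T> W ==> W \<subseteq> V ==> s \<in> F V ==> t \<in> F V ==>
   \<rho> V W (opr V s t) = opr W (\<rho> V W s) (\<rho> V W t)"
begin

text \<open>Any two pairs of representatives agree on a smaller neighbourhood, so the union in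
  \<open>sheafify_op\<close> runs over a single germ.\<close>

lemma sheafify_op_germ:
 assumes W: "openin \<T> W" "s \<in> F W" "t \<in> F W" "p \<in> W" and p: "p \<in> V"
  and st: "\<sigma> p = grm W s p" "\<tau> p = grm W t p"
 shows "sheafify_op \<T> F \<rho> opr V \<sigma> \<tau> p = grm W (opr W s t) p"
proof -
 have eq: "grm W' (opr W' s' t') p = grm W (opr W s t) p" if m: "(W', s') \<in> \<sigma> p" "(W', t') \<in> \<tau> p" for W' s' t'
 proof -
  have m1: "(W', s') \<in> grm W s p" "(W', t') \<in> grm W t p" using m st by auto
  have W': "openin \<T> W'" "p \<in> W'" "s' \<in> F W'" "t' \<in> F W'" using germ_of_mem[OF W(1,2,4) m1(1)] germ_of_mem[OF W(1,3,4) m1(2)] by auto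
  obtain N where N: "openin \<T> N" "p \<in> N" "N \<subseteq> W \<inter> W'" "\<rho> W N s = \<rho> W' N s'" using m1(1) by (auto simp: mem_germ_iff agree_def)
  obtain M where M: "openin \<T> M" "p \<in> M" "M \<subseteq> W \<inter> W'" "\<rho> W M t = \<rho> W' M t'" using m1(2) by (auto simp: mem_germ_iff agree_def)
  have o: "openin \<T> (N \<inter> M)" using N(1) M(1) by blast
  have e1: "\<rho> W (N \<inter> M) s = \<rho> W' (N \<inter> M) s'" by (rule agree_shrink[OF W(1,2) W'(1,3) N(1,3,4) o]) simp
  have e2: "\<rho> W (N \<inter> M) t = \<rho> W' (N \<inter> M) t'" by (rule agree_shrink[OF W(1,3) W'(1,4) M(1,3,4) o]) simp
  have sub: "N \<inter> M \<subseteq> W" "N \<inter> M \<subseteq> W'" using N M by auto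
  have "\<rho> W' (N \<inter> M) (opr W' s' t') = \<rho> W (N \<inter> M) (opr W s t)"
   using opr_restr[OF W'(1) o sub(2) W'(3,4)] opr_restr[OF W(1) o sub(1) W(2,3)] e1 e2 by simp
  then show ?thesis
   by (intro germ_eq_of_restr_eq[OF W'(1) opr_closed[OF W'(1,3,4)] W(1) opr_closed[OF W(1-3)] o sub(2,1)]) (use N M in auto)
 qed
 have mem: "(W, s) \<in> \<sigma> p" "(W, t) \<in> \<tau> p" using st mem_germ W by auto
 have "{grm W (opr W s t) p | W s t. (W, s) \<in> \<sigma> p \<and> (W, t) \<in> \<tau> p} = {grm W (opr W s t) p}" using eq mem by blast
 then show ?thesis using p by (simp add: sheafify_op_def)
qed

lemma section_common_germ:
 assumes s: "\<sigma> \<in> sheafify_sections \<T> F \<rho> V" "\<tau> \<in> sheafify_sections \<T> F \<rho> V" and p: "p \<in> V"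
 shows "\<exists>W s t. openin \<T> W \<and> p \<in> W \<and> W \<subseteq> V \<and> s \<in> F W \<and> t \<in> F W \<and>
  (\<forall>q\<in>W. \<sigma> q = grm W s q) \<and> (\<forall>q\<in>W. \<tau> q = grm W t q)"
proof -
 obtain W s where W: "openin \<T> W" "p \<in> W" "W \<subseteq> V" "s \<in> F W" "\<forall>q\<in>W. \<sigma> q = grm W s q" using section_germ[OF s(1) p] by blast
 obtain W' t where W': "openin \<T> W'" "p \<in> W'" "W' \<subseteq> V" "t \<in> F W'" "\<forall>q\<in>W'. \<tau> q = grm W' t q" using section_germ[OF s(2) p] by blast
 have o: "openin \<T> (W \<inter> W')" using W(1) W'(1) by blast
 show ?thesis
 proof (intro exI conjI ballI)
  show "\<rho> W (W \<inter> W') s \<in> F (W \<inter> W')" by (rule restr_closed[OF W(1) o _ W(4)]) simp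
  show "\<rho> W' (W \<inter> W') t \<in> F (W \<inter> W')" by (rule restr_closed[OF W'(1) o _ W'(4)]) simp
  show "\<sigma> q = grm (W \<inter> W') (\<rho> W (W \<inter> W') s) q" if "q \<in> W \<inter> W'" for q using germ_restr[OF W(1,4) o _ that] W(5) that by simp
  show "\<tau> q = grm (W \<inter> W') (\<rho> W' (W \<inter> W') t) q" if "q \<in> W \<inter> W'" for q using germ_restr[OF W'(1,4) o _ that] W'(5) that by simp
 qed (use W W' o in auto)
qed

lemma sheafify_op_section:
 assumes s: "\<sigma> \<in> sheafify_sections \<T> F \<rho> V" "\<tau> \<in> sheafify_sections \<T> F \<rho> V"
 shows "sheafify_op \<T> F \<rho> opr V \<sigma> \<tau> \<in> sheafify_sections \<T> F \<rho> V"
proof -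
 have "\<exists>W s. openin \<T> W \<and> p \<in> W \<and> W \<subseteq> V \<and> s \<in> F W \<and> (\<forall>q\<in>W. sheafify_op \<T> F \<rho> opr V \<sigma> \<tau> q = grm W s q)" if p: "p \<in> V" for p
 proof -
  obtain W s t where W: "openin \<T> W" "p \<in> W" "W \<subseteq> V" "s \<in> F W" "t \<in> F W"
   "\<forall>q\<in>W. \<sigma> q = grm W s q" "\<forall>q\<in>W. \<tau> q = grm W t q" using section_common_germ[OF s p] by blast
  show ?thesis
  proof (intro exI conjI ballI)
   show "opr W s t \<in> F W" by (rule opr_closed[OF W(1,4,5)])
   fix q assume q: "q \<in> W"
   show "sheafify_op \<T> F \<rho> opr V \<sigma> \<tau> q = grm W (opr W s t) q" by (rule sheafify_op_germ[OF W(1,4,5) q]) (use q W in auto)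
  qed (use W in auto)
 qed
 moreover have "sheafify_op \<T> F \<rho> opr V \<sigma> \<tau> \<in> extensional V" by (simp add: sheafify_op_def)
 ultimately show ?thesis unfolding sheafify_sections_def by simp
qed

end

section \<open>Group completion of a commutative monoid\<close>

locale cmonoid = comm_monoid G for G :: "'a monoid" (structure)
begin

lemma gp_rel_iff:
 "((a, b), (c, d)) \<in> gp_rel G \<longleftrightarrow> a \<in> carrier G \<and> b \<in> carrier G \<and> c \<in> carrier G \<and> d \<in> carrier G \<and>
  (\<exists>e\<in>carrier G. e \<otimes> (a \<otimes> d) = e \<otimes> (c \<otimes> b))" by (auto simp: gp_rel_def)

lemma equiv_gp_rel: "equiv (carrier G \<times> carrier G) (gp_rel G)"
proof (rule equivI)
 show "gp_rel G \<subseteq> (carrier G \<times> carrier G) \<times> carrier G \<times> carrier G" by (auto simp: gp_rel_def)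
 show "refl_on (carrier G \<times> carrier G) (gp_rel G)" by (rule refl_onI) (auto simp: gp_rel_iff)
 show "sym (gp_rel G)"
 proof (rule symI)
  fix x y assume "(x, y) \<in> gp_rel G"
  then show "(y, x) \<in> gp_rel G" by (cases x; cases y) (simp add: gp_rel_iff, metis)
 qed
 show "trans (gp_rel G)"
 proof (rule transI)
  fix x y z assume xy: "(x, y) \<in> gp_rel G" and yz: "(y, z) \<in> gp_rel G"
  obtain a b c d e f where xyz: "x = (a, b)" "y = (c, d)" "z = (e, f)" by (cases x; cases y; cases z) blast
  have c: "a \<in> carrier G" "b \<in> carrier G" "c \<in> carrier G" "d \<in> carrier G" "e \<in> carrier G" "f \<in> carrier G"
   using xy yz by (auto simp: xyz gp_rel_iff)
  obtain u where u: "u \<in> carrier G" "u \<otimes> (a \<otimes> d) = u \<otimes> (c \<otimes> b)" using xy by (auto simp: xyz gp_rel_iff)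
  obtain v where v: "v \<in> carrier G" "v \<otimes> (c \<otimes> f) = v \<otimes> (e \<otimes> d)" using yz by (auto simp: xyz gp_rel_iff)
  \<comment> \<open>Without cancellation \<open>c\<close> and \<open>d\<close> have to be part of
    the multiplier: they complete the two given equations to products that contain a f and e
    b.\<close>
  have "(u \<otimes> v \<otimes> c \<otimes> d) \<otimes> (a \<otimes> f) = (u \<otimes> (a \<otimes> d)) \<otimes> (v \<otimes> (c \<otimes> f))" using c u(1) v(1) by (simp add: m_ac)
  also have "\<dots> = (u \<otimes> (c \<otimes> b)) \<otimes> (v \<otimes> (e \<otimes> d))" by (simp only: u(2) v(2))
  also have "\<dots> = (u \<otimes> v \<otimes> c \<otimes> d) \<otimes> (e \<otimes> b)" using c u(1) v(1) by (simp add: m_ac)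
  finally have "(u \<otimes> v \<otimes> c \<otimes> d) \<otimes> (a \<otimes> f) = (u \<otimes> v \<otimes> c \<otimes> d) \<otimes> (e \<otimes> b)" .
  then show "(x, z) \<in> gp_rel G" unfolding xyz gp_rel_iff using c u v by (intro conjI bexI[of _ "u \<otimes> v \<otimes> c \<otimes> d"]) auto
 qed
qed

lemma gp_class_eq_iff:
 assumes "a \<in> carrier G" "b \<in> carrier G" "c \<in> carrier G" "d \<in> carrier G"
 shows "gp_class G a b = gp_class G c d \<longleftrightarrow> (\<exists>e\<in>carrier G. e \<otimes> (a \<otimes> d) = e \<otimes> (c \<otimes> b))"
 unfolding gp_class_def using eq_equiv_class_iff[OF equiv_gp_rel, of "(a, b)" "(c, d)"] assms by (auto simp: gp_rel_iff)

lemma gp_class_mem: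
 "(c, d) \<in> gp_class G a b \<longleftrightarrow> ((a, b), (c, d)) \<in> gp_rel G" by (simp add: gp_class_def)

lemma gp_class_in_carrier: "a \<in> carrier G ==> b \<in> carrier G ==> gp_class G a b \<in> carrier (gp_completion G)"
 by (auto simp: gp_completion_def gp_class_def intro: quotientI)

lemma gp_carrierE:
 assumes "A \<in> carrier (gp_completion G)"
 obtains a b where "a \<in> carrier G" "b \<in> carrier G" "A = gp_class G a b"
 using assms by (auto simp: gp_completion_def gp_class_def elim!: quotientE)

lemma gp_class_self: "a \<in> carrier G ==> b \<in> carrier G ==> (a, b) \<in> gp_class G a b" by (auto simp: gp_class_mem gp_rel_iff)

lemma UN_gp_class:
 assumes ab: "a \<in> carrier G" "b \<in> carrier G"
  and resp: "\<And>c d. (c, d) \<in> gp_class G a b ==> h c d = h a b"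
 shows "(\<Union>(c, d)\<in>gp_class G a b. h c d) = h a b"
proof -
 have ne: "(a, b) \<in> gp_class G a b" by (rule gp_class_self[OF ab])
 show ?thesis
 proof
  show "(\<Union>(c, d)\<in>gp_class G a b. h c d) \<subseteq> h a b" using resp by blast
  show "h a b \<subseteq> (\<Union>(c, d)\<in>gp_class G a b. h c d)" using ne by blast
 qed
qed

lemma gp_mult_class:
 assumes c: "a \<in> carrier G" "b \<in> carrier G" "c \<in> carrier G" "d \<in> carrier G"
 shows "gp_class G a b \<otimes>\<^bsub>gp_completion G\<^esub> gp_class G c d = gp_class G (a \<otimes> c) (b \<otimes> d)"
proof -
 have resp: "gp_class G (a' \<otimes> c') (b' \<otimes> d') = gp_class G (a \<otimes> c) (b \<otimes> d)"
  if m: "(a', b') \<in> gp_class G a b" "(c', d') \<in> gp_class G c d" for a' b' c' d'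
 proof -
  have m': "a' \<in> carrier G" "b' \<in> carrier G" "c' \<in> carrier G" "d' \<in> carrier G" using m by (auto simp: gp_class_mem gp_rel_iff)
  obtain u where u: "u \<in> carrier G" "u \<otimes> (a \<otimes> b') = u \<otimes> (a' \<otimes> b)" using m(1) by (auto simp: gp_class_mem gp_rel_iff)
  obtain v where v: "v \<in> carrier G" "v \<otimes> (c \<otimes> d') = v \<otimes> (c' \<otimes> d)" using m(2) by (auto simp: gp_class_mem gp_rel_iff)
  have "(u \<otimes> v) \<otimes> ((a' \<otimes> c') \<otimes> (b \<otimes> d)) = (u \<otimes> (a' \<otimes> b)) \<otimes> (v \<otimes> (c' \<otimes> d))" using c m' u(1) v(1) by (simp add: m_ac)
  also have "\<dots> = (u \<otimes> (a \<otimes> b')) \<otimes> (v \<otimes> (c \<otimes> d'))" by (simp only: u(2) v(2))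
  also have "\<dots> = (u \<otimes> v) \<otimes> ((a \<otimes> c) \<otimes> (b' \<otimes> d'))" using c m' u(1) v(1) by (simp add: m_ac)
  finally show ?thesis using c m' u(1) v(1) by (subst gp_class_eq_iff) auto
 qed
 have inner: "(\<Union>(c', d')\<in>gp_class G c d. gp_class G (a' \<otimes> c') (b' \<otimes> d')) = gp_class G (a' \<otimes> c) (b' \<otimes> d)"
  if "(a', b') \<in> gp_class G a b" for a' b'
 proof (rule UN_gp_class[OF c(3,4), where h = "\<lambda>c' d'. gp_class G (a' \<otimes> c') (b' \<otimes> d')"])
  fix c' d' assume "(c', d') \<in> gp_class G c d"
  then show "gp_class G (a' \<otimes> c') (b' \<otimes> d') = gp_class G (a' \<otimes> c) (b' \<otimes> d)"
   using resp[OF that] resp[OF that gp_class_self[OF c(3,4)]] by simp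
 qed
 have "gp_class G a b \<otimes>\<^bsub>gp_completion G\<^esub> gp_class G c d =
  (\<Union>(a', b')\<in>gp_class G a b. \<Union>(c', d')\<in>gp_class G c d. gp_class G (a' \<otimes> c') (b' \<otimes> d'))" by (simp add: gp_completion_def)
 also have "\<dots> = (\<Union>(a', b')\<in>gp_class G a b. gp_class G (a' \<otimes> c) (b' \<otimes> d))" by (intro SUP_cong refl) (use inner in auto)
 also have "\<dots> = gp_class G (a \<otimes> c) (b \<otimes> d)" by (rule UN_gp_class[OF c(1,2), where h = "\<lambda>a' b'. gp_class G (a' \<otimes> c) (b' \<otimes> d)"])
   (rule resp[OF _ gp_class_self[OF c(3,4)]])
 finally show ?thesis .
qed

end

section \<open>Sections of the group completion of a positive log structure\<close>

locale plog =
 fixes S :: "('p, 'm) log_space"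
 assumes mfd_S: "manifold_with_corners (space_of S) (atlas S)" and log_S: "positive_log_structure S"

sublocale plog \<subseteq> mwc "space_of S" "atlas S" by unfold_locales (rule mfd_S)

context plog
begin

abbreviation "M V \<equiv> log_secs S V"
abbreviation "res V W a \<equiv> log_restr S V W a"
abbreviation "al V a \<equiv> log_alpha S V a"

lemma sheaf_M: "sheaf_of_monoids (space_of S) (log_secs S) (log_restr S)" using log_S unfolding positive_log_structure_def by blast

lemmas sheaf_conds = sheaf_M[unfolded sheaf_of_monoids_def]

lemma comm_monoid_M: "opn V ==> comm_monoid (M V)" using sheaf_conds[THEN conjunct1] by (elim allE impE)

lemma cmonoid_M: "opn V ==> cmonoid (M V)" using comm_monoid_M by (simp add: cmonoid_def)

lemma res_hom:
 assumes "opn V" "opn W" "W \<subseteq> V"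
 shows "res V W \<in> hom (M V) (M W)" "res V W \<one>\<^bsub>M V\<^esub> = \<one>\<^bsub>M W\<^esub>"
 using sheaf_conds[THEN conjunct2, THEN conjunct1, rule_format, of V W] assms by blast+

lemma res_closed: "opn V ==> opn W ==> W \<subseteq> V ==> a \<in> carrier (M V) ==> res V W a \<in> carrier (M W)" using res_hom(1) by (auto simp: hom_def)

lemma res_mult: "opn V ==> opn W ==> W \<subseteq> V ==> a \<in> carrier (M V) ==> b \<in> carrier (M V) ==>
  res V W (a \<otimes>\<^bsub>M V\<^esub> b) = res V W a \<otimes>\<^bsub>M W\<^esub> res V W b" using res_hom(1) by (auto simp: hom_def)

lemma res_comp: "opn V ==> opn W ==> opn N ==> N \<subseteq> W ==> W \<subseteq> V ==> a \<in> carrier (M V) ==>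
  res W N (res V W a) = res V N a"
 using sheaf_conds[THEN conjunct2, THEN conjunct2, THEN conjunct2, THEN conjunct1, rule_format, of V W N a] by blast

lemma res_id: "opn V ==> a \<in> carrier (M V) ==> res V V a = a"
 using sheaf_conds[THEN conjunct2, THEN conjunct2, THEN conjunct1, rule_format, of V a] by blast

lemmas log_conds = log_S[unfolded positive_log_structure_def, THEN conjunct2]

lemma al_res: "opn V ==> opn W ==> W \<subseteq> V ==> a \<in> carrier (M V) ==> al W (res V W a) = restrict (al V a) W"
 using log_conds[THEN conjunct2, rule_format, of V W a] by blast

lemma one_M: "opn V ==> \<one>\<^bsub>M V\<^esub> \<in> carrier (M V)" using comm_monoid_M by (simp add: comm_monoid.axioms(1) monoid.one_closed)

lemma mult_M: "opn V ==> a \<in> carrier (M V) ==> b \<in> carrier (M V) ==> a \<otimes>\<^bsub>M V\<^esub> b \<in> carrier (M V)"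
 using comm_monoid_M by (simp add: comm_monoid.axioms(1) monoid.m_closed)

abbreviation "cls V a b \<equiv> gp_class (M V) a b"
abbreviation "GC V \<equiv> carrier (gp_presheaf S V)"

lemma gp_restr_class:
 assumes V: "opn V" "opn W" "W \<subseteq> V" and c: "a \<in> carrier (M V)" "b \<in> carrier (M V)"
 shows "gp_presheaf_restr S V W (cls V a b) = cls W (res V W a) (res V W b)"
proof -
 interpret G: cmonoid "M V" by (rule cmonoid_M[OF V(1)])
 interpret H: cmonoid "M W" by (rule cmonoid_M[OF V(2)])
 show ?thesis unfolding gp_presheaf_restr_def
 proof (rule G.UN_gp_class[OF c, where h = "\<lambda>a b. cls W (res V W a) (res V W b)"])
  fix a' b' assume m: "(a', b') \<in> cls V a b"
  have c': "a' \<in> carrier (M V)" "b' \<in> carrier (M V)" using m by (auto simp: G.gp_class_mem G.gp_rel_iff)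
  obtain e where e: "e \<in> carrier (M V)" "e \<otimes>\<^bsub>M V\<^esub> (a \<otimes>\<^bsub>M V\<^esub> b') = e \<otimes>\<^bsub>M V\<^esub> (a' \<otimes>\<^bsub>M V\<^esub> b)"
   using m by (auto simp: G.gp_class_mem G.gp_rel_iff)
  have "res V W e \<otimes>\<^bsub>M W\<^esub> (res V W a \<otimes>\<^bsub>M W\<^esub> res V W b') = res V W (e \<otimes>\<^bsub>M V\<^esub> (a \<otimes>\<^bsub>M V\<^esub> b'))" using V c c' e(1) by (simp add: res_mult)
  also have "\<dots> = res V W (e \<otimes>\<^bsub>M V\<^esub> (a' \<otimes>\<^bsub>M V\<^esub> b))" by (simp only: e(2))
  also have "\<dots> = res V W e \<otimes>\<^bsub>M W\<^esub> (res V W a' \<otimes>\<^bsub>M W\<^esub> res V W b)" using V c c' e(1) by (simp add: res_mult)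
  finally have eq: "res V W e \<otimes>\<^bsub>M W\<^esub> (res V W a \<otimes>\<^bsub>M W\<^esub> res V W b') = res V W e \<otimes>\<^bsub>M W\<^esub> (res V W a' \<otimes>\<^bsub>M W\<^esub> res V W b)" .
  have "cls W (res V W a) (res V W b) = cls W (res V W a') (res V W b')"
   by (subst H.gp_class_eq_iff) (use res_closed[OF V] c c' e(1) eq in auto)
  then show "cls W (res V W a') (res V W b') = cls W (res V W a) (res V W b)" by simp
 qed
qed

lemma GC_iff: "opn V ==> A \<in> GC V \<longleftrightarrow> (\<exists>a\<in>carrier (M V). \<exists>b\<in>carrier (M V). A = cls V a b)" unfolding gp_presheaf_def
 by (blast elim: cmonoid.gp_carrierE[OF cmonoid_M] intro: cmonoid.gp_class_in_carrier[OF cmonoid_M])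

lemma cls_GC: "opn V ==> a \<in> carrier (M V) ==> b \<in> carrier (M V) ==> cls V a b \<in> GC V" using GC_iff by blast

sublocale gp: presheaf_op "space_of S" GC "gp_presheaf_restr S" "\<lambda>V. mult (gp_presheaf S V)"
proof
 fix V W :: "'p set" and A
 assume V: "opn V" "opn W" "W \<subseteq> V" and A: "A \<in> GC V"
 obtain a b where ab: "a \<in> carrier (M V)" "b \<in> carrier (M V)" "A = cls V a b" using A GC_iff[OF V(1)] by blast
 show "gp_presheaf_restr S V W A \<in> GC W" unfolding ab(3) gp_restr_class[OF V ab(1,2)] by (intro cls_GC V res_closed ab)
next
 fix V W N :: "'p set" and A
 assume V: "opn V" "opn W" "opn N" "N \<subseteq> W" "W \<subseteq> V" and A: "A \<in> GC V"
 obtain a b where ab: "a \<in> carrier (M V)" "b \<in> carrier (M V)" "A = cls V a b" using A GC_iff[OF V(1)] by blast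
 have NV: "N \<subseteq> V" using V by blast
 show "gp_presheaf_restr S W N (gp_presheaf_restr S V W A) = gp_presheaf_restr S V N A"
  unfolding ab(3) gp_restr_class[OF V(1,2,5) ab(1,2)] gp_restr_class[OF V(1,3) NV ab(1,2)]
   gp_restr_class[OF V(2,3,4) res_closed[OF V(1,2,5) ab(1)] res_closed[OF V(1,2,5) ab(2)]]
  by (simp only: res_comp[OF V ab(1)] res_comp[OF V ab(2)])
next
 fix V :: "'p set" and A B
 assume V: "opn V" and A: "A \<in> GC V" and B: "B \<in> GC V"
 obtain a b where ab: "a \<in> carrier (M V)" "b \<in> carrier (M V)" "A = cls V a b" using A GC_iff[OF V(1)] by blast
 obtain c d where cd: "c \<in> carrier (M V)" "d \<in> carrier (M V)" "B = cls V c d" using B GC_iff[OF V(1)] by blast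
 show "A \<otimes>\<^bsub>gp_presheaf S V\<^esub> B \<in> GC V" unfolding ab(3) cd(3) using cmonoid.gp_mult_class[OF cmonoid_M[OF V] ab(1,2) cd(1,2)]
  by (simp add: gp_presheaf_def[of S V, symmetric] cls_GC V mult_M ab cd)
next
 fix V W :: "'p set" and A B
 assume V: "opn V" "opn W" "W \<subseteq> V" and A: "A \<in> GC V" and B: "B \<in> GC V"
 obtain a b where ab: "a \<in> carrier (M V)" "b \<in> carrier (M V)" "A = cls V a b" using A GC_iff[OF V(1)] by blast
 obtain c d where cd: "c \<in> carrier (M V)" "d \<in> carrier (M V)" "B = cls V c d" using B GC_iff[OF V(1)] by blast
 note m = cmonoid.gp_mult_class[OF cmonoid_M, folded gp_presheaf_def]
 note rc = res_closed[OF V]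
 show "gp_presheaf_restr S V W (A \<otimes>\<^bsub>gp_presheaf S V\<^esub> B) = gp_presheaf_restr S V W A \<otimes>\<^bsub>gp_presheaf S W\<^esub> gp_presheaf_restr S V W B"
  unfolding ab(3) cd(3) m[OF V(1) ab(1,2) cd(1,2)] gp_restr_class[OF V ab(1,2)] gp_restr_class[OF V cd(1,2)]
   gp_restr_class[OF V mult_M[OF V(1) ab(1) cd(1)] mult_M[OF V(1) ab(2) cd(2)]]
   m[OF V(2) rc[OF ab(1)] rc[OF ab(2)] rc[OF cd(1)] rc[OF cd(2)]] res_mult[OF V ab(1) cd(1)] res_mult[OF V ab(2) cd(2)] ..
qed

abbreviation "GS V \<equiv> carrier (gp_secs S V)"

lemma GS_eq: "GS V = sheafify_sections (space_of S) GC (gp_presheaf_restr S) V" by (simp add: gp_secs_def sheafify_monoid_def)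

lemma GS_mult: "\<sigma> \<otimes>\<^bsub>gp_secs S V\<^esub> \<tau> = sheafify_op (space_of S) GC (gp_presheaf_restr S) (\<lambda>W. mult (gp_presheaf S W)) V \<sigma> \<tau>"
 by (simp add: gp_secs_def sheafify_monoid_def)

lemma GS_mult_closed: "\<sigma> \<in> GS V ==> \<tau> \<in> GS V ==> \<sigma> \<otimes>\<^bsub>gp_secs S V\<^esub> \<tau> \<in> GS V" unfolding GS_eq GS_mult by (rule gp.sheafify_op_section)

lemma GS_restrict: "opn V ==> opn W ==> W \<subseteq> V ==> \<sigma> \<in> GS V ==> restrict \<sigma> W \<in> GS W" unfolding GS_eq by (rule gp.restrict_section)

lemma GS_restrict_mult:
 "W \<subseteq> V ==> restrict (\<sigma> \<otimes>\<^bsub>gp_secs S V\<^esub> \<tau>) W = restrict \<sigma> W \<otimes>\<^bsub>gp_secs S W\<^esub> restrict \<tau> W" unfolding GS_mult sheafify_op_def by (rule ext) auto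

lemma GS_ext: "\<sigma> \<in> GS V ==> \<tau> \<in> GS V ==> (\<And>p. p \<in> V ==> \<sigma> p = \<tau> p) ==> \<sigma> = \<tau>" by (auto simp: GS_eq sheafify_sections_def intro: extensionalityI)

lemma to_gp_GS: "opn V ==> f \<in> carrier (M V) ==> to_gp S V f \<in> GS V" unfolding GS_eq to_gp_def by (intro gp.to_sheafify_section cls_GC one_M)

lemma to_gp_germ: "p \<in> V ==> to_gp S V f p = gp.grm V (cls V f \<one>\<^bsub>M V\<^esub>) p" by (simp add: to_gp_def to_sheafify_def)

lemma to_gp_restrict:
 assumes V: "opn V" "opn W" "W \<subseteq> V" and f: "f \<in> carrier (M V)"
 shows "restrict (to_gp S V f) W = to_gp S W (res V W f)"
proof (rule GS_ext)
 show "restrict (to_gp S V f) W \<in> GS W" by (rule GS_restrict[OF V to_gp_GS[OF V(1) f]])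
 show "to_gp S W (res V W f) \<in> GS W" by (rule to_gp_GS[OF V(2) res_closed[OF V f]])
 fix p assume p: "p \<in> W"
 have "gp.grm W (gp_presheaf_restr S V W (cls V f \<one>\<^bsub>M V\<^esub>)) p = gp.grm V (cls V f \<one>\<^bsub>M V\<^esub>) p"
  by (rule gp.germ_restr[OF V(1) cls_GC[OF V(1) f one_M[OF V(1)]] V(2,3) p])
 then show "restrict (to_gp S V f) W p = to_gp S W (res V W f) p"
  using p V by (simp add: to_gp_germ subsetD[OF V(3)] gp_restr_class[OF V f one_M[OF V(1)]] res_hom(2)[OF V])
qed

lemma to_gp_mult:
 assumes V: "opn V" and f: "f \<in> carrier (M V)" "g \<in> carrier (M V)"
 shows "to_gp S V (f \<otimes>\<^bsub>M V\<^esub> g) = to_gp S V f \<otimes>\<^bsub>gp_secs S V\<^esub> to_gp S V g"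
proof (rule GS_ext)
 show "to_gp S V (f \<otimes>\<^bsub>M V\<^esub> g) \<in> GS V" "to_gp S V f \<otimes>\<^bsub>gp_secs S V\<^esub> to_gp S V g \<in> GS V"
  using V f by (auto intro!: to_gp_GS GS_mult_closed mult_M)
 fix p assume p: "p \<in> V"
 interpret G: cmonoid "M V" by (rule cmonoid_M[OF V])
 have "(to_gp S V f \<otimes>\<^bsub>gp_secs S V\<^esub> to_gp S V g) p =
   gp.grm V (cls V f \<one>\<^bsub>M V\<^esub> \<otimes>\<^bsub>gp_presheaf S V\<^esub> cls V g \<one>\<^bsub>M V\<^esub>) p"
  unfolding GS_mult by (rule gp.sheafify_op_germ[OF V _ _ p p]) (use f p V in \<open>auto simp: to_gp_germ intro: cls_GC one_M\<close>)
 also have "cls V f \<one>\<^bsub>M V\<^esub> \<otimes>\<^bsub>gp_presheaf S V\<^esub> cls V g \<one>\<^bsub>M V\<^esub> = cls V (f \<otimes>\<^bsub>M V\<^esub> g) \<one>\<^bsub>M V\<^esub>"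
  using G.gp_mult_class[OF f(1) G.one_closed f(2) G.one_closed] by (simp add: gp_presheaf_def)
 finally show "to_gp S V (f \<otimes>\<^bsub>M V\<^esub> g) p = (to_gp S V f \<otimes>\<^bsub>gp_secs S V\<^esub> to_gp S V g) p" using p by (simp add: to_gp_germ)
qed

text \<open>Locally a section of the completion is a quotient a / b of sections of the monoid sheaf.
  It is stated as a product so that the relation between symbols, which speaks of products, applies
  directly.\<close>

lemma GS_local:
 assumes V: "opn V" and s: "\<sigma> \<in> GS V" and p: "p \<in> V"
 shows "\<exists>W a b. opn W \<and> p \<in> W \<and> W \<subseteq> V \<and> a \<in> carrier (M W) \<and> b \<in> carrier (M W) \<and>
  restrict \<sigma> W \<otimes>\<^bsub>gp_secs S W\<^esub> to_gp S W b = to_gp S W a"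
proof -
 obtain W A where W: "opn W" "p \<in> W" "W \<subseteq> V" "A \<in> GC W" "\<forall>q\<in>W. \<sigma> q = gp.grm W A q" using gp.section_germ[OF s[unfolded GS_eq] p] by blast
 obtain a b where ab: "a \<in> carrier (M W)" "b \<in> carrier (M W)" "A = cls W a b" using W(4) GC_iff[OF W(1)] by blast
 interpret G: cmonoid "M W" by (rule cmonoid_M[OF W(1)])
 have "restrict \<sigma> W \<otimes>\<^bsub>gp_secs S W\<^esub> to_gp S W b = to_gp S W a"
 proof (rule GS_ext)
  show "restrict \<sigma> W \<otimes>\<^bsub>gp_secs S W\<^esub> to_gp S W b \<in> GS W" "to_gp S W a \<in> GS W"
   using V W s ab by (auto intro!: to_gp_GS GS_mult_closed intro: GS_restrict)
  fix q assume q: "q \<in> W"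
  have "(restrict \<sigma> W \<otimes>\<^bsub>gp_secs S W\<^esub> to_gp S W b) q = gp.grm W (cls W a b \<otimes>\<^bsub>gp_presheaf S W\<^esub> cls W b \<one>\<^bsub>M W\<^esub>) q" unfolding GS_mult
   by (rule gp.sheafify_op_germ[OF W(1) _ _ q q])
    (use W ab q in \<open>auto simp: to_gp_germ intro: cls_GC one_M\<close>)
  also have "cls W a b \<otimes>\<^bsub>gp_presheaf S W\<^esub> cls W b \<one>\<^bsub>M W\<^esub> = cls W (a \<otimes>\<^bsub>M W\<^esub> b) (b \<otimes>\<^bsub>M W\<^esub> \<one>\<^bsub>M W\<^esub>)"
   using G.gp_mult_class[OF ab(1,2,2) G.one_closed] by (simp add: gp_presheaf_def)
  also have "\<dots> = cls W a \<one>\<^bsub>M W\<^esub>" using ab by (subst G.gp_class_eq_iff) (auto simp: G.m_ac)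
  finally show "(restrict \<sigma> W \<otimes>\<^bsub>gp_secs S W\<^esub> to_gp S W b) q = to_gp S W a q" using q by (simp only: to_gp_germ)
 qed
 then show ?thesis using W ab by blast
qed

text \<open>Meaningful only if \<open>\<mu>\<close> is additive and compatible with restriction at \<open>q\<close>.\<close>

definition gp_val :: "('p set \<Rightarrow> 'm \<Rightarrow> 'v::ab_group_add) \<Rightarrow> 'p \<Rightarrow> ('p, 'm) gp_section \<Rightarrow> 'v" where
 "gp_val \<mu> q \<sigma> = (THE v. \<exists>W a b. (W, cls W a b) \<in> \<sigma> q \<and> opn W \<and> q \<in> W \<and> a \<in> carrier (M W) \<and> b \<in> carrier (M W) \<and> v = \<mu> W a - \<mu> W b)"

text \<open>A homomorphism from the stalk of the monoid sheaf at \<open>q\<close> to an abelian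
  group, phrased through representatives.\<close>

definition germ_additive :: "('p set \<Rightarrow> 'm \<Rightarrow> 'v::ab_group_add) \<Rightarrow> 'p \<Rightarrow> bool" where
 "germ_additive \<mu> q \<longleftrightarrow>
  (\<forall>W a b. opn W \<and> q \<in> W \<and> a \<in> carrier (M W) \<and> b \<in> carrier (M W) \<longrightarrow> \<mu> W (a \<otimes>\<^bsub>M W\<^esub> b) = \<mu> W a + \<mu> W b) \<and>
  (\<forall>W N a. opn W \<and> opn N \<and> q \<in> N \<and> N \<subseteq> W \<and> a \<in> carrier (M W) \<longrightarrow> \<mu> N (res W N a) = \<mu> W a)"

text \<open>The value of a quotient is well defined because the target is a group: the multiplier
  \<open>e\<close> that makes two fractions equal cancels after applying
  \<open>\<mu>\<close>.\<close>

lemma gp_val_germ: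
 assumes \<mu>: "germ_additive \<mu> q" and W: "opn W" "q \<in> W" "a \<in> carrier (M W)" "b \<in> carrier (M W)"
  and s: "\<sigma> q = gp.grm W (cls W a b) q"
 shows "gp_val \<mu> q \<sigma> = \<mu> W a - \<mu> W b" unfolding gp_val_def
proof (rule the_equality)
 show "\<exists>W' a' b'. (W', cls W' a' b') \<in> \<sigma> q \<and> opn W' \<and> q \<in> W' \<and> a' \<in> carrier (M W') \<and> b' \<in> carrier (M W') \<and> \<mu> W a - \<mu> W b = \<mu> W' a' - \<mu> W' b'"
  using gp.mem_germ[OF W(1) cls_GC[OF W(1,3,4)] W(2)] W s by metis
next
 fix v assume "\<exists>W a b. (W, cls W a b) \<in> \<sigma> q \<and> opn W \<and> q \<in> W \<and> a \<in> carrier (M W) \<and> b \<in> carrier (M W) \<and> v = \<mu> W a - \<mu> W b"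
 then obtain W' a' b' where m: "(W', cls W' a' b') \<in> gp.grm W (cls W a b) q" and W': "opn W'" "q \<in> W'" "a' \<in> carrier (M W')" "b' \<in> carrier (M W')"
  and v: "v = \<mu> W' a' - \<mu> W' b'" using s by auto
 obtain N where N: "opn N" "q \<in> N" "N \<subseteq> W \<inter> W'" "gp_presheaf_restr S W N (cls W a b) = gp_presheaf_restr S W' N (cls W' a' b')"
  using m unfolding gp.mem_germ_iff gp.agree_def by blast
 have sub: "N \<subseteq> W" "N \<subseteq> W'" using N(3) by auto
 interpret G: cmonoid "M N" by (rule cmonoid_M[OF N(1)])
 have c: "res W N a \<in> carrier (M N)" "res W N b \<in> carrier (M N)" "res W' N a' \<in> carrier (M N)" "res W' N b' \<in> carrier (M N)"
  using res_closed W W' N(1) sub by auto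
 have "cls N (res W N a) (res W N b) = cls N (res W' N a') (res W' N b')"
  using N(4) gp_restr_class[OF W(1) N(1) sub(1) W(3,4)] gp_restr_class[OF W'(1) N(1) sub(2) W'(3,4)] by simp
 then obtain e where e: "e \<in> carrier (M N)"
  "e \<otimes>\<^bsub>M N\<^esub> (res W N a \<otimes>\<^bsub>M N\<^esub> res W' N b') = e \<otimes>\<^bsub>M N\<^esub> (res W' N a' \<otimes>\<^bsub>M N\<^esub> res W N b)" using G.gp_class_eq_iff[OF c] by blast
 have add: "\<mu> N (x \<otimes>\<^bsub>M N\<^esub> y) = \<mu> N x + \<mu> N y" if "x \<in> carrier (M N)" "y \<in> carrier (M N)" for x y
  using \<mu> N(1,2) that unfolding germ_additive_def by blast
 have r: "\<mu> N (res W N x) = \<mu> W x" if "x \<in> carrier (M W)" for x using \<mu> W(1) N(1,2) sub that unfolding germ_additive_def by blast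
 have r': "\<mu> N (res W' N x) = \<mu> W' x" if "x \<in> carrier (M W')" for x using \<mu> W'(1) N(1,2) sub that unfolding germ_additive_def by blast
 have "\<mu> N (e \<otimes>\<^bsub>M N\<^esub> (res W N a \<otimes>\<^bsub>M N\<^esub> res W' N b')) = \<mu> N (e \<otimes>\<^bsub>M N\<^esub> (res W' N a' \<otimes>\<^bsub>M N\<^esub> res W N b))" by (simp only: e(2))
 then have "\<mu> W a + \<mu> W' b' = \<mu> W' a' + \<mu> W b" using e(1) c W W' by (simp add: add r r')
 then show "v = \<mu> W a - \<mu> W b" unfolding v by (simp add: algebra_simps)
qed

lemma gp_val_to_gp:
 assumes \<mu>: "germ_additive \<mu> q" and W: "opn W" "q \<in> W" "a \<in> carrier (M W)"
 shows "gp_val \<mu> q (to_gp S W a) = \<mu> W a"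
proof -
 have "\<mu> W (\<one>\<^bsub>M W\<^esub> \<otimes>\<^bsub>M W\<^esub> \<one>\<^bsub>M W\<^esub>) = \<mu> W \<one>\<^bsub>M W\<^esub> + \<mu> W \<one>\<^bsub>M W\<^esub>" using \<mu> W(1,2) one_M[OF W(1)] unfolding germ_additive_def by blast
 moreover have "\<one>\<^bsub>M W\<^esub> \<otimes>\<^bsub>M W\<^esub> \<one>\<^bsub>M W\<^esub> = \<one>\<^bsub>M W\<^esub>" using comm_monoid_M[OF W(1)] by (simp add: comm_monoid.axioms(1) monoid.l_one one_M[OF W(1)])
 ultimately have "\<mu> W \<one>\<^bsub>M W\<^esub> = 0" by simp
 then show ?thesis using gp_val_germ[OF \<mu> W one_M[OF W(1)], where \<sigma> = "to_gp S W a"] to_gp_germ[OF W(2)] by simp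
qed

lemma gp_val_mult:
 assumes \<mu>: "germ_additive \<mu> q" and V: "opn V" "q \<in> V" "\<sigma> \<in> GS V" "\<tau> \<in> GS V"
 shows "gp_val \<mu> q (\<sigma> \<otimes>\<^bsub>gp_secs S V\<^esub> \<tau>) = gp_val \<mu> q \<sigma> + gp_val \<mu> q \<tau>"
proof -
 obtain W A B where W: "opn W" "q \<in> W" "W \<subseteq> V" "A \<in> GC W" "B \<in> GC W" "\<forall>p\<in>W. \<sigma> p = gp.grm W A p" "\<forall>p\<in>W. \<tau> p = gp.grm W B p"
  using gp.section_common_germ[OF V(3,4)[unfolded GS_eq] V(2)] by blast
 obtain a b where ab: "a \<in> carrier (M W)" "b \<in> carrier (M W)" "A = cls W a b" using W(4) GC_iff[OF W(1)] by blast
 obtain c d where cd: "c \<in> carrier (M W)" "d \<in> carrier (M W)" "B = cls W c d" using W(5) GC_iff[OF W(1)] by blast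
 have st: "\<sigma> q = gp.grm W A q" "\<tau> q = gp.grm W B q" using W by auto
 have "(\<sigma> \<otimes>\<^bsub>gp_secs S V\<^esub> \<tau>) q = gp.grm W (A \<otimes>\<^bsub>gp_presheaf S W\<^esub> B) q"
  unfolding GS_mult by (rule gp.sheafify_op_germ[where \<sigma> = \<sigma> and \<tau> = \<tau>, OF W(1,4,5,2) V(2) st])
 also have "A \<otimes>\<^bsub>gp_presheaf S W\<^esub> B = cls W (a \<otimes>\<^bsub>M W\<^esub> c) (b \<otimes>\<^bsub>M W\<^esub> d)"
  unfolding ab(3) cd(3) using cmonoid.gp_mult_class[OF cmonoid_M[OF W(1)] ab(1,2) cd(1,2)] by (simp add: gp_presheaf_def)
 finally have "gp_val \<mu> q (\<sigma> \<otimes>\<^bsub>gp_secs S V\<^esub> \<tau>) = \<mu> W (a \<otimes>\<^bsub>M W\<^esub> c) - \<mu> W (b \<otimes>\<^bsub>M W\<^esub> d)" by (intro gp_val_germ[OF \<mu> W(1,2)] mult_M W(1) ab cd)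
 also have "\<dots> = (\<mu> W a + \<mu> W c) - (\<mu> W b + \<mu> W d)" using \<mu> W(1,2) ab cd unfolding germ_additive_def by simp
 also have "\<dots> = gp_val \<mu> q \<sigma> + gp_val \<mu> q \<tau>"
  using gp_val_germ[OF \<mu> W(1,2) ab(1,2), of \<sigma>] gp_val_germ[OF \<mu> W(1,2) cd(1,2), of \<tau>] st ab(3) cd(3) by simp
 finally show ?thesis .
qed

lemma gp_val_restrict: "q \<in> W ==> gp_val \<mu> q (restrict \<sigma> W) = gp_val \<mu> q \<sigma>" by (simp add: gp_val_def)

end

section \<open>The presheaf of logarithmic functions\<close>

text \<open>Phrased for a map into a ring of the type class, so that evaluation at a point can be
  used as it stands.\<close>

lemma (in cring) kernel_idealI:
 fixes h :: "'a \<Rightarrow> 'v::comm_ring"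
 assumes add: "\<And>a b. a \<in> carrier R ==> b \<in> carrier R ==> h (a \<oplus> b) = h a + h b"
  and mult: "\<And>a b. a \<in> carrier R ==> b \<in> carrier R ==> h (a \<otimes> b) = h a * h b"
 shows "ideal {a \<in> carrier R. h a = 0} R"
proof (rule idealI[OF ring_axioms])
 have z: "h \<zero> = 0" using add[of \<zero> \<zero>] by simp
 have inv: "h (\<ominus> a) = 0" if "a \<in> carrier R" "h a = 0" for a using add[of a "\<ominus> a"] that z by (simp add: r_neg)
 show "subgroup {a \<in> carrier R. h a = 0} (add_monoid R)" by (rule add.subgroupI) (use z add inv in auto)
qed (auto simp: mult)

context plog
begin

abbreviation "FR V \<equiv> free_log_ring S V"
abbreviation "fvar V \<equiv> free_log_var S V"
abbreviation "fconst V \<equiv> free_log_const S V"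

lemma FR_eq: "FR V = MP V (GS V)" by (simp add: free_log_ring_def)

lemma cring_FR: "opn V ==> cring (FR V)" unfolding FR_eq by (rule cring_MP)

definition rm :: "'p set \<Rightarrow> 'p set \<Rightarrow> ('p, 'm) free_log \<Rightarrow> ('p, 'm) free_log" where
 "rm V W = mpoly_map (R V) (R W) (\<lambda>f. restrict f W) (\<lambda>\<sigma>. restrict \<sigma> W)"

lemma rm:
 assumes V: "opn V" "opn W" "W \<subseteq> V" and P: "P \<in> carrier (FR V)"
 shows "rm V W P \<in> carrier (FR W)"
  and "q \<in> W ==> at_pt (rm V W P) q = subst_poly (\<lambda>\<sigma>. pvar (restrict \<sigma> W)) (at_pt P q)" unfolding FR_eq rm_def
 by (rule MP_map[OF V P[unfolded FR_eq]], rule GS_restrict[OF V], assumption)+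

lemma FR_const: "opn V ==> f \<in> carrier (R V) ==> fconst V f \<in> carrier (FR V)" unfolding FR_eq by (rule MP_const)

lemma FR_var: "opn V ==> \<sigma> \<in> GS V ==> fvar V \<sigma> \<in> carrier (FR V)" unfolding FR_eq by (rule MP_var)

lemma FR_ext:
 assumes "opn V" "P \<in> carrier (FR V)" "Q \<in> carrier (FR V)" "\<And>q. q \<in> V ==> at_pt P q = at_pt Q q"
 shows "P = Q" using MP_ext[OF assms(1), where I = "GS V" and J = "GS V"] assms(2-4) unfolding FR_eq by blast

lemma rm_const:
 "opn V ==> opn W ==> W \<subseteq> V ==> f \<in> carrier (R V) ==> rm V W (fconst V f) = fconst W (restrict f W)" unfolding rm_def by (rule MP_map_const)

lemma rm_var:
 "opn V ==> opn W ==> W \<subseteq> V ==> rm V W (fvar V \<sigma>) = fvar W (restrict \<sigma> W)" unfolding rm_def by (rule MP_map_var)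

lemma FR_add: "opn V ==> P \<in> carrier (FR V) ==> Q \<in> carrier (FR V) ==> q \<in> V ==> at_pt (P \<oplus>\<^bsub>FR V\<^esub> Q) q = at_pt P q + at_pt Q q"
 unfolding FR_eq by (rule MP_add(2))

lemma FR_mult: "opn V ==> P \<in> carrier (FR V) ==> Q \<in> carrier (FR V) ==> q \<in> V ==> at_pt (P \<otimes>\<^bsub>FR V\<^esub> Q) q = at_pt P q * at_pt Q q"
 unfolding FR_eq by (rule MP_mult(2))

lemma FR_minus: "opn V ==> P \<in> carrier (FR V) ==> Q \<in> carrier (FR V) ==> q \<in> V ==> at_pt (P \<ominus>\<^bsub>FR V\<^esub> Q) q = at_pt P q - at_pt Q q"
 unfolding FR_eq by (rule MP_minus)

lemma rm_ring_hom: "opn V ==> opn W ==> W \<subseteq> V ==> rm V W \<in> ring_hom (FR V) (FR W)" unfolding rm_def FR_eq by (intro MP_map_hom GS_restrict)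

lemma rm_ring_hom_ring: "opn V ==> opn W ==> W \<subseteq> V ==> ring_hom_ring (FR V) (FR W) (rm V W)"
 by (intro ring_hom_ringI2 rm_ring_hom cring.axioms(1)[OF cring_FR])

lemma rm_comp:
 assumes V: "opn V" "opn W" "opn N" "N \<subseteq> W" "W \<subseteq> V" and P: "P \<in> carrier (FR V)"
 shows "rm W N (rm V W P) = rm V N P"
proof (rule FR_ext[OF V(3)])
 have NV: "N \<subseteq> V" using V by blast
 note a = rm[OF V(1,2,5) P] and b = rm[OF V(1,3) NV P]
 note c = rm[OF V(2-4) a(1)]
 show "rm W N (rm V W P) \<in> carrier (FR N)" "rm V N P \<in> carrier (FR N)" by (rule c(1), rule b(1))
 fix q assume q: "q \<in> N"
 then have qW: "q \<in> W" using V by blast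
 have e: "restrict (restrict \<sigma> W) N = restrict \<sigma> N" for \<sigma> :: "('p, 'm) gp_section" by (rule ext) (use V(4) in auto)
 show "at_pt (rm W N (rm V W P)) q = at_pt (rm V N P) q" unfolding c(2)[OF q] b(2)[OF q] a(2)[OF qW] subst_poly_compose subst_poly_var e ..
qed

lemma basic_restrict:
 assumes V: "opn V" "opn W" "W \<subseteq> V" and f: "f \<in> basic_secs S V"
 shows "res V W f \<in> basic_secs S W"
proof -
 have fc: "f \<in> carrier (M V)" using f by (simp add: basic_secs_def)
 have "\<exists>q\<in>N. al W (res V W f) q \<noteq> 0" if N: "opn N" "p \<in> N" "N \<subseteq> W" for p N
 proof -
  have "p \<in> V" "N \<subseteq> V" using N V by auto
  then obtain q where "q \<in> N" "al V f q \<noteq> 0" using f N unfolding basic_secs_def by blast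
  then show ?thesis using N by (intro bexI[of _ q]) (auto simp: al_res[OF V fc])
 qed
 then show ?thesis using res_closed[OF V fc] unfolding basic_secs_def by blast
qed

lemma log_relations_closed:
 assumes V: "opn V" shows "log_relations S V \<subseteq> carrier (FR V)"
proof
 interpret A: cring "FR V" by (rule cring_FR[OF V])
 fix P assume "P \<in> log_relations S V"
 then consider (1) f1 f2 where "f1 \<in> GS V" "f2 \<in> GS V" "P = fvar V (f1 \<otimes>\<^bsub>gp_secs S V\<^esub> f2) \<ominus>\<^bsub>FR V\<^esub> (fvar V f1 \<oplus>\<^bsub>FR V\<^esub> fvar V f2)"
  | (2) f g G where "f \<in> basic_secs S V" "g \<in> carrier (R V)" "G \<in> carrier (R V)"
   "P = (fconst V g \<otimes>\<^bsub>FR V\<^esub> fvar V (to_gp S V f)) \<ominus>\<^bsub>FR V\<^esub> fconst V G" unfolding log_relations_def by blast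
 then show "P \<in> carrier (FR V)"
 proof cases
  case 1
  show ?thesis unfolding 1(3) by (intro A.minus_closed A.a_closed FR_var V 1 GS_mult_closed)
 next
  case 2
  then have "f \<in> carrier (M V)" by (simp add: basic_secs_def)
  then show ?thesis unfolding 2(4) by (intro A.minus_closed A.m_closed FR_var FR_const V 2 to_gp_GS)
 qed
qed

lemma log_ideal_ideal: "opn V ==> ideal (log_ideal S V) (FR V)"
 unfolding log_ideal_def by (intro ring.genideal_ideal cring.axioms(1)[OF cring_FR] log_relations_closed)

lemma log_ideal_minimal: "opn V ==> ideal I (FR V) ==> log_relations S V \<subseteq> I ==> log_ideal S V \<subseteq> I"
 unfolding log_ideal_def by (intro ring.genideal_minimal cring.axioms(1)[OF cring_FR])

lemma log_relations_ideal: "opn V ==> log_relations S V \<subseteq> log_ideal S V"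
 unfolding log_ideal_def by (intro ring.genideal_self cring.axioms(1)[OF cring_FR] log_relations_closed)

text \<open>Generators restrict to generators: products of sections, basic sections and the identity
  defining the second kind are all compatible with restriction.\<close>

lemma rm_relations:
 assumes V: "opn V" "opn W" "W \<subseteq> V" and P: "P \<in> log_relations S V"
 shows "rm V W P \<in> log_relations S W"
proof -
 interpret A: cring "FR V" by (rule cring_FR[OF V(1)])
 interpret B: cring "FR W" by (rule cring_FR[OF V(2)])
 interpret h: ring_hom_ring "FR V" "FR W" "rm V W" by (rule rm_ring_hom_ring[OF V])
 have hm: "rm V W (x \<ominus>\<^bsub>FR V\<^esub> y) = rm V W x \<ominus>\<^bsub>FR W\<^esub> rm V W y" if "x \<in> carrier (FR V)" "y \<in> carrier (FR V)" for x y
  using that by (simp add: A.minus_eq B.minus_eq)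
 from P consider (1) f1 f2 where "f1 \<in> GS V" "f2 \<in> GS V" "P = fvar V (f1 \<otimes>\<^bsub>gp_secs S V\<^esub> f2) \<ominus>\<^bsub>FR V\<^esub> (fvar V f1 \<oplus>\<^bsub>FR V\<^esub> fvar V f2)"
  | (2) f g G where "f \<in> basic_secs S V" "g \<in> carrier (R V)" "G \<in> carrier (R V)" "\<forall>p\<in>V \<inter> mfd_interior (atlas S). G p = g p * ln (log_alpha S V f p)"
   "P = (fconst V g \<otimes>\<^bsub>FR V\<^esub> fvar V (to_gp S V f)) \<ominus>\<^bsub>FR V\<^esub> fconst V G" unfolding log_relations_def by blast
 then show ?thesis
 proof cases
  case 1
  note c = FR_var[OF V(1) 1(1)] FR_var[OF V(1) 1(2)] FR_var[OF V(1) GS_mult_closed[OF 1(1,2)]]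
  have "rm V W P = fvar W (restrict f1 W \<otimes>\<^bsub>gp_secs S W\<^esub> restrict f2 W) \<ominus>\<^bsub>FR W\<^esub>
    (fvar W (restrict f1 W) \<oplus>\<^bsub>FR W\<^esub> fvar W (restrict f2 W))"
   unfolding 1(3) hm[OF c(3) A.a_closed[OF c(1,2)]] h.hom_add[OF c(1,2)] rm_var[OF V]
    GS_restrict_mult[OF V(3)] ..
  then show ?thesis unfolding log_relations_def using GS_restrict[OF V 1(1)] GS_restrict[OF V 1(2)] by blast
 next
  case 2
  have fc: "f \<in> carrier (M V)" using 2(1) by (simp add: basic_secs_def)
  note c = FR_const[OF V(1) 2(2)] FR_var[OF V(1) to_gp_GS[OF V(1) fc]] FR_const[OF V(1) 2(3)]
  have "rm V W P = (fconst W (restrict g W) \<otimes>\<^bsub>FR W\<^esub> fvar W (to_gp S W (res V W f))) \<ominus>\<^bsub>FR W\<^esub> fconst W (restrict G W)"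
   unfolding 2(5) hm[OF A.m_closed[OF c(1,2)] c(3)] h.hom_mult[OF c(1,2)] rm_const[OF V 2(2)] rm_const[OF V 2(3)]
    rm_var[OF V] to_gp_restrict[OF V fc] ..
  moreover have "\<forall>p\<in>W \<inter> mfd_interior (atlas S). restrict G W p = restrict g W p * ln (log_alpha S W (res V W f) p)"
   using 2(4) V(3) by (auto simp: al_res[OF V fc])
  ultimately show ?thesis unfolding log_relations_def using basic_restrict[OF V 2(1)] R_restrict[OF V 2(2)] R_restrict[OF V 2(3)] by blast
 qed
qed

text \<open>The preimage of the ideal over \<open>W\<close> is an ideal over \<open>V\<close> and
  contains the generators.\<close>

lemma rm_ideal:
 assumes V: "opn V" "opn W" "W \<subseteq> V" and P: "P \<in> log_ideal S V"
 shows "rm V W P \<in> log_ideal S W"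
proof -
 interpret h: ring_hom_ring "FR V" "FR W" "rm V W" by (rule rm_ring_hom_ring[OF V])
 have "ideal {r \<in> carrier (FR V). rm V W r \<in> log_ideal S W} (FR V)" by (rule h.ideal_vimage[OF log_ideal_ideal[OF V(2)]])
 moreover have "log_relations S V \<subseteq> {r \<in> carrier (FR V). rm V W r \<in> log_ideal S W}"
  using log_relations_closed[OF V(1)] rm_relations[OF V] log_relations_ideal[OF V(2)] by blast
 ultimately show ?thesis using log_ideal_minimal[OF V(1)] P by blast
qed

abbreviation "LC V \<equiv> log_class S V"
abbreviation "LP V \<equiv> log_presheaf S V"

lemma cring_LP: "opn V ==> cring (LP V)" unfolding log_presheaf_def by (intro ideal.quotient_is_cring log_ideal_ideal cring_FR)

lemma LC_hom: "opn V ==> LC V \<in> ring_hom (FR V) (LP V)"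
 using ideal.rcos_ring_hom[OF log_ideal_ideal[of V]] unfolding log_presheaf_def log_class_def .

lemma LC_ring_hom_ring: "opn V ==> ring_hom_ring (FR V) (LP V) (LC V)"
 by (intro ring_hom_ringI2 LC_hom cring.axioms(1)[OF cring_FR] cring.axioms(1)[OF cring_LP])

lemma LC_eq_iff: "opn V ==> P \<in> carrier (FR V) ==> Q \<in> carrier (FR V) ==> LC V P = LC V Q \<longleftrightarrow> P \<ominus>\<^bsub>FR V\<^esub> Q \<in> log_ideal S V"
 unfolding log_class_def using ring.quotient_eq_iff_same_a_r_cos[OF cring.axioms(1)[OF cring_FR] log_ideal_ideal] by blast

lemma LP_carrier: "carrier (LP V) = LC V ` carrier (FR V)" by (auto simp: log_presheaf_def log_class_def FactRing_def A_RCOSETS_def')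

lemma LC_self:
 assumes V: "opn V" and P: "P \<in> carrier (FR V)" shows "P \<in> LC V P"
proof -
 interpret A: cring "FR V" by (rule cring_FR[OF V])
 interpret I: ideal "log_ideal S V" "FR V" by (rule log_ideal_ideal[OF V])
 show ?thesis unfolding log_class_def a_r_coset_def' by (rule UN_I[OF I.zero_closed]) (simp add: P)
qed

lemma LC_mem: "opn V ==> P \<in> carrier (FR V) ==> Q \<in> LC V P ==> Q \<in> carrier (FR V) \<and> LC V Q = LC V P"
proof -
 assume V: "opn V" and P: "P \<in> carrier (FR V)" and Q: "Q \<in> LC V P"
 interpret A: cring "FR V" by (rule cring_FR[OF V])
 interpret I: ideal "log_ideal S V" "FR V" by (rule log_ideal_ideal[OF V])
 obtain i where i: "i \<in> log_ideal S V" "Q = i \<oplus>\<^bsub>FR V\<^esub> P" using Q by (auto simp: log_class_def a_r_coset_def')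
 have ic: "i \<in> carrier (FR V)" using i(1) I.Icarr by blast
 have Qc: "Q \<in> carrier (FR V)" using i ic P by simp
 have "Q \<ominus>\<^bsub>FR V\<^esub> P = i" unfolding i(2) using ic P by (simp add: A.minus_eq A.a_assoc A.r_neg)
 then show ?thesis using Qc i(1) LC_eq_iff[OF V Qc P] by simp
qed

text \<open>Restriction maps ideal to ideal, so the union in \<open>log_presheaf_restr\<close> is
  over a single coset.\<close>

lemma LP_restr:
 assumes V: "opn V" "opn W" "W \<subseteq> V" and P: "P \<in> carrier (FR V)"
 shows "log_presheaf_restr S V W (LC V P) = LC W (rm V W P)"
proof -
 interpret A: cring "FR V" by (rule cring_FR[OF V(1)])
 interpret B: cring "FR W" by (rule cring_FR[OF V(2)])
 interpret h: ring_hom_ring "FR V" "FR W" "rm V W" by (rule rm_ring_hom_ring[OF V])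
 have e: "LC W (rm V W Q) = LC W (rm V W P)" if "Q \<in> LC V P" for Q
 proof -
  have Q: "Q \<in> carrier (FR V)" "LC V Q = LC V P" using LC_mem[OF V(1) P that] by auto
  have "rm V W (Q \<ominus>\<^bsub>FR V\<^esub> P) \<in> log_ideal S W" using LC_eq_iff[OF V(1) Q(1) P] Q(2) rm_ideal[OF V] by blast
  then have "rm V W Q \<ominus>\<^bsub>FR W\<^esub> rm V W P \<in> log_ideal S W" using Q P by (simp add: A.minus_eq B.minus_eq)
  then show ?thesis using LC_eq_iff[OF V(2) rm(1)[OF V Q(1)] rm(1)[OF V P]] by blast
 qed
 have "log_presheaf_restr S V W (LC V P) = (\<Union>Q\<in>LC V P. LC W (rm V W Q))" unfolding log_presheaf_restr_def rm_def ..
 also have "\<dots> = (\<Union>Q\<in>LC V P. LC W (rm V W P))" by (rule SUP_cong[OF refl e])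
 also have "\<dots> = LC W (rm V W P)" using LC_self[OF V(1) P] by blast
 finally show ?thesis .
qed

abbreviation "LPC V \<equiv> carrier (LP V)"

sublocale lp: set_presheaf "space_of S" LPC "log_presheaf_restr S"
proof
 fix V W :: "'p set" and s
 assume V: "opn V" "opn W" "W \<subseteq> V" and s: "s \<in> LPC V"
 obtain P where P: "P \<in> carrier (FR V)" "s = LC V P" using s LP_carrier by blast
 show "log_presheaf_restr S V W s \<in> LPC W" unfolding P(2) LP_restr[OF V P(1)] LP_carrier using rm(1)[OF V P(1)] by blast
next
 fix V W N :: "'p set" and s
 assume V: "opn V" "opn W" "opn N" "N \<subseteq> W" "W \<subseteq> V" and s: "s \<in> LPC V"
 have NV: "N \<subseteq> V" using V by blast
 obtain P where P: "P \<in> carrier (FR V)" "s = LC V P" using s LP_carrier by blast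
 show "log_presheaf_restr S W N (log_presheaf_restr S V W s) = log_presheaf_restr S V N s"
  unfolding P(2) LP_restr[OF V(1,2,5) P(1)] LP_restr[OF V(2-4) rm(1)[OF V(1,2,5) P(1)]] LP_restr[OF V(1,3) NV P(1)] rm_comp[OF V P(1)] ..
qed

lemma LC_op:
 assumes V: "opn V" and P: "P \<in> carrier (FR V)" "Q \<in> carrier (FR V)"
 shows "LC V P \<oplus>\<^bsub>LP V\<^esub> LC V Q = LC V (P \<oplus>\<^bsub>FR V\<^esub> Q)" "LC V P \<otimes>\<^bsub>LP V\<^esub> LC V Q = LC V (P \<otimes>\<^bsub>FR V\<^esub> Q)"
 using ring_hom_add[OF LC_hom[OF V] P] ring_hom_mult[OF LC_hom[OF V] P] by simp_all

sublocale lpa: presheaf_op "space_of S" LPC "log_presheaf_restr S" "\<lambda>V. add (LP V)"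
proof
 fix V :: "'p set" and s t assume V: "opn V" and st: "s \<in> LPC V" "t \<in> LPC V"
 interpret L: cring "LP V" by (rule cring_LP[OF V])
 show "s \<oplus>\<^bsub>LP V\<^esub> t \<in> LPC V" by (rule L.a_closed[OF st])
next
 fix V W :: "'p set" and s t assume V: "opn V" "opn W" "W \<subseteq> V" and st: "s \<in> LPC V" "t \<in> LPC V"
 interpret A: cring "FR V" by (rule cring_FR[OF V(1)])
 obtain P where P: "P \<in> carrier (FR V)" "s = LC V P" using st LP_carrier by blast
 obtain Q where Q: "Q \<in> carrier (FR V)" "t = LC V Q" using st LP_carrier by blast
 show "log_presheaf_restr S V W (s \<oplus>\<^bsub>LP V\<^esub> t) = log_presheaf_restr S V W s \<oplus>\<^bsub>LP W\<^esub> log_presheaf_restr S V W t"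
  unfolding P(2) Q(2) LC_op(1)[OF V(1) P(1) Q(1)] LP_restr[OF V P(1)] LP_restr[OF V Q(1)] LP_restr[OF V A.a_closed[OF P(1) Q(1)]]
   LC_op(1)[OF V(2) rm(1)[OF V P(1)] rm(1)[OF V Q(1)]] ring_hom_add[OF rm_ring_hom[OF V] P(1) Q(1)] ..
qed

sublocale lpm: presheaf_op "space_of S" LPC "log_presheaf_restr S" "\<lambda>V. mult (LP V)"
proof
 fix V :: "'p set" and s t assume V: "opn V" and st: "s \<in> LPC V" "t \<in> LPC V"
 interpret L: cring "LP V" by (rule cring_LP[OF V])
 show "s \<otimes>\<^bsub>LP V\<^esub> t \<in> LPC V" by (rule L.m_closed[OF st])
next
 fix V W :: "'p set" and s t assume V: "opn V" "opn W" "W \<subseteq> V" and st: "s \<in> LPC V" "t \<in> LPC V"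
 interpret A: cring "FR V" by (rule cring_FR[OF V(1)])
 obtain P where P: "P \<in> carrier (FR V)" "s = LC V P" using st LP_carrier by blast
 obtain Q where Q: "Q \<in> carrier (FR V)" "t = LC V Q" using st LP_carrier by blast
 show "log_presheaf_restr S V W (s \<otimes>\<^bsub>LP V\<^esub> t) = log_presheaf_restr S V W s \<otimes>\<^bsub>LP W\<^esub> log_presheaf_restr S V W t"
  unfolding P(2) Q(2) LC_op(2)[OF V(1) P(1) Q(1)] LP_restr[OF V P(1)] LP_restr[OF V Q(1)] LP_restr[OF V A.m_closed[OF P(1) Q(1)]]
   LC_op(2)[OF V(2) rm(1)[OF V P(1)] rm(1)[OF V Q(1)]] ring_hom_mult[OF rm_ring_hom[OF V] P(1) Q(1)] ..
qed

lemma LC_rel1: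
 assumes V: "opn V" and s: "\<sigma> \<in> GS V" "\<tau> \<in> GS V"
 shows "LC V (fvar V (\<sigma> \<otimes>\<^bsub>gp_secs S V\<^esub> \<tau>)) = LC V (fvar V \<sigma>) \<oplus>\<^bsub>LP V\<^esub> LC V (fvar V \<tau>)"
proof -
 interpret A: cring "FR V" by (rule cring_FR[OF V])
 note c = FR_var[OF V s(1)] FR_var[OF V s(2)] FR_var[OF V GS_mult_closed[OF s]]
 have "fvar V (\<sigma> \<otimes>\<^bsub>gp_secs S V\<^esub> \<tau>) \<ominus>\<^bsub>FR V\<^esub> (fvar V \<sigma> \<oplus>\<^bsub>FR V\<^esub> fvar V \<tau>) \<in> log_relations S V" unfolding log_relations_def using s by blast
 then show ?thesis unfolding LC_op(1)[OF V c(1,2)] LC_eq_iff[OF V c(3) A.a_closed[OF c(1,2)]] using log_relations_ideal[OF V] by blast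
qed

lemma LC_rel2:
 assumes V: "opn V" and f: "f \<in> basic_secs S V" and g: "g \<in> carrier (R V)" "G \<in> carrier (R V)"
  and e: "\<And>p. p \<in> V ==> p \<in> mfd_interior (atlas S) ==> G p = g p * ln (al V f p)"
 shows "LC V (fconst V g) \<otimes>\<^bsub>LP V\<^esub> LC V (fvar V (to_gp S V f)) = LC V (fconst V G)"
proof -
 interpret A: cring "FR V" by (rule cring_FR[OF V])
 have fc: "f \<in> carrier (M V)" using f by (simp add: basic_secs_def)
 note c = FR_const[OF V g(1)] FR_var[OF V to_gp_GS[OF V fc]] FR_const[OF V g(2)]
 have "(fconst V g \<otimes>\<^bsub>FR V\<^esub> fvar V (to_gp S V f)) \<ominus>\<^bsub>FR V\<^esub> fconst V G \<in> log_relations S V" unfolding log_relations_def using f g e by blast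
 then show ?thesis unfolding LC_op(2)[OF V c(1,2)] LC_eq_iff[OF V A.m_closed[OF c(1,2)] c(3)] using log_relations_ideal[OF V] by blast
qed

text \<open>Evaluation of the coefficients at \<open>q\<close> followed by a substitution for the
  symbols is multiplicative and additive, so its kernel is an ideal and only the two kinds of
  generators have to be checked.\<close>

lemma log_ideal_eval:
 assumes V: "opn V" and q: "q \<in> V"
  and add: "\<And>\<sigma> \<tau>. \<sigma> \<in> GS V ==> \<tau> \<in> GS V ==> v (\<sigma> \<otimes>\<^bsub>gp_secs S V\<^esub> \<tau>) = v \<sigma> + v \<tau>"
  and rel: "\<And>f g G. f \<in> basic_secs S V ==> g \<in> carrier (R V) ==> G \<in> carrier (R V) ==>
   (\<And>p. p \<in> V ==> p \<in> mfd_interior (atlas S) ==> G p = g p * ln (al V f p)) ==> pconst (g q) * v (to_gp S V f) = pconst (G q)"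
  and P: "P \<in> log_ideal S V"
 shows "subst_poly v (at_pt P q) = 0"
proof -
 interpret A: cring "FR V" by (rule cring_FR[OF V])
 let ?I = "{P \<in> carrier (FR V). subst_poly v (at_pt P q) = 0}"
 have "ideal ?I (FR V)" by (rule A.kernel_idealI) (simp_all add: FR_add[OF V _ _ q] FR_mult[OF V _ _ q] subst_poly_add subst_poly_mult)
 moreover have "log_relations S V \<subseteq> ?I"
 proof
  fix P assume P: "P \<in> log_relations S V"
  then have Pc: "P \<in> carrier (FR V)" using log_relations_closed[OF V] by blast
  from P consider (1) f1 f2 where "f1 \<in> GS V" "f2 \<in> GS V" "P = fvar V (f1 \<otimes>\<^bsub>gp_secs S V\<^esub> f2) \<ominus>\<^bsub>FR V\<^esub> (fvar V f1 \<oplus>\<^bsub>FR V\<^esub> fvar V f2)"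
   | (2) f g G where "f \<in> basic_secs S V" "g \<in> carrier (R V)" "G \<in> carrier (R V)" "\<forall>p\<in>V \<inter> mfd_interior (atlas S). G p = g p * ln (log_alpha S V f p)"
    "P = (fconst V g \<otimes>\<^bsub>FR V\<^esub> fvar V (to_gp S V f)) \<ominus>\<^bsub>FR V\<^esub> fconst V G" unfolding log_relations_def by blast
  then have "subst_poly v (at_pt P q) = 0"
  proof cases
   case 1
   note c = FR_var[OF V 1(1)] FR_var[OF V 1(2)] FR_var[OF V GS_mult_closed[OF 1(1,2)]]
   show ?thesis unfolding 1(3) FR_minus[OF V c(3) A.a_closed[OF c(1,2)] q] FR_add[OF V c(1,2) q]
     MP_var(2)[OF V 1(1) q] MP_var(2)[OF V 1(2) q] MP_var(2)[OF V GS_mult_closed[OF 1(1,2)] q]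
    by (simp add: subst_poly_diff subst_poly_add add 1)
  next
   case 2
   have fc: "f \<in> carrier (M V)" using 2(1) by (simp add: basic_secs_def)
   note c = FR_const[OF V 2(2)] FR_var[OF V to_gp_GS[OF V fc]] FR_const[OF V 2(3)]
   have e: "pconst (g q) * v (to_gp S V f) = pconst (G q)" by (rule rel[OF 2(1-3)]) (use 2(4) in blast)
   show ?thesis unfolding 2(5) FR_minus[OF V A.m_closed[OF c(1,2)] c(3) q] FR_mult[OF V c(1,2) q]
     MP_var(2)[OF V to_gp_GS[OF V fc] q] MP_const(2)[OF V 2(2) q] MP_const(2)[OF V 2(3) q] by (simp add: subst_poly_diff subst_poly_mult e)
  qed
  then show "P \<in> ?I" using Pc by simp
 qed
 ultimately show ?thesis using log_ideal_minimal[OF V] P by blast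
qed

end

section \<open>Evaluation and normal forms in log coordinates\<close>

locale log_coords = plog S for S :: "('p, 'm) log_space" +
 fixes n k :: nat and U :: "'p set" and \<phi> :: "'p \<Rightarrow> nat \<Rightarrow> real" and \<Phi> :: "(nat \<Rightarrow> real) set \<Rightarrow> std_section \<Rightarrow> 'm"
 assumes log_chart: "log_chart S n k U \<phi> \<Phi>"
begin

lemma chart_U: "(n, U, \<phi>) \<in> atlas S" using log_chart by (simp add: log_chart_def)

lemma open_U: "opn U" by (rule chart_open[OF chart_U])

lemma inj_phi: "inj_on \<phi> U" by (rule chart_inj[OF chart_U])

abbreviation "std V \<equiv> std_log_secs n k (\<phi> ` V)"
abbreviation "\<Phi>\<^sub>0 V \<equiv> \<Phi> (\<phi> ` V)"

lemma preimage_image: "V \<subseteq> U ==> U \<inter> \<phi> -` (\<phi> ` V) = V" using inj_phi by (auto simp: inj_on_def)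

lemma image_open: "opn V ==> V \<subseteq> U ==> openin (orthant n) (\<phi> ` V)" by (rule chart_image_openin[OF chart_U])

lemma log_chart_conds:
 assumes V: "opn V" "V \<subseteq> U"
 shows "\<Phi>\<^sub>0 V \<in> iso (std V) (M V)"
  and "s \<in> carrier (std V) ==> p \<in> V ==> al V (\<Phi>\<^sub>0 V s) p = std_alpha s (\<phi> p)"
  and "opn W ==> W \<subseteq> V ==> s \<in> carrier (std V) ==> res V W (\<Phi>\<^sub>0 V s) = \<Phi>\<^sub>0 W (restrict s (\<phi> ` W))"
proof -
 note c = log_chart[unfolded log_chart_def, THEN conjunct2]
 have i: "openin (orthant n) (\<phi> ` V) \<and> \<phi> ` V \<subseteq> \<phi> ` U" using image_open[OF V] V by blast
 note c1 = c[THEN conjunct1, rule_format, OF i, unfolded preimage_image[OF V(2)]]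
 show "\<Phi>\<^sub>0 V \<in> iso (std V) (M V)" using c1 by blast
 show "al V (\<Phi>\<^sub>0 V s) p = std_alpha s (\<phi> p)" if "s \<in> carrier (std V)" "p \<in> V" using c1 that by blast
 show "res V W (\<Phi>\<^sub>0 V s) = \<Phi>\<^sub>0 W (restrict s (\<phi> ` W))" if W: "opn W" "W \<subseteq> V" and s: "s \<in> carrier (std V)"
 proof -
  have WU: "W \<subseteq> U" using W V by blast
  have "openin (orthant n) (\<phi> ` V) \<and> openin (orthant n) (\<phi> ` W) \<and> \<phi> ` W \<subseteq> \<phi> ` V \<and> \<phi> ` V \<subseteq> \<phi> ` U" using i image_open[OF W(1) WU] W by blast
  from c[THEN conjunct2, rule_format, OF this s] show ?thesis unfolding preimage_image[OF V(2)] preimage_image[OF WU] .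
 qed
qed

lemma Phi_bij: "opn V ==> V \<subseteq> U ==> bij_betw (\<Phi>\<^sub>0 V) (carrier (std V)) (carrier (M V))" using log_chart_conds(1) by (simp add: iso_def)

lemma Phi_mult: "opn V ==> V \<subseteq> U ==> s \<in> carrier (std V) ==> t \<in> carrier (std V) ==>
  \<Phi>\<^sub>0 V (s \<otimes>\<^bsub>std V\<^esub> t) = \<Phi>\<^sub>0 V s \<otimes>\<^bsub>M V\<^esub> \<Phi>\<^sub>0 V t" using log_chart_conds(1) by (simp add: iso_def hom_def)

lemma Phi_closed: "opn V ==> V \<subseteq> U ==> s \<in> carrier (std V) ==> \<Phi>\<^sub>0 V s \<in> carrier (M V)" using Phi_bij bij_betwE by blast

definition sec :: "'p set \<Rightarrow> 'm \<Rightarrow> std_section" where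
 "sec V a = inv_into (carrier (std V)) (\<Phi>\<^sub>0 V) a"

lemma sec:
 assumes V: "opn V" "V \<subseteq> U" and a: "a \<in> carrier (M V)"
 shows "sec V a \<in> carrier (std V)" "\<Phi>\<^sub>0 V (sec V a) = a"
 unfolding sec_def using bij_betw_imp_surj_on[OF Phi_bij[OF V]] a inv_into_into f_inv_into_f by metis+

lemma sec_Phi: "opn V ==> V \<subseteq> U ==> s \<in> carrier (std V) ==> sec V (\<Phi>\<^sub>0 V s) = s"
 unfolding sec_def by (rule inv_into_f_f[OF bij_betw_imp_inj_on[OF Phi_bij]])

lemma std_carrier:
 "s \<in> carrier (std_log_secs n k W) \<longleftrightarrow> s \<in> extensional W \<and> (\<forall>x\<in>W. \<exists>N h a c.
    openin (orthant n) N \<and> x \<in> N \<and> N \<subseteq> W \<and> smooth_on n N h \<and> (\<forall>y\<in>N. 0 < h y) \<and>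
    set_mset c \<subseteq> {..<k} \<and> (\<forall>y\<in>N. s y = (h y * (\<Prod>i<n. y i ^ a i), c)))" by (simp add: std_log_secs_def)

lemma std_carrierD:
 assumes "s \<in> carrier (std_log_secs n k W)" "x \<in> W"
 obtains N h a c where "openin (orthant n) N" "x \<in> N" "N \<subseteq> W" "smooth_on n N h" "\<forall>y\<in>N. 0 < h y"
   "set_mset c \<subseteq> {..<k}" "\<forall>y\<in>N. s y = (h y * (\<Prod>i<n. y i ^ a i), c)"
 using bspec[OF conjunct2[OF assms(1)[unfolded std_carrier]] assms(2)] by (elim exE conjE) (rule that)

lemma std_restrict:
 assumes V: "opn V" "V \<subseteq> U" "opn W" "W \<subseteq> V" and s: "s \<in> carrier (std V)"
 shows "restrict s (\<phi> ` W) \<in> carrier (std W)"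
proof -
 have WU: "W \<subseteq> U" using V by blast
 have "\<exists>N h a c. openin (orthant n) N \<and> x \<in> N \<and> N \<subseteq> \<phi> ` W \<and> smooth_on n N h \<and> (\<forall>y\<in>N. 0 < h y) \<and>
    set_mset c \<subseteq> {..<k} \<and> (\<forall>y\<in>N. restrict s (\<phi> ` W) y = (h y * (\<Prod>i<n. y i ^ a i), c))" if x: "x \<in> \<phi> ` W" for x
 proof -
  have "x \<in> \<phi> ` V" using x V by blast
  from s this obtain N h a c where N: "openin (orthant n) N" "x \<in> N" "N \<subseteq> \<phi> ` V" "smooth_on n N h" "\<forall>y\<in>N. 0 < h y"
   "set_mset c \<subseteq> {..<k}" "\<forall>y\<in>N. s y = (h y * (\<Prod>i<n. y i ^ a i), c)" by (rule std_carrierD)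
  show ?thesis
  proof (intro exI conjI)
   show "openin (orthant n) (N \<inter> \<phi> ` W)" using N(1) image_open[OF V(3) WU] by blast
   show "smooth_on n (N \<inter> \<phi> ` W) h" by (rule smooth_on_subset[OF N(4)]) simp
   show "\<forall>y\<in>N \<inter> \<phi> ` W. restrict s (\<phi> ` W) y = (h y * (\<Prod>i<n. y i ^ a i), c)" using N(7) by simp
  qed (use N x in auto)
 qed
 moreover have "restrict s (\<phi> ` W) \<in> extensional (\<phi> ` W)" by simp
 ultimately show ?thesis unfolding std_carrier by blast
qed

lemma std_mult: "s \<otimes>\<^bsub>std V\<^esub> t = (\<lambda>x\<in>\<phi> ` V. (fst (s x) * fst (t x), snd (s x) + snd (t x)))" by (simp add: std_log_secs_def)

lemma comm_monoid_std_closed: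
 assumes V: "opn V" "V \<subseteq> U" and s: "s \<in> carrier (std V)" "t \<in> carrier (std V)"
 shows "s \<otimes>\<^bsub>std V\<^esub> t \<in> carrier (std V)"
proof -
 have "\<exists>N h a c. openin (orthant n) N \<and> x \<in> N \<and> N \<subseteq> \<phi> ` V \<and> smooth_on n N h \<and> (\<forall>y\<in>N. 0 < h y) \<and>
    set_mset c \<subseteq> {..<k} \<and> (\<forall>y\<in>N. (s \<otimes>\<^bsub>std V\<^esub> t) y = (h y * (\<Prod>i<n. y i ^ a i), c))" if x: "x \<in> \<phi> ` V" for x
 proof -
  obtain N h a c where N: "openin (orthant n) N" "x \<in> N" "N \<subseteq> \<phi> ` V" "smooth_on n N h" "\<forall>y\<in>N. 0 < h y"
   "set_mset c \<subseteq> {..<k}" "\<forall>y\<in>N. s y = (h y * (\<Prod>i<n. y i ^ a i), c)" using s(1) x by (rule std_carrierD)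
  obtain N' h' a' c' where N': "openin (orthant n) N'" "x \<in> N'" "N' \<subseteq> \<phi> ` V" "smooth_on n N' h'" "\<forall>y\<in>N'. 0 < h' y"
   "set_mset c' \<subseteq> {..<k}" "\<forall>y\<in>N'. t y = (h' y * (\<Prod>i<n. y i ^ a' i), c')" using s(2) x by (rule std_carrierD)
  have o: "openin (orthant n) (N \<inter> N')" using N(1) N'(1) by blast
  have sm: "smooth n (N \<inter> N') (\<lambda>y. h y * h' y)"
   by (intro smooth_mult slices_fat_openin_orthant o smooth_subset[OF smooth_on_imp_smooth[OF N(4)]]
     smooth_subset[OF smooth_on_imp_smooth[OF N'(4)]]) auto
  have xx: "x \<in> N \<inter> N'" using N(2) N'(2) by blast
  obtain O' where O': "openin (orthant n) O'" "x \<in> O'" "O' \<subseteq> N \<inter> N'" "smooth_on n O' (\<lambda>y. h y * h' y)"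
   by (rule smooth_imp_locally_smooth_on[OF o sm xx])
  show ?thesis
  proof (intro exI conjI)
   show "smooth_on n O' (\<lambda>y. h y * h' y)" by (rule O'(4))
   show "\<forall>y\<in>O'. (s \<otimes>\<^bsub>std V\<^esub> t) y = (h y * h' y * (\<Prod>i<n. y i ^ (a i + a' i)), c + c')"
   proof
    fix y assume "y \<in> O'"
    then have "y \<in> N" "y \<in> N'" "y \<in> \<phi> ` V" using O' N by auto
    then show "(s \<otimes>\<^bsub>std V\<^esub> t) y = (h y * h' y * (\<Prod>i<n. y i ^ (a i + a' i)), c + c')"
     using N(7) N'(7) by (simp add: std_mult power_add prod.distrib mult_ac)
   qed
   show "\<forall>y\<in>O'. 0 < h y * h' y" using N(5) N'(5) O'(3) by (auto intro!: mult_pos_pos)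
   show "set_mset (c + c') \<subseteq> {..<k}" using N(6) N'(6) by simp
  qed (use O' N N' in blast)+
 qed
 moreover have "s \<otimes>\<^bsub>std V\<^esub> t \<in> extensional (\<phi> ` V)" unfolding std_mult by simp
 ultimately show ?thesis unfolding std_carrier by blast
qed

lemma sec_mult:
 assumes V: "opn V" "V \<subseteq> U" and a: "a \<in> carrier (M V)" "b \<in> carrier (M V)"
 shows "sec V (a \<otimes>\<^bsub>M V\<^esub> b) = sec V a \<otimes>\<^bsub>std V\<^esub> sec V b" using sec_Phi[OF V comm_monoid_std_closed[OF V sec(1)[OF V a(1)] sec(1)[OF V a(2)]]]
  Phi_mult[OF V sec(1)[OF V a(1)] sec(1)[OF V a(2)]] sec(2)[OF V a(1)] sec(2)[OF V a(2)] by simp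

lemma sec_res:
 assumes V: "opn V" "V \<subseteq> U" "opn W" "W \<subseteq> V" and a: "a \<in> carrier (M V)"
 shows "sec W (res V W a) = restrict (sec V a) (\<phi> ` W)"
proof -
 have WU: "W \<subseteq> U" using V by blast
 have "res V W a = \<Phi>\<^sub>0 W (restrict (sec V a) (\<phi> ` W))"
  using log_chart_conds(3)[OF V(1,2) V(3,4) sec(1)[OF V(1,2) a]] sec(2)[OF V(1,2) a] by simp
 then show ?thesis using sec_Phi[OF V(3) WU std_restrict[OF V sec(1)[OF V(1,2) a]]] by simp
qed

definition val :: "'p set \<Rightarrow> 'm \<Rightarrow> 'p \<Rightarrow> real \<times> nat multiset" where
 "val W a q = sec (W \<inter> U) (res W (W \<inter> U) a) (\<phi> q)"

lemma val_Phi: "opn V ==> V \<subseteq> U ==> s \<in> carrier (std V) ==> val V (\<Phi>\<^sub>0 V s) q = s (\<phi> q)"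
 by (simp add: val_def Int_absorb2 res_id Phi_closed sec_Phi)

lemma WU: "opn W ==> opn (W \<inter> U)" using open_U by blast

lemma val_mult:
 assumes W: "opn W" and a: "a \<in> carrier (M W)" "b \<in> carrier (M W)" and q: "q \<in> W \<inter> U"
 shows "val W (a \<otimes>\<^bsub>M W\<^esub> b) q = (fst (val W a q) * fst (val W b q), snd (val W a q) + snd (val W b q))"
proof -
 note r = res_closed[OF W WU[OF W] Int_lower1]
 show ?thesis unfolding val_def res_mult[OF W WU[OF W] Int_lower1 a] sec_mult[OF WU[OF W] Int_lower2 r[OF a(1)] r[OF a(2)]] std_mult
  using q by simp
qed

lemma val_res:
 assumes W: "opn W" "opn N" "N \<subseteq> W" and a: "a \<in> carrier (M W)" and q: "q \<in> N \<inter> U"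
 shows "val N (res W N a) q = val W a q"
proof -
 have sub: "N \<inter> U \<subseteq> W \<inter> U" "N \<inter> U \<subseteq> W" using W by auto
 have "res N (N \<inter> U) (res W N a) = res W (N \<inter> U) a" by (rule res_comp[OF W(1,2) WU[OF W(2)] Int_lower1 W(3) a])
 also have "\<dots> = res (W \<inter> U) (N \<inter> U) (res W (W \<inter> U) a)" by (rule res_comp[OF W(1) WU[OF W(1)] WU[OF W(2)] sub(1) Int_lower1 a, symmetric])
 finally show ?thesis unfolding val_def
  using sec_res[OF WU[OF W(1)] Int_lower2 WU[OF W(2)] sub(1) res_closed[OF W(1) WU[OF W(1)] Int_lower1 a]] q by auto
qed

lemma smooth_comp_phi:
 assumes V: "opn V" "V \<subseteq> U" and h: "smooth n (\<phi> ` V) h"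
 shows "smooth_fun (atlas S) V (\<lambda>p. h (\<phi> p))" unfolding smooth_fun_chart_iff[OF V(1) chart_U V(2)]
proof (rule smooth_cong[OF h])
 fix x assume "x \<in> \<phi> ` V"
 then obtain p where "p \<in> V" "x = \<phi> p" by blast
 then show "h x = pull U \<phi> (\<lambda>p. h (\<phi> p)) x" using V pull_chart[OF chart_U] by auto
qed

lemma std_local:
 assumes V: "opn V" "V \<subseteq> U" and s: "s \<in> carrier (std V)" and p: "p \<in> V"
 shows "\<exists>N h a c. opn N \<and> p \<in> N \<and> N \<subseteq> V \<and> smooth_on n (\<phi> ` N) h \<and> (\<forall>y\<in>\<phi> ` N. 0 < h y) \<and>
    set_mset c \<subseteq> {..<k} \<and> (\<forall>y\<in>\<phi> ` N. s y = (h y * (\<Prod>i<n. y i ^ a i), c))"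
proof -
 obtain N h a c where N: "openin (orthant n) N" "\<phi> p \<in> N" "N \<subseteq> \<phi> ` V" "smooth_on n N h" "\<forall>y\<in>N. 0 < h y"
   "set_mset c \<subseteq> {..<k}" "\<forall>y\<in>N. s y = (h y * (\<Prod>i<n. y i ^ a i), c)" using s imageI[OF p] by (rule std_carrierD)
 have NU: "N \<subseteq> \<phi> ` U" using N(3) V(2) by blast
 have im: "\<phi> ` (U \<inter> \<phi> -` N) = N" using NU by auto
 have sub: "U \<inter> \<phi> -` N \<subseteq> V" using N(3) preimage_image[OF V(2)] by blast
 show ?thesis by (intro exI[of _ "U \<inter> \<phi> -` N"] exI[of _ h] exI[of _ a] exI[of _ c])
   (use N p V sub chart_preimage_openin[OF chart_U N(1) NU] in \<open>auto simp: im\<close>)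
qed

lemma val_local:
 assumes W: "opn W" and a: "a \<in> carrier (M W)" and p: "p \<in> W \<inter> U"
 shows "\<exists>N h e c. opn N \<and> p \<in> N \<and> N \<subseteq> W \<inter> U \<and> (\<forall>q\<in>N. 0 < h q) \<and> (\<forall>q\<in>N. val W a q = (h q * (\<Prod>i<n. \<phi> q i ^ e i), c))"
proof -
 from std_local[OF WU[OF W] Int_lower2 sec(1)[OF WU[OF W] Int_lower2 res_closed[OF W WU[OF W] Int_lower1 a]] p]
 obtain N h e c where N: "opn N" "p \<in> N" "N \<subseteq> W \<inter> U" "\<forall>y\<in>\<phi> ` N. 0 < h y"
  "\<forall>y\<in>\<phi> ` N. sec (W \<inter> U) (res W (W \<inter> U) a) y = (h y * (\<Prod>i<n. y i ^ e i), c)" by blast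
 show ?thesis by (intro exI[of _ N] exI[of _ "\<lambda>q. h (\<phi> q)"] exI[of _ e] exI[of _ c]) (use N in \<open>auto simp: val_def\<close>)
qed

lemma interior_pos: "p \<in> U ==> p \<in> mfd_interior (atlas S) ==> i < n ==> 0 < \<phi> p i" using interior_chart_iff[OF chart_U] by blast

lemma val_pos:
 assumes W: "opn W" and a: "a \<in> carrier (M W)" and p: "p \<in> W \<inter> U" "p \<in> mfd_interior (atlas S)"
 shows "0 < fst (val W a p)"
proof -
 obtain N h e c where N: "p \<in> N" "\<forall>q\<in>N. 0 < h q" "\<forall>q\<in>N. val W a q = (h q * (\<Prod>i<n. \<phi> q i ^ e i), c)"
  using val_local[OF W a p(1)] by (blast 9)
 have "0 < (\<Prod>i<n. \<phi> p i ^ e i)" by (rule prod_pos) (use interior_pos p in auto)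
 then show ?thesis using N by simp
qed

lemma al_val:
 assumes W: "opn W" and a: "a \<in> carrier (M W)" and p: "p \<in> W \<inter> U"
 shows "al W a p = (if snd (val W a p) = {#} then fst (val W a p) else 0)"
proof -
 note r = res_closed[OF W WU[OF W] Int_lower1 a]
 have "al W a p = al (W \<inter> U) (res W (W \<inter> U) a) p" using al_res[OF W WU[OF W] Int_lower1 a] p by simp
 also have "\<dots> = al (W \<inter> U) (\<Phi>\<^sub>0 (W \<inter> U) (sec (W \<inter> U) (res W (W \<inter> U) a))) p" by (simp only: sec(2)[OF WU[OF W] Int_lower2 r])
 also have "\<dots> = std_alpha (sec (W \<inter> U) (res W (W \<inter> U) a)) (\<phi> p)"
  by (rule log_chart_conds(2)[OF WU[OF W] Int_lower2 sec(1)[OF WU[OF W] Int_lower2 r] p])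
 finally show ?thesis by (simp add: std_alpha_def val_def)
qed

text \<open>The phantom monomial is locally constant, and near \<open>p\<close> there is a point
  where \<open>\<alpha>\<close> is nonzero, which forces it to be trivial.\<close>

lemma basic_val:
 assumes W: "opn W" and f: "f \<in> basic_secs S W" and p: "p \<in> W \<inter> U"
 shows "snd (val W f p) = {#}"
proof -
 have fc: "f \<in> carrier (M W)" using f by (simp add: basic_secs_def)
 obtain N h e c where N: "opn N" "p \<in> N" "N \<subseteq> W \<inter> U" "\<forall>q\<in>N. val W f q = (h q * (\<Prod>i<n. \<phi> q i ^ e i), c)"
  using val_local[OF W fc p] by (blast 9)
 obtain q where q: "q \<in> N" "al W f q \<noteq> 0" using f N p unfolding basic_secs_def by blast
 have "q \<in> W \<inter> U" using q(1) N(3) by blast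
 then have "snd (val W f q) = {#}" using q(2) al_val[OF W fc] by metis
 then show ?thesis using N q by simp
qed

definition log_val :: "'p \<Rightarrow> 'p set \<Rightarrow> 'm \<Rightarrow> nat multiset \<Rightarrow>\<^sub>0 real" where
 "log_val q W a = pconst (ln (fst (val W a q))) + sum_mset (image_mset pvar (snd (val W a q)))"

text \<open>Positivity of the numerical part at interior points is what makes its logarithm
  additive.\<close>

lemma log_val_additive:
 assumes q: "q \<in> U" "q \<in> mfd_interior (atlas S)"
 shows "germ_additive (log_val q) q" unfolding germ_additive_def
proof safe
 fix W a b assume W: "opn W" "q \<in> W" and a: "a \<in> carrier (M W)" and b: "b \<in> carrier (M W)"
 have qW: "q \<in> W \<inter> U" using q W by blast
 show "log_val q W (a \<otimes>\<^bsub>M W\<^esub> b) = log_val q W a + log_val q W b" using val_pos[OF W(1) a qW q(2)] val_pos[OF W(1) b qW q(2)]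
  by (simp add: log_val_def val_mult[OF W(1) a b qW] ln_mult single_add)
next
 fix W N a assume W: "opn W" "opn N" "q \<in> N" "N \<subseteq> W" and a: "a \<in> carrier (M W)"
 show "log_val q N (res W N a) = log_val q W a" using val_res[OF W(1,2,4) a] W q by (simp add: log_val_def)
qed

abbreviation "ival \<equiv> mfd_interior (atlas S)"

definition ev :: "('p, 'm) free_log \<Rightarrow> 'p \<Rightarrow> nat multiset \<Rightarrow>\<^sub>0 real" where
 "ev P q = subst_poly (gp_val (log_val q) q) (at_pt P q)"

text \<open>A basic section has no phantom part, so its value at an interior point is the logarithm
  of its image under \<open>\<alpha>\<close>; there a relation of the second kind reads as its
  defining equation.\<close>

lemma ev_ideal:
 assumes V: "opn V" and q: "q \<in> V" "q \<in> U" "q \<in> ival" and P: "P \<in> log_ideal S V"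
 shows "ev P q = 0" unfolding ev_def
proof (rule log_ideal_eval[OF V q(1) _ _ P])
 note la = log_val_additive[OF q(2,3)]
 show "gp_val (log_val q) q (\<sigma> \<otimes>\<^bsub>gp_secs S V\<^esub> \<tau>) = gp_val (log_val q) q \<sigma> + gp_val (log_val q) q \<tau>"
  if "\<sigma> \<in> GS V" "\<tau> \<in> GS V" for \<sigma> \<tau> by (rule gp_val_mult[OF la V q(1) that])
 fix f g G assume f: "f \<in> basic_secs S V"
  and e: "\<And>p. p \<in> V ==> p \<in> ival ==> G p = g p * ln (al V f p)"
 have fc: "f \<in> carrier (M V)" using f by (simp add: basic_secs_def)
 have qV: "q \<in> V \<inter> U" using q by blast
 have "gp_val (log_val q) q (to_gp S V f) = log_val q V f" by (rule gp_val_to_gp[OF la V q(1) fc])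
 also have "\<dots> = pconst (ln (al V f q))" by (simp add: log_val_def basic_val[OF V f qV] al_val[OF V fc qV])
 finally show "pconst (g q) * gp_val (log_val q) q (to_gp S V f) = pconst (G q)" by (simp add: mult_single e[OF q(1,3)])
qed

lemma ev_rm:
 assumes V: "opn V" "opn W" "W \<subseteq> V" and P: "P \<in> carrier (FR V)" and q: "q \<in> W"
 shows "ev (rm V W P) q = ev P q" unfolding ev_def rm(2)[OF V P q] subst_poly_compose subst_poly_var gp_val_restrict[OF q] ..

lemma ev_ops:
 assumes V: "opn V" "q \<in> V" and P: "P \<in> carrier (FR V)" "Q \<in> carrier (FR V)"
 shows "ev (P \<oplus>\<^bsub>FR V\<^esub> Q) q = ev P q + ev Q q" "ev (P \<otimes>\<^bsub>FR V\<^esub> Q) q = ev P q * ev Q q" "ev (P \<ominus>\<^bsub>FR V\<^esub> Q) q = ev P q - ev Q q"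
 unfolding ev_def FR_add[OF V(1) P V(2)] FR_mult[OF V(1) P V(2)] FR_minus[OF V(1) P V(2)]
 by (rule subst_poly_add, rule subst_poly_mult, rule subst_poly_diff)

lemma ev_const: "opn V ==> q \<in> V ==> f \<in> carrier (R V) ==> ev (fconst V f) q = pconst (f q)" by (simp add: ev_def MP_const(2))

lemma ev_var: "opn V ==> q \<in> V ==> \<sigma> \<in> GS V ==> ev (fvar V \<sigma>) q = gp_val (log_val q) q \<sigma>" by (simp add: ev_def MP_var(2))

lemma ev_LC:
 assumes V: "opn V" and q: "q \<in> V" "q \<in> U" "q \<in> ival" and P: "P \<in> carrier (FR V)" "Q \<in> carrier (FR V)"
  and e: "LC V P = LC V Q"
 shows "ev P q = ev Q q" using ev_ideal[OF V q, of "P \<ominus>\<^bsub>FR V\<^esub> Q"] ev_ops(3)[OF V q(1) P] e LC_eq_iff[OF V P] by simp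

abbreviation "LS V \<equiv> carrier (log_sheaf S V)"

lemma LS_eq: "LS V = sheafify_sections (space_of S) LPC (log_presheaf_restr S) V" by (simp add: log_sheaf_def sheafify_ring_def)

text \<open>A germ is a set of representatives. At interior points of \<open>U\<close> they share
  one value, because \<open>ev\<close> vanishes on the ideal; elsewhere the description carries no
  meaning.\<close>

definition Ev :: "('p, 'm) log_section \<Rightarrow> 'p \<Rightarrow> nat multiset \<Rightarrow>\<^sub>0 real" where
 "Ev \<sigma> q = (THE e. \<exists>W P. (W, LC W P) \<in> \<sigma> q \<and> opn W \<and> q \<in> W \<and> P \<in> carrier (FR W) \<and> e = ev P q)"

lemma Ev_germ:
 assumes q: "q \<in> U" "q \<in> ival" and W: "opn W" "q \<in> W" "P \<in> carrier (FR W)" and s: "\<sigma> q = lp.grm W (LC W P) q"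
 shows "Ev \<sigma> q = ev P q" unfolding Ev_def
proof (rule the_equality)
 have c: "LC W P \<in> LPC W" using LP_carrier W by blast
 have "(W, LC W P) \<in> \<sigma> q" unfolding s by (rule lp.mem_germ[OF W(1) c W(2)])
 then show "\<exists>W' P'. (W', LC W' P') \<in> \<sigma> q \<and> opn W' \<and> q \<in> W' \<and> P' \<in> carrier (FR W') \<and> ev P q = ev P' q" using W by blast
 fix e assume "\<exists>W' P'. (W', LC W' P') \<in> \<sigma> q \<and> opn W' \<and> q \<in> W' \<and> P' \<in> carrier (FR W') \<and> e = ev P' q"
 then obtain W' P' where m: "(W', LC W' P') \<in> lp.grm W (LC W P) q" and W': "opn W'" "q \<in> W'" "P' \<in> carrier (FR W')" and e: "e = ev P' q"
  unfolding s by blast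
 obtain N where N: "opn N" "q \<in> N" "N \<subseteq> W \<inter> W'" "log_presheaf_restr S W N (LC W P) = log_presheaf_restr S W' N (LC W' P')"
  using m unfolding lp.mem_germ_iff lp.agree_def by blast
 have sub: "N \<subseteq> W" "N \<subseteq> W'" using N(3) by auto
 have "LC N (rm W N P) = LC N (rm W' N P')" using N(4) LP_restr[OF W(1) N(1) sub(1) W(3)] LP_restr[OF W'(1) N(1) sub(2) W'(3)] by simp
 then have "ev (rm W N P) q = ev (rm W' N P') q"
  by (rule ev_LC[OF N(1,2) q rm(1)[OF W(1) N(1) sub(1) W(3)] rm(1)[OF W'(1) N(1) sub(2) W'(3)]])
 then show "e = ev P q" using ev_rm[OF W(1) N(1) sub(1) W(3) N(2)] ev_rm[OF W'(1) N(1) sub(2) W'(3) N(2)] e by simp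
qed

lemma LS_local:
 assumes s: "\<sigma> \<in> LS V" and p: "p \<in> V"
 shows "\<exists>W P. opn W \<and> p \<in> W \<and> W \<subseteq> V \<and> P \<in> carrier (FR W) \<and> (\<forall>q\<in>W. \<sigma> q = lp.grm W (LC W P) q)"
proof -
 obtain W s where W: "opn W" "p \<in> W" "W \<subseteq> V" "s \<in> LPC W" "\<forall>q\<in>W. \<sigma> q = lp.grm W s q" using lp.section_germ[OF s[unfolded LS_eq] p] by blast
 obtain P where "P \<in> carrier (FR W)" "s = LC W P" using W(4) LP_carrier by blast
 then show ?thesis using W by blast
qed

end

section \<open>Local normal forms in the logarithms of the coordinates\<close>

context log_coords
begin

abbreviation Idx :: "(nat + nat) set" where "Idx \<equiv> {..<n} <+> {..<k}"

definition gen :: "'p set \<Rightarrow> nat + nat \<Rightarrow> std_section" where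
 "gen V x = (case x of Inl i \<Rightarrow> std_basic (\<phi> ` V) i | Inr l \<Rightarrow> std_phantom (\<phi> ` V) l)"

definition theta :: "'p set \<Rightarrow> nat + nat \<Rightarrow> ('p, 'm) gp_section" where
 "theta V x = to_gp S V (\<Phi>\<^sub>0 V (gen V x))"

lemma std_memI:
 assumes V: "opn V" "V \<subseteq> U" and h: "smooth n (\<phi> ` V) h" "\<And>y. y \<in> \<phi> ` V ==> 0 < h y" and c: "set_mset c \<subseteq> {..<k}"
 shows "(\<lambda>y\<in>\<phi> ` V. (h y * (\<Prod>i<n. y i ^ a i), c)) \<in> carrier (std V)"
proof -
 have "\<exists>N h' a' c'. openin (orthant n) N \<and> x \<in> N \<and> N \<subseteq> \<phi> ` V \<and> smooth_on n N h' \<and> (\<forall>y\<in>N. 0 < h' y) \<and>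
    set_mset c' \<subseteq> {..<k} \<and> (\<forall>y\<in>N. (\<lambda>y\<in>\<phi> ` V. (h y * (\<Prod>i<n. y i ^ a i), c)) y = (h' y * (\<Prod>i<n. y i ^ a' i), c'))"
  if x: "x \<in> \<phi> ` V" for x
 proof -
  obtain N where N: "openin (orthant n) N" "x \<in> N" "N \<subseteq> \<phi> ` V" "smooth_on n N h"
   by (rule smooth_imp_locally_smooth_on[OF image_open[OF V] h(1) x])
  show ?thesis by (intro exI[of _ N] exI[of _ h] exI[of _ a] exI[of _ c]) (use N c h(2) in auto)
 qed
 then show ?thesis unfolding std_carrier by (intro conjI ballI) simp_all
qed

lemma gen_std:
 assumes V: "opn V" "V \<subseteq> U" and x: "x \<in> Idx" shows "gen V x \<in> carrier (std V)" using x
proof (rule PlusE)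
 fix i assume i: "x = Inl i" "i \<in> {..<n}"
 have "y i = 1 * (\<Prod>j<n. y j ^ (if j = i then 1 else 0))" for y :: "nat \<Rightarrow> real"
  using i by (simp add: if_distrib[of "\<lambda>e. _ ^ e"] prod.delta cong: if_cong)
 then have "gen V x = (\<lambda>y\<in>\<phi> ` V. (1 * (\<Prod>j<n. y j ^ (if j = i then 1 else 0)), {#}))" by (simp add: i(1) gen_def std_basic_def)
 then show ?thesis using std_memI[OF V, of "\<lambda>_. 1" "{#}" "\<lambda>j. if j = i then 1 else 0"] by (simp add: smooth_const)
next
 fix l assume l: "x = Inr l" "l \<in> {..<k}"
 show ?thesis using std_memI[OF V, of "\<lambda>_. 1" "{#l#}" "\<lambda>j. 0"] l by (simp add: smooth_const gen_def std_phantom_def)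
qed

lemma gen_restrict: "W \<subseteq> V ==> restrict (gen V x) (\<phi> ` W) = gen W x"
proof -
 assume "W \<subseteq> V"
 then have "\<phi> ` W \<subseteq> \<phi> ` V" by blast
 then show ?thesis by (intro ext) (auto simp: gen_def std_basic_def std_phantom_def restrict_def split: sum.splits)
qed

lemma theta_GS: "opn V ==> V \<subseteq> U ==> x \<in> Idx ==> theta V x \<in> GS V" unfolding theta_def by (intro to_gp_GS Phi_closed gen_std)

lemma theta_restrict:
 assumes V: "opn V" "V \<subseteq> U" "opn W" "W \<subseteq> V" and x: "x \<in> Idx"
 shows "restrict (theta V x) W = theta W x" unfolding theta_def to_gp_restrict[OF V(1,3,4) Phi_closed[OF V(1,2) gen_std[OF V(1,2) x]]]
  log_chart_conds(3)[OF V(1,2) V(3,4) gen_std[OF V(1,2) x]] gen_restrict[OF V(4)] ..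

abbreviation Theta :: "'p set \<Rightarrow> ((nat + nat) multiset \<Rightarrow> 'p \<Rightarrow> real) \<Rightarrow> ('p, 'm) free_log" where
 "Theta V \<equiv> mm V V (theta V)"

definition nfm :: "'p set \<Rightarrow> ((nat + nat) multiset \<Rightarrow> 'p \<Rightarrow> real) \<Rightarrow> ('p, 'm) free_log set" where
 "nfm V C = LC V (Theta V C)"

lemma Theta_hom: "opn V ==> V \<subseteq> U ==> Theta V \<in> ring_hom (MP V Idx) (FR V)" unfolding FR_eq by (intro MP_map_hom theta_GS) auto

lemma Theta_closed: "opn V ==> V \<subseteq> U ==> C \<in> carrier (MP V Idx) ==> Theta V C \<in> carrier (FR V)" by (rule ring_hom_closed[OF Theta_hom])

lemma nfm_hom: "opn V ==> V \<subseteq> U ==> ring_hom_ring (MP V Idx) (LP V) (nfm V)"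
proof (rule ring_hom_ringI2)
 assume V: "opn V" "V \<subseteq> U"
 show "ring (MP V Idx)" "ring (LP V)" using cring_MP[OF V(1)] cring_LP[OF V(1)] cring.axioms(1) by blast+
 show "nfm V \<in> ring_hom (MP V Idx) (LP V)"
 proof -
  have "nfm V = LC V \<circ> Theta V" by (simp add: fun_eq_iff nfm_def)
  then show ?thesis using ring_hom_trans[OF Theta_hom[OF V] LC_hom[OF V(1)]] by (simp only:)
 qed
qed

lemma Theta_restrict:
 assumes V: "opn V" "V \<subseteq> U" "opn W" "W \<subseteq> V" and C: "C \<in> carrier (MP V Idx)"
 shows "mm V W id C \<in> carrier (MP W Idx)" "rm V W (Theta V C) = Theta W (mm V W id C)"
proof -
 have WU: "W \<subseteq> U" using V by blast
 have id: "\<And>i. i \<in> Idx ==> id i \<in> Idx" by simp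
 note m = MP_map[OF V(1,3,4) C id]
 have th: "\<And>i. i \<in> Idx ==> theta V i \<in> GS V" by (rule theta_GS[OF V(1,2)])
 have th': "\<And>i. i \<in> Idx ==> theta W i \<in> GS W" by (rule theta_GS[OF V(3) WU])
 show c: "mm V W id C \<in> carrier (MP W Idx)" by (rule m(1))
 show "rm V W (Theta V C) = Theta W (mm V W id C)"
 proof (rule FR_ext[OF V(3)])
  show "rm V W (Theta V C) \<in> carrier (FR W)" by (rule rm(1)[OF V(1,3,4) Theta_closed[OF V(1,2) C]])
  show "Theta W (mm V W id C) \<in> carrier (FR W)" by (rule Theta_closed[OF V(3) WU c])
  fix q assume q: "q \<in> W"
  then have qV: "q \<in> V" using V by blast
  have keys: "x \<in> Idx" if m: "m \<in> keys (at_pt C q)" "x \<in># m" for m x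
  proof -
   have "C m q \<noteq> 0" using m(1) by (simp add: in_keys_iff lookup_at_pt[OF V(1) C qV])
   then have "C m \<noteq> \<zero>\<^bsub>R V\<^esub>" using qV by auto
   then show ?thesis using C m(2) unfolding MP_carrier[OF V(1)] by blast
  qed
  have "at_pt (rm V W (Theta V C)) q = subst_poly (\<lambda>\<sigma>. pvar (restrict \<sigma> W)) (subst_poly (\<lambda>i. pvar (theta V i)) (at_pt C q))"
   using rm(2)[OF V(1,3,4) Theta_closed[OF V(1,2) C] q] MP_map(2)[OF V(1,1) order_refl C th qV] by simp
  also have "\<dots> = subst_poly (\<lambda>i. pvar (restrict (theta V i) W)) (at_pt C q)" by (simp only: subst_poly_compose subst_poly_var)
  also have "\<dots> = subst_poly (\<lambda>i. pvar (theta W i)) (at_pt C q)" by (rule subst_poly_cong) (simp add: theta_restrict[OF V keys])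
  also have "\<dots> = subst_poly (\<lambda>i. pvar (theta W i)) (subst_poly (\<lambda>i. pvar (id i)) (at_pt C q))"
   by (simp only: subst_poly_compose subst_poly_var id_apply)
  also have "\<dots> = at_pt (Theta W (mm V W id C)) q" using MP_map(2)[OF V(3,3) order_refl c th' q] m(2)[OF _ q] by simp
  finally show "at_pt (rm V W (Theta V C)) q = at_pt (Theta W (mm V W id C)) q" .
 qed
qed

text \<open>The classes that are polynomials in the symbols of the coordinates with smooth
  coefficients. As the image of a ring homomorphism they are closed under the ring
  operations.\<close>

definition nf :: "'p set \<Rightarrow> ('p, 'm) free_log set set" where
 "nf V = nfm V ` carrier (MP V Idx)"

lemma nf_ops:
 assumes V: "opn V" "V \<subseteq> U" and a: "a \<in> nf V" "b \<in> nf V"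
 shows "a \<oplus>\<^bsub>LP V\<^esub> b \<in> nf V" "a \<otimes>\<^bsub>LP V\<^esub> b \<in> nf V" "a \<ominus>\<^bsub>LP V\<^esub> b \<in> nf V"
proof -
 interpret h: ring_hom_ring "MP V Idx" "LP V" "nfm V" by (rule nfm_hom[OF V])
 obtain A B where A: "A \<in> carrier (MP V Idx)" "a = nfm V A" and B: "B \<in> carrier (MP V Idx)" "b = nfm V B" using a unfolding nf_def by blast
 have "a \<oplus>\<^bsub>LP V\<^esub> b = nfm V (A \<oplus>\<^bsub>MP V Idx\<^esub> B)" "a \<otimes>\<^bsub>LP V\<^esub> b = nfm V (A \<otimes>\<^bsub>MP V Idx\<^esub> B)" "a \<ominus>\<^bsub>LP V\<^esub> b = nfm V (A \<ominus>\<^bsub>MP V Idx\<^esub> B)"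
  using A B by (simp_all add: h.R.minus_eq h.S.minus_eq)
 then show "a \<oplus>\<^bsub>LP V\<^esub> b \<in> nf V" "a \<otimes>\<^bsub>LP V\<^esub> b \<in> nf V" "a \<ominus>\<^bsub>LP V\<^esub> b \<in> nf V"
  unfolding nf_def using A(1) B(1) by (simp_all only: imageI h.R.a_closed h.R.m_closed h.R.minus_closed)
qed

lemma nf_const: "opn V ==> V \<subseteq> U ==> f \<in> carrier (R V) ==> LC V (fconst V f) \<in> nf V" unfolding nf_def nfm_def
 by (rule image_eqI[of _ _ "ring.indexed_const (R V) f"])
  (simp_all add: MP_map_const MP_const(1) R_carrier extensional_restrict)

lemma nf_theta: "opn V ==> V \<subseteq> U ==> x \<in> Idx ==> LC V (fvar V (theta V x)) \<in> nf V" unfolding nf_def nfm_def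
 by (rule image_eqI[of _ _ "ring.indexed_var (R V) x"]) (simp_all only: MP_map_var MP_var(1) order_refl)

lemma nf_restrict:
 assumes V: "opn V" "V \<subseteq> U" "opn W" "W \<subseteq> V" and P: "P \<in> carrier (FR V)" and e: "LC V P \<in> nf V"
 shows "LC W (rm V W P) \<in> nf W"
proof -
 obtain C where C: "C \<in> carrier (MP V Idx)" "LC V P = LC V (Theta V C)" using e unfolding nf_def nfm_def by blast
 have "LC W (rm V W P) = LC W (rm V W (Theta V C))"
  using LP_restr[OF V(1,3,4) P] LP_restr[OF V(1,3,4) Theta_closed[OF V(1,2) C(1)]] C(2) by simp
 then show ?thesis unfolding nf_def nfm_def Theta_restrict(2)[OF V C(1)] using Theta_restrict(1)[OF V C(1)] by blast
qed

definition nfs :: "'p set \<Rightarrow> std_section \<Rightarrow> bool" where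
 "nfs V s \<longleftrightarrow> s \<in> carrier (std V) \<and> LC V (fvar V (to_gp S V (\<Phi>\<^sub>0 V s))) \<in> nf V"

lemma nfs_mult:
 assumes V: "opn V" "V \<subseteq> U" and s: "nfs V s" "nfs V t"
 shows "nfs V (s \<otimes>\<^bsub>std V\<^esub> t)"
proof -
 have c: "s \<in> carrier (std V)" "t \<in> carrier (std V)" using s by (auto simp: nfs_def)
 note p = Phi_closed[OF V c(1)] Phi_closed[OF V c(2)]
 show ?thesis unfolding nfs_def Phi_mult[OF V c] to_gp_mult[OF V(1) p] LC_rel1[OF V(1) to_gp_GS[OF V(1) p(1)] to_gp_GS[OF V(1) p(2)]]
  using comm_monoid_std_closed[OF V c] nf_ops(1)[OF V] s by (simp add: nfs_def)
qed

lemma nfs_gen: "opn V ==> V \<subseteq> U ==> x \<in> Idx ==> nfs V (gen V x)" unfolding nfs_def using nf_theta[of V x] gen_std[of V x] by (simp add: theta_def)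

text \<open>The relation of the second kind with \<open>g = 1\<close>: the logarithm of a positive
  smooth function is smooth up to the boundary, so the symbol of a unit equals a smooth
  function.\<close>

lemma nfs_unit:
 assumes V: "opn V" "V \<subseteq> U" and h: "smooth n (\<phi> ` V) h" "\<And>y. y \<in> \<phi> ` V ==> 0 < h y"
 shows "nfs V (\<lambda>y\<in>\<phi> ` V. (h y, {#}))"
proof -
 let ?s = "\<lambda>y\<in>\<phi> ` V. (h y, {#} :: nat multiset)"
 have s: "?s \<in> carrier (std V)" using std_memI[OF V h, of "{#}" "\<lambda>_. 0"] by simp
 have al: "al V (\<Phi>\<^sub>0 V ?s) p = h (\<phi> p)" if "p \<in> V" for p using log_chart_conds(2)[OF V s that] that by (simp add: std_alpha_def)
 have pos: "0 < h (\<phi> p)" if "p \<in> V" for p using h(2) that by blast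
 have b: "\<Phi>\<^sub>0 V ?s \<in> basic_secs S V" unfolding basic_secs_def
 proof (intro CollectI conjI ballI allI impI)
  show "\<Phi>\<^sub>0 V ?s \<in> carrier (M V)" by (rule Phi_closed[OF V s])
  fix p N assume "p \<in> V" "opn N \<and> p \<in> N \<and> N \<subseteq> V"
  then show "\<exists>q\<in>N. al V (\<Phi>\<^sub>0 V ?s) q \<noteq> 0" using al[of p] pos[of p] by (intro bexI[of _ p]) auto
 qed
 define G where "G = (\<lambda>p\<in>V. ln (h (\<phi> p)))"
 have G: "G \<in> carrier (R V)" unfolding G_def
  by (rule R_memI[OF V(1) smooth_fun_op(5)[OF V(1) smooth_comp_phi[OF V h(1)] smooth_comp_phi[OF V h(1)] pos]])
 have one: "LC V (fconst V (\<lambda>p\<in>V. 1)) = \<one>\<^bsub>LP V\<^esub>" using ring_hom_one[OF LC_hom[OF V(1)]] by (simp add: FR_eq MP_simps)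
 interpret L: cring "LP V" by (rule cring_LP[OF V(1)])
 have v: "LC V (fvar V (to_gp S V (\<Phi>\<^sub>0 V ?s))) \<in> LPC V" using FR_var[OF V(1) to_gp_GS[OF V(1) Phi_closed[OF V s]]] LP_carrier by blast
 have "LC V (fconst V (\<lambda>p\<in>V. 1)) \<otimes>\<^bsub>LP V\<^esub> LC V (fvar V (to_gp S V (\<Phi>\<^sub>0 V ?s))) = LC V (fconst V G)"
  by (rule LC_rel2[OF V(1) b R_closed(1)[OF V(1)] G]) (simp add: G_def al)
 then have "LC V (fvar V (to_gp S V (\<Phi>\<^sub>0 V ?s))) = LC V (fconst V G)" unfolding one L.l_one[OF v] .
 then show ?thesis unfolding nfs_def using s nf_const[OF V G] by simp
qed

lemma nfs_monomial:
 assumes V: "opn V" "V \<subseteq> U" and h: "smooth n (\<phi> ` V) h" "\<And>y. y \<in> \<phi> ` V ==> 0 < h y" and c: "set_mset c \<subseteq> {..<k}"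
 shows "nfs V (\<lambda>y\<in>\<phi> ` V. (h y * (\<Prod>i<n. y i ^ a i), c))"
proof -
 have one: "nfs V (\<lambda>y\<in>\<phi> ` V. (1, {#}))" by (rule nfs_unit[OF V smooth_const]) simp
 have pow: "nfs V (\<lambda>y\<in>\<phi> ` V. (y i ^ e, {#}))" if i: "i < n" for i e
 proof (induction e)
  case 0 then show ?case using one by (simp only: power_0)
 next
  case (Suc e)
  have eq: "(\<lambda>y\<in>\<phi> ` V. (y i ^ Suc e, {#})) = (\<lambda>y\<in>\<phi> ` V. (y i ^ e, {#})) \<otimes>\<^bsub>std V\<^esub> gen V (Inl i)"
   unfolding std_mult by (rule restrict_ext) (simp add: gen_def std_basic_def mult.commute)
  show ?case unfolding eq by (rule nfs_mult[OF V Suc nfs_gen[OF V]]) (use i in auto)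
 qed
 have prod: "nfs V (\<lambda>y\<in>\<phi> ` V. (\<Prod>i\<in>F. y i ^ a i, {#}))" if "finite F" "F \<subseteq> {..<n}" for F using that
 proof (induction F rule: finite_induct)
  case empty then show ?case using one by (simp only: prod.empty)
 next
  case (insert i F)
  have eq: "(\<lambda>y\<in>\<phi> ` V. (\<Prod>i\<in>insert i F. y i ^ a i, {#})) =
    (\<lambda>y\<in>\<phi> ` V. (y i ^ a i, {#})) \<otimes>\<^bsub>std V\<^esub> (\<lambda>y\<in>\<phi> ` V. (\<Prod>i\<in>F. y i ^ a i, {#}))" unfolding std_mult by (rule restrict_ext) (simp add: insert)
  have i: "i < n" and F: "F \<subseteq> {..<n}" using insert.prems by auto
  show ?case unfolding eq by (rule nfs_mult[OF V pow[OF i] insert.IH[OF F]])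
 qed
 have ph: "nfs V (\<lambda>y\<in>\<phi> ` V. (1, c))" using c
 proof (induction c)
  case empty then show ?case using one by (simp only:)
 next
  case (add l c)
  have eq: "(\<lambda>y\<in>\<phi> ` V. (1, add_mset l c)) = (\<lambda>y\<in>\<phi> ` V. (1, c)) \<otimes>\<^bsub>std V\<^esub> gen V (Inr l)"
   unfolding std_mult by (rule restrict_ext) (simp add: gen_def std_phantom_def)
  have l: "Inr l \<in> Idx" and c: "set_mset c \<subseteq> {..<k}" using add.prems by auto
  show ?case unfolding eq by (rule nfs_mult[OF V add.IH[OF c] nfs_gen[OF V l]])
 qed
 have eq: "(\<lambda>y\<in>\<phi> ` V. (h y * (\<Prod>i<n. y i ^ a i), c)) =
   ((\<lambda>y\<in>\<phi> ` V. (h y, {#})) \<otimes>\<^bsub>std V\<^esub> (\<lambda>y\<in>\<phi> ` V. (\<Prod>i<n. y i ^ a i, {#}))) \<otimes>\<^bsub>std V\<^esub> (\<lambda>y\<in>\<phi> ` V. (1, c))"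
  unfolding std_mult by (rule restrict_ext) simp
 show ?thesis unfolding eq by (rule nfs_mult[OF V nfs_mult[OF V nfs_unit[OF V h] prod] ph]) auto
qed

lemma nf_section:
 assumes V: "opn V" "V \<subseteq> U" and a: "a \<in> carrier (M V)" and p: "p \<in> V"
 shows "\<exists>N. opn N \<and> p \<in> N \<and> N \<subseteq> V \<and> LC N (fvar N (to_gp S N (res V N a))) \<in> nf N"
proof -
 obtain N h e c where N: "opn N" "p \<in> N" "N \<subseteq> V" "smooth_on n (\<phi> ` N) h" "\<forall>y\<in>\<phi> ` N. 0 < h y"
  "set_mset c \<subseteq> {..<k}" "\<forall>y\<in>\<phi> ` N. sec V a y = (h y * (\<Prod>i<n. y i ^ e i), c)"
  using std_local[OF V sec(1)[OF V a] p] by (elim exE conjE) (rule that)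
 have NU: "N \<subseteq> U" using N(3) V by blast
 have "restrict (sec V a) (\<phi> ` N) = (\<lambda>y\<in>\<phi> ` N. (h y * (\<Prod>i<n. y i ^ e i), c))" by (rule restrict_ext) (use N(7) in blast)
 moreover have "nfs N (\<lambda>y\<in>\<phi> ` N. (h y * (\<Prod>i<n. y i ^ e i), c))"
  by (rule nfs_monomial[OF N(1) NU smooth_on_imp_smooth[OF N(4)] _ N(6)]) (use N(5) in blast)
 moreover have "res V N a = \<Phi>\<^sub>0 N (restrict (sec V a) (\<phi> ` N))" using log_chart_conds(3)[OF V N(1,3) sec(1)[OF V a]] sec(2)[OF V a] by simp
 ultimately show ?thesis using N(1-3) unfolding nfs_def by (intro exI[of _ N]) simp
qed

text \<open>Near \<open>p\<close> the section is a quotient a / b, and additivity makes its symbol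
  the difference of two symbols of sections of the monoid sheaf.\<close>

lemma nf_var:
 assumes V: "opn V" "V \<subseteq> U" and s: "\<sigma> \<in> GS V" and p: "p \<in> V"
 shows "\<exists>N. opn N \<and> p \<in> N \<and> N \<subseteq> V \<and> LC N (fvar N (restrict \<sigma> N)) \<in> nf N"
proof -
 obtain W a b where W: "opn W" "p \<in> W" "W \<subseteq> V" and ab: "a \<in> carrier (M W)" "b \<in> carrier (M W)"
  and e: "restrict \<sigma> W \<otimes>\<^bsub>gp_secs S W\<^esub> to_gp S W b = to_gp S W a" using GS_local[OF V(1) s p] by (elim exE conjE) (rule that)
 have WU: "W \<subseteq> U" using W V by blast
 obtain N1 where N1: "opn N1" "p \<in> N1" "N1 \<subseteq> W" "LC N1 (fvar N1 (to_gp S N1 (res W N1 a))) \<in> nf N1"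
  using nf_section[OF W(1) WU ab(1) W(2)] by blast
 obtain N2 where N2: "opn N2" "p \<in> N2" "N2 \<subseteq> W" "LC N2 (fvar N2 (to_gp S N2 (res W N2 b))) \<in> nf N2"
  using nf_section[OF W(1) WU ab(2) W(2)] by blast
 define N where "N = N1 \<inter> N2"
 have N: "opn N" "p \<in> N" "N \<subseteq> W" "N \<subseteq> N1" "N \<subseteq> N2" "N \<subseteq> V" "N \<subseteq> U" using N1 N2 W WU unfolding N_def by auto
 have N12: "N1 \<subseteq> U" "N2 \<subseteq> U" using N1 N2 WU by auto
 have tr: "LC N (fvar N (to_gp S N (res W N c))) \<in> nf N"
  if N': "opn N'" "N' \<subseteq> W" "N \<subseteq> N'" "N' \<subseteq> U" and c: "c \<in> carrier (M W)" "LC N' (fvar N' (to_gp S N' (res W N' c))) \<in> nf N'" for N' c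
 proof -
  note r = res_closed[OF W(1) N'(1,2) c(1)]
  have "rm N' N (fvar N' (to_gp S N' (res W N' c))) = fvar N (to_gp S N (res W N c))"
   unfolding rm_var[OF N'(1) N(1) N'(3)] to_gp_restrict[OF N'(1) N(1) N'(3) r]
    res_comp[OF W(1) N'(1) N(1) N'(3,2) c(1)] ..
  then show ?thesis using nf_restrict[OF N'(1,4) N(1) N'(3) FR_var[OF N'(1) to_gp_GS[OF N'(1) r]] c(2)] by simp
 qed
 note ra = res_closed[OF W(1) N(1,3) ab(1)] and rb = res_closed[OF W(1) N(1,3) ab(2)]
 have sN: "restrict \<sigma> N \<in> GS N" by (rule GS_restrict[OF V(1) N(1,6) s])
 have "restrict \<sigma> N \<otimes>\<^bsub>gp_secs S N\<^esub> to_gp S N (res W N b) = to_gp S N (res W N a)"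
 proof -
  have "restrict (restrict \<sigma> W \<otimes>\<^bsub>gp_secs S W\<^esub> to_gp S W b) N = restrict (restrict \<sigma> W) N \<otimes>\<^bsub>gp_secs S N\<^esub> restrict (to_gp S W b) N"
   by (rule GS_restrict_mult[OF N(3)])
  moreover have "restrict (restrict \<sigma> W) N = restrict \<sigma> N" by (rule ext) (use N(3) in auto)
  ultimately show ?thesis unfolding e to_gp_restrict[OF W(1) N(1,3) ab(1)] to_gp_restrict[OF W(1) N(1,3) ab(2)] by simp
 qed
 then have eq: "LC N (fvar N (to_gp S N (res W N a))) =
   LC N (fvar N (restrict \<sigma> N)) \<oplus>\<^bsub>LP N\<^esub> LC N (fvar N (to_gp S N (res W N b)))" using LC_rel1[OF N(1) sN to_gp_GS[OF N(1) rb]] by simp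
 interpret L: cring "LP N" by (rule cring_LP[OF N(1)])
 have c: "LC N (fvar N (restrict \<sigma> N)) \<in> LPC N" "LC N (fvar N (to_gp S N (res W N b))) \<in> LPC N"
  using FR_var[OF N(1) sN] FR_var[OF N(1) to_gp_GS[OF N(1) rb]] LP_carrier by blast+
 have "LC N (fvar N (restrict \<sigma> N)) =
   LC N (fvar N (to_gp S N (res W N a))) \<ominus>\<^bsub>LP N\<^esub> LC N (fvar N (to_gp S N (res W N b)))"
  unfolding eq using c by (simp add: L.minus_eq L.a_assoc L.r_neg)
 then have "LC N (fvar N (restrict \<sigma> N)) \<in> nf N"
  using nf_ops(3)[OF N(1,7) tr[OF N1(1,3) N(4) N12(1) ab(1) N1(4)] tr[OF N2(1,3) N(5) N12(2) ab(2) N2(4)]] by simp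
 then show ?thesis using N by blast
qed

text \<open>Induction over the construction of the polynomial. Only finitely many symbols occur, so
  the neighbourhood of \<open>p\<close> is shrunk finitely often.\<close>

theorem local_normal_form:
 assumes V: "opn V" "V \<subseteq> U" and P: "P \<in> carrier (FR V)" and p: "p \<in> V"
 shows "\<exists>N. opn N \<and> p \<in> N \<and> N \<subseteq> V \<and> LC N (rm V N P) \<in> nf N"
proof -
 interpret RR: cring "R V" by (rule cring_R[OF V(1)])
 have "P \<in> RR.indexed_pset (GS V) (carrier (R V))" using P by (simp only: FR_eq MP_simps(5))
 then show ?thesis
 proof (induction rule: RR.indexed_pset.induct)
  case (indexed_const f)
  have "LC V (rm V V (fconst V f)) \<in> nf V" unfolding rm_const[OF V(1,1) order_refl indexed_const]
   by (rule nf_const[OF V R_restrict[OF V(1,1) order_refl indexed_const]])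
  then show ?case using V p by blast
 next
  case (indexed_padd P Q)
  have c: "P \<in> carrier (FR V)" "Q \<in> carrier (FR V)" using indexed_padd(1,2) by (simp_all only: FR_eq MP_simps(5))
  obtain N1 where N1: "opn N1" "p \<in> N1" "N1 \<subseteq> V" "LC N1 (rm V N1 P) \<in> nf N1" using indexed_padd by blast
  obtain N2 where N2: "opn N2" "p \<in> N2" "N2 \<subseteq> V" "LC N2 (rm V N2 Q) \<in> nf N2" using indexed_padd by blast
  define N where "N = N1 \<inter> N2"
  have N: "opn N" "p \<in> N" "N \<subseteq> V" "N \<subseteq> N1" "N \<subseteq> N2" "N \<subseteq> U" "N1 \<subseteq> U" "N2 \<subseteq> U" using N1 N2 V unfolding N_def by auto
  have 1: "LC N (rm V N P) \<in> nf N"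
   using nf_restrict[OF N1(1) N(7,1,4) rm(1)[OF V(1) N1(1,3) c(1)] N1(4)] rm_comp[OF V(1) N1(1) N(1,4) N1(3) c(1)] by simp
  have 2: "LC N (rm V N Q) \<in> nf N"
   using nf_restrict[OF N2(1) N(8,1,5) rm(1)[OF V(1) N2(1,3) c(2)] N2(4)] rm_comp[OF V(1) N2(1) N(1,5) N2(3) c(2)] by simp
  have e: "RR.indexed_padd P Q = P \<oplus>\<^bsub>FR V\<^esub> Q" by (simp only: FR_eq MP_simps)
  have "LC N (rm V N (P \<oplus>\<^bsub>FR V\<^esub> Q)) \<in> nf N"
   unfolding ring_hom_add[OF rm_ring_hom[OF V(1) N(1,3)] c] ring_hom_add[OF LC_hom[OF N(1)] rm(1)[OF V(1) N(1,3) c(1)] rm(1)[OF V(1) N(1,3) c(2)]]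
   by (rule nf_ops(1)[OF N(1,6) 1 2])
  then show ?case unfolding e using N by blast
 next
  case (indexed_pmult P \<sigma>)
  have c: "P \<in> carrier (FR V)" "fvar V \<sigma> \<in> carrier (FR V)" using indexed_pmult FR_var[OF V(1)] by (simp_all only: FR_eq MP_simps(5))
  obtain N1 where N1: "opn N1" "p \<in> N1" "N1 \<subseteq> V" "LC N1 (rm V N1 P) \<in> nf N1" using indexed_pmult by blast
  obtain N2 where N2: "opn N2" "p \<in> N2" "N2 \<subseteq> V" "LC N2 (fvar N2 (restrict \<sigma> N2)) \<in> nf N2" using nf_var[OF V indexed_pmult(2) p] by blast
  then have N2': "LC N2 (rm V N2 (fvar V \<sigma>)) \<in> nf N2" using rm_var[OF V(1) N2(1,3)] by simp
  define N where "N = N1 \<inter> N2"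
  have N: "opn N" "p \<in> N" "N \<subseteq> V" "N \<subseteq> N1" "N \<subseteq> N2" "N \<subseteq> U" "N1 \<subseteq> U" "N2 \<subseteq> U" using N1 N2 V unfolding N_def by auto
  have 1: "LC N (rm V N P) \<in> nf N"
   using nf_restrict[OF N1(1) N(7,1,4) rm(1)[OF V(1) N1(1,3) c(1)] N1(4)] rm_comp[OF V(1) N1(1) N(1,4) N1(3) c(1)] by simp
  have 2: "LC N (rm V N (fvar V \<sigma>)) \<in> nf N"
   using nf_restrict[OF N2(1) N(8,1,5) rm(1)[OF V(1) N2(1,3) c(2)] N2'] rm_comp[OF V(1) N2(1) N(1,5) N2(3) c(2)] by simp
  have e: "RR.indexed_pmult P \<sigma> = P \<otimes>\<^bsub>FR V\<^esub> fvar V \<sigma>" unfolding FR_eq by (rule MP_pmult[OF V(1) c(1)[unfolded FR_eq] indexed_pmult(2)])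
  have "LC N (rm V N (P \<otimes>\<^bsub>FR V\<^esub> fvar V \<sigma>)) \<in> nf N"
   unfolding ring_hom_mult[OF rm_ring_hom[OF V(1) N(1,3)] c] ring_hom_mult[OF LC_hom[OF N(1)] rm(1)[OF V(1) N(1,3) c(1)] rm(1)[OF V(1) N(1,3) c(2)]]
   by (rule nf_ops(2)[OF N(1,6) 1 2])
  then show ?case unfolding e using N by blast
 qed
qed

end

section \<open>Splitting monomials into a basic and a phantom part\<close>

definition mset_lft :: "('a + 'b) multiset \<Rightarrow> 'a multiset" where
 "mset_lft m = image_mset projl (filter_mset isl m)"

definition mset_rgt :: "('a + 'b) multiset \<Rightarrow> 'b multiset" where
 "mset_rgt m = image_mset projr (filter_mset (\<lambda>x. \<not> isl x) m)"

definition mset_join :: "'a multiset \<Rightarrow> 'b multiset \<Rightarrow> ('a + 'b) multiset" where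
 "mset_join I J = image_mset Inl I + image_mset Inr J"

lemma mset_lft_rgt_simps [simp]:
 "mset_lft {#} = {#}" "mset_rgt {#} = {#}"
 "mset_lft (add_mset (Inl i) m) = add_mset i (mset_lft m)" "mset_lft (add_mset (Inr l) m) = mset_lft m"
 "mset_rgt (add_mset (Inr l) m) = add_mset l (mset_rgt m)" "mset_rgt (add_mset (Inl i) m) = mset_rgt m"
 by (simp_all add: mset_lft_def mset_rgt_def)

lemma mset_join_lft_rgt [simp]: "mset_join (mset_lft m) (mset_rgt m) = m"
proof (induction m)
 case (add x m)
 then show ?case by (cases x) (simp_all add: mset_join_def)
qed (simp add: mset_join_def)

lemma mset_lft_join [simp]: "mset_lft (mset_join I J) = I" and mset_rgt_join [simp]: "mset_rgt (mset_join I J) = J"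
proof -
 have J: "mset_lft (image_mset Inr J) = {#} \<and> mset_rgt (image_mset Inr J) = J" for J :: "'b multiset" by (induction J) simp_all
 have "mset_lft (image_mset Inl I + image_mset Inr J) = I \<and> mset_rgt (image_mset Inl I + image_mset Inr J) = J"
  by (induction I) (simp_all add: J)
 then show "mset_lft (mset_join I J) = I" "mset_rgt (mset_join I J) = J" by (simp_all add: mset_join_def)
qed

lemma set_mset_lft: "i \<in># mset_lft m \<longleftrightarrow> Inl i \<in># m" and set_mset_rgt: "l \<in># mset_rgt m \<longleftrightarrow> Inr l \<in># m"
proof -
 have "set_mset (mset_join I J) = Inl ` set_mset I \<union> Inr ` set_mset J" for I :: "'a multiset" and J :: "'b multiset" by (simp add: mset_join_def)
 from this[of "mset_lft m" "mset_rgt m"] show "i \<in># mset_lft m \<longleftrightarrow> Inl i \<in># m" "l \<in># mset_rgt m \<longleftrightarrow> Inr l \<in># m" by auto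
qed

lemma subst_poly_pvar: "subst_poly pvar p = p"
 using poly_mapping_sum_single[of p] unfolding subst_poly_def prod_mset_pvar by (simp add: mult_single)

context mwc
begin

lemma MP_keys:
 assumes V: "openin \<T> V" and C: "C \<in> carrier (MP V I)" and q: "q \<in> V" and m: "m \<in> keys (at_pt C q)"
 shows "C m \<noteq> \<zero>\<^bsub>R V\<^esub>" "x \<in># m ==> x \<in> I"
proof -
 have "C m q \<noteq> 0" using m by (simp add: in_keys_iff lookup_at_pt[OF V C q])
 then show nz: "C m \<noteq> \<zero>\<^bsub>R V\<^esub>" using q by auto
 show "x \<in># m ==> x \<in> I" using C nz unfolding MP_carrier[OF V] by blast
qed

lemma MP_id:
 assumes V: "openin \<T> V" "openin \<T> W" "W \<subseteq> V" and C: "C \<in> carrier (MP V I)"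
 shows "mm V W id C \<in> carrier (MP W I)" "q \<in> W ==> at_pt (mm V W id C) q = at_pt C q"
proof -
 have id: "\<And>i. i \<in> I ==> id i \<in> I" by simp
 show "mm V W id C \<in> carrier (MP W I)" by (rule MP_map(1)[OF V C id])
 show "at_pt (mm V W id C) q = at_pt C q" if "q \<in> W" using MP_map(2)[OF V C id that] by (simp add: subst_poly_pvar)
qed

definition mono_fun :: "'p set \<Rightarrow> 'c multiset \<Rightarrow> 'c multiset \<Rightarrow> 'p \<Rightarrow> real" where
 "mono_fun V m0 m = (if m = m0 then \<one>\<^bsub>R V\<^esub> else \<zero>\<^bsub>R V\<^esub>)"

lemma mono_fun:
 assumes V: "openin \<T> V" and m: "set_mset m0 \<subseteq> I"
 shows "mono_fun V m0 \<in> carrier (MP V I)" "q \<in> V ==> at_pt (mono_fun V m0) q = Poly_Mapping.single m0 1"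
proof -
 have sub: "{m. mono_fun V m0 m \<noteq> \<zero>\<^bsub>R V\<^esub>} \<subseteq> {m0}" by (auto simp: mono_fun_def split: if_splits)
 show c: "mono_fun V m0 \<in> carrier (MP V I)" unfolding MP_carrier[OF V]
 proof (intro conjI allI impI)
  show "finite {m. mono_fun V m0 m \<noteq> \<zero>\<^bsub>R V\<^esub>}" by (rule finite_subset[OF sub]) simp
  show "mono_fun V m0 m \<in> carrier (R V)" for m using R_closed(1)[OF V] by (simp add: mono_fun_def)
  show "set_mset m' \<subseteq> I" if "mono_fun V m0 m' \<noteq> \<zero>\<^bsub>R V\<^esub>" for m' using sub that m by blast
 qed
 show "at_pt (mono_fun V m0) q = Poly_Mapping.single m0 1" if q: "q \<in> V"
  by (rule poly_mapping_eqI) (use q in \<open>auto simp: lookup_at_pt[OF V c q] mono_fun_def lookup_single when_def\<close>)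
qed

end

context log_coords
begin

lemma ev_gen:
 assumes V: "opn V" "V \<subseteq> U" and q: "q \<in> V" "q \<in> ival" and x: "x \<in> Idx"
 shows "gp_val (log_val q) q (theta V x) = (case x of Inl i \<Rightarrow> pconst (ln (\<phi> q i)) | Inr l \<Rightarrow> pvar l)"
proof -
 have qU: "q \<in> U" using q V by blast
 have "gp_val (log_val q) q (theta V x) = log_val q V (\<Phi>\<^sub>0 V (gen V x))"
  unfolding theta_def by (rule gp_val_to_gp[OF log_val_additive[OF qU q(2)] V(1) q(1) Phi_closed[OF V gen_std[OF V x]]])
 also have "\<dots> = (case x of Inl i \<Rightarrow> pconst (ln (\<phi> q i)) | Inr l \<Rightarrow> pvar l)"
  using q unfolding log_val_def val_Phi[OF V gen_std[OF V x]] by (cases x) (simp_all add: gen_def std_basic_def std_phantom_def)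
 finally show ?thesis .
qed

text \<open>At an interior point the basic logarithms become numbers while the phantom ones stay
  variables, so all terms with phantom part \<open>J\<close> are collected in one
  coefficient.\<close>

lemma lookup_ev_Theta:
 assumes V: "opn V" "V \<subseteq> U" and C: "C \<in> carrier (MP V Idx)" and q: "q \<in> V" "q \<in> ival"
 shows "coef (ev (Theta V C) q) J =
  (\<Sum>m\<in>{m. C m \<noteq> \<zero>\<^bsub>R V\<^esub> \<and> mset_rgt m = J}. C m q * (\<Prod>i<n. ln (\<phi> q i) ^ count (mset_lft m) i))"
proof -
 let ?w = "\<lambda>x. case x of Inl i \<Rightarrow> pconst (ln (\<phi> q i)) | Inr l \<Rightarrow> pvar (l :: nat)"
 let ?S = "{m. C m \<noteq> \<zero>\<^bsub>R V\<^esub>}"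
 have S: "finite ?S" "\<And>m. m \<in> ?S ==> set_mset m \<subseteq> Idx" using C unfolding MP_carrier[OF V(1)] by blast+
 have th: "\<And>i. i \<in> Idx ==> theta V i \<in> GS V" by (rule theta_GS[OF V])
 have mono: "prod_mset (image_mset ?w m) = Poly_Mapping.single (mset_rgt m) (prod_mset (image_mset (\<lambda>i. ln (\<phi> q i)) (mset_lft m)))" for m
 proof (induction m)
  case (add x m)
  then show ?case by (cases x) (simp_all add: mult_single)
 qed simp
 have prod: "prod_mset (image_mset (\<lambda>i. ln (\<phi> q i)) (mset_lft m)) = (\<Prod>i<n. ln (\<phi> q i) ^ count (mset_lft m) i)" if m: "m \<in> ?S" for m
 proof -
  have "set_mset (mset_lft m) \<subseteq> {..<n}"
  proof
   fix i assume "i \<in># mset_lft m"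
   then have "Inl i \<in> Idx" using S(2)[OF m] by (auto simp: set_mset_lft)
   then show "i \<in> {..<n}" by auto
  qed
  then show ?thesis unfolding image_prod_mset_multiplicity by (intro prod.mono_neutral_left) (auto simp: not_in_iff)
 qed
 have "ev (Theta V C) q = subst_poly (\<lambda>x. gp_val (log_val q) q (theta V x)) (at_pt C q)"
 proof -
  have "at_pt (Theta V C) q = subst_poly (\<lambda>x. pvar (theta V x)) (at_pt C q)" by (rule MP_map(2)[OF V(1,1) order_refl C th q(1)])
  then show ?thesis by (simp only: ev_def subst_poly_compose subst_poly_var)
 qed
 also have "\<dots> = subst_poly ?w (at_pt C q)" by (rule subst_poly_cong) (rule ev_gen[OF V q MP_keys(2)[OF V(1) C q(1)]])
 also have "\<dots> = (\<Sum>m\<in>?S. pconst (coef (at_pt C q) m) * prod_mset (image_mset ?w m))"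
  by (rule subst_poly_superset[OF S(1)]) (use MP_keys(1)[OF V(1) C q(1)] in blast)
 also have "\<dots> = (\<Sum>m\<in>?S. Poly_Mapping.single (mset_rgt m) (C m q * (\<Prod>i<n. ln (\<phi> q i) ^ count (mset_lft m) i)))"
 proof (rule sum.cong[OF refl])
  fix m assume m: "m \<in> ?S"
  show "pconst (coef (at_pt C q) m) * prod_mset (image_mset ?w m) =
    Poly_Mapping.single (mset_rgt m) (C m q * (\<Prod>i<n. ln (\<phi> q i) ^ count (mset_lft m) i))"
   unfolding mono prod[OF m] lookup_at_pt[OF V(1) C q(1)] mult_single by simp
 qed
 finally have "coef (ev (Theta V C) q) J =
   (\<Sum>m\<in>?S. if mset_rgt m = J then C m q * (\<Prod>i<n. ln (\<phi> q i) ^ count (mset_lft m) i) else 0)"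
  by (simp only: lookup_sum lookup_single when_def)
 also have "\<dots> = (\<Sum>m\<in>{m \<in> ?S. mset_rgt m = J}. C m q * (\<Prod>i<n. ln (\<phi> q i) ^ count (mset_lft m) i))"
  by (rule sum.inter_filter[OF S(1), symmetric])
 also have "{m \<in> ?S. mset_rgt m = J} = {m. C m \<noteq> \<zero>\<^bsub>R V\<^esub> \<and> mset_rgt m = J}" by blast
 finally show ?thesis .
qed

lemma chart_box:
 assumes V: "opn V" "V \<subseteq> U" and p: "p \<in> V"
 shows "\<exists>d>0. \<forall>x\<in>orth n. (\<forall>i<n. \<bar>x i - \<phi> p i\<bar> < d) \<longrightarrow> x \<in> \<phi> ` V"
proof -
 obtain O' where O': "open O'" "\<phi> ` V = orth n \<inter> O'" using image_open[OF V] unfolding orthant_top_of_set openin_open by blast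
 have po: "\<phi> p \<in> O'" "\<phi> p \<in> espace n" using imageI[OF p, of \<phi>] unfolding O'(2) orth_def by auto
 obtain d where d: "d > 0" "espace n \<inter> ebox n (\<phi> p) d \<subseteq> O'" by (rule ebox_subset_open[OF O'(1) po])
 show ?thesis unfolding O'(2) by (rule exI[of _ d]) (use d in \<open>auto simp: ebox_def orth_def\<close>)
qed

lemma phi_orth: "p \<in> U ==> \<phi> p \<in> orth n" using chart_image_subset[OF chart_U] by blast

text \<open>Raising all coordinates by \<open>d / 2\<close> leaves the chart image intact and makes
  them positive.\<close>

lemma interior_dense:
 assumes V: "opn V" "V \<subseteq> U" and p: "p \<in> V"
 shows "\<exists>q\<in>V. q \<in> ival"
proof -
 obtain d where d: "d > 0" "\<And>x. x \<in> orth n ==> (\<And>i. i < n ==> \<bar>x i - \<phi> p i\<bar> < d) ==> x \<in> \<phi> ` V" using chart_box[OF V p] by blast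
 define x where "x i = (if i < n then \<phi> p i + d / 2 else 0)" for i
 have pos: "0 \<le> \<phi> p i" if "i < n" for i using phi_orth[of p] p V that by (auto simp: orth_def)
 have "x \<in> \<phi> ` V" by (rule d(2)) (use pos d(1) in \<open>auto simp: x_def orth_def espace_def add_nonneg_nonneg\<close>)
 then obtain q where q: "q \<in> V" "x = \<phi> q" by blast
 have "0 < \<phi> q i" if "i < n" for i using pos[OF that] d(1) that unfolding q(2)[symmetric] by (simp add: x_def add_nonneg_pos)
 then have "q \<in> ival" using interior_chart_iff[OF chart_U] q V by blast
 then show ?thesis using q by blast
qed

lemma basic_gen:
 assumes V: "opn V" "V \<subseteq> U" and i: "i < n"
 shows "\<Phi>\<^sub>0 V (gen V (Inl i)) \<in> basic_secs S V" "p \<in> V ==> al V (\<Phi>\<^sub>0 V (gen V (Inl i))) p = \<phi> p i"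
proof -
 have x: "Inl i \<in> Idx" using i by blast
 show al: "al V (\<Phi>\<^sub>0 V (gen V (Inl i))) p = \<phi> p i" if "p \<in> V" for p
  using log_chart_conds(2)[OF V gen_std[OF V x] that] that by (simp add: std_alpha_def gen_def std_basic_def)
 show "\<Phi>\<^sub>0 V (gen V (Inl i)) \<in> basic_secs S V" unfolding basic_secs_def
 proof (intro CollectI conjI ballI allI impI)
  show "\<Phi>\<^sub>0 V (gen V (Inl i)) \<in> carrier (M V)" by (rule Phi_closed[OF V gen_std[OF V x]])
  fix p N assume p: "p \<in> V" and N: "opn N \<and> p \<in> N \<and> N \<subseteq> V"
  then obtain q where q: "q \<in> N" "q \<in> ival" using interior_dense[of N p] V by blast
  have "q \<in> V" "q \<in> U" using q N V by blast+
  then show "\<exists>q\<in>N. al V (\<Phi>\<^sub>0 V (gen V (Inl i))) q \<noteq> 0" using al interior_pos[of q i] q i by (intro bexI[of _ q]) auto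
 qed
qed

lemma smooth_fun_phi:
 assumes V: "opn V" "V \<subseteq> U" and g: "smooth n D g" "\<phi> ` V \<subseteq> D"
 shows "(\<lambda>q\<in>V. g (\<phi> q)) \<in> carrier (R V)" by (rule R_memI[OF V(1) smooth_comp_phi[OF V smooth_subset[OF g]]])

lemma nfm_const: "opn V ==> g \<in> carrier (R V) ==> nfm V (ring.indexed_const (R V) g) = LC V (fconst V g)"
 by (simp add: nfm_def MP_map_const R_carrier extensional_restrict)

lemma nfm_var: "opn V ==> nfm V (ring.indexed_var (R V) x) = LC V (fvar V (theta V x))" by (simp only: nfm_def MP_map_var order_refl)

text \<open>Each elementary relation between the coefficients comes from a relation of the second kind for a basic coordinate.\<close>

lemma log_null_transport:
 assumes F: "log_null n D F" and V: "opn V" "V \<subseteq> U" "\<phi> ` V \<subseteq> D" and J: "set_mset J \<subseteq> {..<k}"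
 shows "\<exists>C\<in>carrier (MP V Idx). nfm V C = \<zero>\<^bsub>LP V\<^esub> \<and>
  (\<forall>m. \<forall>q\<in>V. C m q = (if mset_rgt m = J then F (mset_lft m) (\<phi> q) else 0))" using F
proof (induction rule: log_null.induct)
 interpret h: ring_hom_ring "MP V Idx" "LP V" "nfm V" by (rule nfm_hom[OF V(1,2)])
 case (zero F)
 have "\<zero>\<^bsub>MP V Idx\<^esub> m q = 0" if "q \<in> V" for m q
  using lookup_at_pt[OF V(1) MP_one(3)[OF V(1)] that, of Idx m] MP_one(4)[OF V(1) that, where I = Idx] by simp
 then show ?case using zero V(3) by (intro bexI[of _ "\<zero>\<^bsub>MP V Idx\<^esub>"]) auto
next
 interpret h: ring_hom_ring "MP V Idx" "LP V" "nfm V" by (rule nfm_hom[OF V(1,2)])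
 case (step F i I g h F')
 obtain C where C: "C \<in> carrier (MP V Idx)" "nfm V C = \<zero>\<^bsub>LP V\<^esub>"
  "\<And>m q. q \<in> V ==> C m q = (if mset_rgt m = J then F (mset_lft m) (\<phi> q) else 0)" using step.IH by blast
 define g' where "g' = (\<lambda>q\<in>V. g (\<phi> q))"
 define h' where "h' = (\<lambda>q\<in>V. h (\<phi> q))"
 define m0 where "m0 = mset_join I J"
 have g': "g' \<in> carrier (R V)" unfolding g'_def by (rule smooth_fun_phi[OF V(1,2) step.hyps(4) V(3)])
 have h': "h' \<in> carrier (R V)" unfolding h'_def by (rule smooth_fun_phi[OF V(1,2) step.hyps(5) V(3)])
 have x: "Inl i \<in> Idx" using step.hyps(2) by blast
 have m0: "set_mset m0 \<subseteq> Idx" using step.hyps(3) J by (auto simp: m0_def mset_join_def)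
 note gc = MP_const(1)[OF V(1) g', where I = Idx] MP_const(2)[OF V(1) g']
  and hc = MP_const(1)[OF V(1) h', where I = Idx] MP_const(2)[OF V(1) h'] and v = MP_var[OF V(1) x] and mf = mono_fun[OF V(1) m0]
 define A where "A = ring.indexed_const (R V) g' \<otimes>\<^bsub>MP V Idx\<^esub> ring.indexed_var (R V) (Inl i)"
 define E where "E = A \<ominus>\<^bsub>MP V Idx\<^esub> ring.indexed_const (R V) h'"
 have A: "A \<in> carrier (MP V Idx)" unfolding A_def by (rule h.R.m_closed[OF gc(1) v(1)])
 have E: "E \<in> carrier (MP V Idx)" unfolding E_def by (rule h.R.minus_closed[OF A hc(1)])
 have "nfm V A = nfm V (ring.indexed_const (R V) h')"
 proof -
  have "nfm V A = LC V (fconst V g') \<otimes>\<^bsub>LP V\<^esub> LC V (fvar V (to_gp S V (\<Phi>\<^sub>0 V (gen V (Inl i)))))"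
   unfolding A_def h.hom_mult[OF gc(1) v(1)] nfm_const[OF V(1) g'] nfm_var[OF V(1)] theta_def ..
  also have "\<dots> = LC V (fconst V h')"
  proof (rule LC_rel2[OF V(1) basic_gen(1)[OF V(1,2) step.hyps(2)] g' h'])
   fix q assume q: "q \<in> V" "q \<in> ival"
   have "\<phi> q \<in> D" "0 < \<phi> q i" using q V interior_pos[of q i] step.hyps(2) by auto
   from step.hyps(6)[OF this] show "h' q = g' q * ln (al V (\<Phi>\<^sub>0 V (gen V (Inl i))) q)"
    using q by (simp add: g'_def h'_def basic_gen(2)[OF V(1,2) step.hyps(2)])
  qed
  finally show ?thesis by (simp only: nfm_const[OF V(1) h'])
 qed
 then have nE: "nfm V E = \<zero>\<^bsub>LP V\<^esub>" using A hc(1) unfolding E_def by (simp add: h.R.minus_eq h.S.r_neg)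
 \<comment> \<open>Multiplying the elementary relation \<open>E\<close> by the monomial with
   exponents \<open>I\<close> and \<open>J\<close> produces exactly the change from \<open>F\<close>
   to \<open>F'\<close>.\<close>
 define C' where "C' = C \<oplus>\<^bsub>MP V Idx\<^esub> E \<otimes>\<^bsub>MP V Idx\<^esub> mono_fun V m0"
 have C': "C' \<in> carrier (MP V Idx)" unfolding C'_def by (intro h.R.a_closed h.R.m_closed C E mf)
 have "nfm V C' = \<zero>\<^bsub>LP V\<^esub>" unfolding C'_def using C E mf(1) nE by simp
 moreover have "C' m q = (if mset_rgt m = J then F' (mset_lft m) (\<phi> q) else 0)" if q: "q \<in> V" for m q
 proof -
  have D: "\<phi> q \<in> D" using q V by blast
  have "at_pt C' q = at_pt C q + (pconst (g' q) * pvar (Inl i) - pconst (h' q)) * Poly_Mapping.single m0 1" unfolding C'_def E_def A_def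
   by (simp only: MP_add(2)[OF V(1) C(1) h.R.m_closed[OF E[unfolded E_def A_def] mf(1)] q] MP_mult(2)[OF V(1) E[unfolded E_def A_def] mf(1) q]
    MP_minus[OF V(1) A[unfolded A_def] hc(1) q] MP_mult(2)[OF V(1) gc(1) v(1) q] gc(2)[OF q] hc(2)[OF q] v(2)[OF q] mf(2)[OF q])
  also have "\<dots> = at_pt C q + Poly_Mapping.single (add_mset (Inl i) m0) (g' q) - Poly_Mapping.single m0 (h' q)"
   by (simp add: left_diff_distrib mult_single)
  finally have "C' m q = C m q + (if m = add_mset (Inl i) m0 then g' q else 0) - (if m = m0 then h' q else 0)"
   using lookup_at_pt[OF V(1) C' q, of m] lookup_at_pt[OF V(1) C(1) q, of m] by (simp add: lookup_add lookup_minus lookup_single when_def eq_commute)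
  moreover have "m = m0 \<longleftrightarrow> mset_lft m = I \<and> mset_rgt m = J" unfolding m0_def by (metis mset_join_lft_rgt mset_lft_join mset_rgt_join)
  moreover have "m = add_mset (Inl i) m0 \<longleftrightarrow> mset_lft m = add_mset i I \<and> mset_rgt m = J"
  proof -
   have "add_mset (Inl i) m0 = mset_join (add_mset i I) J" by (simp add: m0_def mset_join_def)
   then show ?thesis by (metis mset_join_lft_rgt mset_lft_join mset_rgt_join)
  qed
  ultimately show ?thesis using C(3)[OF q, of m] step.hyps(7)[OF D, of "mset_lft m"] q by (simp add: g'_def h'_def)
 qed
 ultimately show ?case using C' by blast
qed

text \<open>Because the phantom logarithms are free variables, the coefficient of each phantom
  monomial vanishes by itself. It is a relation between basic logarithms on a closed box in the
  chart, hence a consequence of elementary relations, and these hold in the presheaf.\<close>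

theorem normal_form_unique:
 assumes V: "opn V" "V \<subseteq> U" and C: "C \<in> carrier (MP V Idx)" and p: "p \<in> V"
  and z: "\<And>q. q \<in> V ==> q \<in> ival ==> ev (Theta V C) q = 0"
 shows "\<exists>N. opn N \<and> p \<in> N \<and> N \<subseteq> V \<and> LC N (rm V N (Theta V C)) = \<zero>\<^bsub>LP N\<^esub>"
proof -
 let ?S = "{m. C m \<noteq> \<zero>\<^bsub>R V\<^esub>}"
 have S: "finite ?S" "\<And>m. C m \<in> carrier (R V)" "\<And>m. m \<in> ?S ==> set_mset m \<subseteq> Idx" using C unfolding MP_carrier[OF V(1)] by blast+
 obtain d where d: "d > 0" "\<And>x. x \<in> orth n ==> (\<And>i. i < n ==> \<bar>x i - \<phi> p i\<bar> < d) ==> x \<in> \<phi> ` V" using chart_box[OF V p] by blast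
 have pos: "0 \<le> \<phi> p i" if "i < n" for i using phi_orth[of p] p V that by (auto simp: orth_def)
 \<comment> \<open>The box has half-width \<open>d / 2\<close>, which keeps it inside the chart
   image, and is cut off at 0 to stay in the orthant.\<close>
 define lo where "lo i = max 0 (\<phi> p i - d / 2)" for i
 define hi where "hi i = \<phi> p i + d / 2" for i
 interpret B: corner_box n lo hi by unfold_locales (use pos d(1) in \<open>auto simp: lo_def hi_def add_nonneg_pos\<close>)
 have DV: "B.D \<subseteq> \<phi> ` V"
 proof
  fix x assume x: "x \<in> B.D"
  have b: "0 \<le> x i" "\<bar>x i - \<phi> p i\<bar> < d" if "i < n" for i
  proof -
   have "lo i \<le> x i" "x i \<le> hi i" using x that by (auto simp: B.D_def)
   then show "0 \<le> x i" "\<bar>x i - \<phi> p i\<bar> < d" using d(1) by (auto simp: lo_def hi_def)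
  qed
  show "x \<in> \<phi> ` V" by (rule d(2)) (use x b in \<open>auto simp: orth_def B.D_def\<close>)
 qed
 \<comment> \<open>The analysis uses the compact box, the presheaf an open set; \<open>O'\<close> is
   a relatively open neighbourhood of the image of \<open>p\<close> within the box.\<close>
 define O' where "O' = orth n \<inter> ebox n (\<phi> p) (d / 2)"
 have oO: "openin (orthant n) O'" unfolding O'_def orthant_top_of_set openin_open using open_ebox by blast
 have OD: "O' \<subseteq> B.D"
 proof
  fix x assume x: "x \<in> O'"
  have "lo i \<le> x i \<and> x i \<le> hi i" if i: "i < n" for i
  proof -
   have "0 \<le> x i" "\<bar>x i - \<phi> p i\<bar> < d / 2" using x i by (auto simp: O'_def orth_def ebox_def)
   then have "0 \<le> x i" "\<phi> p i - d / 2 \<le> x i" "x i \<le> \<phi> p i + d / 2" by linarith+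
   then show ?thesis by (simp add: lo_def hi_def)
  qed
  then show "x \<in> B.D" using x by (auto simp: B.D_def O'_def orth_def)
 qed
 have OU: "O' \<subseteq> \<phi> ` U" using OD DV V by blast
 define N where "N = U \<inter> \<phi> -` O'"
 have oN: "opn N" unfolding N_def by (rule chart_preimage_openin[OF chart_U oO OU])
 have ND: "\<phi> ` N \<subseteq> B.D" using OD unfolding N_def by blast
 have NU: "N \<subseteq> U" unfolding N_def by blast
 have NV: "N \<subseteq> V"
 proof
  fix q assume q: "q \<in> N"
  then have "q \<in> U" "\<phi> q \<in> \<phi> ` V" using ND DV unfolding N_def by blast+
  then show "q \<in> V" using preimage_image[OF V(2)] by blast
 qed
 have pU: "p \<in> U" using p V by blast
 have pN: "p \<in> N" unfolding N_def O'_def using pU phi_orth[OF pU] d(1) by (auto simp: ebox_def)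
 interpret h: ring_hom_ring "MP N Idx" "LP N" "nfm N" by (rule nfm_hom[OF oN NU])
 have comp: "\<exists>C'\<in>carrier (MP N Idx). nfm N C' = \<zero>\<^bsub>LP N\<^esub> \<and> (\<forall>m. \<forall>q\<in>N. C' m q = (if mset_rgt m = J then C m q else 0))"
  if J: "set_mset J \<subseteq> {..<k}" for J
 proof -
  define A where "A = {I. C (mset_join I J) \<noteq> \<zero>\<^bsub>R V\<^esub>}"
  define f where "f I = pull U \<phi> (C (mset_join I J))" for I
  have "A \<subseteq> mset_lft ` ?S"
  proof
   fix I assume "I \<in> A"
   then have "mset_join I J \<in> ?S" by (simp add: A_def)
   from imageI[OF this, of mset_lft] show "I \<in> mset_lft ` ?S" by simp
  qed
  then have finA: "finite A" by (rule finite_subset) (rule finite_imageI[OF S(1)])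
  have setA: "set_mset I \<subseteq> {..<n}" if "I \<in> A" for I
  proof -
   have "set_mset (mset_join I J) \<subseteq> Idx" by (rule S(3)) (use that in \<open>simp add: A_def\<close>)
   then show ?thesis by (auto simp: mset_join_def)
  qed
  have fs: "smooth n B.D (f I)" for I
  proof -
   have "smooth_fun (atlas S) V (C (mset_join I J))" using S(2) by (simp add: R_carrier)
   then show ?thesis unfolding smooth_fun_chart_iff[OF V(1) chart_U V(2)] f_def by (rule smooth_subset[OF _ DV])
  qed
  have rel: "(\<Sum>I\<in>A. f I x * (\<Prod>i\<in>{..<n}. ln (x i) ^ count I i)) = 0" if x: "x \<in> B.inner" for x
  proof -
   have xD: "x \<in> B.D" "\<And>i. i < n ==> 0 < x i" using x by (auto simp: B.inner_def)
   obtain q where q: "q \<in> V" "x = \<phi> q" using xD(1) DV by blast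
   have qU: "q \<in> U" using q V by blast
   have qi: "q \<in> ival" using interior_chart_iff[OF chart_U qU] xD(2) q by blast
   have "(\<Sum>I\<in>A. f I x * (\<Prod>i\<in>{..<n}. ln (x i) ^ count I i)) =
     (\<Sum>m\<in>{m. C m \<noteq> \<zero>\<^bsub>R V\<^esub> \<and> mset_rgt m = J}. C m q * (\<Prod>i<n. ln (\<phi> q i) ^ count (mset_lft m) i))"
    by (rule sum.reindex_bij_witness[of _ mset_lft "\<lambda>I. mset_join I J"])
     (auto simp: A_def f_def q(2) pull_chart[OF chart_U qU])
   also have "\<dots> = coef (ev (Theta V C) q) J" by (rule lookup_ev_Theta[OF V C q(1) qi, symmetric])
   also have "\<dots> = 0" by (simp add: z[OF q(1) qi])
   finally show ?thesis .
  qed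
  have "log_null n B.D (\<lambda>I x. if I \<in> A then f I x else 0)" by (rule B.log_relation_null[OF order_refl finA setA fs rel])
  from log_null_transport[OF this oN NU ND J] obtain C' where C': "C' \<in> carrier (MP N Idx)" "nfm N C' = \<zero>\<^bsub>LP N\<^esub>"
   "\<And>m q. q \<in> N ==> C' m q = (if mset_rgt m = J then (if mset_lft m \<in> A then f (mset_lft m) (\<phi> q) else 0) else 0)" by blast
  have "C' m q = (if mset_rgt m = J then C m q else 0)" if q: "q \<in> N" for m q
  proof (cases "mset_rgt m = J")
   case True
   have qq: "q \<in> U" "q \<in> V" using q NU NV by blast+
   have "mset_join (mset_lft m) J = m" using True mset_join_lft_rgt[of m] by simp
   then show ?thesis using C'(3)[OF q, of m] True qq by (auto simp: A_def f_def pull_chart[OF chart_U])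
  qed (use C'(3)[OF q] in simp)
  then show ?thesis using C'(1,2) by blast
 qed
 \<comment> \<open>Only finitely many phantom monomials occur, so the null polynomials found for
   each of them add up to the given one.\<close>
 have fin: "\<exists>C'\<in>carrier (MP N Idx). nfm N C' = \<zero>\<^bsub>LP N\<^esub> \<and> (\<forall>m. \<forall>q\<in>N. C' m q = (if mset_rgt m \<in> \<J> then C m q else 0))"
  if "finite \<J>" "\<And>J. J \<in> \<J> ==> set_mset J \<subseteq> {..<k}" for \<J> using that
 proof (induction \<J> rule: finite_induct)
  case empty
  have "\<zero>\<^bsub>MP N Idx\<^esub> m q = 0" if "q \<in> N" for m q
   using lookup_at_pt[OF oN MP_one(3)[OF oN] that, of Idx m] MP_one(4)[OF oN that, where I = Idx] by simp
  then show ?case by (intro bexI[of _ "\<zero>\<^bsub>MP N Idx\<^esub>"]) auto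
 next
  case (insert J \<J>)
  obtain C1 where C1: "C1 \<in> carrier (MP N Idx)" "nfm N C1 = \<zero>\<^bsub>LP N\<^esub>" "\<And>m q. q \<in> N ==> C1 m q = (if mset_rgt m \<in> \<J> then C m q else 0)"
   using insert.IH insert.prems by blast
  obtain C2 where C2: "C2 \<in> carrier (MP N Idx)" "nfm N C2 = \<zero>\<^bsub>LP N\<^esub>" "\<And>m q. q \<in> N ==> C2 m q = (if mset_rgt m = J then C m q else 0)"
   using comp[of J] insert.prems by blast
  have c: "C1 \<oplus>\<^bsub>MP N Idx\<^esub> C2 \<in> carrier (MP N Idx)" by (rule h.R.a_closed[OF C1(1) C2(1)])
  have "(C1 \<oplus>\<^bsub>MP N Idx\<^esub> C2) m q = C1 m q + C2 m q" if q: "q \<in> N" for m q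
   using lookup_at_pt[OF oN c q, of m] lookup_at_pt[OF oN C1(1) q, of m] lookup_at_pt[OF oN C2(1) q, of m]
   by (simp add: MP_add(2)[OF oN C1(1) C2(1) q] lookup_add)
  then show ?case using c C1 C2 insert.hyps(2) by (intro bexI[of _ "C1 \<oplus>\<^bsub>MP N Idx\<^esub> C2"]) auto
 qed
 have rgt: "set_mset J \<subseteq> {..<k}" if "J \<in> mset_rgt ` ?S" for J
 proof
  obtain m where m: "m \<in> ?S" "J = mset_rgt m" using \<open>J \<in> mset_rgt ` ?S\<close> by (rule imageE)
  fix l assume "l \<in># J"
  then have "Inr l \<in> Idx" using S(3)[OF m(1)] unfolding m(2) by (auto simp: set_mset_rgt)
  then show "l \<in> {..<k}" by auto
 qed
 obtain C' where C'': "C' \<in> carrier (MP N Idx)"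
  "nfm N C' = \<zero>\<^bsub>LP N\<^esub> \<and> (\<forall>m. \<forall>q\<in>N. C' m q = (if mset_rgt m \<in> mset_rgt ` ?S then C m q else 0))"
  using fin[OF finite_imageI[OF S(1)] rgt] by (rule bexE)
 have C': "C' \<in> carrier (MP N Idx)" "nfm N C' = \<zero>\<^bsub>LP N\<^esub>" by (rule C''(1), rule conjunct1[OF C''(2)])
 have C'3: "C' m q = (if mset_rgt m \<in> mset_rgt ` ?S then C m q else 0)" if "q \<in> N" for m q
  by (rule conjunct2[OF C''(2), rule_format, OF that])
 note r = MP_id[OF V(1) oN NV C]
 have "mm V N id C = C'"
 proof (rule MP_ext[OF oN r(1) C'(1)])
  fix q assume q: "q \<in> N"
  have qV: "q \<in> V" using q NV by blast
  have "C' m q = C m q" for m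
  proof (cases "m \<in> ?S")
   case False
   then have "C m q = 0" using qV by simp
   then show ?thesis using C'3[OF q, of m] by simp
  qed (use C'3[OF q, of m] in auto)
  then show "at_pt (mm V N id C) q = at_pt C' q" unfolding r(2)[OF q] by (simp add: at_pt_def)
 qed
 then have "LC N (rm V N (Theta V C)) = \<zero>\<^bsub>LP N\<^esub>" using C'(2) unfolding Theta_restrict(2)[OF V oN NV C] nfm_def by simp
 then show ?thesis using oN pN NV by blast
qed

end

context mwc
begin

lemma smooth_fun_local:
 assumes "\<And>p. p \<in> V ==> \<exists>W. p \<in> W \<and> W \<subseteq> V \<and> smooth_fun \<A> W f"
 shows "smooth_fun \<A> V f" unfolding smooth_fun_def
proof
 fix p assume "p \<in> V"
 then obtain W where W: "p \<in> W" "W \<subseteq> V" "smooth_fun \<A> W f" using assms by blast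
 then obtain c where "c \<in> \<A>" "case c of (n, U, \<phi>) \<Rightarrow> p \<in> U \<and> U \<subseteq> W \<and> smooth_on n (\<phi> ` U) (f \<circ> inv_into U \<phi>)"
  unfolding smooth_fun_def by blast
 then show "\<exists>(n, U, \<phi>)\<in>\<A>. p \<in> U \<and> U \<subseteq> V \<and> smooth_on n (\<phi> ` U) (f \<circ> inv_into U \<phi>)"
  using W(2) by (intro bexI[of _ c]) (auto split: prod.splits)
qed

lemma smooth_fun_power: "openin \<T> V ==> smooth_fun \<A> V f ==> smooth_fun \<A> V (\<lambda>p. f p ^ e)"
 by (induction e) (simp_all add: smooth_fun_const smooth_fun_op(2))

lemma smooth_fun_sum:
 "openin \<T> V ==> finite A ==> (\<And>a. a \<in> A ==> smooth_fun \<A> V (f a)) ==> smooth_fun \<A> V (\<lambda>p. \<Sum>a\<in>A. f a p)"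
 by (induction A rule: infinite_finite_induct) (simp_all add: smooth_fun_const smooth_fun_op(1))

lemma smooth_fun_prod:
 "openin \<T> V ==> finite A ==> (\<And>a. a \<in> A ==> smooth_fun \<A> V (f a)) ==> smooth_fun \<A> V (\<lambda>p. \<Prod>a\<in>A. f a p)"
 by (induction A rule: infinite_finite_induct) (simp_all add: smooth_fun_const smooth_fun_op(2))

end

section \<open>The comparison map: well-definedness, image and inverse\<close>

context log_coords
begin

lemma open_ival:
 assumes V: "opn V" "V \<subseteq> U" shows "opn (V \<inter> ival)"
proof -
 define X' where "X' = (\<Inter>i\<in>{..<n}. {x :: nat \<Rightarrow> real. 0 < x i})"
 have oX: "open X'" unfolding X'_def
  by (intro open_INT finite_lessThan ballI open_Collect_less continuous_on_const continuous_on_product_coordinates)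
 obtain O' where O': "open O'" "\<phi> ` V = orth n \<inter> O'" using image_open[OF V] unfolding orthant_top_of_set openin_open by blast
 have o: "openin (orthant n) (\<phi> ` V \<inter> X')" unfolding orthant_top_of_set openin_open O'(2)
  by (rule exI[of _ "O' \<inter> X'"]) (use O'(1) oX in auto)
 have sub: "\<phi> ` V \<inter> X' \<subseteq> \<phi> ` U" using V by blast
 have "V \<inter> ival = U \<inter> \<phi> -` (\<phi> ` V \<inter> X')"
 proof (rule Set.set_eqI)
  fix q
  have "q \<in> V \<longleftrightarrow> q \<in> U \<and> \<phi> q \<in> \<phi> ` V" using preimage_image[OF V(2)] by blast
  moreover have "q \<in> ival \<longleftrightarrow> \<phi> q \<in> X'" if "q \<in> U" using interior_chart_iff[OF chart_U that] by (auto simp: X'_def)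
  ultimately show "q \<in> V \<inter> ival \<longleftrightarrow> q \<in> U \<inter> \<phi> -` (\<phi> ` V \<inter> X')" by auto
 qed
 then show ?thesis using chart_preimage_openin[OF chart_U o sub] by simp
qed

text \<open>Germs of logarithmic functions are determined by their values at interior points near
  \<open>p\<close>: the difference is brought into normal form on a neighbourhood, its values are 0,
  and uniqueness makes it 0 on a smaller one. This yields injectivity and also the compatibility for
  gluing preimages.\<close>

lemma germ_eq:
 assumes A: "opn A" "A \<subseteq> U" "P \<in> carrier (FR A)" and B: "opn B" "Q \<in> carrier (FR B)" and p: "p \<in> A" "p \<in> B"
  and e: "\<And>q. q \<in> A ==> q \<in> B ==> q \<in> ival ==> ev P q = ev Q q"
 shows "lp.grm A (LC A P) p = lp.grm B (LC B Q) p"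
proof -
 define W where "W = A \<inter> B"
 have W: "opn W" "W \<subseteq> A" "W \<subseteq> B" "p \<in> W" "W \<subseteq> U" using A B p unfolding W_def by auto
 interpret FW: cring "FR W" by (rule cring_FR[OF W(1)])
 note rP = rm[OF A(1) W(1,2) A(3)] and rQ = rm[OF B(1) W(1,3) B(2)]
 define E where "E = rm A W P \<ominus>\<^bsub>FR W\<^esub> rm B W Q"
 have E: "E \<in> carrier (FR W)" unfolding E_def by (rule FW.minus_closed[OF rP(1) rQ(1)])
 obtain N where N: "opn N" "p \<in> N" "N \<subseteq> W" "LC N (rm W N E) \<in> nf N" using local_normal_form[OF W(1,5) E W(4)] by blast
 have NU: "N \<subseteq> U" using N W by blast
 obtain C where C: "C \<in> carrier (MP N Idx)" "LC N (rm W N E) = LC N (Theta N C)" using N(4) unfolding nf_def nfm_def by blast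
 have "ev (Theta N C) q = 0" if q: "q \<in> N" "q \<in> ival" for q
 proof -
  have qW: "q \<in> W" "q \<in> U" "q \<in> A" "q \<in> B" using q N W by auto
  have "ev (Theta N C) q = ev (rm W N E) q"
   by (rule ev_LC[OF N(1) q(1) qW(2) q(2) Theta_closed[OF N(1) NU C(1)] rm(1)[OF W(1) N(1,3) E] C(2)[symmetric]])
  also have "\<dots> = ev E q" by (rule ev_rm[OF W(1) N(1,3) E q(1)])
  also have "\<dots> = ev P q - ev Q q" unfolding E_def ev_ops(3)[OF W(1) qW(1) rP(1) rQ(1)]
    ev_rm[OF A(1) W(1,2) A(3) qW(1)] ev_rm[OF B(1) W(1,3) B(2) qW(1)] ..
  finally show ?thesis using e[OF qW(3,4) q(2)] by simp
 qed
 from normal_form_unique[OF N(1) NU C(1) N(2) this] obtain N' where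
  N': "opn N'" "p \<in> N'" "N' \<subseteq> N" "LC N' (rm N N' (Theta N C)) = \<zero>\<^bsub>LP N'\<^esub>" by blast
 have sub: "N' \<subseteq> W" "N' \<subseteq> A" "N' \<subseteq> B" using N' N W by auto
 interpret h: ring_hom_ring "FR N'" "LP N'" "LC N'" by (rule LC_ring_hom_ring[OF N'(1)])
 interpret g: ring_hom_ring "FR W" "FR N'" "rm W N'" by (rule rm_ring_hom_ring[OF W(1) N'(1) sub(1)])
 have "LC N' (rm W N' E) = LC N' (rm N N' (rm W N E))" by (simp only: rm_comp[OF W(1) N(1) N'(1) N'(3) N(3) E])
 also have "\<dots> = log_presheaf_restr S N N' (LC N (rm W N E))" by (rule LP_restr[OF N(1) N'(1,3) rm(1)[OF W(1) N(1,3) E], symmetric])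
 also have "\<dots> = \<zero>\<^bsub>LP N'\<^esub>" unfolding C(2) LP_restr[OF N(1) N'(1,3) Theta_closed[OF N(1) NU C(1)]] by (rule N'(4))
 finally have z: "LC N' (rm W N' E) = \<zero>\<^bsub>LP N'\<^esub>" .
 have rP': "rm A N' P \<in> carrier (FR N')" and rQ': "rm B N' Q \<in> carrier (FR N')"
  by (rule rm(1)[OF A(1) N'(1) sub(2) A(3)], rule rm(1)[OF B(1) N'(1) sub(3) B(2)])
 have "rm W N' E = rm A N' P \<ominus>\<^bsub>FR N'\<^esub> rm B N' Q" unfolding E_def using rP(1) rQ(1)
  by (simp add: FW.minus_eq h.R.minus_eq rm_comp[OF A(1) W(1) N'(1) sub(1) W(2) A(3)] rm_comp[OF B(1) W(1) N'(1) sub(1) W(3) B(2)])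
 then have "LC N' (rm A N' P) \<ominus>\<^bsub>LP N'\<^esub> LC N' (rm B N' Q) = \<zero>\<^bsub>LP N'\<^esub>" using z rP' rQ' by (simp add: h.R.minus_eq h.S.minus_eq)
 then have "LC N' (rm A N' P) = LC N' (rm B N' Q)" using h.S.r_right_minus_eq[OF h.hom_closed[OF rP'] h.hom_closed[OF rQ']] by blast
 then have eq: "log_presheaf_restr S A N' (LC A P) = log_presheaf_restr S B N' (LC B Q)"
  unfolding LP_restr[OF A(1) N'(1) sub(2) A(3)] LP_restr[OF B(1) N'(1) sub(3) B(2)] .
 have "LC A P \<in> LPC A" "LC B Q \<in> LPC B" using LP_carrier A(3) B(2) by blast+
 then show ?thesis by (intro lp.germ_eq_of_restr_eq[OF A(1) _ B(1) _ N'(1) sub(2,3) N'(2) eq])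
qed

text \<open>The coefficients of the pointwise values as functions on the interior, where alone the
  basic logarithms are defined.\<close>

definition Psi :: "'p set \<Rightarrow> ('p, 'm) log_section \<Rightarrow> nat multiset \<Rightarrow> 'p \<Rightarrow> real" where
 "Psi V \<sigma> J = (\<lambda>q\<in>V \<inter> ival. coef (Ev \<sigma> q) J)"

lemma Psi_eqI:
 assumes "\<And>J. G J \<in> carrier (R (V \<inter> ival))" "\<And>J q. q \<in> V ==> q \<in> ival ==> coef (Ev \<sigma> q) J = G J q"
 shows "Psi V \<sigma> = G"
proof
 fix J
 have "G J \<in> extensional (V \<inter> ival)" using assms(1) by (simp add: R_carrier)
 then show "Psi V \<sigma> J = G J" using assms(2) unfolding Psi_def by (intro extensionalityI[of _ "V \<inter> ival"]) auto
qed

lemma Psi_restrict: "W \<subseteq> V ==> Psi W (restrict \<sigma> W) = poly_sheaf_restr S W (Psi V \<sigma>)"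
proof -
 have "Ev (restrict \<sigma> W) q = Ev \<sigma> q" if "q \<in> W" for q using that by (simp add: Ev_def)
 then show "W \<subseteq> V ==> ?thesis" by (auto simp: fun_eq_iff Psi_def poly_sheaf_restr_def)
qed

lemma Ev_class:
 assumes V: "opn V" "V \<subseteq> U" and P: "P \<in> carrier (FR V)" and q: "q \<in> V" "q \<in> ival"
 shows "Ev (log_sheaf_class S V P) q = ev P q"
proof (rule Ev_germ[OF _ q(2) V(1) q(1) P])
 show "q \<in> U" using q V by blast
 show "log_sheaf_class S V P q = lp.grm V (LC V P) q" using q by (simp add: log_sheaf_class_def to_sheafify_def)
qed

lemma LS_mult: "\<sigma> \<otimes>\<^bsub>log_sheaf S V\<^esub> \<tau> = sheafify_op (space_of S) LPC (log_presheaf_restr S) (\<lambda>W. mult (LP W)) V \<sigma> \<tau>"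
 and LS_add: "\<sigma> \<oplus>\<^bsub>log_sheaf S V\<^esub> \<tau> = sheafify_op (space_of S) LPC (log_presheaf_restr S) (\<lambda>W. add (LP W)) V \<sigma> \<tau>"
 by (simp_all add: log_sheaf_def sheafify_ring_def)

lemma LS_one:
 assumes V: "opn V" shows "\<one>\<^bsub>log_sheaf S V\<^esub> = log_sheaf_class S V \<one>\<^bsub>FR V\<^esub>"
 using ring_hom_one[OF LC_hom[OF V]] by (simp add: log_sheaf_def sheafify_ring_def log_sheaf_class_def)

lemma Ev_ops:
 assumes V: "V \<subseteq> U" and s: "\<sigma> \<in> LS V" "\<tau> \<in> LS V" and q: "q \<in> V" "q \<in> ival"
 shows "Ev (\<sigma> \<otimes>\<^bsub>log_sheaf S V\<^esub> \<tau>) q = Ev \<sigma> q * Ev \<tau> q" "Ev (\<sigma> \<oplus>\<^bsub>log_sheaf S V\<^esub> \<tau>) q = Ev \<sigma> q + Ev \<tau> q"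
proof -
 have qU: "q \<in> U" using q V by blast
 obtain W a b where W: "opn W" "q \<in> W" "a \<in> LPC W" "b \<in> LPC W" "\<forall>q\<in>W. \<sigma> q = lp.grm W a q" "\<forall>q\<in>W. \<tau> q = lp.grm W b q"
  using lpa.section_common_germ[OF s[unfolded LS_eq] q(1)] by blast
 obtain P where P: "P \<in> carrier (FR W)" "a = LC W P" using W(3) LP_carrier by blast
 obtain Q where Q: "Q \<in> carrier (FR W)" "b = LC W Q" using W(4) LP_carrier by blast
 interpret F: cring "FR W" by (rule cring_FR[OF W(1)])
 have g: "\<sigma> q = lp.grm W a q" "\<tau> q = lp.grm W b q" using W by auto
 have e: "Ev \<sigma> q = ev P q" "Ev \<tau> q = ev Q q" by (rule Ev_germ[where \<sigma> = \<sigma>, OF qU q(2) W(1,2) P(1) g(1)[unfolded P(2)]],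
    rule Ev_germ[where \<sigma> = \<tau>, OF qU q(2) W(1,2) Q(1) g(2)[unfolded Q(2)]])
 have "(\<sigma> \<otimes>\<^bsub>log_sheaf S V\<^esub> \<tau>) q = lp.grm W (a \<otimes>\<^bsub>LP W\<^esub> b) q"
  unfolding LS_mult by (rule lpm.sheafify_op_germ[where \<sigma> = \<sigma> and \<tau> = \<tau>, OF W(1,3,4,2) q(1) g])
 then have "Ev (\<sigma> \<otimes>\<^bsub>log_sheaf S V\<^esub> \<tau>) q = ev (P \<otimes>\<^bsub>FR W\<^esub> Q) q"
  unfolding P(2) Q(2) LC_op(2)[OF W(1) P(1) Q(1)] by (rule Ev_germ[OF qU q(2) W(1,2) F.m_closed[OF P(1) Q(1)]])
 then show "Ev (\<sigma> \<otimes>\<^bsub>log_sheaf S V\<^esub> \<tau>) q = Ev \<sigma> q * Ev \<tau> q" unfolding ev_ops(2)[OF W(1,2) P(1) Q(1)] e .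
 have "(\<sigma> \<oplus>\<^bsub>log_sheaf S V\<^esub> \<tau>) q = lp.grm W (a \<oplus>\<^bsub>LP W\<^esub> b) q"
  unfolding LS_add by (rule lpa.sheafify_op_germ[where \<sigma> = \<sigma> and \<tau> = \<tau>, OF W(1,3,4,2) q(1) g])
 then have "Ev (\<sigma> \<oplus>\<^bsub>log_sheaf S V\<^esub> \<tau>) q = ev (P \<oplus>\<^bsub>FR W\<^esub> Q) q"
  unfolding P(2) Q(2) LC_op(1)[OF W(1) P(1) Q(1)] by (rule Ev_germ[OF qU q(2) W(1,2) F.a_closed[OF P(1) Q(1)]])
 then show "Ev (\<sigma> \<oplus>\<^bsub>log_sheaf S V\<^esub> \<tau>) q = Ev \<sigma> q + Ev \<tau> q" unfolding ev_ops(1)[OF W(1,2) P(1) Q(1)] e .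
qed

text \<open>The link between abstract sections and explicit expansions: near each point the values
  are those of a polynomial in the coordinate symbols.\<close>

lemma LS_nf:
 assumes V: "V \<subseteq> U" and s: "\<sigma> \<in> LS V" and p: "p \<in> V"
 shows "\<exists>N C. opn N \<and> p \<in> N \<and> N \<subseteq> V \<and> C \<in> carrier (MP N Idx) \<and> (\<forall>q\<in>N. q \<in> ival \<longrightarrow> Ev \<sigma> q = ev (Theta N C) q)"
proof -
 obtain W P where W: "opn W" "p \<in> W" "W \<subseteq> V" "P \<in> carrier (FR W)" "\<forall>q\<in>W. \<sigma> q = lp.grm W (LC W P) q" using LS_local[OF s p] by blast
 have WU: "W \<subseteq> U" using W V by blast
 obtain N where N: "opn N" "p \<in> N" "N \<subseteq> W" "LC N (rm W N P) \<in> nf N" using local_normal_form[OF W(1) WU W(4,2)] by blast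
 have NU: "N \<subseteq> U" using N WU by blast
 obtain C where C: "C \<in> carrier (MP N Idx)" "LC N (rm W N P) = LC N (Theta N C)" using N(4) unfolding nf_def nfm_def by blast
 have "Ev \<sigma> q = ev (Theta N C) q" if q: "q \<in> N" "q \<in> ival" for q
 proof -
  have qq: "q \<in> U" "q \<in> W" using q N NU by auto
  have "Ev \<sigma> q = ev P q" by (rule Ev_germ[OF qq(1) q(2) W(1) qq(2) W(4)]) (use W(5) qq in blast)
  also have "\<dots> = ev (rm W N P) q" by (rule ev_rm[OF W(1) N(1,3) W(4) q(1), symmetric])
  also have "\<dots> = ev (Theta N C) q" by (rule ev_LC[OF N(1) q(1) qq(1) q(2) rm(1)[OF W(1) N(1,3) W(4)] Theta_closed[OF N(1) NU C(1)] C(2)])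
  finally show ?thesis .
 qed
 then show ?thesis using N W(3) C(1) by blast
qed

lemma coeff_smooth:
 assumes V: "opn V" "V \<subseteq> U" and C: "C \<in> carrier (MP V Idx)"
 shows "(\<lambda>q\<in>V \<inter> ival. coef (ev (Theta V C) q) J) \<in> carrier (R (V \<inter> ival))"
proof -
 let ?O = "V \<inter> ival"
 have O: "opn ?O" by (rule open_ival[OF V])
 have OU: "?O \<subseteq> U" using V by blast
 let ?S = "{m. C m \<noteq> \<zero>\<^bsub>R V\<^esub> \<and> mset_rgt m = J}"
 have S: "finite {m. C m \<noteq> \<zero>\<^bsub>R V\<^esub>}" "\<And>m. C m \<in> carrier (R V)" using C unfolding MP_carrier[OF V(1)] by blast+
 have fin: "finite ?S" by (rule finite_subset[OF _ S(1)]) blast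
 have coord: "smooth_fun (atlas S) ?O (\<lambda>q. \<phi> q i)" if "i < n" for i by (rule smooth_comp_phi[OF O OU smooth_coord])
 have ln: "smooth_fun (atlas S) ?O (\<lambda>q. ln (\<phi> q i))" if "i < n" for i
  by (rule smooth_fun_op(5)[OF O coord[OF that] coord[OF that]]) (use interior_pos that V in blast)
 have "smooth_fun (atlas S) ?O (\<lambda>q. \<Sum>m\<in>?S. C m q * (\<Prod>i<n. ln (\<phi> q i) ^ count (mset_lft m) i))"
 proof (intro smooth_fun_sum smooth_fun_op(2) smooth_fun_prod smooth_fun_power O fin finite_lessThan)
  show "smooth_fun (atlas S) ?O (C m)" for m using S(2)[of m] smooth_fun_subset[OF _ V(1) O] by (simp add: R_carrier)
  show "smooth_fun (atlas S) ?O (\<lambda>q. ln (\<phi> q i))" if "i \<in> {..<n}" for i using ln that by simp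
 qed
 from R_memI[OF O this] have "(\<lambda>q\<in>?O. \<Sum>m\<in>?S. C m q * (\<Prod>i<n. ln (\<phi> q i) ^ count (mset_lft m) i)) \<in> carrier (R ?O)" .
 moreover have "(\<lambda>q\<in>?O. coef (ev (Theta V C) q) J) = (\<lambda>q\<in>?O. \<Sum>m\<in>?S. C m q * (\<Prod>i<n. ln (\<phi> q i) ^ count (mset_lft m) i))"
  by (rule restrict_ext) (use lookup_ev_Theta[OF V C] in blast)
 ultimately show ?thesis by simp
qed

lemma coeff_support:
 assumes V: "opn V" "V \<subseteq> U" and C: "C \<in> carrier (MP V Idx)" and q: "q \<in> V" "q \<in> ival"
  and nz: "coef (ev (Theta V C) q) J \<noteq> 0"
 shows "J \<in> mset_rgt ` {m. C m \<noteq> \<zero>\<^bsub>R V\<^esub>}"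
proof (rule ccontr)
 assume "\<not> ?thesis"
 then have "{m. C m \<noteq> \<zero>\<^bsub>R V\<^esub> \<and> mset_rgt m = J} = {}" by blast
 then show False using nz unfolding lookup_ev_Theta[OF V C q] by (simp only: sum.empty)
qed

lemma mset_rgt_Idx:
 assumes V: "opn V" and C: "C \<in> carrier (MP V Idx)" and m: "C m \<noteq> \<zero>\<^bsub>R V\<^esub>"
 shows "set_mset (mset_rgt m) \<subseteq> {..<k}" "set_mset (mset_lft m) \<subseteq> {..<n}"
proof -
 have sub: "set_mset m \<subseteq> Idx" using C m unfolding MP_carrier[OF V] by blast
 have "l < k" if "l \<in># mset_rgt m" for l using that sub by (auto simp: set_mset_rgt)
 then show "set_mset (mset_rgt m) \<subseteq> {..<k}" by blast
 have "i < n" if "i \<in># mset_lft m" for i using that sub by (auto simp: set_mset_lft)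
 then show "set_mset (mset_lft m) \<subseteq> {..<n}" by blast
qed

context
 fixes r :: "nat \<Rightarrow> 'm"
 assumes r: "\<And>i. i < n ==> r i = \<Phi>\<^sub>0 U (gen U (Inl i))"
begin

abbreviation "TS V \<equiv> log_poly_sheaf S U n k r V"

lemma al_r: "i < n ==> q \<in> U ==> al U (r i) q = \<phi> q i" using basic_gen(2)[OF open_U order_refl] r by simp

lemma TS_simps:
 "mult (TS V) = mult (MP (V \<inter> ival) {..<k})" "one (TS V) = one (MP (V \<inter> ival) {..<k})" "add (TS V) = add (MP (V \<inter> ival) {..<k})"
 by (simp_all add: log_poly_sheaf_def poly_sheaf_def)

lemma TS_carrier:
 "F \<in> carrier (TS V) \<longleftrightarrow> (\<forall>J. F J \<in> carrier (R (V \<inter> ival))) \<and>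
    (\<forall>p\<in>V. \<exists>W. opn W \<and> p \<in> W \<and> W \<subseteq> V \<and> (\<lambda>J. restrict (F J) (W \<inter> ival)) \<in> carrier (MP (W \<inter> ival) {..<k})) \<and>
    (\<forall>p\<in>V. \<exists>W A c. opn W \<and> p \<in> W \<and> W \<subseteq> V \<and> finite A \<and>
     (\<forall>(I, J)\<in>A. set_mset I \<subseteq> {..<n} \<and> set_mset J \<subseteq> {..<k} \<and> c I J \<in> carrier (R W)) \<and>
     (\<forall>J. \<forall>q\<in>W \<inter> ival. F J q = (\<Sum>I | (I, J) \<in> A. c I J q * (\<Prod>i<n. ln (al U (r i) q) ^ count I i))))"
 by (simp add: log_poly_sheaf_def poly_sheaf_def)

text \<open>Local finiteness and the expansion both come from a normal form near the point, whose
  coefficients are smooth up to the boundary.\<close>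

lemma Psi_closed:
 assumes V: "opn V" "V \<subseteq> U" and s: "\<sigma> \<in> LS V"
 shows "Psi V \<sigma> \<in> carrier (TS V)" unfolding TS_carrier
proof (intro conjI allI ballI)
 fix J
 have "smooth_fun (atlas S) (V \<inter> ival) (\<lambda>q. coef (Ev \<sigma> q) J)"
 proof (rule smooth_fun_local)
  fix p assume p: "p \<in> V \<inter> ival"
  then have pV: "p \<in> V" by blast
  obtain N C where N: "opn N" "p \<in> N" "N \<subseteq> V" "C \<in> carrier (MP N Idx)" "\<forall>q\<in>N. q \<in> ival \<longrightarrow> Ev \<sigma> q = ev (Theta N C) q"
   using LS_nf[OF V(2) s pV] by blast
  have NU: "N \<subseteq> U" using N V by blast
  have "smooth_fun (atlas S) (N \<inter> ival) (\<lambda>q\<in>N \<inter> ival. coef (ev (Theta N C) q) J)"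
   using coeff_smooth[OF N(1) NU N(4), of J] by (simp only: R_carrier)
  then have "smooth_fun (atlas S) (N \<inter> ival) (\<lambda>q. coef (Ev \<sigma> q) J)" by (rule smooth_fun_cong[OF open_ival[OF N(1) NU]]) (use N(5) in simp)
  then show "\<exists>W. p \<in> W \<and> W \<subseteq> V \<inter> ival \<and> smooth_fun (atlas S) W (\<lambda>q. coef (Ev \<sigma> q) J)" using N p by (intro exI[of _ "N \<inter> ival"]) auto
 qed
 then show "Psi V \<sigma> J \<in> carrier (R (V \<inter> ival))" unfolding Psi_def by (rule R_memI[OF open_ival[OF V]])
next
 fix p assume p: "p \<in> V"
 obtain N C where N: "opn N" "p \<in> N" "N \<subseteq> V" "C \<in> carrier (MP N Idx)" "\<forall>q\<in>N. q \<in> ival \<longrightarrow> Ev \<sigma> q = ev (Theta N C) q"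
  using LS_nf[OF V(2) s p] by blast
 have NU: "N \<subseteq> U" using N V by blast
 let ?S = "{m. C m \<noteq> \<zero>\<^bsub>R N\<^esub>}"
 have S: "finite ?S" "\<And>m. C m \<in> carrier (R N)" using N(4) unfolding MP_carrier[OF N(1)] by blast+
 have F: "restrict (Psi V \<sigma> J) (N \<inter> ival) = (\<lambda>q\<in>N \<inter> ival. coef (ev (Theta N C) q) J)" for J
  by (rule restrict_ext) (use N(3,5) in \<open>auto simp: Psi_def\<close>)
 have supp: "J \<in> mset_rgt ` ?S" if "restrict (Psi V \<sigma> J) (N \<inter> ival) \<noteq> \<zero>\<^bsub>R (N \<inter> ival)\<^esub>" for J
 proof (rule ccontr)
  assume "\<not> ?thesis"
  then have "coef (ev (Theta N C) q) J = 0" if "q \<in> N \<inter> ival" for q using coeff_support[OF N(1) NU N(4), of q J] that by blast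
  then have "(\<lambda>q\<in>N \<inter> ival. coef (ev (Theta N C) q) J) = \<zero>\<^bsub>R (N \<inter> ival)\<^esub>" unfolding R_simps by (rule restrict_ext)
  then show False using that unfolding F by blast
 qed
 have "(\<lambda>J. restrict (Psi V \<sigma> J) (N \<inter> ival)) \<in> carrier (MP (N \<inter> ival) {..<k})" unfolding MP_carrier[OF open_ival[OF N(1) NU]]
 proof (intro conjI allI impI)
  show "finite {J. restrict (Psi V \<sigma> J) (N \<inter> ival) \<noteq> \<zero>\<^bsub>R (N \<inter> ival)\<^esub>}"
   by (rule finite_subset[OF _ finite_imageI[OF S(1), of mset_rgt]]) (use supp in blast)
  show "restrict (Psi V \<sigma> J) (N \<inter> ival) \<in> carrier (R (N \<inter> ival))" for J unfolding F by (rule coeff_smooth[OF N(1) NU N(4)])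
  show "set_mset J \<subseteq> {..<k}" if nz: "restrict (Psi V \<sigma> J) (N \<inter> ival) \<noteq> \<zero>\<^bsub>R (N \<inter> ival)\<^esub>" for J
   using supp[OF nz] mset_rgt_Idx(1)[OF N(1,4)] by blast
 qed
 then show "\<exists>W. opn W \<and> p \<in> W \<and> W \<subseteq> V \<and> (\<lambda>J. restrict (Psi V \<sigma> J) (W \<inter> ival)) \<in> carrier (MP (W \<inter> ival) {..<k})" using N(1-3) by blast
 define A where "A = (\<lambda>m. (mset_lft m, mset_rgt m)) ` ?S"
 define c where "c I J = C (mset_join I J)" for I J
 have A: "finite A" "\<forall>(I, J)\<in>A. set_mset I \<subseteq> {..<n} \<and> set_mset J \<subseteq> {..<k} \<and> c I J \<in> carrier (R N)"
  using S mset_rgt_Idx[OF N(1,4)] by (auto simp: A_def c_def)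
 have Aiff: "(I, J) \<in> A \<longleftrightarrow> mset_join I J \<in> ?S" for I J
 proof
  assume "(I, J) \<in> A"
  then obtain m where "m \<in> ?S" "I = mset_lft m" "J = mset_rgt m" unfolding A_def by blast
  then show "mset_join I J \<in> ?S" by simp
 next
  assume "mset_join I J \<in> ?S"
  then show "(I, J) \<in> A" unfolding A_def by (rule image_eqI[rotated]) simp
 qed
 have "Psi V \<sigma> J q = (\<Sum>I | (I, J) \<in> A. c I J q * (\<Prod>i<n. ln (al U (r i) q) ^ count I i))" if q: "q \<in> N \<inter> ival" for J q
 proof -
  have qq: "q \<in> N" "q \<in> ival" "q \<in> V" "q \<in> U" using q N V by auto
  have "Psi V \<sigma> J q = coef (ev (Theta N C) q) J" using qq N(5) by (simp add: Psi_def)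
  also have "\<dots> = (\<Sum>m\<in>{m. C m \<noteq> \<zero>\<^bsub>R N\<^esub> \<and> mset_rgt m = J}. C m q * (\<Prod>i<n. ln (\<phi> q i) ^ count (mset_lft m) i))"
   by (rule lookup_ev_Theta[OF N(1) NU N(4) qq(1,2)])
  also have "\<dots> = (\<Sum>I\<in>{I. (I, J) \<in> A}. c I J q * (\<Prod>i<n. ln (al U (r i) q) ^ count I i))"
   by (rule sum.reindex_bij_witness[of _ "\<lambda>I. mset_join I J" mset_lft])
    (auto simp: Aiff c_def al_r[OF _ qq(4)] simp del: R_simps)
  finally show ?thesis .
 qed
 then show "\<exists>W A c. opn W \<and> p \<in> W \<and> W \<subseteq> V \<and> finite A \<and>
     (\<forall>(I, J)\<in>A. set_mset I \<subseteq> {..<n} \<and> set_mset J \<subseteq> {..<k} \<and> c I J \<in> carrier (R W)) \<and>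
     (\<forall>J. \<forall>q\<in>W \<inter> ival. Psi V \<sigma> J q = (\<Sum>I | (I, J) \<in> A. c I J q * (\<Prod>i<n. ln (al U (r i) q) ^ count I i)))"
  by (intro exI[of _ N] exI[of _ A] exI[of _ c] conjI N(1-3) A) blast
qed

lemma Psi_hom:
 assumes V: "opn V" "V \<subseteq> U"
 shows "Psi V \<in> ring_hom (log_sheaf S V) (TS V)"
proof (rule ring_hom_memI)
 let ?O = "V \<inter> ival"
 have O: "opn ?O" by (rule open_ival[OF V])
 interpret RO: cring "R ?O" by (rule cring_R[OF O])
 show cl: "Psi V \<sigma> \<in> carrier (TS V)" if "\<sigma> \<in> LS V" for \<sigma> by (rule Psi_closed[OF V that])
 have pc: "Psi V \<sigma> J \<in> carrier (R ?O)" if "\<sigma> \<in> LS V" for \<sigma> J using cl[OF that] unfolding TS_carrier by blast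
 fix \<sigma> \<tau> assume s: "\<sigma> \<in> LS V" "\<tau> \<in> LS V"
 show "Psi V (\<sigma> \<otimes>\<^bsub>log_sheaf S V\<^esub> \<tau>) = Psi V \<sigma> \<otimes>\<^bsub>TS V\<^esub> Psi V \<tau>"
 proof (rule Psi_eqI)
  fix J
  have mc: "Psi V \<sigma> a \<otimes>\<^bsub>R ?O\<^esub> Psi V \<tau> (J - a) \<in> carrier (R ?O)" for a by (rule RO.m_closed[OF pc[OF s(1)] pc[OF s(2)]])
  show "(Psi V \<sigma> \<otimes>\<^bsub>TS V\<^esub> Psi V \<tau>) J \<in> carrier (R ?O)" unfolding TS_simps MP_simps by (rule RO.finsum_closed) (use mc in blast)
  fix q assume q: "q \<in> V" "q \<in> ival"
  then have qO: "q \<in> ?O" by blast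
  have "(Psi V \<sigma> \<otimes>\<^bsub>TS V\<^esub> Psi V \<tau>) J q = (\<Sum>a\<in>{a. a \<subseteq># J}. (Psi V \<sigma> a \<otimes>\<^bsub>R ?O\<^esub> Psi V \<tau> (J - a)) q)"
   unfolding TS_simps MP_simps by (rule R_finsum[OF O finite_submultisets mc qO])
  then show "coef (Ev (\<sigma> \<otimes>\<^bsub>log_sheaf S V\<^esub> \<tau>) q) J = (Psi V \<sigma> \<otimes>\<^bsub>TS V\<^esub> Psi V \<tau>) J q"
   using q by (simp add: Ev_ops(1)[OF V(2) s q] lookup_mult_mset Psi_def)
 qed
 have add: "(Psi V \<sigma> \<oplus>\<^bsub>TS V\<^esub> Psi V \<tau>) J = Psi V \<sigma> J \<oplus>\<^bsub>R ?O\<^esub> Psi V \<tau> J" for J unfolding TS_simps MP_simps by (simp only: RO.indexed_padd_def)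
 show "Psi V (\<sigma> \<oplus>\<^bsub>log_sheaf S V\<^esub> \<tau>) = Psi V \<sigma> \<oplus>\<^bsub>TS V\<^esub> Psi V \<tau>"
 proof (rule Psi_eqI)
  fix J
  show "(Psi V \<sigma> \<oplus>\<^bsub>TS V\<^esub> Psi V \<tau>) J \<in> carrier (R ?O)" unfolding add by (rule RO.a_closed[OF pc[OF s(1)] pc[OF s(2)]])
  fix q assume q: "q \<in> V" "q \<in> ival"
  then show "coef (Ev (\<sigma> \<oplus>\<^bsub>log_sheaf S V\<^esub> \<tau>) q) J = (Psi V \<sigma> \<oplus>\<^bsub>TS V\<^esub> Psi V \<tau>) J q"
   unfolding add by (simp add: Ev_ops(2)[OF V(2) s q] lookup_add Psi_def)
 qed
next
 have O: "opn (V \<inter> ival)" by (rule open_ival[OF V])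
 note o = MP_one(1,2)[OF O, where I = "{..<k}"]
 show "Psi V \<one>\<^bsub>log_sheaf S V\<^esub> = \<one>\<^bsub>TS V\<^esub>" unfolding TS_simps
 proof (rule Psi_eqI)
  show "\<one>\<^bsub>MP (V \<inter> ival) {..<k}\<^esub> J \<in> carrier (R (V \<inter> ival))" for J using o(1) unfolding MP_carrier[OF O] by blast
  fix J q assume q: "q \<in> V" "q \<in> ival"
  then have qO: "q \<in> V \<inter> ival" by blast
  note oV = MP_one(1,2)[OF V(1), where I = "GS V"]
  have "Ev \<one>\<^bsub>log_sheaf S V\<^esub> q = ev \<one>\<^bsub>FR V\<^esub> q" unfolding LS_one[OF V(1)] by (rule Ev_class[OF V oV(1)[folded FR_eq] q])
  also have "\<dots> = 1" unfolding ev_def FR_eq oV(2)[OF q(1)] by simp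
  finally have "Ev \<one>\<^bsub>log_sheaf S V\<^esub> q = 1" .
  then show "coef (Ev \<one>\<^bsub>log_sheaf S V\<^esub> q) J = \<one>\<^bsub>MP (V \<inter> ival) {..<k}\<^esub> J q" using lookup_at_pt[OF O o(1) qO, of J] o(2)[OF qO] by simp
 qed
qed

text \<open>Equal coefficient functions mean equal values at all interior points of
  \<open>V\<close>, and these determine the germ at every point of \<open>V\<close>, boundary points
  included.\<close>

lemma Psi_inj:
 assumes V: "opn V" "V \<subseteq> U" shows "inj_on (Psi V) (LS V)"
proof (rule inj_onI)
 fix \<sigma> \<tau> assume s: "\<sigma> \<in> LS V" "\<tau> \<in> LS V" and e: "Psi V \<sigma> = Psi V \<tau>"
 have Ev: "Ev \<sigma> q = Ev \<tau> q" if q: "q \<in> V" "q \<in> ival" for q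
 proof (rule poly_mapping_eqI)
  fix J have "Psi V \<sigma> J q = Psi V \<tau> J q" using e by simp
  then show "coef (Ev \<sigma> q) J = coef (Ev \<tau> q) J" using q by (simp add: Psi_def)
 qed
 show "\<sigma> = \<tau>"
 proof (rule extensionalityI[of _ V])
  show "\<sigma> \<in> extensional V" "\<tau> \<in> extensional V" using s unfolding LS_eq sheafify_sections_def by auto
  fix p assume p: "p \<in> V"
  obtain A P where A: "opn A" "p \<in> A" "A \<subseteq> V" "P \<in> carrier (FR A)" "\<forall>q\<in>A. \<sigma> q = lp.grm A (LC A P) q" using LS_local[OF s(1) p] by blast
  obtain B Q where B: "opn B" "p \<in> B" "B \<subseteq> V" "Q \<in> carrier (FR B)" "\<forall>q\<in>B. \<tau> q = lp.grm B (LC B Q) q" using LS_local[OF s(2) p] by blast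
  have AU: "A \<subseteq> U" using A V by blast
  have "lp.grm A (LC A P) p = lp.grm B (LC B Q) p"
  proof (rule germ_eq[OF A(1) AU A(4) B(1,4) A(2) B(2)])
   fix q assume q: "q \<in> A" "q \<in> B" "q \<in> ival"
   have qV: "q \<in> V" "q \<in> U" using q A V by auto
   have "Ev \<sigma> q = ev P q" by (rule Ev_germ[OF qV(2) q(3) A(1) q(1) A(4)]) (use A(5) q in blast)
   moreover have "Ev \<tau> q = ev Q q" by (rule Ev_germ[OF qV(2) q(3) B(1) q(2) B(4)]) (use B(5) q in blast)
   ultimately show "ev P q = ev Q q" using Ev[OF qV(1) q(3)] by simp
  qed
  then show "\<sigma> p = \<tau> p" using A(2,5) B(2,5) by simp
 qed
qed

text \<open>A local expansion is read as a polynomial in the coordinate symbols. Two such local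
  preimages have the same values on their overlap, hence the same germs, so they glue without any
  compatible choice of expansions.\<close>

lemma Psi_surj:
 assumes V: "opn V" "V \<subseteq> U" and F: "F \<in> carrier (TS V)"
 shows "\<exists>\<sigma>\<in>LS V. Psi V \<sigma> = F"
proof -
 have loc: "\<exists>N P. opn N \<and> p \<in> N \<and> N \<subseteq> V \<and> P \<in> carrier (FR N) \<and>
   (\<forall>q\<in>N. q \<in> ival \<longrightarrow> (\<forall>J. coef (ev P q) J = F J q))" if p: "p \<in> V" for p
 proof -
  obtain N A c where N: "opn N" "p \<in> N" "N \<subseteq> V" and A: "finite A"
   "\<forall>(I, J)\<in>A. set_mset I \<subseteq> {..<n} \<and> set_mset J \<subseteq> {..<k} \<and> c I J \<in> carrier (R N)"
   and e: "\<forall>J. \<forall>q\<in>N \<inter> ival. F J q = (\<Sum>I | (I, J) \<in> A. c I J q * (\<Prod>i<n. ln (al U (r i) q) ^ count I i))"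
   using F[unfolded TS_carrier, THEN conjunct2, THEN conjunct2, rule_format, OF p] by (elim exE conjE) (rule that)
  have NU: "N \<subseteq> U" using N V by blast
  define C where "C m = (if (mset_lft m, mset_rgt m) \<in> A then c (mset_lft m) (mset_rgt m) else \<zero>\<^bsub>R N\<^esub>)" for m
  have sub: "{m. C m \<noteq> \<zero>\<^bsub>R N\<^esub>} \<subseteq> (\<lambda>(I, J). mset_join I J) ` A"
  proof
   fix m assume "m \<in> {m. C m \<noteq> \<zero>\<^bsub>R N\<^esub>}"
   then have "(mset_lft m, mset_rgt m) \<in> A" by (auto simp: C_def split: if_splits)
   then show "m \<in> (\<lambda>(I, J). mset_join I J) ` A" by (rule image_eqI[rotated]) simp
  qed
  have C: "C \<in> carrier (MP N Idx)" unfolding MP_carrier[OF N(1)]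
  proof (intro conjI allI impI)
   show "finite {m. C m \<noteq> \<zero>\<^bsub>R N\<^esub>}" by (rule finite_subset[OF sub finite_imageI[OF A(1)]])
   show "C m \<in> carrier (R N)" for m using A(2) R_closed(1)[OF N(1)] by (auto simp: C_def)
   show "set_mset m \<subseteq> Idx" if "C m \<noteq> \<zero>\<^bsub>R N\<^esub>" for m
   proof -
    have "(mset_lft m, mset_rgt m) \<in> A" using that by (auto simp: C_def split: if_splits)
    then have "set_mset (mset_lft m) \<subseteq> {..<n}" "set_mset (mset_rgt m) \<subseteq> {..<k}" using A(2) by blast+
    then have "set_mset (mset_join (mset_lft m) (mset_rgt m)) \<subseteq> Idx" unfolding mset_join_def by auto
    then show ?thesis by simp
   qed
  qed
  have "coef (ev (Theta N C) q) J = F J q" if q: "q \<in> N" "q \<in> ival" for q J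
  proof -
   have qU: "q \<in> U" using q NU by blast
   have fin: "finite {I. (I, J) \<in> A}" by (rule finite_subset[OF _ finite_imageI[OF A(1), of fst]]) force
   have "coef (ev (Theta N C) q) J =
     (\<Sum>m\<in>{m. C m \<noteq> \<zero>\<^bsub>R N\<^esub> \<and> mset_rgt m = J}. C m q * (\<Prod>i<n. ln (\<phi> q i) ^ count (mset_lft m) i))" by (rule lookup_ev_Theta[OF N(1) NU C q])
   also have "\<dots> = (\<Sum>I\<in>{I. (I, J) \<in> A \<and> c I J \<noteq> \<zero>\<^bsub>R N\<^esub>}. c I J q * (\<Prod>i<n. ln (al U (r i) q) ^ count I i))"
    by (rule sum.reindex_bij_witness[of _ "\<lambda>I. mset_join I J" mset_lft])
     (auto simp: C_def al_r[OF _ qU] split: if_splits simp del: R_simps)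
   also have "\<dots> = (\<Sum>I\<in>{I. (I, J) \<in> A}. c I J q * (\<Prod>i<n. ln (al U (r i) q) ^ count I i))"
    by (rule sum.mono_neutral_left[OF fin]) (use q in auto)
   also have "\<dots> = F J q" using e q by simp
   finally show ?thesis .
  qed
  then show ?thesis using N Theta_closed[OF N(1) NU C] by blast
 qed
 \<comment> \<open>For each point one neighbourhood and one representative are chosen; the germ at
   \<open>p\<close> will be taken from the choice made for \<open>p\<close>.\<close>
 have "\<exists>f. \<forall>p\<in>V. opn (fst (f p)) \<and> p \<in> fst (f p) \<and> fst (f p) \<subseteq> V \<and> snd (f p) \<in> carrier (FR (fst (f p))) \<and>
   (\<forall>q\<in>fst (f p). q \<in> ival \<longrightarrow> (\<forall>J. coef (ev (snd (f p)) q) J = F J q))" by (rule bchoice) (use loc in simp)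
 then obtain f where f: "\<forall>p\<in>V. opn (fst (f p)) \<and> p \<in> fst (f p) \<and> fst (f p) \<subseteq> V \<and> snd (f p) \<in> carrier (FR (fst (f p))) \<and>
   (\<forall>q\<in>fst (f p). q \<in> ival \<longrightarrow> (\<forall>J. coef (ev (snd (f p)) q) J = F J q))" by (rule exE)
 define N where "N p = fst (f p)" for p
 define P where "P p = snd (f p)" for p
 have N: "opn (N p)" "p \<in> N p" "N p \<subseteq> V" "N p \<subseteq> U" and P: "P p \<in> carrier (FR (N p))"
  and PF: "\<And>q J. q \<in> N p ==> q \<in> ival ==> coef (ev (P p) q) J = F J q" if "p \<in> V" for p
  using bspec[OF f that] V(2) unfolding N_def P_def by auto
 define \<sigma> where "\<sigma> = (\<lambda>p\<in>V. lp.grm (N p) (LC (N p) (P p)) p)"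
 \<comment> \<open>On the neighbourhood chosen for \<open>p\<close> the section is given by the
   single representative of \<open>p\<close>, although its germs come from different
   choices.\<close>
 have germ: "\<sigma> q = lp.grm (N p) (LC (N p) (P p)) q" if p: "p \<in> V" and q: "q \<in> N p" for p q
 proof -
  have qV: "q \<in> V" using q N(3)[OF p] by blast
  have "lp.grm (N q) (LC (N q) (P q)) q = lp.grm (N p) (LC (N p) (P p)) q"
  proof (rule germ_eq[OF N(1,4)[OF qV] P[OF qV] N(1)[OF p] P[OF p] N(2)[OF qV] q])
   fix x assume x: "x \<in> N q" "x \<in> N p" "x \<in> ival"
   show "ev (P q) x = ev (P p) x" by (rule poly_mapping_eqI) (simp add: PF[OF qV x(1,3)] PF[OF p x(2,3)])
  qed
  then show ?thesis using qV by (simp add: \<sigma>_def)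
 qed
 have LC: "LC (N p) (P p) \<in> LPC (N p)" if "p \<in> V" for p using P[OF that] LP_carrier by blast
 have "\<exists>W s. opn W \<and> p \<in> W \<and> W \<subseteq> V \<and> s \<in> LPC W \<and> (\<forall>q\<in>W. \<sigma> q = lp.grm W s q)" if p: "p \<in> V" for p
  using N(1-3)[OF p] LC[OF p] germ[OF p] by (intro exI[of _ "N p"] exI[of _ "LC (N p) (P p)"]) simp
 moreover have "\<sigma> \<in> extensional V" by (simp add: \<sigma>_def)
 ultimately have s: "\<sigma> \<in> LS V" unfolding LS_eq sheafify_sections_def by simp
 have "Psi V \<sigma> = F"
 proof (rule Psi_eqI)
  show "F J \<in> carrier (R (V \<inter> ival))" for J using F unfolding TS_carrier by blast
  fix J q assume q: "q \<in> V" "q \<in> ival"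
  have "q \<in> U" using q V by blast
  from Ev_germ[where \<sigma> = \<sigma>, OF this q(2) N(1,2)[OF q(1)] P[OF q(1)] germ[OF q(1) N(2)[OF q(1)]]]
  show "coef (Ev \<sigma> q) J = F J q" using PF[OF q(1) N(2)[OF q(1)] q(2)] by simp
 qed
 then show ?thesis using s by blast
qed

lemma Psi_iso:
 assumes V: "opn V" "V \<subseteq> U" shows "Psi V \<in> ring_iso (log_sheaf S V) (TS V)" unfolding ring_iso_def
proof (intro CollectI conjI Psi_hom[OF V])
 have "Psi V ` LS V = carrier (TS V)" using Psi_surj[OF V] Psi_closed[OF V] by blast
 then show "bij_betw (Psi V) (LS V) (carrier (TS V))" using Psi_inj[OF V] by (simp add: bij_betw_def)
qed

end

text \<open>Covers the scalars as well as the symbols of the basic coordinates: in both cases the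
  value at every interior point is a constant polynomial.\<close>

lemma Psi_scalar_like:
 assumes V: "opn V" "V \<subseteq> U" and P: "P \<in> carrier (FR V)"
  and g: "smooth_fun (atlas S) (V \<inter> ival) g" and e: "\<And>q. q \<in> V ==> q \<in> ival ==> ev P q = pconst (g q)"
 shows "Psi V (log_sheaf_class S V P) = poly_scalar S V g"
proof (rule Psi_eqI)
 have O: "opn (V \<inter> ival)" by (rule open_ival[OF V])
 note gO = R_memI[OF O g]
 note c = MP_const(1)[OF O gO, where I = UNIV] MP_const(2)[OF O gO]
 show "poly_scalar S V g J \<in> carrier (R (V \<inter> ival))" for J using c(1) unfolding MP_carrier[OF O] poly_scalar_def by blast
 fix J q assume q: "q \<in> V" "q \<in> ival"
 then have qO: "q \<in> V \<inter> ival" by blast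
 show "coef (Ev (log_sheaf_class S V P) q) J = poly_scalar S V g J q"
  unfolding Ev_class[OF V P q] e[OF q] poly_scalar_def lookup_at_pt[OF O c(1) qO, symmetric] c(2)[OF qO] using qO by simp
qed

lemma Psi_scalar:
 assumes V: "opn V" "V \<subseteq> U" and g: "g \<in> carrier (R V)"
 shows "Psi V (log_scalar S V g) = poly_scalar S V g" unfolding log_scalar_def
proof (rule Psi_scalar_like[OF V FR_const[OF V(1) g]])
 show "smooth_fun (atlas S) (V \<inter> ival) g" using smooth_fun_subset[OF _ V(1) open_ival[OF V]] g by (simp add: R_carrier)
qed (rule ev_const[OF V(1) _ g])

lemma Psi_basic:
 assumes i: "i < n"
 shows "Psi U (log_symbol S U (to_gp S U (\<Phi>\<^sub>0 U (gen U (Inl i))))) = poly_scalar S U (\<lambda>p. ln (al U (\<Phi>\<^sub>0 U (gen U (Inl i))) p))"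
 unfolding log_symbol_def
proof (rule Psi_scalar_like[OF open_U order_refl])
 have x: "Inl i \<in> Idx" using i by blast
 note th = theta_GS[OF open_U order_refl x]
 show "fvar U (to_gp S U (\<Phi>\<^sub>0 U (gen U (Inl i)))) \<in> carrier (FR U)" using FR_var[OF open_U th] unfolding theta_def .
 have O: "opn (U \<inter> ival)" by (rule open_ival[OF open_U order_refl])
 have coord: "smooth_fun (atlas S) (U \<inter> ival) (\<lambda>q. \<phi> q i)" by (rule smooth_comp_phi[OF O Int_lower1 smooth_coord])
 have "smooth_fun (atlas S) (U \<inter> ival) (\<lambda>q. ln (\<phi> q i))" by (rule smooth_fun_op(5)[OF O coord coord]) (use interior_pos i in blast)
 then show "smooth_fun (atlas S) (U \<inter> ival) (\<lambda>p. ln (al U (\<Phi>\<^sub>0 U (gen U (Inl i))) p))"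
  by (rule smooth_fun_cong[OF O]) (simp add: basic_gen(2)[OF open_U order_refl i])
 fix q assume q: "q \<in> U" "q \<in> ival"
 show "ev (fvar U (to_gp S U (\<Phi>\<^sub>0 U (gen U (Inl i))))) q = pconst (ln (al U (\<Phi>\<^sub>0 U (gen U (Inl i))) q))"
  using ev_var[OF open_U q(1) th] ev_gen[OF open_U order_refl q x] by (simp add: theta_def basic_gen(2)[OF open_U order_refl i q(1)])
qed

lemma Psi_phantom:
 assumes l: "l < k"
 shows "Psi U (log_symbol S U (to_gp S U (\<Phi>\<^sub>0 U (gen U (Inr l))))) = ring.indexed_var (R (U \<inter> ival)) l" unfolding log_symbol_def
proof (rule Psi_eqI)
 have x: "Inr l \<in> Idx" using l by blast
 note th = theta_GS[OF open_U order_refl x]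
 have O: "opn (U \<inter> ival)" by (rule open_ival[OF open_U order_refl])
 have lk: "l \<in> {..<k}" using l by simp
 note v = MP_var[OF O lk]
 show "ring.indexed_var (R (U \<inter> ival)) l J \<in> carrier (R (U \<inter> ival))" for J using v(1) unfolding MP_carrier[OF O] by blast
 fix J q assume q: "q \<in> U" "q \<in> ival"
 then have qO: "q \<in> U \<inter> ival" by blast
 have "Ev (log_sheaf_class S U (fvar U (theta U (Inr l)))) q = pvar l"
  using Ev_class[OF open_U order_refl FR_var[OF open_U th] q] ev_var[OF open_U q(1) th] ev_gen[OF open_U order_refl q x] by simp
 then show "coef (Ev (log_sheaf_class S U (fvar U (to_gp S U (\<Phi>\<^sub>0 U (gen U (Inr l)))))) q) J
   = ring.indexed_var (R (U \<inter> ival)) l J q" using lookup_at_pt[OF O v(1) qO, of J] v(2)[OF qO] by (simp add: theta_def)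
qed

end

theorem theorem1p3:
  fixes S :: "('p, 'm) log_space"
    and U :: "'p set" and n k :: nat and r t :: "nat \<Rightarrow> 'm"
  assumes "manifold_with_log_corners S"
    and "openin (space_of S) U"
    and "log_coordinates S U n k r t"
  shows "\<exists>\<Psi>.
    (\<forall>V. openin (space_of S) V \<and> V \<subseteq> U \<longrightarrow>
       \<Psi> V \<in> ring_iso (log_sheaf S V) (log_poly_sheaf S U n k r V) \<and>
       (\<forall>g\<in>carrier (smooth_ring (atlas S) V). \<Psi> V (log_scalar S V g) = poly_scalar S V g)) \<and>
    (\<forall>V W. openin (space_of S) V \<and> openin (space_of S) W \<and> W \<subseteq> V \<and> V \<subseteq> U \<longrightarrow>
       (\<forall>\<sigma>\<in>carrier (log_sheaf S V).
          \<Psi> W (restrict \<sigma> W) = poly_sheaf_restr S W (\<Psi> V \<sigma>))) \<and>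
    (\<forall>i<n. \<Psi> U (log_symbol S U (to_gp S U (r i))) =
       poly_scalar S U (\<lambda>p. ln (log_alpha S U (r i) p))) \<and>
    (\<forall>l<k. \<Psi> U (log_symbol S U (to_gp S U (t l))) =
       ring.indexed_var (interior_ring S U) l)"
proof -
  obtain \<phi> \<Phi> where lc: "log_chart S n k U \<phi> \<Phi>"
    and r: "\<And>i. i < n \<Longrightarrow> r i = \<Phi> (\<phi> ` U) (std_basic (\<phi> ` U) i)"
    and t: "\<And>l. l < k \<Longrightarrow> t l = \<Phi> (\<phi> ` U) (std_phantom (\<phi> ` U) l)"
    using assms(3) unfolding log_coordinates_def by blast
  interpret log_coords S n k U \<phi> \<Phi>
    by unfold_locales (use assms(1) lc in \<open>simp_all add: manifold_with_log_corners_def\<close>)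
  have r': "r i = \<Phi>\<^sub>0 U (gen U (Inl i))" if "i < n" for i using r[OF that] by (simp add: gen_def)
  have t': "t l = \<Phi>\<^sub>0 U (gen U (Inr l))" if "l < k" for l using t[OF that] by (simp add: gen_def)
  show ?thesis
  proof (intro exI[of _ Psi] conjI allI impI ballI)
    fix V assume V: "openin (space_of S) V \<and> V \<subseteq> U"
    show "Psi V \<in> ring_iso (log_sheaf S V) (log_poly_sheaf S U n k r V)" using Psi_iso[OF r'] V by blast
    show "Psi V (log_scalar S V g) = poly_scalar S V g" if "g \<in> carrier (smooth_ring (atlas S) V)" for g
      using Psi_scalar V that by blast
  next
    fix V W \<sigma> assume "openin (space_of S) V \<and> openin (space_of S) W \<and> W \<subseteq> V \<and> V \<subseteq> U"
    then show "Psi W (restrict \<sigma> W) = poly_sheaf_restr S W (Psi V \<sigma>)" using Psi_restrict by blast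
  next
    fix i assume "i < n"
    then show "Psi U (log_symbol S U (to_gp S U (r i))) = poly_scalar S U (\<lambda>p. ln (log_alpha S U (r i) p))"
      using Psi_basic r' by simp
  next
    fix l assume "l < k"
    then show "Psi U (log_symbol S U (to_gp S U (t l))) = ring.indexed_var (interior_ring S U) l"
      using Psi_phantom t' by simp
  qed
qed

end
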